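(* Under assumptions (A1)-(A3) and (B1)-(B3) listed in the context, for every $\delta>0$ it holds that $$\Phi\left(\frac1n\sum_{i=1}^n\mathbf{1}_{\{c_i>K\}}>\frac{1}{n^{1/2-\delta}}\ \Big|\ X_{1:n}\right)\to0$$ as $n\to\infty$ in $Q^{(\infty)}$-probability.
   Context: Let $D\ge 1$, let $\|\cdot\|$ be the Euclidean norm, and let $f$ be a probability density on $\mathbb{R}^D$ (w.r.t. Lebesgue measure). For a probability measure $P$ on $\mathbb{R}^D$ write $Pf(x)=\int f(x-\theta)\,P(d\theta)$. Prior: $\alpha>0$, $P_0$ is a probability measure on $\Theta\subset\mathbb{R}^D$, and $\Pi$ is the law of the Dirichlet process $P\sim \mathrm{DP}(\alpha,P_0)$ in stick-breaking form, $P=\sum_{k\ge1}w_k\delta_{\theta_k}$, $w_k=v_k\prod_{j=1}^{k-1}(1-v_j)$, $v_k$ i.i.d. $\mathrm{Beta}(1,\alpha)$, $\theta_k$ i.i.d. $P_0$, the two sequences being independent. Allocation variables: consider the model $X_i\mid P,c_i\sim f(\cdot-\theta_{c_i})$ independently, $c_i\mid P$ i.i.d. categorical on $\mathbb{N}=\{1,2,\dots\}$ with probabilities $(w_k)_{k\ge1}$, $P\sim\mathrm{DP}(\alpha,P_0)$. $\Phi(\cdot\mid X_{1:n})$ is the induced posterior law of $c_{1:n}=(c_1,\dots,c_n)$: $\Phi(c_{1:n}=k_{1:n}\mid X_{1:n})=\int\prod_{i=1}^n w_{k_i}f(X_i-\theta_{k_i})\,d\Pi\big/\int\prod_{i=1}^nPf(X_i)\,\Pi(dP)$.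 Assumptions: (A1) $X_1,X_2,\dots$ are i.i.d. from $Q(dx)=P^*f(x)\,dx$, where $P^*=\sum_{k=1}^K w_k^*\delta_{\theta_k^*}$, $K<\infty$, $(w_1^*,\dots,w_K^* )$ is a probability vector, and $P^*$ has exactly $K$ support points (the $\theta_k^*$ are distinct and $w_k^*>0$). (A2) $\Theta\subset\mathbb{R}^D$ is compact and $\theta_k^*\in\Theta$ for all $k=1,\dots,K$. (A3) $P_0$ has a continuous bounded density $p_0$ on $\Theta$ w.r.t. Lebesgue measure, with $p_0(\theta_k^* )>0$ for all $k=1,\dots,K$. (B1) $f\in C^3(\mathbb{R}^D)$ and there is a constant $F$ with $0<f(x)<F$ for all $x$. (B2) There are $R>0$, $\gamma\ge0$ with $\|\nabla\log f(x)\|\le R(1+\|x\|)^\gamma$ and $\|\nabla^2\log f(x)\|\le R(1+\|x\|)^\gamma$ for all $x$, and $\int e^{M\|x\|^\gamma}f(x)\,dx<\infty$ for every $M>0$. (B3) There are $C,r>0$ with $\|\nabla^g f(x)\|\le C(1+\|x\|)^{-(D+r)}$ for all $x$ and $g=1,2,3$. $Q^{(\infty)}$ is the law of the i.i.d. sequence $(X_i)_{i\ge1}$, and $X_{1:n}=(X_1,\dots,X_n)$.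
   Formalization: In addition to (A2)-(A3), it is assumed that Θ is not Lebesgue-thin at the true atoms: for some c>0, the Lebesgue measure of Θ∩B(θ_k*,ε) is at least cε^D for all k≤K and 0<ε≤1; without such a condition the claim can fail (e.g. θ_k* isolated in Θ). *)

theory Defs
  imports "HOL-Probability.Probability"
begin

text \<open>
  For \<open>f :: real ^ 'd \<Rightarrow> real\<close> the iterates \<open>nabla f\<close>, \<open>nabla (nabla f)\<close>, \<open>nabla (nabla (nabla f))\<close>
  take values in \<open>real ^ 'd\<close>, \<open>real ^ 'd ^ 'd\<close>, \<open>real ^ 'd ^ 'd ^ 'd\<close>: they are the arrays of all partial
  derivatives of order 1, 2, 3, and the library norm on these types is the Frobenius norm.
\<close>

definition nabla :: "(real ^ 'd \<Rightarrow> 'b::real_normed_vector) \<Rightarrow> real ^ 'd \<Rightarrow> 'b ^ 'd" where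
  "nabla f x = (\<chi> i. frechet_derivative f (at x) (axis i 1))"

definition C3 :: "(real ^ 'd \<Rightarrow> real) \<Rightarrow> bool" where
  "C3 f \<longleftrightarrow> f differentiable_on UNIV \<and> nabla f differentiable_on UNIV \<and>
     nabla (nabla f) differentiable_on UNIV \<and> continuous_on UNIV (nabla (nabla (nabla f)))"

definition probability_density :: "('a::euclidean_space \<Rightarrow> real) \<Rightarrow> bool" where
  "probability_density f \<longleftrightarrow>
     f \<in> borel_measurable borel \<and> (\<forall>x. 0 \<le> f x) \<and> (\<integral>\<^sup>+x. ennreal (f x) \<partial>lborel) = 1"

text \<open>The measure \<open>\<Sum>k\<in>I. w k * \<delta>(\<theta> k)\<close>, as the image under \<open>\<theta>\<close> of the measure on \<open>I\<close> with masses \<open>w k\<close>.\<close>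

definition atomic_measure ::
  "nat set \<Rightarrow> (nat \<Rightarrow> real) \<Rightarrow> (nat \<Rightarrow> 'a::topological_space) \<Rightarrow> 'a measure" where
  "atomic_measure I w \<theta> = distr (point_measure I (\<lambda>k. ennreal (w k))) borel \<theta>"

definition mixture :: "('a::real_normed_vector \<Rightarrow> real) \<Rightarrow> 'a measure \<Rightarrow> 'a \<Rightarrow> real" where
  "mixture f P x = (\<integral>\<theta>. f (x - \<theta>) \<partial>P)"

definition beta_density :: "real \<Rightarrow> real \<Rightarrow> real \<Rightarrow> real" where
  "beta_density a b x =
     (if 0 < x \<and> x < 1 then x powr (a - 1) * (1 - x) powr (b - 1) / Beta a b else 0)"

definition beta_distribution :: "real \<Rightarrow> real \<Rightarrow> real measure" where
  "beta_distribution a b = density lborel (\<lambda>x. ennreal (beta_density a b x))"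

definition stick_weight :: "(nat \<Rightarrow> real) \<Rightarrow> nat \<Rightarrow> real" where
  "stick_weight v k = v k * (\<Prod>j = 1..<k. 1 - v j)"

text \<open>
  The joint law of the stick proportions \<open>v\<close> and the atoms \<open>\<theta>\<close> (all sequences are indexed from 1), and
  the Dirichlet process as a random measure on this space. An integral over the law of the Dirichlet
  process, or over its weights and atoms, is an integral over \<open>stick_breaking_prior\<close>.
\<close>

definition stick_breaking_prior ::
  "real \<Rightarrow> 'a measure \<Rightarrow> ((nat \<Rightarrow> real) \<times> (nat \<Rightarrow> 'a)) measure" where
  "stick_breaking_prior \<alpha> P0 =
     (\<Pi>\<^sub>M k\<in>{1..}. beta_distribution 1 \<alpha>) \<Otimes>\<^sub>M (\<Pi>\<^sub>M k\<in>{1..}. P0)"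

definition dirichlet_process ::
  "(nat \<Rightarrow> real) \<times> (nat \<Rightarrow> 'a::topological_space) \<Rightarrow> 'a measure" where
  "dirichlet_process = (\<lambda>(v, \<theta>). atomic_measure {1..} (stick_weight v) \<theta>)"

definition allocation_mass ::
  "('a::real_normed_vector \<Rightarrow> real) \<Rightarrow> real \<Rightarrow> 'a measure \<Rightarrow> nat \<Rightarrow> (nat \<Rightarrow> 'a) \<Rightarrow> (nat \<Rightarrow> nat) \<Rightarrow> real"
where
  "allocation_mass f \<alpha> P0 n X k =
     (\<integral>(v, \<theta>). (\<Prod>i = 1..n. stick_weight v (k i) * f (X i - \<theta> (k i))) \<partial>stick_breaking_prior \<alpha> P0) /
     (\<integral>\<omega>. (\<Prod>i = 1..n. mixture f (dirichlet_process \<omega>) (X i)) \<partial>stick_breaking_prior \<alpha> P0)"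

text \<open>A measure on the countable set of all \<open>k\<^sub>1, \<dots>, k\<^sub>n \<ge> 1\<close>; it uses only \<open>X 1, \<dots>, X n\<close>.\<close>

definition allocation_posterior ::
  "('a::real_normed_vector \<Rightarrow> real) \<Rightarrow> real \<Rightarrow> 'a measure \<Rightarrow> nat \<Rightarrow> (nat \<Rightarrow> 'a) \<Rightarrow> (nat \<Rightarrow> nat) measure"
where
  "allocation_posterior f \<alpha> P0 n X =
     point_measure ({1..n} \<rightarrow>\<^sub>E {1..}) (\<lambda>k. ennreal (allocation_mass f \<alpha> P0 n X k))"

text \<open>
  Measurability is part of the notion: for a non-measurable set \<open>measure\<close> returns 0, which would make
  the limit statement void.
\<close>

definition tendsto_in_prob :: "'w measure \<Rightarrow> (nat \<Rightarrow> 'w \<Rightarrow> real) \<Rightarrow> real \<Rightarrow> bool" where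
  "tendsto_in_prob M Y l \<longleftrightarrow>
     (\<forall>n. Y n \<in> borel_measurable M) \<and>
     (\<forall>\<epsilon>>0. (\<lambda>n. measure M {\<omega> \<in> space M. \<bar>Y n \<omega> - l\<bar> > \<epsilon>}) \<longlonglongrightarrow> 0)"

end

theory Submission
  imports Defs
begin

text \<open>
  Conditionally on sticks and atoms the labels are independent, so if the sticks after the \<open>K\<close>-th one have total
  mass at most \<open>\<rho> = n powr (\<delta> - 1/2) / 4\<close>, then more than \<open>t = n powr (1/2 + \<delta>)\<close> labels above \<open>K\<close>
  occur with probability at most \<open>exp (2 * \<rho> * n - t)\<close>. If that mass exceeds \<open>\<rho>\<close>, then either one of finitely many
  bounded statistics of the data rejects the mixing measure with exponentially small error, or the mixing measure
  is \<open>\<tau>\<close>-close to the truth, with \<open>\<tau>\<close> slightly larger than \<open>n powr - (1/2)\<close>. The prior probability of the latter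
  is of order \<open>\<tau> powr N * (\<tau> / \<rho>) powr (1/4)\<close> up to small powers of \<open>n\<close>, where \<open>N = K - 1 + \<alpha> + K * D\<close>: a remaining mass
  \<open>\<rho>\<close> much larger than \<open>\<tau>\<close> would have to be spent on atoms near the true ones. By a second moment bound for likelihood
  ratios the evidence is at least of order \<open>\<epsilon> powr N\<close> with \<open>\<epsilon>\<close> slightly smaller than \<open>n powr - (1/2)\<close>. The factor
  \<open>(\<tau> / \<rho>) powr (1/4)\<close> decays like a power of \<open>n\<close> and beats the loss \<open>(\<tau> / \<epsilon>) powr N\<close>.
\<close>

subsection \<open>Product measures\<close>

text \<open>The upper bound on the prior and the lower bound on the evidence must carry the same
  exponent \<open>N\<close>: then passing from the radius \<epsilon> to the larger \<tau> costs only
  a small power of \<open>n\<close>, which a fixed gain from \<rho> beats. The evidence side needs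
  just the first \<open>K\<close> sticks and atoms near one configuration. The obstacle is the upper
  bound: a mixing measure near the truth may split every true atom over many of infinitely many
  sticks. Therefore only a slowly growing number \<open>m\<close> of sticks is inspected, and one
  heavy atom per true component is chosen as leader, a union bound that costs a power of
  \<open>m\<close>. With everything else frozen, the constraints confine the \<open>K\<close>
  leading atoms and all leading sticks but the last to sets of size about \<tau>. The stick that is
  left after deleting those leading sticks supplies the exponent \<alpha> and the additional 1/4.
  The statistics are trigonometric because averaging over the kernel only rotates and scales a
  cosine and sine pair, so bounded functions of the data with prescribed means can be written
  down.\<close>

lemma measurable_override_component[measurable]:
  assumes "i \<in> I"
  shows "(\<lambda>(x, X). X(i := x)) \<in> M i \<Otimes>\<^sub>M Pi\<^sub>M I M \<rightarrow>\<^sub>M Pi\<^sub>M I M"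
proof -
  have "(\<lambda>(x, X). X(i := x)) \<in> M i \<Otimes>\<^sub>M Pi\<^sub>M I M \<rightarrow>\<^sub>M Pi\<^sub>M (insert i I) M"
    by measurable
  then show ?thesis
    using assms by (simp add: insert_absorb)
qed

text \<open>An independent redraw of one coordinate preserves the product law. As \<open>I\<close>
  may be infinite, this is the device by which single sticks and atoms are integrated out of the
  whole sequence.\<close>

lemma nn_integral_PiM_resample:
  assumes M: "\<And>i. i \<in> I \<Longrightarrow> prob_space (M i)" and i: "i \<in> I"
    and F[measurable]: "F \<in> borel_measurable (Pi\<^sub>M I M)"
  shows "(\<integral>\<^sup>+X. F X \<partial>Pi\<^sub>M I M) = (\<integral>\<^sup>+X. (\<integral>\<^sup>+x. F (X(i := x)) \<partial>M i) \<partial>Pi\<^sub>M I M)"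
proof -
  have ii: "insert i I = I" using i by auto
  interpret Mi: prob_space "M i" using M i by auto
  interpret P: prob_space "Pi\<^sub>M I M" by (rule prob_space_PiM) (rule M)
  interpret pair_sigma_finite "M i" "Pi\<^sub>M I M" ..
  note measurable_override_component[OF i, measurable]
  have "Pi\<^sub>M I M = distr (M i \<Otimes>\<^sub>M Pi\<^sub>M I M) (Pi\<^sub>M I M) (\<lambda>(x, X). X(i := x))"
    using distr_pair_PiM_eq_PiM[of I M i] M i by (simp add: ii)
  then have "(\<integral>\<^sup>+X. F X \<partial>Pi\<^sub>M I M) = (\<integral>\<^sup>+X. F X \<partial>distr (M i \<Otimes>\<^sub>M Pi\<^sub>M I M) (Pi\<^sub>M I M) (\<lambda>(x, X). X(i := x)))"
    by simp
  also have "\<dots> = (\<integral>\<^sup>+z. F (case z of (x, X) \<Rightarrow> X(i := x)) \<partial>(M i \<Otimes>\<^sub>M Pi\<^sub>M I M))"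
    by (rule nn_integral_distr) measurable
  also have "\<dots> = (\<integral>\<^sup>+z. (\<lambda>(x, X). F (X(i := x))) z \<partial>(M i \<Otimes>\<^sub>M Pi\<^sub>M I M))"
    by (auto intro!: nn_integral_cong split: prod.splits)
  also have "\<dots> = (\<integral>\<^sup>+X. (\<integral>\<^sup>+x. F (X(i := x)) \<partial>M i) \<partial>Pi\<^sub>M I M)"
  proof -
    have m: "(\<lambda>(x, X). F (X(i := x))) \<in> borel_measurable (M i \<Otimes>\<^sub>M Pi\<^sub>M I M)"
      using measurable_compose[OF measurable_override_component[OF i] F]
      by (simp add: case_prod_beta')
    show ?thesis by (rule nn_integral_snd[OF m, simplified, symmetric])
  qed
  finally show ?thesis .
qed

lemma nn_integral_PiM_prod:
  assumes M: "\<And>i. i \<in> I \<Longrightarrow> prob_space (M i)" and J: "finite J" "J \<subseteq> I"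
    and u: "\<And>j. j \<in> J \<Longrightarrow> u j \<in> borel_measurable (M j)"
  shows "(\<integral>\<^sup>+X. (\<Prod>j\<in>J. u j (X j)) \<partial>Pi\<^sub>M I M) = (\<Prod>j\<in>J. \<integral>\<^sup>+x. u j x \<partial>M j)"
  using J u
proof (induction J)
  case empty
  interpret P: prob_space "Pi\<^sub>M I M" by (rule prob_space_PiM) (rule M)
  show ?case using P.emeasure_space_1 by simp
next
  case (insert i J)
  have i: "i \<in> I" using insert by auto
  have m: "(\<lambda>X. u j (X j)) \<in> borel_measurable (Pi\<^sub>M I M)" if "j \<in> insert i J" for j
    using that insert by (intro measurable_compose[OF measurable_component_singleton]) auto
  have "(\<integral>\<^sup>+X. (\<Prod>j\<in>insert i J. u j (X j)) \<partial>Pi\<^sub>M I M) =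
     (\<integral>\<^sup>+X. (\<integral>\<^sup>+x. (\<Prod>j\<in>insert i J. u j ((X(i := x)) j)) \<partial>M i) \<partial>Pi\<^sub>M I M)"
    using m by (intro nn_integral_PiM_resample M i borel_measurable_prod_ennreal) auto
  also have "\<dots> = (\<integral>\<^sup>+X. (\<integral>\<^sup>+x. u i x * (\<Prod>j\<in>J. u j (X j)) \<partial>M i) \<partial>Pi\<^sub>M I M)"
  proof (intro nn_integral_cong)
    fix X x
    have "(\<Prod>j\<in>J. u j ((X(i := x)) j)) = (\<Prod>j\<in>J. u j (X j))"
      using insert by (intro prod.cong) auto
    then show "(\<Prod>j\<in>insert i J. u j ((X(i := x)) j)) = u i x * (\<Prod>j\<in>J. u j (X j))"
      using insert by simp
  qed
  also have "\<dots> = (\<integral>\<^sup>+X. (\<integral>\<^sup>+x. u i x \<partial>M i) * (\<Prod>j\<in>J. u j (X j)) \<partial>Pi\<^sub>M I M)"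
    using insert by (intro nn_integral_cong nn_integral_multc) auto
  also have "\<dots> = (\<integral>\<^sup>+x. u i x \<partial>M i) * (\<integral>\<^sup>+X. (\<Prod>j\<in>J. u j (X j)) \<partial>Pi\<^sub>M I M)"
    using m by (intro nn_integral_cmult borel_measurable_prod_ennreal) auto
  finally show ?case using insert by simp
qed

lemma nn_integral_PiM_override:
  assumes M: "\<And>i. i \<in> I \<Longrightarrow> prob_space (M i)" and L: "finite L" "L \<subseteq> I"
    and F: "F \<in> borel_measurable (Pi\<^sub>M I M)"
  shows "(\<integral>\<^sup>+X. F X \<partial>Pi\<^sub>M I M) =
    (\<integral>\<^sup>+X. (\<integral>\<^sup>+y. F (\<lambda>i. if i \<in> L then y i else X i) \<partial>Pi\<^sub>M L M) \<partial>Pi\<^sub>M I M)"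
  using L
proof (induction L)
  case empty
  show ?case by (simp add: PiM_empty)
next
  case (insert c L)
  have c: "c \<in> I" using insert by auto
  \<comment> \<open>Outside \<open>I\<close> the family is filled up with \<open>M c\<close>,
    because the calculus of finite products wants a probability measure at every index.\<close>
  define M' where "M' = (\<lambda>i. if i \<in> I then M i else M c)"
  have M': "prob_space (M' i)" for i using M c by (auto simp: M'_def)
  have ppM': "product_prob_space M'" using M' by (intro product_prob_spaceI)
  interpret M': product_prob_space M' by (rule ppM')
  have eq: "Pi\<^sub>M J M = Pi\<^sub>M J M'" if "J \<subseteq> I" for J using that by (intro PiM_cong) (auto simp: M'_def)
  have eqc: "M c = M' c" using c by (simp add: M'_def)
  have meas: "(\<lambda>(X, y) i. if i \<in> J then y i else X i) \<in> Pi\<^sub>M I M' \<Otimes>\<^sub>M Pi\<^sub>M J M' \<rightarrow>\<^sub>M Pi\<^sub>M I M'" if J: "J \<subseteq> I" for J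
  proof -
    have "(\<lambda>z. \<lambda>i\<in>I. if i \<in> J then snd z i else fst z i) \<in> Pi\<^sub>M I M' \<Otimes>\<^sub>M Pi\<^sub>M J M' \<rightarrow>\<^sub>M Pi\<^sub>M I M'"
    proof (rule measurable_restrict)
      fix i assume i: "i \<in> I"
      show "(\<lambda>z. if i \<in> J then snd z i else fst z i) \<in> Pi\<^sub>M I M' \<Otimes>\<^sub>M Pi\<^sub>M J M' \<rightarrow>\<^sub>M M' i"
        by (cases "i \<in> J") (use i in \<open>auto intro!: measurable_compose[OF measurable_snd] measurable_compose[OF measurable_fst] measurable_component_singleton\<close>)
    qed
    moreover have "(\<lambda>z. \<lambda>i\<in>I. if i \<in> J then snd z i else fst z i) z = (\<lambda>(X, y) i. if i \<in> J then y i else X i) z"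
      if "z \<in> space (Pi\<^sub>M I M' \<Otimes>\<^sub>M Pi\<^sub>M J M')" for z
      using that J by (auto simp: space_pair_measure space_PiM fun_eq_iff PiE_def extensional_def)
    ultimately show ?thesis by (rule measurable_cong[THEN iffD1, rotated])
  qed
  have F': "F \<in> borel_measurable (Pi\<^sub>M I M')" using F eq[of I] by simp
  have mF: "(\<lambda>(X,y). F (\<lambda>i. if i \<in> J then y i else X i)) \<in> borel_measurable (Pi\<^sub>M I M' \<Otimes>\<^sub>M Pi\<^sub>M J M')" if "J \<subseteq> I" for J
    using measurable_compose[OF meas[OF that] F'] by (simp add: case_prod_beta')
  have LI: "L \<subseteq> I" "insert c L \<subseteq> I" using insert by auto
  interpret L: prob_space "Pi\<^sub>M L M'" by (rule prob_space_PiM) (rule M')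
  have "(\<integral>\<^sup>+X. F X \<partial>Pi\<^sub>M I M) = (\<integral>\<^sup>+X. (\<integral>\<^sup>+y. F (\<lambda>i. if i \<in> L then y i else X i) \<partial>Pi\<^sub>M L M') \<partial>Pi\<^sub>M I M')"
    using insert eq LI by simp
  also have "\<dots> = (\<integral>\<^sup>+X. (\<integral>\<^sup>+x. (\<integral>\<^sup>+y. F (\<lambda>i. if i \<in> L then y i else (X(c:=x)) i) \<partial>Pi\<^sub>M L M') \<partial>M' c) \<partial>Pi\<^sub>M I M')"
    by (rule nn_integral_PiM_resample[OF M' c]) (use L.borel_measurable_nn_integral[OF mF[OF LI(1)]] in simp)
  also have "\<dots> = (\<integral>\<^sup>+X. (\<integral>\<^sup>+y. F (\<lambda>i. if i \<in> insert c L then y i else X i) \<partial>Pi\<^sub>M (insert c L) M') \<partial>Pi\<^sub>M I M')"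
  proof (rule nn_integral_cong)
    fix X assume X: "X \<in> space (Pi\<^sub>M I M')"
    have m: "(\<lambda>y. F (\<lambda>i. if i \<in> insert c L then y i else X i)) \<in> borel_measurable (Pi\<^sub>M (insert c L) M')"
      using measurable_compose[OF measurable_Pair1'[OF X] mF[OF LI(2)]] by simp
    have "(\<integral>\<^sup>+y. F (\<lambda>i. if i \<in> insert c L then y i else X i) \<partial>Pi\<^sub>M (insert c L) M') =
       (\<integral>\<^sup>+x. (\<integral>\<^sup>+y. F (\<lambda>i. if i \<in> insert c L then (y(c:=x)) i else X i) \<partial>Pi\<^sub>M L M') \<partial>M' c)"
      using insert by (intro M'.product_nn_integral_insert_rev m) auto
    also have "\<dots> = (\<integral>\<^sup>+x. (\<integral>\<^sup>+y. F (\<lambda>i. if i \<in> L then y i else (X(c:=x)) i) \<partial>Pi\<^sub>M L M') \<partial>M' c)"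
      using insert by (intro nn_integral_cong arg_cong[of _ _ F]) auto
    finally show "(\<integral>\<^sup>+x. (\<integral>\<^sup>+y. F (\<lambda>i. if i \<in> L then y i else (X(c:=x)) i) \<partial>Pi\<^sub>M L M') \<partial>M' c) =
       (\<integral>\<^sup>+y. F (\<lambda>i. if i \<in> insert c L then y i else X i) \<partial>Pi\<^sub>M (insert c L) M')" by simp
  qed
  finally show ?case using eq LI by simp
qed

lemma emeasure_PiM_diameter_bound:
  fixes b :: ennreal
  assumes M: "\<And>i. i \<in> I \<Longrightarrow> prob_space (M i)" and L: "finite L" "L \<subseteq> I"
    and E: "E \<in> sets (Pi\<^sub>M I M)" and E0: "E0 \<in> sets (Pi\<^sub>M I M)" and sub: "E \<subseteq> E0"
    and inv: "\<And>X Y. X \<in> E \<Longrightarrow> Y \<in> space (Pi\<^sub>M I M) \<Longrightarrow> (\<And>i. i \<notin> L \<Longrightarrow> X i = Y i) \<Longrightarrow> Y \<in> E0"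
    and T: "\<And>X Y c. X \<in> E \<Longrightarrow> Y \<in> E \<Longrightarrow> (\<And>i. i \<notin> L \<Longrightarrow> X i = Y i) \<Longrightarrow> c \<in> L \<Longrightarrow> Y c \<in> T c (X c)"
    and Tm: "\<And>c x. c \<in> L \<Longrightarrow> x \<in> space (M c) \<Longrightarrow> T c x \<in> sets (M c)"
    and Tb: "\<And>c x. c \<in> L \<Longrightarrow> x \<in> space (M c) \<Longrightarrow> emeasure (M c) (T c x) \<le> b"
  shows "emeasure (Pi\<^sub>M I M) E \<le> b ^ card L * emeasure (Pi\<^sub>M I M) E0"
proof -
  let ?ov = "\<lambda>X y i. if i \<in> L then y i else X i"
  have "emeasure (Pi\<^sub>M I M) E = (\<integral>\<^sup>+X. indicator E X \<partial>Pi\<^sub>M I M)" using E by simp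
  also have "\<dots> = (\<integral>\<^sup>+X. (\<integral>\<^sup>+y. indicator E (?ov X y) \<partial>Pi\<^sub>M L M) \<partial>Pi\<^sub>M I M)"
    by (rule nn_integral_PiM_override[OF M L]) (use E in auto)
  also have "\<dots> \<le> (\<integral>\<^sup>+X. b ^ card L * indicator E0 X \<partial>Pi\<^sub>M I M)"
  proof (rule nn_integral_mono)
    fix X assume X: "X \<in> space (Pi\<^sub>M I M)"
    show "(\<integral>\<^sup>+y. indicator E (?ov X y) \<partial>Pi\<^sub>M L M) \<le> b ^ card L * indicator E0 X"
    proof (cases "\<exists>y\<in>space (Pi\<^sub>M L M). ?ov X y \<in> E")
      case False
      then have "(\<integral>\<^sup>+y. indicator E (?ov X y) \<partial>Pi\<^sub>M L M) = (\<integral>\<^sup>+y. 0 \<partial>Pi\<^sub>M L M)"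
        by (intro nn_integral_cong) auto
      then show ?thesis by simp
    next
      case True
      then obtain z where z: "z \<in> space (Pi\<^sub>M L M)" "?ov X z \<in> E" by auto
      have zc: "z c \<in> space (M c)" if "c \<in> L" for c using z that by (auto simp: space_PiM)
      have XE: "X \<in> E0" by (rule inv[OF z(2) X]) auto
      have "(\<integral>\<^sup>+y. indicator E (?ov X y) \<partial>Pi\<^sub>M L M) \<le> (\<integral>\<^sup>+y. (\<Prod>c\<in>L. indicator (T c (z c)) (y c)) \<partial>Pi\<^sub>M L M)"
      proof (rule nn_integral_mono)
        fix y assume y: "y \<in> space (Pi\<^sub>M L M)"
        show "indicator E (?ov X y) \<le> (\<Prod>c\<in>L. indicator (T c (z c)) (y c) :: ennreal)"
        proof (cases "?ov X y \<in> E")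
          case True
          have "y c \<in> T c (z c)" if c: "c \<in> L" for c
            using T[OF z(2) True _ c] c by auto
          then show ?thesis using True by simp
        qed simp
      qed
      also have "\<dots> = (\<Prod>c\<in>L. \<integral>\<^sup>+x. indicator (T c (z c)) x \<partial>M c)"
        by (rule nn_integral_PiM_prod) (use M L Tm zc in auto)
      also have "\<dots> = (\<Prod>c\<in>L. emeasure (M c) (T c (z c)))"
        using Tm zc by (intro prod.cong) auto
      also have "\<dots> \<le> (\<Prod>c\<in>L. b)"
        using Tb zc by (intro prod_mono_ennreal) auto
      finally show ?thesis using XE by simp
    qed
  qed
  also have "\<dots> = b ^ card L * emeasure (Pi\<^sub>M I M) E0"
    using E0 by (simp add: nn_integral_cmult)
  finally show ?thesis .
qed

subsection \<open>Stick lengths\<close>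

definition stick_rem :: "(nat \<Rightarrow> real) \<Rightarrow> nat \<Rightarrow> real" where
  "stick_rem v k = (\<Prod>j = 1..k. 1 - v j)"

lemma stick_rem_0 [simp]: "stick_rem v 0 = 1"
  by (simp add: stick_rem_def)

lemma stick_rem_Suc: "stick_rem v (Suc k) = stick_rem v k * (1 - v (Suc k))"
  by (simp add: stick_rem_def)

lemma stick_weight_Suc: "stick_weight v (Suc k) = v (Suc k) * stick_rem v k"
  by (simp add: stick_weight_def stick_rem_def atLeastLessThanSuc_atLeastAtMost)

lemma stick_weight_eq_diff: "k \<ge> 1 \<Longrightarrow> stick_weight v k = stick_rem v (k - 1) - stick_rem v k"
  by (cases k) (auto simp: stick_weight_Suc stick_rem_Suc algebra_simps)

lemma stick_weight_eq: "k \<ge> 1 \<Longrightarrow> stick_weight v k = v k * stick_rem v (k - 1)"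
  by (cases k) (auto simp: stick_weight_Suc)

lemma stick_rem_eq: "k \<ge> 1 \<Longrightarrow> stick_rem v k = stick_rem v (k - 1) * (1 - v k)"
  by (cases k) (auto simp: stick_rem_Suc)

lemma sum_stick_weight: "(\<Sum>k = 1..m. stick_weight v k) = 1 - stick_rem v m"
  by (induction m) (auto simp: stick_weight_eq_diff)

lemma stick_rem_pos: "(\<And>j. j \<in> {1..k} \<Longrightarrow> v j < 1) \<Longrightarrow> stick_rem v k > 0"
  unfolding stick_rem_def by (intro prod_pos) auto

lemma stick_rem_antimono:
  assumes "\<And>j. j \<in> {1..t} \<Longrightarrow> 0 \<le> v j \<and> v j \<le> 1" and "s \<le> t"
  shows "stick_rem v t \<le> stick_rem v s"
  using assms(2,1)
proof (induction t rule: dec_induct)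
  case (step n)
  have "stick_rem v n \<ge> 0" unfolding stick_rem_def using step by (intro prod_nonneg) auto
  then have "stick_rem v (Suc n) \<le> stick_rem v n"
    using step.prems[of "Suc n"] by (simp add: stick_rem_Suc mult_left_le)
  also have "\<dots> \<le> stick_rem v s" using step by auto
  finally show ?case .
qed simp

lemma stick_rem_le_1:
  assumes "\<And>j. j \<in> {1..t} \<Longrightarrow> 0 \<le> v j \<and> v j \<le> 1"
  shows "stick_rem v t \<le> 1"
  using stick_rem_antimono[where s = 0, OF assms] by simp

text \<open>
  If the sticks outside \<open>L - {Max L}\<close> are fixed, then the cluster masses determine the remaining sticks,
  and stably so. The proof propagates the discrepancy \<open>D j\<close> of the remaining masses backwards through
  \<open>L\<close>: the mass that one cluster gains after the index \<open>t\<close> has to be lost before it.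
\<close>

lemma stick_diameter:
  fixes v v' :: "nat \<Rightarrow> real" and C :: "'c set"
  assumes v: "\<And>j. j \<in> {1..m} \<Longrightarrow> 0 < v j \<and> v j < 1"
    and v': "\<And>j. j \<in> {1..m} \<Longrightarrow> 0 < v' j \<and> v' j < 1"
    and C: "finite C" "C \<noteq> {}" and l: "inj_on l C" and L: "L = l ` C" "L \<subseteq> {1..m}"
    and p: "p = Max L" and agree: "\<And>j. j \<notin> L - {p} \<Longrightarrow> v j = v' j"
    and N: "\<And>c. c \<in> C \<Longrightarrow> N c \<subseteq> {1..m} - L" and dis: "disjoint_family_on N C"
    and cl: "\<And>c. c \<in> C \<Longrightarrow> \<bar>(stick_weight v (l c) + (\<Sum>k\<in>N c. stick_weight v k)) -
        (stick_weight v' (l c) + (\<Sum>k\<in>N c. stick_weight v' k))\<bar> \<le> \<eta>"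
    and h: "0 < h" "h \<le> 1"
    and heavy: "\<And>j. j \<in> L \<Longrightarrow> stick_weight v j \<ge> h"
    and t: "t \<in> L - {p}"
  shows "\<bar>v t - v' t\<bar> \<le> 2 * (real (card C) * \<eta>) * (4 / h) ^ (card C + 2)"
proof -
  define D where "D j = \<bar>stick_rem v j - stick_rem v' j\<bar>" for j
  define b where "b j = \<bar>stick_weight v j - stick_weight v' j\<bar>" for j
  define B where "B = real (card C) * \<eta>"
  define S where "S t = (\<Sum>k\<in>{t+1..m} - L. b k)" for t
  define n where "n t = card {s \<in> L. t \<le> s}" for t
  have fin: "finite L" using C L by auto
  have pL: "p \<in> L" using p L C fin by auto
  have pm: "p \<le> m" "p \<ge> 1" using pL L by auto
  have Lp: "j \<le> p" if "j \<in> L" for j using that p fin by auto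
  have [simp]: "b j \<ge> 0" "D j \<ge> 0" for j by (auto simp: b_def D_def)
  have eta: "\<eta> \<ge> 0" using cl C by fastforce
  have B0: "B \<ge> 0" using eta by (simp add: B_def)
  have cardL: "card L = card C" using l L by (simp add: card_image)
  have S0: "S t \<ge> 0" for t unfolding S_def by (intro sum_nonneg) auto
  \<comment> \<open>Where the proportions agree, a discrepancy in the mass before \<open>j\<close>
    is divided between the piece \<open>j\<close> and the rest exactly as the stick is, so
    \<open>D\<close> shrinks there. Only indices in \<open>L - {p}\<close> can create
    discrepancy.\<close>
  have bD: "b j = v j * D (j - 1)" "D j = (1 - v j) * D (j - 1)" if "j \<in> {1..m}" "j \<notin> L - {p}" for j
  proof -
    have e: "v j = v' j" using agree that by auto
    have "stick_weight v j - stick_weight v' j = v j * (stick_rem v (j - 1) - stick_rem v' (j - 1))"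
      using that e by (simp add: stick_weight_eq algebra_simps)
    then show "b j = v j * D (j - 1)" using v[of j] that by (simp add: b_def D_def abs_mult)
    have "stick_rem v j - stick_rem v' j = (1 - v j) * (stick_rem v (j - 1) - stick_rem v' (j - 1))"
      using that e by (simp add: stick_rem_eq algebra_simps)
    then show "D j = (1 - v j) * D (j - 1)" using v[of j] that by (simp add: D_def abs_mult)
  qed
  have Db: "D (j - 1) = D j + b j" if "j \<in> {1..m}" "j \<notin> L - {p}" for j
    using bD[OF that] by (simp add: algebra_simps)
  have Dle: "D j \<le> D (j - 1) + b j" if "j \<ge> 1" for j
    using that stick_weight_eq_diff[of j v] stick_weight_eq_diff[of j v'] by (simp add: D_def b_def)
  have tele: "D t \<le> (\<Sum>j\<in>{1..t} \<inter> (L - {p}). b j) - (\<Sum>j\<in>{1..t} - (L - {p}). b j)" if "t \<le> m" for t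
    using that
  proof (induction t)
    case 0
    then show ?case by (simp add: D_def)
  next
    case (Suc t)
    show ?case
    proof (cases "Suc t \<in> L - {p}")
      case True
      have 1: "{1..Suc t} \<inter> (L - {p}) = insert (Suc t) ({1..t} \<inter> (L - {p}))" using True by auto
      have 2: "{1..Suc t} - (L - {p}) = {1..t} - (L - {p})" using True by (auto simp: le_Suc_eq)
      show ?thesis unfolding 1 2 using Suc Dle[of "Suc t"] by simp
    next
      case False
      have 1: "{1..Suc t} - (L - {p}) = insert (Suc t) ({1..t} - (L - {p}))" using False by auto
      have 2: "{1..Suc t} \<inter> (L - {p}) = {1..t} \<inter> (L - {p})" using False by (auto simp: le_Suc_eq)
      show ?thesis unfolding 1 2 using Suc Db[of "Suc t"] False by simp
    qed
  qed
  \<comment> \<open>The change of a leader is compensated, up to \<open>\<eta>\<close>, by the other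
    members of its own cluster. The clusters are disjoint, so the errors add up to
    \<open>B\<close>.\<close>
  have clus: "(\<Sum>j\<in>L''. b j) \<le> B + (\<Sum>k\<in>{1..m} - L. b k)" if L'': "L'' \<subseteq> L" for L''
  proof -
    have "(\<Sum>j\<in>L''. b j) \<le> (\<Sum>j\<in>L. b j)" using L'' fin by (intro sum_mono2) auto
    also have "\<dots> = (\<Sum>c\<in>C. b (l c))" using L l by (simp add: sum.reindex)
    also have "\<dots> \<le> (\<Sum>c\<in>C. \<eta> + (\<Sum>k\<in>N c. b k))"
    proof (rule sum_mono)
      fix c assume c: "c \<in> C"
      have "\<bar>(\<Sum>k\<in>N c. stick_weight v k) - (\<Sum>k\<in>N c. stick_weight v' k)\<bar> \<le> (\<Sum>k\<in>N c. b k)"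
        unfolding b_def sum_subtractf[symmetric] by (rule sum_abs)
      then show "b (l c) \<le> \<eta> + (\<Sum>k\<in>N c. b k)" using cl[OF c] unfolding b_def by linarith
    qed
    also have "\<dots> = B + (\<Sum>c\<in>C. \<Sum>k\<in>N c. b k)" by (simp add: sum.distrib B_def)
    also have "(\<Sum>c\<in>C. \<Sum>k\<in>N c. b k) = (\<Sum>k\<in>(\<Union>c\<in>C. N c). b k)"
      using C N dis finite_subset[OF N] by (intro sum.UNION_disjoint[symmetric]) (auto simp: disjoint_family_on_def)
    also have "\<dots> \<le> (\<Sum>k\<in>{1..m} - L. b k)" using N by (intro sum_mono2) auto
    finally show ?thesis by simp
  qed
  \<comment> \<open>Inserting \<open>clus\<close> into \<open>tele\<close> cancels the non-leaders
    before \<open>t\<close>. Only those behind \<open>t\<close> remain, and later discrepancies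
    control them; this makes a backward induction possible.\<close>
  have star: "D (t - 1) \<le> B + S t" if t: "t \<in> L" for t
  proof -
    have t1: "t \<ge> 1" "t \<le> m" using t L by auto
    have "D (t - 1) \<le> (\<Sum>j\<in>{1..t-1} \<inter> (L - {p}). b j) - (\<Sum>j\<in>{1..t-1} - (L - {p}). b j)"
      using tele[of "t - 1"] t1 by auto
    also have "\<dots> \<le> B + (\<Sum>k\<in>{1..m} - L. b k) - (\<Sum>j\<in>{1..t-1} - L. b j)"
    proof -
      have "(\<Sum>j\<in>{1..t-1} - L. b j) \<le> (\<Sum>j\<in>{1..t-1} - (L - {p}). b j)" by (intro sum_mono2) auto
      then show ?thesis using clus[of "{1..t-1} \<inter> (L - {p})"] by fastforce
    qed
    also have "{1..m} - L = ({1..t-1} - L) \<union> ({t+1..m} - L)"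
    proof (intro set_eqI)
      fix x show "x \<in> {1..m} - L \<longleftrightarrow> x \<in> ({1..t-1} - L) \<union> ({t+1..m} - L)"
        using t t1 by (cases "x = t") auto
    qed
    also have "(\<Sum>k\<in>({1..t-1} - L) \<union> ({t+1..m} - L). b k) = (\<Sum>j\<in>{1..t-1} - L. b j) + S t"
      unfolding S_def by (intro sum.union_disjoint) auto
    finally show ?thesis by simp
  qed
  \<comment> \<open>Between two leaders discrepancy is only passed on: what \<open>D\<close> loses
    appears in the changes \<open>b\<close>, and at least the fraction \<open>stick_rem v t\<close>
    survives. Hence a bound just before the next leader bounds \<open>D\<close> just behind the
    previous one.\<close>
  have gap: "D s = D t + (\<Sum>j = s+1..t. b j) \<and> D t \<ge> stick_rem v t * D s"
    if "s \<le> t" "t \<le> m" "\<And>j. s < j \<Longrightarrow> j \<le> t \<Longrightarrow> j \<notin> L - {p}" for s t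
    using that
  proof (induction t rule: dec_induct)
    case base
    have "stick_rem v s \<le> 1" using base v by (intro stick_rem_le_1) (auto simp: less_imp_le)
    then show ?case using mult_right_mono[of "stick_rem v s" 1 "D s"] by simp
  next
    case (step t)
    have IH: "D s = D t + (\<Sum>j = s+1..t. b j)" "D t \<ge> stick_rem v t * D s"
      using step by auto
    have n: "Suc t \<in> {1..m}" "Suc t \<notin> L - {p}" using step by auto
    have "D s = D (Suc t) + (\<Sum>j = s+1..Suc t. b j)"
      using IH(1) Db[OF n] step by simp
    moreover have "stick_rem v (Suc t) * D s \<le> D (Suc t)"
      using IH(2) bD(2)[OF n] v[OF n(1)] mult_left_mono[OF IH(2), of "1 - v (Suc t)"]
      by (simp add: stick_rem_Suc mult_ac)
    ultimately show ?case by simp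
  qed
  have rem_ge: "h \<le> stick_rem v (t - 1)" if "t \<in> L" for t
  proof -
    have t: "t \<in> {1..m}" using that L by auto
    have "stick_rem v (t - 1) > 0" using v t by (intro stick_rem_pos) auto
    then have "stick_weight v t \<le> stick_rem v (t - 1)" using v[OF t] t
      by (auto simp: stick_weight_eq mult_left_le_one_le)
    then show ?thesis using heavy[OF that] by simp
  qed
  have h4: "4 / h \<ge> 4" using h by (simp add: field_simps)
  have next_le: "D t \<le> D (t' - 1) / h \<and> S t \<le> D t + S t'" if t: "t \<in> L" and t': "t' \<in> L" "t < t'"
     and btw: "\<And>j. t < j \<Longrightarrow> j < t' \<Longrightarrow> j \<notin> L" for t t'
  proof -
    have g: "D t = D (t'-1) + (\<Sum>j = t+1..t'-1. b j)" "D (t'-1) \<ge> stick_rem v (t'-1) * D t"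
    proof -
      have "t \<le> t' - 1" "t' - 1 \<le> m" "\<And>j. t < j \<Longrightarrow> j \<le> t' - 1 \<Longrightarrow> j \<notin> L - {p}"
        using t' L btw by auto
      from gap[OF this] show "D t = D (t'-1) + (\<Sum>j = t+1..t'-1. b j)" "D (t'-1) \<ge> stick_rem v (t'-1) * D t"
        by auto
    qed
    have "h * D t \<le> D (t'-1)" using order_trans[OF mult_right_mono[OF rem_ge[OF t'(1)], of "D t"] g(2)] by (simp add: D_def)
    then have 1: "D t \<le> D (t' - 1) / h" using h by (simp add: field_simps)
    have "{t+1..m} - L = {t+1..t'-1} \<union> ({t'+1..m} - L)"
    proof (intro set_eqI)
      fix x
      have "t' \<le> m" "x = t' \<Longrightarrow> x \<in> L" using t' L by auto
      then show "x \<in> {t+1..m} - L \<longleftrightarrow> x \<in> {t+1..t'-1} \<union> ({t'+1..m} - L)"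
        using btw[of x] t' by (cases x t' rule: linorder_cases) auto
    qed
    moreover have "sum b ({t+1..t'-1} \<union> ({t'+1..m} - L)) = (\<Sum>j = t+1..t'-1. b j) + sum b ({t'+1..m} - L)"
      by (intro sum.union_disjoint) auto
    ultimately have "S t = (\<Sum>j = t+1..t'-1. b j) + S t'" by (simp add: S_def)
    then show ?thesis using g 1 by simp
  qed
  \<comment> \<open>\<open>n t\<close> counts the leaders from \<open>t\<close> on. Each step back
    to the previous leader costs a factor \<open>4 / h\<close>: the \<open>1 / h\<close> is the loss
    in \<open>next_le\<close>, the 4 pays for adding \<open>B\<close>, \<open>D t\<close> and the
    later changes.\<close>
  have main: "t \<in> L \<Longrightarrow> D (t - 1) \<le> B * (4/h) ^ n t \<and> S t \<le> B * (4/h) ^ n t" for t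
  proof (induction "m - t" arbitrary: t rule: less_induct)
    case less
    have tm: "t \<le> m" "t \<ge> 1" using less L by auto
    show ?case
    proof (cases "t = p")
      case True
      have "{s \<in> L. p \<le> s} = {p}" using pL Lp by force
      then have n: "n t = 1" by (simp add: n_def True)
      have Sp: "S p = (\<Sum>k\<in>{p+1..m}. b k)" unfolding S_def using Lp by (intro sum.cong) fastforce+
      have "D p = D m + (\<Sum>k\<in>{p+1..m}. b k)" using gap[of p m] pm Lp by force
      then have Sle: "S p \<le> D p" using Sp by simp
      have Dp: "D (p - 1) = D p + b p" "b p = v p * D (p - 1)" using Db[of p] bD[of p] pm by auto
      \<comment> \<open>At \<open>p\<close> the proportions agree, so \<open>b p\<close> is the drop
        of \<open>D\<close> across \<open>p\<close>, and \<open>star\<close> bounds it by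
        \<open>B\<close>. Since \<open>b p = v p * D (p - 1)\<close> with \<open>v p\<close> at
        least \<open>h\<close>, this bounds \<open>D (p - 1)\<close> itself and starts the
        induction.\<close>
      have "b p \<le> B" using star[OF pL] Sle Dp by simp
      moreover have "h \<le> v p"
      proof -
        have "stick_rem v (p - 1) \<le> 1" using v pm by (intro stick_rem_le_1) (auto simp: less_imp_le)
        then have "stick_weight v p \<le> v p" using v[of p] pm by (simp add: stick_weight_eq mult_left_le)
        then show ?thesis using heavy[OF pL] by simp
      qed
      ultimately have "h * D (p - 1) \<le> B" using Dp mult_right_mono[of h "v p" "D (p - 1)"] by simp
      then have "D (p - 1) \<le> B / h" using h by (simp add: field_simps)
      also have "\<dots> \<le> B * (4 / h)" using B0 h by (simp add: field_simps)
      finally have *: "D (p - 1) \<le> B * (4 / h)" .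
      have "D p \<le> D (p - 1)" using Dp by (simp add: b_def)
      then show ?thesis using True n Sle * by simp
    next
      case False
      define t' where "t' = Min {s \<in> L. t < s}"
      have ne: "{s \<in> L. t < s} \<noteq> {}" using False pL Lp[OF less(2)] by force
      then have t': "t' \<in> L" "t < t'" using fin Min_in[of "{s \<in> L. t < s}"] by (auto simp: t'_def)
      have btw: "j \<notin> L" if "t < j" "j < t'" for j
        proof
          assume "j \<in> L"
          then have "t' \<le> j" unfolding t'_def using fin that by (intro Min_le) auto
          then show False using that by simp
        qed
      have "{s \<in> L. t \<le> s} = insert t {s \<in> L. t' \<le> s}"
      proof (intro set_eqI)
        fix s show "s \<in> {s \<in> L. t \<le> s} \<longleftrightarrow> s \<in> insert t {s \<in> L. t' \<le> s}"
          using less(2) t' btw[of s] by (cases "s < t'"; cases "s = t") auto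
      qed
      then have n: "n t = Suc (n t')" unfolding n_def using fin t' by simp
      have IH: "D (t' - 1) \<le> B * (4/h) ^ n t'" "S t' \<le> B * (4/h) ^ n t'"
        using less(1)[of t'] t' tm L by auto
      define X where "X = B * (4/h) ^ n t'"
      have "1 \<le> (4/h) ^ n t'" using h4 by (intro one_le_power) simp
      then have X: "B \<le> X" unfolding X_def using B0 mult_left_mono[of 1 "(4/h) ^ n t'" B] by simp
      have Xh: "X * h \<le> X" using X B0 h by (intro mult_left_le) auto
      have "D t \<le> X / h" using next_le[OF less(2) t' btw] IH h unfolding X_def
        by (meson divide_right_mono less_imp_le order_trans)
      then have "S t \<le> X / h + X" using next_le[OF less(2) t' btw] IH unfolding X_def by linarith
      moreover have "X \<le> X / h" using Xh h by (simp add: pos_le_divide_eq)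
      moreover have "D (t - 1) \<le> B + S t" using star less by auto
      moreover have "B * (4/h) ^ n t = 4 * (X / h)" by (simp add: n X_def)
      moreover have "X / h \<ge> 0" using X B0 h by simp
      ultimately show ?thesis using X by linarith
    qed
  qed
  define Z where "Z = B * (4/h) ^ card C"
  have Z: "D (t - 1) \<le> Z" if "t \<in> L" for t
  proof -
    have "n t \<le> card C" unfolding n_def cardL[symmetric] using fin by (intro card_mono) auto
    then have "B * (4/h) ^ n t \<le> Z" unfolding Z_def using h4 B0 by (intro mult_left_mono power_increasing) auto
    then show ?thesis using main[OF that] by simp
  qed
  have Z0: "Z \<ge> 0" using B0 h by (simp add: Z_def)
  have tL: "t \<in> L" "t \<in> {1..m}" using t L by auto
  define t' where "t' = Min {s \<in> L. t < s}"
  have ne: "{s \<in> L. t < s} \<noteq> {}" using t pL Lp[of t] by force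
  then have t': "t' \<in> L" "t < t'" using fin Min_in[of "{s \<in> L. t < s}"] by (auto simp: t'_def)
  have btw: "j \<notin> L" if "t < j" "j < t'" for j
    proof
      assume "j \<in> L"
      then have "t' \<le> j" unfolding t'_def using fin that by (intro Min_le) auto
      then show False using that by simp
    qed
  have "D t \<le> D (t' - 1) / h" using next_le[OF tL(1) t' btw] by simp
  also have "\<dots> \<le> Z / h" using Z[OF t'(1)] h by (simp add: divide_right_mono)
  finally have Dt: "D t \<le> Z / h" .
  have "Z * h \<le> Z" using Z0 h by (intro mult_left_le) auto
  then have Z1: "Z \<le> Z / h" using h by (simp add: pos_le_divide_eq)
  have rp: "stick_rem v (t - 1) \<ge> h" using rem_ge[OF tL(1)] .
  \<comment> \<open>The proportion at \<open>t\<close> is recovered from the masses remaining before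
    and after \<open>t\<close>. The division by the mass before \<open>t\<close> is stable because
    that mass is at least \<open>h\<close>.\<close>
  have "stick_rem v (t - 1) * (v t - v' t) =
     (stick_rem v (t-1) - stick_rem v' (t-1)) * (1 - v' t) - (stick_rem v t - stick_rem v' t)"
    using tL by (simp add: stick_rem_eq[of t] algebra_simps)
  then have "\<bar>stick_rem v (t - 1) * (v t - v' t)\<bar> \<le> D (t - 1) * \<bar>1 - v' t\<bar> + D t"
    unfolding D_def by (metis abs_mult abs_triangle_ineq4)
  also have "\<dots> \<le> D (t - 1) + D t" using v'[OF tL(2)] by (simp add: mult_left_le)
  also have "\<dots> \<le> 2 * (Z / h)" using Z[OF tL(1)] Dt Z1 by simp
  finally have "stick_rem v (t - 1) * \<bar>v t - v' t\<bar> \<le> 2 * (Z / h)" using rp h by (simp add: abs_mult)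
  then have "h * \<bar>v t - v' t\<bar> \<le> 2 * (Z / h)" using mult_right_mono[OF rp, of "\<bar>v t - v' t\<bar>"] by simp
  then have "\<bar>v t - v' t\<bar> \<le> 2 * (Z / h) / h" using h by (simp add: field_simps)
  also have "\<dots> \<le> 2 * Z * (4 / h) ^ 2" using Z0 h by (simp add: field_simps power2_eq_square)
  also have "\<dots> = 2 * B * (4 / h) ^ (card C + 2)" unfolding Z_def power_add by (simp only: mult_ac)
  finally show ?thesis by (simp add: B_def)
qed

subsection \<open>Beta distributed proportions\<close>

lemma Beta_one_left: "\<alpha> > 0 \<Longrightarrow> Beta 1 (\<alpha>::real) = 1 / \<alpha>"
proof -
  assume a: "\<alpha> > 0"
  then have "Gamma (1 + \<alpha>) = \<alpha> * Gamma \<alpha>" using Gamma_plus1[of \<alpha>] by (auto simp: add.commute nonpos_Ints_def)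
  moreover have "Gamma \<alpha> > 0" using a by (rule Gamma_real_pos)
  ultimately show ?thesis by (simp add: Beta_def)
qed

lemma beta_density_one:
  assumes "\<alpha> > 0"
  shows "beta_density 1 \<alpha> x = (if 0 < x \<and> x < 1 then \<alpha> * (1 - x) powr (\<alpha> - 1) else 0)"
  using assms by (simp add: beta_density_def Beta_one_left)

lemma beta_density_measurable [measurable]: "beta_density a b \<in> borel_measurable borel"
  unfolding beta_density_def by measurable

lemma space_beta [simp]: "space (beta_distribution a b) = UNIV"
  by (simp add: beta_distribution_def)

lemma sets_beta [simp, measurable_cong]: "sets (beta_distribution a b) = sets borel"
  by (simp add: beta_distribution_def)

lemma nn_integral_beta:
  assumes [measurable]: "F \<in> borel_measurable borel"
  shows "(\<integral>\<^sup>+v. F v \<partial>beta_distribution 1 \<alpha>) = (\<integral>\<^sup>+v. ennreal (beta_density 1 \<alpha> v) * F v \<partial>lborel)"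
  unfolding beta_distribution_def by (subst nn_integral_density) auto

lemma AE_beta: 
  assumes "\<alpha> > 0"
  shows "AE v in beta_distribution 1 \<alpha>. 0 < v \<and> v < 1"
  unfolding beta_distribution_def
  by (subst AE_density) (auto simp: beta_density_one[OF assms] split: if_splits)

lemma nn_integral_beta_powr:
  assumes a: "\<alpha> > 0" and r: "r > -1" and s: "\<alpha> + s > 0"
  shows "(\<integral>\<^sup>+v. ennreal (v powr r * (1 - v) powr s) \<partial>beta_distribution 1 \<alpha>) = ennreal (\<alpha> * Beta (r + 1) (\<alpha> + s))"
proof -
  have "((\<lambda>t. t powr (r + 1 - 1) * (1 - t) powr (\<alpha> + s - 1)) has_integral Beta (r + 1) (\<alpha> + s)) {0..1}"
    using r s by (intro has_integral_Beta_real) auto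
  then have "((\<lambda>t. \<alpha> * (t powr (r + 1 - 1) * (1 - t) powr (\<alpha> + s - 1))) has_integral \<alpha> * Beta (r + 1) (\<alpha> + s)) {0..1}"
    by (rule has_integral_mult_right)
  then have "(\<integral>\<^sup>+t. ennreal (indicator {0..1} t * (\<alpha> * (t powr (r + 1 - 1) * (1 - t) powr (\<alpha> + s - 1)))) \<partial>lborel) =
      ennreal (\<alpha> * Beta (r + 1) (\<alpha> + s))"
    using a by (intro nn_integral_has_integral_lebesgue) auto
  moreover have "(\<integral>\<^sup>+v. ennreal (v powr r * (1 - v) powr s) \<partial>beta_distribution 1 \<alpha>) =
    (\<integral>\<^sup>+t. ennreal (indicator {0..1} t * (\<alpha> * (t powr (r + 1 - 1) * (1 - t) powr (\<alpha> + s - 1)))) \<partial>lborel)"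
  proof (subst nn_integral_beta, measurable, rule nn_integral_cong_AE)
    have "AE v in lborel. v \<noteq> 0 \<and> v \<noteq> (1::real)" by (intro AE_conjI AE_lborel_singleton)
    then show "AE v in lborel. ennreal (beta_density 1 \<alpha> v) * ennreal (v powr r * (1 - v) powr s) =
        ennreal (indicator {0..1} v * (\<alpha> * (v powr (r + 1 - 1) * (1 - v) powr (\<alpha> + s - 1))))"
    proof eventually_elim
      case (elim v)
      have "(1 - v) powr (\<alpha> + s - 1) = (1 - v) powr (\<alpha> - 1) * (1 - v) powr s"
        by (simp add: powr_add[symmetric] algebra_simps)
      then show ?case using elim a
        by (auto simp: beta_density_one ennreal_mult[symmetric] indicator_def mult_ac)
    qed
  qed
  ultimately show ?thesis by simp
qed

lemma prob_space_beta:
  assumes a: "\<alpha> > 0"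
  shows "prob_space (beta_distribution 1 \<alpha>)"
proof
  have "emeasure (beta_distribution 1 \<alpha>) (space (beta_distribution 1 \<alpha>)) = (\<integral>\<^sup>+v. 1 \<partial>beta_distribution 1 \<alpha>)"
    by simp
  also have "\<dots> = (\<integral>\<^sup>+v. ennreal (v powr 0 * (1 - v) powr 0) \<partial>beta_distribution 1 \<alpha>)"
    using AE_beta[OF a] by (intro nn_integral_cong_AE) auto
  also have "\<dots> = 1" using a by (subst nn_integral_beta_powr) (auto simp: Beta_one_left)
  finally show "emeasure (beta_distribution 1 \<alpha>) (space (beta_distribution 1 \<alpha>)) = 1" .
qed

lemma nn_integral_beta_one_minus:
  assumes a: "\<alpha> > 0"
  shows "(\<integral>\<^sup>+v. ennreal (1 - v) \<partial>beta_distribution 1 \<alpha>) = ennreal (\<alpha> / (\<alpha> + 1))"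
proof -
  have "(\<integral>\<^sup>+v. ennreal (1 - v) \<partial>beta_distribution 1 \<alpha>) = (\<integral>\<^sup>+v. ennreal (v powr 0 * (1 - v) powr 1) \<partial>beta_distribution 1 \<alpha>)"
    using AE_beta[OF a] by (intro nn_integral_cong_AE) auto
  also have "\<dots> = ennreal (\<alpha> / (\<alpha> + 1))" using a by (subst nn_integral_beta_powr) (auto simp: Beta_one_left)
  finally show ?thesis .
qed

text \<open>\<open>\<alpha> + s\<close> may be negative. The integral would then diverge at 1
  without the truncation, and the right-hand side grows like \<open>a powr (\<alpha> + s)\<close> as
  \<open>a\<close> tends to 0.\<close>

lemma nn_integral_beta_truncated:
  assumes al: "\<alpha> > 0" and a: "0 < a" "a \<le> 1" and s: "\<alpha> + s \<noteq> 0"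
  shows "(\<integral>\<^sup>+v. ennreal ((1 - v) powr s) * indicator {v. 1 - v > a} v \<partial>beta_distribution 1 \<alpha>) =
     ennreal (\<alpha> / (\<alpha> + s) * (1 - a powr (\<alpha> + s)))"
proof -
  define F where "F v = - (\<alpha> / (\<alpha> + s)) * (1 - v) powr (\<alpha> + s)" for v
  have "(\<integral>\<^sup>+v. ennreal ((1 - v) powr s) * indicator {v. 1 - v > a} v \<partial>beta_distribution 1 \<alpha>) =
    (\<integral>\<^sup>+v. ennreal (\<alpha> * (1 - v) powr (\<alpha> + s - 1)) * indicator {0..1-a} v \<partial>lborel)"
  proof (subst nn_integral_beta, measurable, rule nn_integral_cong_AE)
    have "AE v in lborel. v \<noteq> 0 \<and> v \<noteq> (1 - a::real)" by (intro AE_conjI AE_lborel_singleton)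
    then show "AE v in lborel. ennreal (beta_density 1 \<alpha> v) * (ennreal ((1 - v) powr s) * indicator {v. 1 - v > a} v) =
        ennreal (\<alpha> * (1 - v) powr (\<alpha> + s - 1)) * indicator {0..1-a} v"
    proof eventually_elim
      case (elim v)
      have "(1 - v) powr (\<alpha> + s - 1) = (1 - v) powr (\<alpha> - 1) * (1 - v) powr s"
        by (simp add: powr_add[symmetric] algebra_simps)
      then show ?case using elim al a
        by (auto simp: beta_density_one ennreal_mult[symmetric] indicator_def mult_ac)
    qed
  qed
  also have "\<dots> = ennreal (F (1 - a) - F 0)"
  proof (rule nn_integral_FTC_Icc)
    show "(F has_real_derivative \<alpha> * (1 - v) powr (\<alpha> + s - 1)) (at v)" if "v \<in> {0..1-a}" for v
      unfolding F_def using that a s by (auto intro!: derivative_eq_intros)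
  qed (use al a in auto)
  also have "F (1 - a) - F 0 = \<alpha> / (\<alpha> + s) * (1 - a powr (\<alpha> + s))"
    by (simp add: F_def algebra_simps)
  finally show ?thesis .
qed

lemma beta_upper_tail:
  assumes al: "\<alpha> > 0" and z: "0 < z" "z \<le> 1"
  shows "emeasure (beta_distribution 1 \<alpha>) {v. 1 - v \<le> z} = ennreal (z powr \<alpha>)"
proof -
  interpret prob_space "beta_distribution 1 \<alpha>" by (rule prob_space_beta[OF al])
  have "emeasure (beta_distribution 1 \<alpha>) {v. 1 - v > z} =
     (\<integral>\<^sup>+v. indicator {v. 1 - v > z} v \<partial>beta_distribution 1 \<alpha>)"
    by simp
  also have "\<dots> = (\<integral>\<^sup>+v. ennreal ((1 - v) powr 0) * indicator {v. 1 - v > z} v \<partial>beta_distribution 1 \<alpha>)"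
    by (intro nn_integral_cong_AE, use AE_beta[OF al] in eventually_elim) (use z in \<open>auto simp: indicator_def\<close>)
  also have "\<dots> = ennreal (1 - z powr \<alpha>)"
    using al z by (subst nn_integral_beta_truncated) auto
  finally have *: "emeasure (beta_distribution 1 \<alpha>) {v. 1 - v > z} = ennreal (1 - z powr \<alpha>)" .
  have z1: "z powr \<alpha> \<le> 1" using z al by (simp add: powr_le1)
  have "measure (beta_distribution 1 \<alpha>) {v. 1 - v > z} = 1 - z powr \<alpha>"
    using * z1 by (simp add: measure_def)
  moreover have "{v. 1 - v \<le> z} = space (beta_distribution 1 \<alpha>) - {v. 1 - v > z}" by auto
  ultimately have "measure (beta_distribution 1 \<alpha>) {v. 1 - v \<le> z} = z powr \<alpha>"
    using prob_compl[of "{v. 1 - v > z}"] by simp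
  then show ?thesis by (simp add: emeasure_eq_measure)
qed

text \<open>For \<alpha> below 1 the density is unbounded at 1. Keeping \<open>1 - v\<close> above
  \<open>h\<close> gives the uniform bound \<open>\<alpha> / h\<close>, because
  \<open>(1 - v) powr (\<alpha> - 1)\<close> is a number at most 1 divided by
  \<open>1 - v\<close>.\<close>

lemma beta_interval_upper:
  assumes al: "\<alpha> > 0" and h: "0 < h" "h \<le> 1" and s: "s \<ge> 0"
  shows "emeasure (beta_distribution 1 \<alpha>) {v. \<bar>v - v0\<bar> \<le> s \<and> 1 - v \<ge> h} \<le> ennreal (2 * s * \<alpha> / h)"
proof -
  have "emeasure (beta_distribution 1 \<alpha>) {v. \<bar>v - v0\<bar> \<le> s \<and> 1 - v \<ge> h} =
    (\<integral>\<^sup>+v. ennreal (beta_density 1 \<alpha> v) * indicator {v. \<bar>v - v0\<bar> \<le> s \<and> 1 - v \<ge> h} v \<partial>lborel)"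
    by (subst nn_integral_beta[symmetric]) auto
  also have "\<dots> \<le> (\<integral>\<^sup>+v. ennreal (\<alpha> / h) * indicator {v0 - s..v0 + s} v \<partial>lborel)"
  proof (rule nn_integral_mono)
    fix v :: real
    have "(1 - v) powr (\<alpha> - 1) \<le> 1 / h" if "1 - v \<ge> h" "0 < v"
    proof -
      have "(1 - v) powr (\<alpha> - 1) = (1 - v) powr \<alpha> / (1 - v)" using that h by (simp add: powr_diff)
      also have "\<dots> \<le> 1 / h" using that h al by (intro frac_le powr_le1) auto
      finally show ?thesis .
    qed
    then have "beta_density 1 \<alpha> v \<le> \<alpha> / h" if "1 - v \<ge> h"
      using that al h by (auto simp: beta_density_one field_simps)
    then show "ennreal (beta_density 1 \<alpha> v) * indicator {v. \<bar>v - v0\<bar> \<le> s \<and> 1 - v \<ge> h} v \<le>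
       ennreal (\<alpha> / h) * indicator {v0 - s..v0 + s} v"
      by (auto simp: indicator_def intro!: ennreal_leI)
  qed
  also have "\<dots> = ennreal (\<alpha> / h) * ennreal (2 * s)"
    using s by (subst nn_integral_cmult_indicator) auto
  also have "\<dots> = ennreal (2 * s * \<alpha> / h)" using s al h by (simp add: ennreal_mult[symmetric] mult_ac)
  finally show ?thesis .
qed

lemma beta_interval_lower:
  assumes al: "\<alpha> > 0" and v0: "0 < v0" "v0 < 1"
  shows "\<exists>c>0. \<forall>\<epsilon>\<in>{0<..1}. emeasure (beta_distribution 1 \<alpha>) {v. \<bar>v - v0\<bar> \<le> \<epsilon>} \<ge> ennreal (c * \<epsilon>)"
proof -
  \<comment> \<open>Half the distance to the nearer end point: intervals of radius
    \<open>r * \<epsilon>\<close> then stay where the density is bounded below, for all \<epsilon>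
    up to 1.\<close>
  define r where "r = min v0 (1 - v0) / 2"
  have r: "r > 0" "v0 \<ge> 2 * r" "v0 + 2 * r \<le> 1" using v0 by (auto simp: r_def)
  have "emeasure (beta_distribution 1 \<alpha>) {v. \<bar>v - v0\<bar> \<le> \<epsilon>} \<ge> ennreal (\<alpha> * r powr \<alpha> * (2 * r) * \<epsilon>)" if e: "0 < \<epsilon>" "\<epsilon> \<le> 1" for \<epsilon>
  proof -
    have re: "r * \<epsilon> \<le> r" "r * \<epsilon> > 0" "r * \<epsilon> \<le> \<epsilon>" using r e by (auto simp: mult_left_le)
    have "ennreal (\<alpha> * r powr \<alpha> * (2 * r) * \<epsilon>) = ennreal (\<alpha> * r powr \<alpha>) * ennreal (2 * (r * \<epsilon>))"
      using al r e by (simp add: ennreal_mult[symmetric] mult_ac)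
    also have "\<dots> = (\<integral>\<^sup>+v. ennreal (\<alpha> * r powr \<alpha>) * indicator {v0 - r * \<epsilon>..v0 + r * \<epsilon>} v \<partial>lborel)"
      using re by (subst nn_integral_cmult_indicator) (auto simp: mult_ac)
    also have "\<dots> \<le> (\<integral>\<^sup>+v. ennreal (beta_density 1 \<alpha> v) * indicator {v. \<bar>v - v0\<bar> \<le> \<epsilon>} v \<partial>lborel)"
    proof (rule nn_integral_mono)
      fix v :: real
      have "\<alpha> * r powr \<alpha> \<le> beta_density 1 \<alpha> v" if "v \<in> {v0 - r * \<epsilon>..v0 + r * \<epsilon>}"
      proof -
        have "v0 - r * \<epsilon> \<le> v" "v \<le> v0 + r * \<epsilon>" using that by auto
        then have v: "r \<le> v" "r \<le> 1 - v" using re r by linarith+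
        have "r powr \<alpha> \<le> (1 - v) powr \<alpha>" using v r al by (intro powr_mono2) auto
        also have "\<dots> \<le> (1 - v) powr (\<alpha> - 1)" using v r by (intro powr_mono') auto
        finally show ?thesis using v r al by (simp add: beta_density_one)
      qed
      then show "ennreal (\<alpha> * r powr \<alpha>) * indicator {v0 - r * \<epsilon>..v0 + r * \<epsilon>} v
        \<le> ennreal (beta_density 1 \<alpha> v) * indicator {v. \<bar>v - v0\<bar> \<le> \<epsilon>} v"
        using re by (auto simp: indicator_def intro!: ennreal_leI)
    qed
    also have "\<dots> = emeasure (beta_distribution 1 \<alpha>) {v. \<bar>v - v0\<bar> \<le> \<epsilon>}"
      by (subst nn_integral_beta[symmetric]) auto
    finally show ?thesis .
  qed
  moreover have "\<alpha> * r powr \<alpha> * (2 * r) > 0" using al r by simp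
  ultimately show ?thesis by (intro exI[of _ "\<alpha> * r powr \<alpha> * (2 * r)"]) auto
qed

text \<open>A probability bound that is trivial for small \<open>x\<close> and decays like a power
  for large \<open>x\<close>. The argument will be a weight or a remaining mass measured in units of
  the allowed error.\<close>

definition damp :: "real \<Rightarrow> real \<Rightarrow> real \<Rightarrow> real" where
  "damp A s x = min 1 (A * x powr - s)"

lemma damp_measurable [measurable]: "damp A s \<in> borel_measurable borel"
  unfolding damp_def by measurable

lemma damp_le_1: "damp A s x \<le> 1"
  by (simp add: damp_def)

lemma damp_nonneg: "A \<ge> 0 \<Longrightarrow> damp A s x \<ge> 0"
  by (simp add: damp_def)

lemma damp_eq_1:
  assumes "A \<ge> 1" "0 < x" "x \<le> 1" "s \<ge> 0"
  shows "damp A s x = 1"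
proof -
  have "1 \<le> x powr - s" using assms ge_one_powr_ge_zero[of "1 / x" s]
    by (simp add: powr_minus_divide powr_divide)
  then show ?thesis using mult_mono[of 1 A 1 "x powr - s"] assms by (simp add: damp_def)
qed

lemma damp_antimono:
  assumes "A \<ge> 0" "0 < x" "x \<le> y" "s \<ge> 0"
  shows "damp A s y \<le> damp A s x"
proof -
  have "y powr - s \<le> x powr - s" using assms by (intro powr_mono2') auto
  then show ?thesis using assms mult_left_mono[of "y powr - s" "x powr - s" A]
    by (auto simp: damp_def)
qed

text \<open>The exponent exceeds \<alpha> by 1/4, so \<open>(1 - v) powr - (\<alpha> + 1/4)\<close>
  is not integrable at 1 against the beta law; cutting it off at \<rho> leaves the price
  \<open>\<rho> powr (-1/4)\<close>. This is how the lower bound \<rho> on the late mass enters the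
  prior estimate.\<close>

lemma nn_integral_damp_truncated:
  assumes al: "\<alpha> > 0" and A: "A > 0" and x: "x > 0" and \<rho>: "0 < \<rho>" "\<rho> \<le> 1"
  shows "(\<integral>\<^sup>+v. ennreal (damp A (\<alpha> + 1/4) (x * (1 - v))) * indicator {v. 1 - v > \<rho>} v \<partial>beta_distribution 1 \<alpha>)
      \<le> ennreal (4 * \<alpha> * A * x powr - (\<alpha> + 1/4) * \<rho> powr (-1/4))"
proof -
  let ?b = "\<alpha> + 1/4"
  have "(\<integral>\<^sup>+v. ennreal (damp A ?b (x * (1 - v))) * indicator {v. 1 - v > \<rho>} v \<partial>beta_distribution 1 \<alpha>) \<le>
     (\<integral>\<^sup>+v. ennreal (A * x powr - ?b) * (ennreal ((1 - v) powr - ?b) * indicator {v. 1 - v > \<rho>} v) \<partial>beta_distribution 1 \<alpha>)"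
  proof (rule nn_integral_mono)
    fix v
    show "ennreal (damp A ?b (x * (1 - v))) * indicator {v. 1 - v > \<rho>} v \<le>
       ennreal (A * x powr - ?b) * (ennreal ((1 - v) powr - ?b) * indicator {v. 1 - v > \<rho>} v)"
      using x A \<rho> by (auto simp: damp_def indicator_def ennreal_mult[symmetric] powr_mult intro!: ennreal_leI)
  qed
  also have "\<dots> = ennreal (A * x powr - ?b) * ennreal (\<alpha> / (\<alpha> + - ?b) * (1 - \<rho> powr (\<alpha> + - ?b)))"
    by (subst nn_integral_cmult, measurable, subst nn_integral_beta_truncated[OF al \<rho>]) auto
  also have "\<dots> \<le> ennreal (A * x powr - ?b) * ennreal (4 * \<alpha> * \<rho> powr (-1/4))"
    using al by (intro mult_left_mono ennreal_leI) (auto simp: algebra_simps)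
  also have "\<dots> = ennreal (4 * \<alpha> * A * x powr - ?b * \<rho> powr (-1/4))"
    using al A by (simp add: ennreal_mult[symmetric] mult_ac)
  finally show ?thesis .
qed

text \<open>Split at \<open>1 - v = z\<close> with \<open>z = x0 / x\<close>. The shorter remainders
  have probability \<open>z powr \<alpha>\<close>; on the longer ones the truncated integral with
  cut-off \<open>z\<close> returns the same power, since the surplus 1/4 cancels.\<close>

lemma nn_integral_damp:
  assumes al: "\<alpha> > 0" and x0: "x0 > 0" and x: "x > 0"
  shows "(\<integral>\<^sup>+v. ennreal (damp (x0 powr (\<alpha> + 1/4)) (\<alpha> + 1/4) (x * (1 - v))) \<partial>beta_distribution 1 \<alpha>)
      \<le> ennreal ((1 + 4 * \<alpha>) * (x0 / x) powr \<alpha>)"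
proof -
  let ?b = "\<alpha> + 1/4"
  define A where "A = x0 powr ?b"
  have A: "A > 0" using x0 by (simp add: A_def)
  interpret prob_space "beta_distribution 1 \<alpha>" by (rule prob_space_beta[OF al])
  define z where "z = x0 / x"
  have z: "z > 0" using x0 x by (simp add: z_def)
  show ?thesis
  proof (cases "z \<le> 1")
    case False
    have "(\<integral>\<^sup>+v. ennreal (damp A ?b (x * (1 - v))) \<partial>beta_distribution 1 \<alpha>) \<le> (\<integral>\<^sup>+v. 1 \<partial>beta_distribution 1 \<alpha>)"
      by (intro nn_integral_mono) (simp add: damp_le_1)
    also have "\<dots> = ennreal 1" using emeasure_space_1 by simp
    also have "\<dots> \<le> ennreal ((1 + 4 * \<alpha>) * z powr \<alpha>)"
    proof (rule ennreal_leI)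
      have "1 \<le> z powr \<alpha>" using False al by (intro ge_one_powr_ge_zero) auto
      then show "1 \<le> (1 + 4 * \<alpha>) * z powr \<alpha>" using al mult_mono[of 1 "1 + 4 * \<alpha>" 1 "z powr \<alpha>"] by simp
    qed
    finally show ?thesis by (simp add: A_def z_def)
  next
    case True
    have "(\<integral>\<^sup>+v. ennreal (damp A ?b (x * (1 - v))) \<partial>beta_distribution 1 \<alpha>) \<le>
      (\<integral>\<^sup>+v. indicator {v. 1 - v \<le> z} v + ennreal (damp A ?b (x * (1 - v))) * indicator {v. 1 - v > z} v \<partial>beta_distribution 1 \<alpha>)"
      by (intro nn_integral_mono) (auto simp: indicator_def damp_le_1)
    also have "\<dots> = emeasure (beta_distribution 1 \<alpha>) {v. 1 - v \<le> z} +
       (\<integral>\<^sup>+v. ennreal (damp A ?b (x * (1 - v))) * indicator {v. 1 - v > z} v \<partial>beta_distribution 1 \<alpha>)"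
      by (subst nn_integral_add) auto
    also have "\<dots> \<le> ennreal (z powr \<alpha>) + ennreal (4 * \<alpha> * A * x powr - ?b * z powr (-1/4))"
      by (intro add_mono nn_integral_damp_truncated al A x z True) (simp add: beta_upper_tail al z True)
    also have "A * x powr - ?b = z powr ?b" using x0 x 
      unfolding powr_minus_divide by (simp add: A_def z_def powr_divide)
    then have "4 * \<alpha> * A * x powr - ?b * z powr (-1/4) = 4 * \<alpha> * (z powr ?b * z powr (-1/4))"
      by (simp add: mult_ac)
    also have "z powr ?b * z powr (-1/4) = z powr \<alpha>" by (simp add: powr_add[symmetric])
    also have "ennreal (z powr \<alpha>) + ennreal (4 * \<alpha> * z powr \<alpha>) = ennreal ((1 + 4 * \<alpha>) * z powr \<alpha>)"
      using al by (simp add: ennreal_plus[symmetric] algebra_simps del: ennreal_plus)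
    finally show ?thesis by (simp add: A_def z_def)
  qed
qed

text \<open>
  \<open>damp A (\<alpha> + 1/4)\<close> is a supersolution of the recursion for the probability that all atoms in the rest of
  the stick satisfy a constraint of probability at most \<open>damp C (1/2)\<close> (of their weight). The exponent exceeds
  \<open>\<alpha>\<close>, which is where the gain over the pure stick probability comes from.
\<close>

lemma damp_supersolution:
  assumes al: "\<alpha> > 0" and C: "C \<ge> 0"
  shows "\<exists>x0\<ge>1. \<forall>x>0. (\<integral>\<^sup>+v. ennreal (damp C (1/2) (x * v) * damp (x0 powr (\<alpha> + 1/4)) (\<alpha> + 1/4) (x * (1 - v)))
      \<partial>beta_distribution 1 \<alpha>) \<le> ennreal (damp (x0 powr (\<alpha> + 1/4)) (\<alpha> + 1/4) x)"
proof -
  let ?b = "\<alpha> + 1/4"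
  interpret prob_space "beta_distribution 1 \<alpha>" by (rule prob_space_beta[OF al])
  define c1 where "c1 = \<alpha> * Beta (1/2) \<alpha>"
  define G where "G = max 1 (C * 2 powr ?b * c1 + 2 * C * (1 + 4 * \<alpha>))"
  \<comment> \<open>Chosen so that \<open>x0 powr (-1/2) = 1 / G\<close> swallows the constants of
    both halves of the estimate below.\<close>
  define x0 where "x0 = G ^ 2"
  define A where "A = x0 powr ?b"
  have G: "G \<ge> 1" "C * 2 powr ?b * c1 + 2 * C * (1 + 4 * \<alpha>) \<le> G" by (auto simp: G_def)
  have x0: "x0 \<ge> 1" using G by (simp add: x0_def)
  have A: "A \<ge> 1" using x0 al by (simp add: A_def ge_one_powr_ge_zero)
  have sq: "x0 powr (-1/2) = 1 / G"
    using G x0 by (simp add: x0_def powr_minus_divide powr_half_sqrt)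
  have c1: "(\<integral>\<^sup>+v. ennreal (v powr (-1/2)) \<partial>beta_distribution 1 \<alpha>) = ennreal c1"
  proof -
    have "(\<integral>\<^sup>+v. ennreal (v powr (-1/2)) \<partial>beta_distribution 1 \<alpha>) =
       (\<integral>\<^sup>+v. ennreal (v powr (-1/2) * (1 - v) powr 0) \<partial>beta_distribution 1 \<alpha>)"
      using AE_beta[OF al] by (intro nn_integral_cong_AE) auto
    also have "\<dots> = ennreal c1" unfolding c1_def using al by (subst nn_integral_beta_powr) auto
    finally show ?thesis .
  qed
  have c10: "c1 \<ge> 0"
    unfolding c1_def Beta_def using al by (auto intro!: mult_nonneg_nonneg divide_nonneg_nonneg simp: less_imp_le Gamma_real_pos)
  have "(\<integral>\<^sup>+v. ennreal (damp C (1/2) (x * v) * damp A ?b (x * (1 - v))) \<partial>beta_distribution 1 \<alpha>)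
      \<le> ennreal (damp A ?b x)" if x: "x > 0" for x
  proof (cases "x \<le> x0")
    case True
    have "x powr ?b \<le> A" unfolding A_def using True x al by (intro powr_mono2) auto
    then have d: "damp A ?b x = 1" using x unfolding damp_def powr_minus_divide by simp
    have "(\<integral>\<^sup>+v. ennreal (damp C (1/2) (x * v) * damp A ?b (x * (1 - v))) \<partial>beta_distribution 1 \<alpha>)
       \<le> (\<integral>\<^sup>+v. 1 \<partial>beta_distribution 1 \<alpha>)"
    proof (intro nn_integral_mono)
      fix v
      have "damp C (1/2) (x * v) * damp A ?b (x * (1 - v)) \<le> 1 * 1"
        using A C by (intro mult_mono damp_le_1 damp_nonneg) auto
      then show "ennreal (damp C (1/2) (x * v) * damp A ?b (x * (1 - v))) \<le> 1" by simp
    qed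
    also have "\<dots> = ennreal (damp A ?b x)" using emeasure_space_1 d by simp
    finally show ?thesis .
  next
    case False
    define z where "z = x0 / x"
    have z: "0 < z" "z < 1" using False x0 x by (auto simp: z_def)
    have Ax: "A * x powr - ?b = z powr ?b" using x0 x 
      unfolding powr_minus_divide by (simp add: A_def z_def powr_divide)
    have dx: "damp A ?b x = z powr ?b" unfolding damp_def Ax using z al by (simp add: powr_le1)
    have dm: "(\<integral>\<^sup>+v. ennreal (damp A ?b (x * (1 - v))) \<partial>beta_distribution 1 \<alpha>) \<le> ennreal ((1 + 4 * \<alpha>) * z powr \<alpha>)"
      unfolding A_def z_def by (rule nn_integral_damp[OF al _ x]) (use x0 in simp)
    have "(\<integral>\<^sup>+v. ennreal (damp C (1/2) (x * v) * damp A ?b (x * (1 - v))) \<partial>beta_distribution 1 \<alpha>) \<le>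
      (\<integral>\<^sup>+v. ennreal (C * x powr (-1/2) * z powr ?b * 2 powr ?b) * ennreal (v powr (-1/2)) +
         ennreal (2 * C * x powr (-1/2)) * ennreal (damp A ?b (x * (1 - v))) \<partial>beta_distribution 1 \<alpha>)"
    proof (rule nn_integral_mono_AE, use AE_beta[OF al] in eventually_elim)
      case (elim v)
      have q: "damp C (1/2) (x * v) \<le> C * x powr (-1/2) * v powr (-1/2)"
        using x elim by (simp add: damp_def powr_mult)
      have p: "damp A ?b (x * (1 - v)) \<le> z powr ?b * (1 - v) powr - ?b"
        using x elim by (simp add: damp_def powr_mult Ax[symmetric])
      have nn: "0 \<le> damp A ?b (x * (1 - v))" "0 \<le> damp C (1/2) (x * v)" using A C by (auto intro: damp_nonneg)
      have "damp C (1/2) (x * v) * damp A ?b (x * (1 - v)) \<le>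
          C * x powr (-1/2) * z powr ?b * 2 powr ?b * v powr (-1/2) + 2 * C * x powr (-1/2) * damp A ?b (x * (1 - v))"
      \<comment> \<open>One of the two parts has at least half of the mass. If it is the remainder,
        the second factor is replaced by a multiple of \<open>z powr (\<alpha> + 1/4)\<close> and
        the first is integrated; if it is the piece, the roles are exchanged.\<close>
      proof (cases "v \<le> 1/2")
        case True
        have "(1 - v) powr - ?b \<le> (1/2) powr - ?b" using True al by (intro powr_mono2') auto
        also have "\<dots> = 2 powr ?b" unfolding powr_minus_divide by (simp add: powr_divide)
        finally have "damp A ?b (x * (1 - v)) \<le> z powr ?b * 2 powr ?b"
          using p by (meson mult_left_mono order_trans powr_ge_zero)
        then have "damp C (1/2) (x * v) * damp A ?b (x * (1 - v)) \<le> (C * x powr (-1/2) * v powr (-1/2)) * (z powr ?b * 2 powr ?b)"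
          using q nn C by (intro mult_mono) auto
        moreover have "0 \<le> 2 * C * x powr (-1/2) * damp A ?b (x * (1 - v))" using C nn by simp
        ultimately show ?thesis by (simp add: mult_ac)
      next
        case False
        have "v powr (-1/2) \<le> v powr (-1)" using elim by (intro powr_mono') auto
        also have "\<dots> = 1 / v" using elim by (simp add: powr_neg_one)
        also have "\<dots> \<le> 2" using False elim by (simp add: field_simps)
        finally have "damp C (1/2) (x * v) \<le> 2 * C * x powr (-1/2)"
          using q C mult_left_mono[of "v powr (-1/2)" 2 "C * x powr (-1/2)"] by simp
        then have "damp C (1/2) (x * v) * damp A ?b (x * (1 - v)) \<le> 2 * C * x powr (-1/2) * damp A ?b (x * (1 - v))"
          using nn by (intro mult_right_mono)
        moreover have "0 \<le> C * x powr (-1/2) * z powr ?b * 2 powr ?b * v powr (-1/2)" using C by simp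
        ultimately show ?thesis by linarith
      qed
      then show ?case using C nn
        by (simp add: ennreal_mult[symmetric] ennreal_plus[symmetric] ennreal_leI del: ennreal_plus)
    qed
    also have "\<dots> = (\<integral>\<^sup>+v. ennreal (C * x powr (-1/2) * z powr ?b * 2 powr ?b) * ennreal (v powr (-1/2)) \<partial>beta_distribution 1 \<alpha>) +
         (\<integral>\<^sup>+v. ennreal (2 * C * x powr (-1/2)) * ennreal (damp A ?b (x * (1 - v))) \<partial>beta_distribution 1 \<alpha>)"
      by (rule nn_integral_add; measurable)
    also have "\<dots> = ennreal (C * x powr (-1/2) * z powr ?b * 2 powr ?b) * (\<integral>\<^sup>+v. ennreal (v powr (-1/2)) \<partial>beta_distribution 1 \<alpha>) +
         ennreal (2 * C * x powr (-1/2)) * (\<integral>\<^sup>+v. ennreal (damp A ?b (x * (1 - v))) \<partial>beta_distribution 1 \<alpha>)"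
      by (intro arg_cong2[of _ _ _ _ "(+)"] nn_integral_cmult; measurable)
    also have "\<dots> \<le> ennreal (C * x powr (-1/2) * z powr ?b * 2 powr ?b) * ennreal c1 +
         ennreal (2 * C * x powr (-1/2)) * ennreal ((1 + 4 * \<alpha>) * z powr \<alpha>)"
      unfolding c1 by (intro add_left_mono mult_left_mono dm zero_le)
    also have "\<dots> = ennreal (C * x powr (-1/2) * z powr ?b * 2 powr ?b * c1 + 2 * C * x powr (-1/2) * ((1 + 4 * \<alpha>) * z powr \<alpha>))"
    proof -
      define a where "a = C * x powr (-1/2) * z powr ?b * 2 powr ?b"
      define b where "b = 2 * C * x powr (-1/2)"
      define d where "d = (1 + 4 * \<alpha>) * z powr \<alpha>"
      have "a \<ge> 0" "b \<ge> 0" "d \<ge> 0" using C al by (auto simp: a_def b_def d_def)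
      then have "ennreal a * ennreal c1 + ennreal b * ennreal d = ennreal (a * c1 + b * d)"
        using c10 by (simp add: ennreal_mult)
      then show ?thesis by (simp only: a_def b_def d_def)
    qed
    also have "\<dots> \<le> ennreal (z powr ?b)"
    proof (rule ennreal_leI)
      have alg: "a * y * (1 / G) + b * (y * (1 / G)) = (a + b) * (y / G)" for a b y :: real
        by (simp add: algebra_simps add_divide_distrib)
      have x1: "x powr (-1/2) \<le> 1 / G" unfolding sq[symmetric] using False x0 by (intro powr_mono2') auto
      \<comment> \<open>In the second half only \<open>z powr \<alpha>\<close> is available. The
        factor \<open>x powr (-1/2)\<close> contributes another \<open>z powr (1/2)\<close>, more
        than the missing 1/4; this is why a surplus of 1/4 can be afforded.\<close>
      have za: "x powr (-1/2) * z powr \<alpha> \<le> z powr ?b * (1 / G)"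
      proof -
        have xz: "x = x0 / z" using x0 x by (simp add: z_def)
        have "x powr (-1/2) = x0 powr (-1/2) / z powr (-1/2)" unfolding xz using z x0 by (simp add: powr_divide)
        then have "x powr (-1/2) * z powr \<alpha> = x0 powr (-1/2) * (z powr \<alpha> / z powr (-1/2))" by (simp only: times_divide_eq_left times_divide_eq_right)
        also have "z powr \<alpha> / z powr (-1/2) = z powr (\<alpha> + 1/2)" using powr_diff[of z \<alpha> "-1/2"] by simp
        finally have "x powr (-1/2) * z powr \<alpha> = x0 powr (-1/2) * z powr (\<alpha> + 1/2)" .
        also have "\<dots> \<le> x0 powr (-1/2) * z powr ?b"
          using z by (intro mult_left_mono powr_mono') auto
        finally show ?thesis unfolding sq by (simp only: mult.commute)
      qed
      have "C * x powr (-1/2) * z powr ?b * 2 powr ?b * c1 + 2 * C * x powr (-1/2) * ((1 + 4 * \<alpha>) * z powr \<alpha>)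
        = (C * 2 powr ?b * c1 * z powr ?b) * x powr (-1/2) + 2 * C * (1 + 4 * \<alpha>) * (x powr (-1/2) * z powr \<alpha>)"
        by (simp only: mult_ac)
      also have "\<dots> \<le> (C * 2 powr ?b * c1 * z powr ?b) * (1 / G) + 2 * C * (1 + 4 * \<alpha>) * (z powr ?b * (1 / G))"
        using x1 za C c10 al by (intro add_mono mult_left_mono) auto
      also have "\<dots> = (C * 2 powr ?b * c1 + 2 * C * (1 + 4 * \<alpha>)) * (z powr ?b / G)"
        by (rule alg)
      also have "\<dots> \<le> G * (z powr ?b / G)" using G by (intro mult_right_mono) auto
      also have "\<dots> = z powr ?b" using G by simp
      finally show "C * x powr (-1/2) * z powr ?b * 2 powr ?b * c1 + 2 * C * x powr (-1/2) * ((1 + 4 * \<alpha>) * z powr \<alpha>) \<le> z powr ?b" .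
    qed
    finally show ?thesis by (simp add: dx)
  qed
  then show ?thesis using x0 unfolding A_def by blast
qed

subsection \<open>Prior probability of being close to the truth\<close>

lemma damp_measurable' [measurable (raw)]:
  "f \<in> borel_measurable M \<Longrightarrow> (\<lambda>x. damp A s (f x)) \<in> borel_measurable M"
  by (rule measurable_compose[OF _ damp_measurable])

lemma stick_rem_cong:
  "(\<And>j. j \<in> {1..k} \<Longrightarrow> v j = v' j) \<Longrightarrow> stick_rem v k = stick_rem v' k"
  unfolding stick_rem_def by (intro prod.cong) auto

lemma stick_weight_cong:
  "k \<ge> 1 \<Longrightarrow> (\<And>j. j \<in> {1..k} \<Longrightarrow> v j = v' j) \<Longrightarrow> stick_weight v k = stick_weight v' k"
proof -
  assume k: "k \<ge> 1" and e: "\<And>j. j \<in> {1..k} \<Longrightarrow> v j = v' j"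
  have "stick_rem v (k - 1) = stick_rem v' (k - 1)" using e by (intro stick_rem_cong) auto
  then show ?thesis using e[of k] k by (simp add: stick_weight_eq)
qed

text \<open>An index outside \<open>I\<close> is harmless, as there the points of the product space
  have the constant value \<open>undefined\<close>. Formulas that range over all naturals then need
  no side condition for the index 0.\<close>

lemma measurable_PiM_component_any:
  fixes M :: "'b::topological_space measure"
  assumes "sets M = sets borel"
  shows "(\<lambda>v. v k) \<in> borel_measurable (Pi\<^sub>M I (\<lambda>_. M))"
proof (cases "k \<in> I")
  case True
  then have "(\<lambda>v. v k) \<in> Pi\<^sub>M I (\<lambda>_. M) \<rightarrow>\<^sub>M M" by simp
  then show ?thesis using assms measurable_cong_sets by blast
next
  case False
  then have "v k = undefined" if "v \<in> space (Pi\<^sub>M I (\<lambda>_. M))" for v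
    using that by (auto simp: space_PiM PiE_def extensional_def)
  then show ?thesis by (subst measurable_cong[where g = "\<lambda>_. undefined"]) auto
qed

abbreviation stick_law :: "real \<Rightarrow> (nat \<Rightarrow> real) measure" where
  "stick_law \<alpha> \<equiv> \<Pi>\<^sub>M k\<in>{1..}. beta_distribution 1 \<alpha>"

lemma stick_law_component: "(\<lambda>v. v k) \<in> borel_measurable (stick_law \<alpha>)"
  by (rule measurable_PiM_component_any) simp

lemma stick_rem_measurable [measurable]: "(\<lambda>v. stick_rem v k) \<in> borel_measurable (stick_law \<alpha>)"
  supply stick_law_component[measurable] unfolding stick_rem_def by measurable

lemma stick_weight_measurable [measurable]: "(\<lambda>v. stick_weight v k) \<in> borel_measurable (stick_law \<alpha>)"
  supply stick_law_component[measurable] unfolding stick_weight_def by measurable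

text \<open>A proportion 0 breaks nothing off, so zeroing deletes the indices in \<open>Z\<close>
  from the stick. Conditions on the zeroed stick do not depend on these coordinates, as the diameter
  bound demands of its larger event.\<close>

definition zeroed :: "nat set \<Rightarrow> (nat \<Rightarrow> real) \<Rightarrow> nat \<Rightarrow> real" where
  "zeroed Z v = (\<lambda>j. if j \<in> Z then 0 else v j)"

lemma zeroed_rem_measurable [measurable]: "(\<lambda>v. stick_rem (zeroed Z v) k) \<in> borel_measurable (stick_law \<alpha>)"
  supply stick_law_component[measurable] unfolding stick_rem_def zeroed_def by measurable

lemma zeroed_weight_measurable [measurable]: "(\<lambda>v. stick_weight (zeroed Z v) k) \<in> borel_measurable (stick_law \<alpha>)"
  supply stick_law_component[measurable] unfolding stick_weight_def zeroed_def by measurable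

lemma AE_stick_law:
  assumes "\<alpha> > 0"
  shows "AE v in stick_law \<alpha>. \<forall>j\<ge>1. 0 < v j \<and> v j < 1"
proof -
  have "AE v in stick_law \<alpha>. 0 < v j \<and> v j < 1" if "j \<ge> 1" for j
    by (rule AE_PiM_component[of _ "\<lambda>_. beta_distribution 1 \<alpha>"])
      (use that assms prob_space_beta AE_beta in auto)
  then have "AE v in stick_law \<alpha>. j \<ge> 1 \<longrightarrow> 0 < v j \<and> v j < 1" for j by (cases "j \<ge> 1") auto
  then show ?thesis by (simp add: AE_all_countable)
qed

text \<open>Integrates out the sticks \<open>j\<close>, \<open>j - 1\<close>, ...,
  \<open>p + 1\<close> in turn. Behind \<open>p\<close> nothing is zeroed and nothing is a leader,
  so each redraw produces the integral in \<open>super\<close> with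
  \<open>x = stick_rem (zeroed Z v) n * u\<close>: the factors of the new piece and of the new
  remainder merge into one for the old remainder. The bound does not deteriorate with the number of
  sticks peeled off.\<close>

lemma stick_law_damp_peel:
  assumes al: "\<alpha> > 0" and C: "Cq \<ge> 0" and x0: "x0 > 0" and b: "b = \<alpha> + 1/4" and A: "A = x0 powr b"
    and super: "\<And>x. x > 0 \<Longrightarrow> (\<integral>\<^sup>+v. ennreal (damp Cq (1/2) (x * v) * damp A b (x * (1 - v)))
      \<partial>beta_distribution 1 \<alpha>) \<le> ennreal (damp A b x)"
    and u: "u > 0" and Z: "\<And>z. z \<in> Z \<Longrightarrow> z < p" and g[measurable]: "g \<in> borel_measurable (stick_law \<alpha>)"
    and gcong: "\<And>v v'. (\<And>j. j \<in> {1..p} \<Longrightarrow> v j = v' j) \<Longrightarrow> g v = g v'"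
    and L: "\<And>z. z \<in> L \<Longrightarrow> z \<le> p" and jp: "p \<le> j"
  shows "(\<integral>\<^sup>+v. g v * (\<Prod>k\<in>{1..j} - L. ennreal (damp Cq (1/2) (stick_weight (zeroed Z v) k * u))) *
        ennreal (damp A b (stick_rem (zeroed Z v) j * u)) \<partial>stick_law \<alpha>)
    \<le> (\<integral>\<^sup>+v. g v * (\<Prod>k\<in>{1..p} - L. ennreal (damp Cq (1/2) (stick_weight (zeroed Z v) k * u))) *
        ennreal (damp A b (stick_rem (zeroed Z v) p * u)) \<partial>stick_law \<alpha>)"
  using jp
proof (induction j rule: dec_induct)
  case (step n)
  let ?H = "\<lambda>j v. g v * (\<Prod>k\<in>{1..j} - L. ennreal (damp Cq (1/2) (stick_weight (zeroed Z v) k * u))) *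
        ennreal (damp A b (stick_rem (zeroed Z v) j * u))"
  have A0: "A \<ge> 0" by (simp add: A)
  have mm: "(\<lambda>x. ennreal (damp Cq (1/2) (r * x) * damp A b (r * (1 - x)))) \<in> borel_measurable (beta_distribution 1 \<alpha>)" for r
  proof -
    have 1: "(\<lambda>x. damp c s (r * x)) \<in> borel_measurable borel" "(\<lambda>x. damp c s (r * (1 - x))) \<in> borel_measurable borel" for c s
      by (rule measurable_compose[OF _ damp_measurable], measurable)+
    have "(\<lambda>x. ennreal (damp Cq (1/2) (r * x) * damp A b (r * (1 - x)))) \<in> borel_measurable borel"
      by (intro measurable_compose[OF borel_measurable_times measurable_ennreal] 1)
    then show ?thesis by (subst measurable_cong_sets[OF sets_beta refl])
  qed
  have mH: "?H j \<in> borel_measurable (stick_law \<alpha>)" for j by measurable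
  have "(\<integral>\<^sup>+v. ?H (Suc n) v \<partial>stick_law \<alpha>) = (\<integral>\<^sup>+v. (\<integral>\<^sup>+x. ?H (Suc n) (v(Suc n := x)) \<partial>beta_distribution 1 \<alpha>) \<partial>stick_law \<alpha>)"
    by (rule nn_integral_PiM_resample[OF _ _ mH]) (use al prob_space_beta in auto)
  also have "\<dots> \<le> (\<integral>\<^sup>+v. ?H n v \<partial>stick_law \<alpha>)"
  proof (rule nn_integral_mono_AE, use AE_stick_law[OF al] in eventually_elim)
    case (elim v)
    let ?R = "stick_rem (zeroed Z v) n"
    let ?Q = "\<Prod>k\<in>{1..n} - L. ennreal (damp Cq (1/2) (stick_weight (zeroed Z v) k * u))"
    have R: "?R > 0" using elim by (intro stick_rem_pos) (auto simp: zeroed_def)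
    have "?H (Suc n) (v(Suc n := x)) = (g v * ?Q) * ennreal (damp Cq (1/2) ((?R * u) * x) * damp A b ((?R * u) * (1 - x)))" for x
    proof -
      have nZ: "Suc n \<notin> Z" using Z[of "Suc n"] step by auto
      have e: "{1..Suc n} - L = insert (Suc n) ({1..n} - L)" using L[of "Suc n"] step by force
      have gg: "g (v(Suc n := x)) = g v" using step by (intro gcong) auto
      have rn: "stick_rem (zeroed Z (v(Suc n := x))) n = ?R" by (intro stick_rem_cong) (auto simp: zeroed_def)
      have wk: "stick_weight (zeroed Z (v(Suc n := x))) k = stick_weight (zeroed Z v) k" if "k \<in> {1..n} - L" for k
        using that by (intro stick_weight_cong) (auto simp: zeroed_def)
      have zn: "zeroed Z (v(Suc n := x)) (Suc n) = x" using nZ by (simp add: zeroed_def)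
      have w: "stick_weight (zeroed Z (v(Suc n := x))) (Suc n) = x * ?R" by (simp add: stick_weight_Suc rn zn)
      have r: "stick_rem (zeroed Z (v(Suc n := x))) (Suc n) = ?R * (1 - x)" by (simp add: stick_rem_Suc rn zn)
      have Q: "(\<Prod>k\<in>{1..n} - L. ennreal (damp Cq (1/2) (stick_weight (zeroed Z (v(Suc n := x))) k * u))) = ?Q"
        using wk by (intro prod.cong) auto
      have QQ: "(\<Prod>k\<in>insert (Suc n) ({1..n} - L). ennreal (damp Cq (1/2) (stick_weight (zeroed Z (v(Suc n := x))) k * u))) =
          ennreal (damp Cq (1/2) (x * ?R * u)) * ?Q"
        using Q w by (subst prod.insert) auto
      show ?thesis unfolding e r gg QQ using C A0
        by (simp add: ennreal_mult damp_nonneg mult_ac)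
    qed
    then have "(\<integral>\<^sup>+x. ?H (Suc n) (v(Suc n := x)) \<partial>beta_distribution 1 \<alpha>) =
      (\<integral>\<^sup>+x. (g v * ?Q) * ennreal (damp Cq (1/2) ((?R * u) * x) * damp A b ((?R * u) * (1 - x))) \<partial>beta_distribution 1 \<alpha>)"
      by simp
    also have "\<dots> = (g v * ?Q) * (\<integral>\<^sup>+x. ennreal (damp Cq (1/2) ((?R * u) * x) * damp A b ((?R * u) * (1 - x))) \<partial>beta_distribution 1 \<alpha>)"
      by (rule nn_integral_cmult[OF mm])
    also have "\<dots> \<le> (g v * ?Q) * ennreal (damp A b (?R * u))"
      using R u by (intro mult_left_mono super) auto
    finally show ?case .
  qed
  also note step.IH
  finally show ?case .
qed simp

text \<open>The prior alone, without kernel and data. Closeness to the truth enters through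
  \<open>U\<close>: the assumption \<open>Uq\<close> bounds the chance that an atom whose weight is
  \<open>y\<close> in units of the allowed error is acceptable. The sets \<open>V c\<close> are the
  neighbourhoods that define the clusters, and \<open>ball\<close> is what makes a confined atom
  cost the full power of the dimension.\<close>

locale dp_prior =
  fixes \<alpha> :: real and P0 :: "'a::euclidean_space measure" and U :: "'a \<Rightarrow> real"
    and V :: "nat \<Rightarrow> 'a set" and K :: nat and ws :: "nat \<Rightarrow> real" and ts :: "nat \<Rightarrow> 'a" and Cb Cq :: real
  assumes al: "\<alpha> > 0" and P0: "prob_space P0" and sets_P0 [measurable_cong]: "sets P0 = sets borel"
    and Cb: "Cb \<ge> 0" and Cq: "Cq \<ge> 0"
    and ball: "\<And>x s. s \<ge> 0 \<Longrightarrow> emeasure P0 (cball x s) \<le> ennreal (Cb * s ^ DIM('a))"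
    and U_meas [measurable]: "U \<in> borel_measurable borel"
    and Uq: "\<And>y. y > 0 \<Longrightarrow> emeasure P0 {\<theta>. U \<theta> * y \<le> 1} \<le> ennreal (damp Cq (1/2) y)"
    and V_meas [measurable]: "\<And>c. V c \<in> sets borel" and V_dis: "disjoint_family_on V {1..K}"
    and K: "K \<ge> 1" and U_nn: "\<And>\<theta>. U \<theta> \<ge> 0"
    and ws: "\<And>c. c \<in> {1..K} \<Longrightarrow> 0 < ws c \<and> ws c \<le> 1"
begin

abbreviation atom_law :: "(nat \<Rightarrow> 'a) measure" where "atom_law \<equiv> \<Pi>\<^sub>M k\<in>{1..}. P0"
abbreviation "prior \<equiv> stick_law \<alpha> \<Otimes>\<^sub>M atom_law"

lemma space_P0 [simp]: "space P0 = UNIV"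
  using sets_eq_imp_space_eq[OF sets_P0] by simp

lemma atom_component: "(\<lambda>\<theta>. \<theta> k) \<in> borel_measurable atom_law"
  by (rule measurable_PiM_component_any[OF sets_P0])

lemma U_set: "{\<theta>. U \<theta> * c \<le> 1} \<in> sets P0"
  unfolding sets_P0 by measurable

lemma prob_stick: "prob_space (stick_law \<alpha>)"
  by (intro prob_space_PiM prob_space_beta al)

lemma prob_atom: "prob_space atom_law"
  by (intro prob_space_PiM P0)

sublocale S: prob_space "stick_law \<alpha>" by (rule prob_stick)
sublocale T: prob_space atom_law by (rule prob_atom)
sublocale ST: pair_prob_space "stick_law \<alpha>" atom_law ..

text \<open>What \<open>stick_event\<close> implies about the coordinates outside \<open>Z\<close>.
  The errors are relaxed to \<open>e / h\<close> because deleting the leading sticks enlarges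
  remaining masses by at most the factor \<open>1 / h\<close>. The last condition matters for
  \<open>p = K\<close>, the case in which every stick up to \<open>p\<close> is a leader.\<close>

definition free_event :: "nat set \<Rightarrow> nat set \<Rightarrow> nat \<Rightarrow> nat \<Rightarrow> real \<Rightarrow> real \<Rightarrow> real \<Rightarrow> ((nat \<Rightarrow> real) \<times> (nat \<Rightarrow> 'a)) set" where
  "free_event L Z p m e h \<rho> = {x \<in> space prior.
     (\<forall>j. 1 \<le> j \<and> j \<notin> Z \<longrightarrow> 0 < fst x j \<and> fst x j < 1) \<and>
     (\<forall>k\<in>{1..m} - L. stick_weight (zeroed Z (fst x)) k * U (snd x k) \<le> e / h) \<and>
     stick_rem (zeroed Z (fst x)) m \<le> e / h \<and> h \<le> stick_rem (zeroed Z (fst x)) (p - 1) \<and>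
     (p = K \<longrightarrow> \<rho> < 1 - fst x p)}"

lemma free_event_measurable [measurable]: "free_event L Z p m e h \<rho> \<in> sets prior"
  supply stick_law_component[measurable] atom_component[measurable] unfolding free_event_def by measurable

text \<open>Behind the deleted leaders the mass is at least \<open>h\<close>, yet from
  \<open>p\<close> on it must end in a tiny remainder or sit on acceptable atoms; this gives the
  power \<alpha>. The additional 1/4 has two sources. If \<open>p = K\<close>, the mass beyond the
  leaders must exceed \<rho>, so the truncated integral applies. If \<open>p > K\<close>, some
  \<open>k0 < p\<close> is not a leader and its atom must be acceptable, which alone contributes the
  power 1/2.\<close>

lemma free_event_bound:
  "\<exists>C\<ge>0. \<forall>L p m e h \<rho>. finite L \<longrightarrow> card L = K \<longrightarrow> L \<subseteq> {1..m} \<longrightarrow> p = Max L \<longrightarrow> 0 < e \<longrightarrow> 0 < h \<longrightarrow> h \<le> 1 \<longrightarrow>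
     0 < \<rho> \<longrightarrow> \<rho> \<le> 1 \<longrightarrow>
     emeasure prior (free_event L (L - {p}) p m e h \<rho>) \<le> ennreal (C * (e / h\<^sup>2) powr \<alpha> * (e / h\<^sup>2 / \<rho>) powr (1/4))"
proof -
  define b where "b = \<alpha> + 1/4"
  obtain x0 where x0: "x0 \<ge> 1" and super0: "\<forall>x>0. (\<integral>\<^sup>+v. ennreal (damp Cq (1/2) (x * v) *
      damp (x0 powr (\<alpha> + 1/4)) (\<alpha> + 1/4) (x * (1 - v))) \<partial>beta_distribution 1 \<alpha>) \<le> ennreal (damp (x0 powr (\<alpha> + 1/4)) (\<alpha> + 1/4) x)"
    using damp_supersolution[OF al Cq] by (elim exE conjE)
  have super: "(\<integral>\<^sup>+v. ennreal (damp Cq (1/2) (x * v) * damp (x0 powr b) b (x * (1 - v))) \<partial>beta_distribution 1 \<alpha>)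
      \<le> ennreal (damp (x0 powr b) b x)" if "x > 0" for x
    using super0[rule_format, OF that] by (simp only: b_def)
  have b0: "b \<ge> 0" using al by (simp add: b_def)
  define A where "A = x0 powr b"
  have A: "A \<ge> 1" using x0 al by (simp add: A_def b_def ge_one_powr_ge_zero)
  define c1 where "c1 = \<alpha> * Beta (1/2) \<alpha>"
  have c10: "c1 \<ge> 0"
    unfolding c1_def Beta_def using al by (auto intro!: mult_nonneg_nonneg divide_nonneg_nonneg less_imp_le[OF Gamma_real_pos])
  have c1: "(\<integral>\<^sup>+v. ennreal (v powr (-1/2)) \<partial>beta_distribution 1 \<alpha>) = ennreal c1"
  proof -
    have "(\<integral>\<^sup>+v. ennreal (v powr (-1/2)) \<partial>beta_distribution 1 \<alpha>) =
       (\<integral>\<^sup>+v. ennreal (v powr (-1/2) * (1 - v) powr 0) \<partial>beta_distribution 1 \<alpha>)"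
      using AE_beta[OF al] by (intro nn_integral_cong_AE) auto
    also have "\<dots> = ennreal c1" unfolding c1_def using al by (subst nn_integral_beta_powr) auto
    finally show ?thesis .
  qed
  interpret B: prob_space "beta_distribution 1 \<alpha>" by (rule prob_space_beta[OF al])
  define C where "C = max (4 * \<alpha> * A) (max 1 (Cq * c1) * ((1 + 4 * \<alpha>) * x0 powr \<alpha>))"
  have C: "C \<ge> 0" using al A by (simp add: C_def le_max_iff_disj)
  have "emeasure prior (free_event L (L - {p}) p m e h \<rho>) \<le> ennreal (C * (e / h\<^sup>2) powr \<alpha> * (e / h\<^sup>2 / \<rho>) powr (1/4))"
    if L: "finite L" "card L = K" "L \<subseteq> {1..m}" and p: "p = Max L" and e: "0 < e" and h: "0 < h" "h \<le> 1"
      and \<rho>: "0 < \<rho>" "\<rho> \<le> 1" for L p m e h \<rho>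
  proof -
    define Z where "Z = L - {p}"
    define y where "y = e / h\<^sup>2"
    have y: "y > 0" using e h by (simp add: y_def)
    define u where "u = h / e"
    have u: "u > 0" using e h by (simp add: u_def)
    \<comment> \<open>One \<open>h\<close> comes from the relaxed error \<open>e / h\<close>, the
      other from the lower bound on the mass before \<open>p\<close>. This is why \<open>y\<close>
      contains the square of \<open>h\<close>.\<close>
    have hu: "h * u = 1 / y" using e h by (simp add: u_def y_def power2_eq_square)
    have ne: "L \<noteq> {}" using L K by auto
    have pL: "p \<in> L" unfolding p using L(1) ne by (rule Max_in)
    have Lp: "z \<le> p" if "z \<in> L" for z unfolding p using L(1) that by (rule Max_ge)
    have Zp: "z < p" if "z \<in> Z" for z using that Lp[of z] by (auto simp: Z_def)
    have pm: "1 \<le> p" "p \<le> m" using pL L by auto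
    have pK: "p \<ge> K"
    proof -
      have "L \<subseteq> {1..p}"
      proof
        fix z assume "z \<in> L"
        then show "z \<in> {1..p}" using Lp[of z] L(3) by auto
      qed
      then have "card L \<le> card {1..p}" by (intro card_mono) auto
      then show ?thesis using L by simp
    qed
    \<comment> \<open>Indicator of those conditions that are determined by the first
      \<open>p\<close> sticks; it is carried along unchanged while the later ones are peeled
      off.\<close>
    define g where "g v = (if h \<le> stick_rem (zeroed Z v) (p - 1) \<and> (p = K \<longrightarrow> \<rho> < 1 - v p) then 1 else 0 :: ennreal)" for v
    have g_meas [measurable]: "g \<in> borel_measurable (stick_law \<alpha>)" supply stick_law_component[measurable] unfolding g_def by measurable
    have gcong: "g v = g v'" if "\<And>j. j \<in> {1..p} \<Longrightarrow> v j = v' j" for v v'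
    proof -
      have "stick_rem (zeroed Z v) (p - 1) = stick_rem (zeroed Z v') (p - 1)"
      proof (rule stick_rem_cong)
        fix j assume "j \<in> {1..p-1}"
        then have "v j = v' j" using that[of j] by auto
        then show "zeroed Z v j = zeroed Z v' j" by (simp only: zeroed_def)
      qed
      moreover have "v p = v' p" using that[of p] pm by auto
      ultimately show ?thesis unfolding g_def by (simp only:)
    qed
    let ?Q = "\<lambda>j v. \<Prod>k\<in>{1..j} - L. ennreal (damp Cq (1/2) (stick_weight (zeroed Z v) k * u))"
    let ?H = "\<lambda>j v. g v * ?Q j v * ennreal (damp A b (stick_rem (zeroed Z v) j * u))"
    have "emeasure prior (free_event L Z p m e h \<rho>) =
       (\<integral>\<^sup>+v. emeasure atom_law (Pair v -` free_event L Z p m e h \<rho>) \<partial>stick_law \<alpha>)"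
      by (rule T.emeasure_pair_measure_alt[OF free_event_measurable])
    also have "\<dots> \<le> (\<integral>\<^sup>+v. ?H m v \<partial>stick_law \<alpha>)"
    proof (rule nn_integral_mono_AE, use AE_stick_law[OF al] AE_space in eventually_elim)
      case (elim v)
      let ?w = "\<lambda>k. stick_weight (zeroed Z v) k"
      show "emeasure atom_law (Pair v -` free_event L Z p m e h \<rho>) \<le> ?H m v"
      proof (cases "h \<le> stick_rem (zeroed Z v) (p - 1) \<and> (p = K \<longrightarrow> \<rho> < 1 - v p) \<and> stick_rem (zeroed Z v) m \<le> e / h")
        case False
        then have "Pair v -` free_event L Z p m e h \<rho> = {}" by (auto simp: free_event_def)
        then show ?thesis by simp
      next
        case True
        have rpos: "stick_rem (zeroed Z v) k > 0" for k using elim by (intro stick_rem_pos) (auto simp: zeroed_def)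
        have wpos: "?w k > 0" if "k \<in> {1..m} - L" for k
          using that elim rpos[of "k - 1"] by (subst stick_weight_eq) (auto simp: zeroed_def Z_def)
        \<comment> \<open>On the event the damping factor of the final remainder equals 1, so it can
          be inserted for free to start the peeling.\<close>
        have d1: "damp A b (stick_rem (zeroed Z v) m * u) = 1"
        proof (rule damp_eq_1)
          show "stick_rem (zeroed Z v) m * u \<le> 1" using True e h by (simp add: u_def field_simps)
        qed (use A rpos u al in \<open>auto simp: b_def\<close>)
        have g1: "g v = 1" using True by (simp add: g_def)
        have "emeasure atom_law (Pair v -` free_event L Z p m e h \<rho>)
           = (\<integral>\<^sup>+\<theta>. indicator (Pair v -` free_event L Z p m e h \<rho>) \<theta> \<partial>atom_law)"
          by (rule nn_integral_indicator[symmetric]) (rule sets_Pair1[OF free_event_measurable])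
        also have "\<dots> \<le> (\<integral>\<^sup>+\<theta>. (\<Prod>k\<in>{1..m} - L. indicator {\<theta>. U \<theta> * (?w k * u) \<le> 1} (\<theta> k)) \<partial>atom_law)"
        proof (rule nn_integral_mono)
          fix \<theta>
          have *: "U (\<theta> k) * (?w k * u) \<le> 1" if "?w k * U (\<theta> k) \<le> e / h" for k
          proof -
            have "?w k * U (\<theta> k) * u \<le> (e / h) * u" using that u by (intro mult_right_mono) auto
            then show ?thesis using e h by (simp add: u_def mult_ac)
          qed
          show "indicator (Pair v -` free_event L Z p m e h \<rho>) \<theta>
            \<le> (\<Prod>k\<in>{1..m} - L. indicator {\<theta>. U \<theta> * (?w k * u) \<le> 1} (\<theta> k) :: ennreal)"
          proof (cases "(v, \<theta>) \<in> free_event L Z p m e h \<rho>")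
            case True
            then have "(\<Prod>k\<in>{1..m} - L. indicator {\<theta>. U \<theta> * (?w k * u) \<le> 1} (\<theta> k) :: ennreal) = (\<Prod>k\<in>{1..m} - L. 1)"
              using * by (intro prod.cong) (auto simp: free_event_def)
            then show ?thesis using True by simp
          qed simp
        qed
        also have "\<dots> = (\<Prod>k\<in>{1..m} - L. \<integral>\<^sup>+\<theta>. indicator {\<theta>. U \<theta> * (?w k * u) \<le> 1} \<theta> \<partial>P0)"
          by (rule nn_integral_PiM_prod) (use P0 in \<open>auto intro!: borel_measurable_indicator U_set\<close>)
        also have "\<dots> = (\<Prod>k\<in>{1..m} - L. emeasure P0 {\<theta>. U \<theta> * (?w k * u) \<le> 1})"
          by (intro prod.cong refl nn_integral_indicator U_set)
        also have "\<dots> \<le> ?Q m v"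
          using wpos u by (intro prod_mono_ennreal Uq) auto
        finally show ?thesis using d1 g1 by simp
      qed
    qed
    also have "\<dots> \<le> (\<integral>\<^sup>+v. ?H p v \<partial>stick_law \<alpha>)"
    proof (rule stick_law_damp_peel[OF al Cq _ b_def A_def _ u Zp g_meas gcong Lp pm(2)])
      show "x0 > 0" using x0 by simp
    qed (use super[folded A_def] in auto)
    also have "\<dots> \<le> ennreal (C * y powr \<alpha> * (y / \<rho>) powr (1/4))"
    proof (cases "p = K")
      case True
      have LK: "L = {1..K}"
      proof (rule card_subset_eq)
        show "L \<subseteq> {1..K}"
        proof
          fix z assume "z \<in> L"
          then show "z \<in> {1..K}" using Lp[of z] L(3) True by auto
        qed
      qed (use L in auto)
      have rp: "stick_rem (zeroed Z v) p = 1 - v p" for v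
      proof -
        have "stick_rem (zeroed Z v) (p - 1) = (\<Prod>j = 1..p-1. 1)" unfolding stick_rem_def
          using LK True by (intro prod.cong) (auto simp: zeroed_def Z_def)
        then show ?thesis using pm by (simp add: stick_rem_eq zeroed_def Z_def)
      qed
      have "(\<integral>\<^sup>+v. ?H p v \<partial>stick_law \<alpha>) \<le> (\<integral>\<^sup>+v. (\<Prod>j\<in>{p}. ennreal (damp A b (u * (1 - v j))) * indicator {x. 1 - x > \<rho>} (v j)) \<partial>stick_law \<alpha>)"
        using LK True by (intro nn_integral_mono) (auto simp: g_def indicator_def rp[unfolded True] mult_ac)
      also have "\<dots> = (\<Prod>j\<in>{p}. \<integral>\<^sup>+v. ennreal (damp A b (u * (1 - v))) * indicator {x. 1 - x > \<rho>} v \<partial>beta_distribution 1 \<alpha>)"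
        by (rule nn_integral_PiM_prod) (use pm prob_space_beta[OF al] in \<open>simp_all, measurable\<close>)
      also have "\<dots> \<le> ennreal (4 * \<alpha> * A * u powr - b * \<rho> powr (-1/4))"
        using nn_integral_damp_truncated[OF al _ u \<rho>, of A] A by (simp add: b_def)
      also have "\<dots> \<le> ennreal (C * y powr \<alpha> * (y / \<rho>) powr (1/4))"
      proof (rule ennreal_leI)
        have "u powr - b = (1 / u) powr b" using u unfolding powr_minus_divide by (simp add: powr_divide)
        also have "1 / u \<le> y" using e h by (simp add: u_def y_def power2_eq_square field_simps mult_left_le)
        then have "(1 / u) powr b \<le> y powr b" using u al by (intro powr_mono2) (auto simp: b_def)
        also have "y powr b = y powr \<alpha> * y powr (1/4)" by (simp add: b_def powr_add)
        finally have 1: "u powr - b \<le> y powr \<alpha> * y powr (1/4)" .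
        have 2: "(y / \<rho>) powr (1/4) = y powr (1/4) * \<rho> powr (-1/4)"
        proof -
          have "\<rho> powr (- (1/4)) = 1 / \<rho> powr (1/4)" by (rule powr_minus_divide)
          then show ?thesis using y \<rho> by (simp add: powr_divide)
        qed
        have "4 * \<alpha> * A * u powr - b * \<rho> powr (-1/4) \<le> C * (y powr \<alpha> * y powr (1/4)) * \<rho> powr (-1/4)"
          using al A by (intro mult_right_mono mult_mono 1 C) (auto simp: C_def)
        also have "\<dots> = C * y powr \<alpha> * (y / \<rho>) powr (1/4)" unfolding 2 by (simp only: mult_ac)
        finally show "4 * \<alpha> * A * u powr - b * \<rho> powr (-1/4) \<le> C * y powr \<alpha> * (y / \<rho>) powr (1/4)" .
      qed
      finally show ?thesis .
    next
      case False
      have "\<not> {1..p-1} \<subseteq> L"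
      proof
        assume "{1..p-1} \<subseteq> L"
        then have "insert p {1..p-1} \<subseteq> L" using pL by auto
        moreover have "card (insert p {1..p-1}) = p" using pm by simp
        ultimately have "p \<le> card L" using L by (metis card_mono)
        then show False using L pK False by simp
      qed
      then obtain k0 where k0: "k0 \<in> {1..p-1}" "k0 \<notin> L" by (meson subsetI)
      have k0Z: "k0 \<notin> Z" "p \<notin> Z" using k0 by (auto simp: Z_def)
      \<comment> \<open>The masses before \<open>k0\<close> and before \<open>p\<close> are both at
        least \<open>h\<close>. Replacing them by \<open>h\<close> leaves functions of the single
        coordinates \<open>v k0\<close> and \<open>v p\<close>, and the integral factorises.\<close>
      define q where "q j x = (if j = p then ennreal (damp A b (h * u * (1 - x))) else ennreal (damp Cq (1/2) (h * u * x)))" for j x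
      have [measurable]: "q j \<in> borel_measurable borel" for j unfolding q_def by (cases "j = p"; simp; measurable)
      have "(\<integral>\<^sup>+v. ?H p v \<partial>stick_law \<alpha>) \<le> (\<integral>\<^sup>+v. (\<Prod>j\<in>{k0, p}. q j (v j)) \<partial>stick_law \<alpha>)"
      proof (rule nn_integral_mono_AE, use AE_stick_law[OF al] in eventually_elim)
        case (elim v)
        show "?H p v \<le> (\<Prod>j\<in>{k0, p}. q j (v j))"
        proof (cases "h \<le> stick_rem (zeroed Z v) (p - 1)")
          case False
          then show ?thesis by (simp add: g_def)
        next
          case True
          have z01: "0 \<le> zeroed Z v j \<and> zeroed Z v j \<le> 1" if "j \<ge> 1" for j using elim that by (auto simp: zeroed_def less_imp_le)
          have hk: "h \<le> stick_rem (zeroed Z v) (k0 - 1)"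
            using True stick_rem_antimono[of "p - 1" "zeroed Z v" "k0 - 1"] z01 k0 by force
          have zk: "zeroed Z v k0 = v k0" "zeroed Z v p = v p" using k0Z by (auto simp: zeroed_def)
          have a: "ennreal (damp A b (stick_rem (zeroed Z v) p * u)) \<le> q p (v p)"
          proof -
            have "h * u * (1 - v p) \<le> stick_rem (zeroed Z v) p * u"
              using True u elim pm mult_right_mono[OF True, of "u * (1 - v p)"] zk by (simp add: stick_rem_eq mult_ac less_imp_le)
            moreover have "0 < h * u * (1 - v p)" using h u elim pm by simp
            ultimately have "damp A b (stick_rem (zeroed Z v) p * u) \<le> damp A b (h * u * (1 - v p))"
              using A b0 by (intro damp_antimono) auto
            then show ?thesis unfolding q_def by (simp add: ennreal_leI)
          qed
          have c: "ennreal (damp Cq (1/2) (stick_weight (zeroed Z v) k0 * u)) \<le> q k0 (v k0)"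
          proof -
            have "h * u * v k0 \<le> stick_weight (zeroed Z v) k0 * u"
              using hk u elim k0 mult_right_mono[OF hk, of "u * v k0"] zk by (simp add: stick_weight_eq mult_ac less_imp_le)
            moreover have "0 < h * u * v k0" using h u elim k0 by simp
            ultimately have "damp Cq (1/2) (stick_weight (zeroed Z v) k0 * u) \<le> damp Cq (1/2) (h * u * v k0)"
              using Cq by (intro damp_antimono) auto
            moreover have "k0 \<noteq> p" using k0 by auto
            ultimately show ?thesis unfolding q_def by (simp add: ennreal_leI)
          qed
          have Q: "?Q p v \<le> ennreal (damp Cq (1/2) (stick_weight (zeroed Z v) k0 * u))"
          proof -
            have "?Q p v = ennreal (damp Cq (1/2) (stick_weight (zeroed Z v) k0 * u)) *
                (\<Prod>k\<in>{1..p} - L - {k0}. ennreal (damp Cq (1/2) (stick_weight (zeroed Z v) k * u)))"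
              using k0 by (intro prod.remove) auto
            also have "(\<Prod>k\<in>{1..p} - L - {k0}. ennreal (damp Cq (1/2) (stick_weight (zeroed Z v) k * u))) \<le> (\<Prod>k\<in>{1..p} - L - {k0}. 1)"
              by (intro prod_mono_ennreal) (simp add: damp_le_1)
            finally show ?thesis by (simp add: mult_left_mono)
          qed
          have "?H p v \<le> 1 * q k0 (v k0) * q p (v p)"
            by (intro mult_mono order_trans[OF Q c] a) (auto simp: g_def indicator_def)
          also have "\<dots> = (\<Prod>j\<in>{k0, p}. q j (v j))" using k0 by auto
          finally show ?thesis .
        qed
      qed
      also have "\<dots> = (\<Prod>j\<in>{k0, p}. \<integral>\<^sup>+x. q j x \<partial>beta_distribution 1 \<alpha>)"
        by (rule nn_integral_PiM_prod) (use pm k0 prob_space_beta[OF al] in auto)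
      also have "\<dots> = (\<integral>\<^sup>+x. q k0 x \<partial>beta_distribution 1 \<alpha>) * (\<integral>\<^sup>+x. q p x \<partial>beta_distribution 1 \<alpha>)"
        using k0 by auto
      also have "\<dots> \<le> ennreal (max 1 (Cq * c1) * (y / \<rho>) powr (1/4)) * ennreal ((1 + 4 * \<alpha>) * (x0 / (1 / y)) powr \<alpha>)"
      proof (intro mult_mono)
        show "(\<integral>\<^sup>+x. q p x \<partial>beta_distribution 1 \<alpha>) \<le> ennreal ((1 + 4 * \<alpha>) * (x0 / (1 / y)) powr \<alpha>)"
        proof -
          have qp: "q p x = ennreal (damp A b (1 / y * (1 - x)))" for x by (simp only: q_def hu if_True simp_thms)
          have y1: "1 / y > 0" and x1: "x0 > 0" using y x0 by auto
          show ?thesis unfolding qp unfolding A_def b_def by (rule nn_integral_damp[OF al x1 y1])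
        qed
        have "k0 \<noteq> p" using k0 by auto
        then have qk: "q k0 x = ennreal (damp Cq (1/2) (1 / y * x))" for x by (simp only: q_def hu if_False simp_thms)
        show "(\<integral>\<^sup>+x. q k0 x \<partial>beta_distribution 1 \<alpha>) \<le> ennreal (max 1 (Cq * c1) * (y / \<rho>) powr (1/4))"
        proof (cases "y \<le> 1")
          case False
          have "(\<integral>\<^sup>+x. q k0 x \<partial>beta_distribution 1 \<alpha>) \<le> (\<integral>\<^sup>+x. 1 \<partial>beta_distribution 1 \<alpha>)"
            unfolding qk by (intro nn_integral_mono) (simp add: damp_le_1)
          also have "\<dots> = ennreal 1" using B.emeasure_space_1 by simp
          also have "\<dots> \<le> ennreal (max 1 (Cq * c1) * (y / \<rho>) powr (1/4))"
          proof (rule ennreal_leI)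
            have "1 \<le> y / \<rho>" using False \<rho> by (simp add: field_simps)
            then have "1 \<le> (y / \<rho>) powr (1/4)" by (intro ge_one_powr_ge_zero) auto
            then show "1 \<le> max 1 (Cq * c1) * (y / \<rho>) powr (1/4)" using mult_mono[of 1 "max 1 (Cq * c1)" 1 "(y / \<rho>) powr (1/4)"] by simp
          qed
          finally show ?thesis .
        next
          case True
          have "(\<integral>\<^sup>+x. q k0 x \<partial>beta_distribution 1 \<alpha>) \<le> (\<integral>\<^sup>+x. ennreal (Cq * y powr (1/2)) * ennreal (x powr (-1/2)) \<partial>beta_distribution 1 \<alpha>)"
          proof (rule nn_integral_mono_AE, use AE_beta[OF al] in eventually_elim)
            case (elim x)
            have "(1 / y * x) powr - (1/2) = y powr (1/2) * x powr (- (1/2))"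
            proof -
              have "y powr - (1/2) = 1 / y powr (1/2)" by (rule powr_minus_divide)
              moreover have "(x / y) powr - (1/2) = x powr - (1/2) / y powr - (1/2)"
                by (rule powr_divide)
              ultimately show ?thesis by simp
            qed
            then have "damp Cq (1/2) (1 / y * x) \<le> (Cq * y powr (1/2)) * x powr (-1/2)"
              unfolding damp_def by simp
            then show ?case unfolding qk using Cq by (subst ennreal_mult[symmetric]) (auto intro!: ennreal_leI)
          qed
          also have "\<dots> = ennreal (Cq * y powr (1/2)) * (\<integral>\<^sup>+x. ennreal (x powr (-1/2)) \<partial>beta_distribution 1 \<alpha>)"
            by (rule nn_integral_cmult) measurable
          also have "\<dots> = ennreal (Cq * y powr (1/2) * c1)"
            unfolding c1 using Cq c10 by (simp add: ennreal_mult)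
          also have "\<dots> \<le> ennreal (max 1 (Cq * c1) * (y / \<rho>) powr (1/4))"
          proof (rule ennreal_leI)
            have "y powr (1/2) \<le> y powr (1/4)" using True y by (intro powr_mono') auto
            also have "\<dots> \<le> (y / \<rho>) powr (1/4)" using y \<rho> by (intro powr_mono2) (auto simp: field_simps mult_left_le)
            finally have 1: "y powr (1/2) \<le> (y / \<rho>) powr (1/4)" .
            have "Cq * y powr (1/2) * c1 = (Cq * c1) * y powr (1/2)" by simp
            also have "\<dots> \<le> max 1 (Cq * c1) * (y / \<rho>) powr (1/4)" by (intro mult_mono 1) auto
            finally show "Cq * y powr (1/2) * c1 \<le> max 1 (Cq * c1) * (y / \<rho>) powr (1/4)" .
          qed
          finally show ?thesis .
        qed
      qed auto
      also have "\<dots> = ennreal (max 1 (Cq * c1) * (y / \<rho>) powr (1/4) * ((1 + 4 * \<alpha>) * (x0 / (1 / y)) powr \<alpha>))"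
        by (rule ennreal_mult[symmetric]) (use al in auto)
      also have "\<dots> \<le> ennreal (C * y powr \<alpha> * (y / \<rho>) powr (1/4))"
      proof (rule ennreal_leI)
        have "(x0 / (1 / y)) powr \<alpha> = x0 powr \<alpha> * y powr \<alpha>" using x0 y by (simp add: powr_mult)
        then have "max 1 (Cq * c1) * (y / \<rho>) powr (1/4) * ((1 + 4 * \<alpha>) * (x0 / (1 / y)) powr \<alpha>) =
          (max 1 (Cq * c1) * ((1 + 4 * \<alpha>) * x0 powr \<alpha>)) * (y powr \<alpha> * (y / \<rho>) powr (1/4))"
          by (simp only: mult_ac)
        also have "\<dots> \<le> C * (y powr \<alpha> * (y / \<rho>) powr (1/4))" by (intro mult_right_mono) (auto simp: C_def)
        finally show "max 1 (Cq * c1) * (y / \<rho>) powr (1/4) * ((1 + 4 * \<alpha>) * (x0 / (1 / y)) powr \<alpha>) \<le> C * y powr \<alpha> * (y / \<rho>) powr (1/4)"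
          by (simp only: mult.assoc)
      qed
      finally show ?thesis .
    qed
    finally show ?thesis by (simp only: y_def Z_def)
  qed
  then show ?thesis using C by blast
qed

end

lemma prod_subset_ge:
  fixes f :: "'b \<Rightarrow> real"
  assumes "finite B" "A \<subseteq> B" "\<And>j. j \<in> B \<Longrightarrow> 0 \<le> f j \<and> f j \<le> 1"
  shows "prod f B \<le> prod f A"
proof -
  have "prod f B = prod f (B - A) * prod f A" using assms by (intro prod.subset_diff)
  also have "\<dots> \<le> 1 * prod f A"
    using assms by (intro mult_right_mono prod_le_1 prod_nonneg) auto
  finally show ?thesis by simp
qed

lemma stick_rem_zeroed:
  "stick_rem v k = stick_rem (zeroed Z v) k * (\<Prod>j\<in>{1..k} \<inter> Z. 1 - v j)"
proof -
  have "stick_rem (zeroed Z v) k = (\<Prod>j\<in>{1..k} - Z. 1 - v j)"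
    unfolding stick_rem_def zeroed_def by (rule prod.mono_neutral_cong_right) auto
  moreover have "stick_rem v k = (\<Prod>j\<in>{1..k} \<inter> Z. 1 - v j) * (\<Prod>j\<in>{1..k} - Z. 1 - v j)"
    unfolding stick_rem_def by (subst prod.Int_Diff[of _ _ Z]) auto
  ultimately show ?thesis by simp
qed

context dp_prior
begin

text \<open>Serves for masses, with \<open>g\<close> constant 1, and for first moments, with
  \<open>g k\<close> the displacement from the centre; hence the vector-valued summand.\<close>

definition cluster_sum :: "(nat \<Rightarrow> real) \<Rightarrow> (nat \<Rightarrow> 'a) \<Rightarrow> nat \<Rightarrow> nat set \<Rightarrow> (nat \<Rightarrow> 'b) \<Rightarrow> 'b::real_vector" where
  "cluster_sum v \<theta> c A g = (\<Sum>k\<in>A. (indicator (V c) (\<theta> k) * stick_weight v k) *\<^sub>R g k)"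

text \<open>Everything that the bounded statistics certify about the first \<open>m\<close> pieces,
  combined with a mass above \<rho> behind the \<open>K\<close>-th stick. This is the event whose
  prior probability has to be beaten by the evidence.\<close>

definition prior_event :: "nat \<Rightarrow> real \<Rightarrow> real \<Rightarrow> ((nat \<Rightarrow> real) \<times> (nat \<Rightarrow> 'a)) set" where
  "prior_event m e \<rho> = {x \<in> space prior. (\<forall>j\<ge>1. 0 < fst x j \<and> fst x j < 1) \<and>
     (\<forall>k\<in>{1..m}. stick_weight (fst x) k * U (snd x k) \<le> e) \<and>
     (\<forall>c\<in>{1..K}. \<bar>cluster_sum (fst x) (snd x) c {1..m} (\<lambda>_. 1) - ws c\<bar> \<le> 2 * e) \<and>
     (\<forall>c\<in>{1..K}. norm (cluster_sum (fst x) (snd x) c {1..m} (\<lambda>k. snd x k - ts c)) \<le> 2 * e) \<and>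
     stick_rem (fst x) m \<le> e \<and> \<rho> < stick_rem (fst x) K}"

text \<open>\<open>l c\<close> names an atom of cluster \<open>c\<close> with weight at least
  \<open>h\<close>. A lower bound on the weight is what converts constraints on cluster sums into
  constraints on a single coordinate.\<close>

definition lead_event :: "(nat \<Rightarrow> nat) \<Rightarrow> nat \<Rightarrow> real \<Rightarrow> real \<Rightarrow> real \<Rightarrow> ((nat \<Rightarrow> real) \<times> (nat \<Rightarrow> 'a)) set" where
  "lead_event l m e h \<rho> = {x \<in> space prior. x \<in> prior_event m e \<rho> \<and>
     (\<forall>c\<in>{1..K}. snd x (l c) \<in> V c \<and> h \<le> stick_weight (fst x) (l c))}"

text \<open>The part of the conditions that does not look at the leading atoms. Once these lie in
  their own clusters, their positions matter only for the first moments, which are dropped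
  here.\<close>

definition stick_event :: "(nat \<Rightarrow> nat) \<Rightarrow> nat \<Rightarrow> real \<Rightarrow> real \<Rightarrow> real \<Rightarrow> ((nat \<Rightarrow> real) \<times> (nat \<Rightarrow> 'a)) set" where
  "stick_event l m e h \<rho> = {x \<in> space prior. (\<forall>j\<ge>1. 0 < fst x j \<and> fst x j < 1) \<and>
     (\<forall>k\<in>{1..m} - l ` {1..K}. stick_weight (fst x) k * U (snd x k) \<le> e) \<and>
     (\<forall>c\<in>{1..K}. \<bar>stick_weight (fst x) (l c) +
        cluster_sum (fst x) (snd x) c ({1..m} - l ` {1..K}) (\<lambda>_. 1) - ws c\<bar> \<le> 2 * e) \<and>
     (\<forall>c\<in>{1..K}. h \<le> stick_weight (fst x) (l c)) \<and>
     stick_rem (fst x) m \<le> e \<and> \<rho> < stick_rem (fst x) K}"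

lemma prior_event_measurable [measurable]: "prior_event m e \<rho> \<in> sets prior"
  supply stick_law_component[measurable] atom_component[measurable]
  unfolding prior_event_def cluster_sum_def by measurable

lemma lead_event_measurable [measurable]: "lead_event l m e h \<rho> \<in> sets prior"
  supply stick_law_component[measurable] atom_component[measurable]
  unfolding lead_event_def by measurable

lemma stick_event_measurable [measurable]: "stick_event l m e h \<rho> \<in> sets prior"
  supply stick_law_component[measurable] atom_component[measurable]
  unfolding stick_event_def cluster_sum_def by measurable

lemma cluster_sum_split:
  assumes l: "inj_on l {1..K}" "l ` {1..K} \<subseteq> {1..m}" and lead: "\<And>c. c \<in> {1..K} \<Longrightarrow> \<theta> (l c) \<in> V c"
    and c: "c \<in> {1..K}"
  shows "cluster_sum v \<theta> c {1..m} g = stick_weight v (l c) *\<^sub>R g (l c) + cluster_sum v \<theta> c ({1..m} - l ` {1..K}) g"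
proof -
  have "cluster_sum v \<theta> c {1..m} g = cluster_sum v \<theta> c ({1..m} - l ` {1..K}) g + cluster_sum v \<theta> c (l ` {1..K}) g"
    unfolding cluster_sum_def using l by (intro sum.subset_diff) auto
  also have "cluster_sum v \<theta> c (l ` {1..K}) g = (\<Sum>d\<in>{1..K}. (indicator (V c) (\<theta> (l d)) * stick_weight v (l d)) *\<^sub>R g (l d))"
    unfolding cluster_sum_def using l by (simp add: sum.reindex)
  also have "\<dots> = (\<Sum>d\<in>{c}. (indicator (V c) (\<theta> (l d)) * stick_weight v (l d)) *\<^sub>R g (l d))"
  proof (rule sum.mono_neutral_right)
    show "\<forall>d\<in>{1..K} - {c}. (indicator (V c) (\<theta> (l d)) * stick_weight v (l d)) *\<^sub>R g (l d) = 0"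
    proof
      fix d assume d: "d \<in> {1..K} - {c}"
      then have "V d \<inter> V c = {}" using V_dis c by (auto simp: disjoint_family_on_def)
      then have "\<theta> (l d) \<notin> V c" using lead[of d] d by auto
      then show "(indicator (V c) (\<theta> (l d)) * stick_weight v (l d)) *\<^sub>R g (l d) = 0" by simp
    qed
  qed (use c in auto)
  also have "\<dots> = stick_weight v (l c) *\<^sub>R g (l c)" using lead[OF c] by simp
  finally show ?thesis by simp
qed

lemma lead_event_subset:
  assumes l: "inj_on l {1..K}" "l ` {1..K} \<subseteq> {1..m}"
  shows "lead_event l m e h \<rho> \<subseteq> stick_event l m e h \<rho>"
proof
  fix x assume x: "x \<in> lead_event l m e h \<rho>"
  have "cluster_sum (fst x) (snd x) c {1..m} (\<lambda>_. 1::real) = stick_weight (fst x) (l c) +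
        cluster_sum (fst x) (snd x) c ({1..m} - l ` {1..K}) (\<lambda>_. 1)" if "c \<in> {1..K}" for c
    using cluster_sum_split[OF l _ that, of "snd x" "fst x" "\<lambda>_. 1::real"] x by (simp add: lead_event_def)
  then show "x \<in> stick_event l m e h \<rho>"
    using x by (simp add: lead_event_def prior_event_def stick_event_def)
qed

text \<open>With the sticks and all other atoms frozen, moving a leader changes the first moment of
  its cluster by its weight times the displacement. Both moments are at most \<open>2 * e\<close>
  and the weight is at least \<open>h\<close>, so two admissible positions are within
  \<open>4 * e / h\<close>. Each of the \<open>K\<close> leaders contributes the probability of such
  a ball.\<close>

lemma emeasure_lead_event:
  assumes l: "inj_on l {1..K}" "l ` {1..K} \<subseteq> {1..m}" and e: "e > 0" and h: "h > 0"
  shows "emeasure prior (lead_event l m e h \<rho>) \<le> ennreal (Cb * (4 * e / h) ^ DIM('a)) ^ K * emeasure prior (stick_event l m e h \<rho>)"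
proof -
  let ?L = "l ` {1..K}" and ?b = "ennreal (Cb * (4 * e / h) ^ DIM('a))"
  have cL: "card ?L = K" using l by (simp add: card_image)
  have "emeasure prior (lead_event l m e h \<rho>) = (\<integral>\<^sup>+v. emeasure atom_law (Pair v -` lead_event l m e h \<rho>) \<partial>stick_law \<alpha>)"
    by (rule T.emeasure_pair_measure_alt[OF lead_event_measurable])
  also have "\<dots> \<le> (\<integral>\<^sup>+v. ?b ^ K * emeasure atom_law (Pair v -` stick_event l m e h \<rho>) \<partial>stick_law \<alpha>)"
  proof (rule nn_integral_mono)
    fix v assume v: "v \<in> space (stick_law \<alpha>)"
    have "emeasure atom_law (Pair v -` lead_event l m e h \<rho>) \<le> ?b ^ card ?L * emeasure atom_law (Pair v -` stick_event l m e h \<rho>)"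
    proof (rule emeasure_PiM_diameter_bound[where T = "\<lambda>_ x. cball x (4 * e / h)"])
      show "Pair v -` lead_event l m e h \<rho> \<in> sets atom_law" "Pair v -` stick_event l m e h \<rho> \<in> sets atom_law"
        by (rule sets_Pair1[OF lead_event_measurable], rule sets_Pair1[OF stick_event_measurable])
      show "Pair v -` lead_event l m e h \<rho> \<subseteq> Pair v -` stick_event l m e h \<rho>"
        using lead_event_subset[OF l, of e h \<rho>] by auto
      show "Y \<in> Pair v -` stick_event l m e h \<rho>" if X: "X \<in> Pair v -` lead_event l m e h \<rho>"
        and Y: "Y \<in> space atom_law" and XY: "\<And>i. i \<notin> ?L \<Longrightarrow> X i = Y i" for X Y
      proof -
        have Xs: "(v, X) \<in> stick_event l m e h \<rho>" using X lead_event_subset[OF l, of e h \<rho>] by auto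
        have cs: "cluster_sum v Y c ({1..m} - ?L) (\<lambda>_. 1::real) = cluster_sum v X c ({1..m} - ?L) (\<lambda>_. 1)" for c
          unfolding cluster_sum_def using XY by (intro sum.cong) auto
        have "stick_weight v k * U (Y k) \<le> e" if "k \<in> {1..m} - ?L" for k
        proof -
          have "stick_weight v k * U (X k) \<le> e" using Xs that unfolding stick_event_def by simp
          then show ?thesis using XY[of k] that by simp
        qed
        moreover have "\<forall>c\<in>{1..K}. \<bar>stick_weight v (l c) + cluster_sum v Y c ({1..m} - ?L) (\<lambda>_. 1) - ws c\<bar> \<le> 2 * e"
          using Xs unfolding stick_event_def cs by simp
        ultimately show ?thesis using Xs v Y unfolding stick_event_def by (simp add: space_pair_measure)
      qed
      show "Y j \<in> cball (X j) (4 * e / h)" if X: "X \<in> Pair v -` lead_event l m e h \<rho>"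
        and Y: "Y \<in> Pair v -` lead_event l m e h \<rho>" and XY: "\<And>i. i \<notin> ?L \<Longrightarrow> X i = Y i" and j: "j \<in> ?L" for X Y j
      proof -
        obtain c where c: "c \<in> {1..K}" "j = l c" using j by auto
        let ?g = "\<lambda>X k. X k - ts c"
        have 1: "cluster_sum v X c {1..m} (?g X) = stick_weight v j *\<^sub>R (X j - ts c) + cluster_sum v X c ({1..m} - ?L) (?g X)"
          using cluster_sum_split[OF l _ c(1), of X v "?g X"] X c by (simp add: lead_event_def)
        have 2: "cluster_sum v Y c {1..m} (?g Y) = stick_weight v j *\<^sub>R (Y j - ts c) + cluster_sum v Y c ({1..m} - ?L) (?g Y)"
          using cluster_sum_split[OF l _ c(1), of Y v "?g Y"] Y c by (simp add: lead_event_def)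
        have 3: "cluster_sum v Y c ({1..m} - ?L) (?g Y) = cluster_sum v X c ({1..m} - ?L) (?g X)"
          unfolding cluster_sum_def using XY by (intro sum.cong) auto
        have n: "norm (cluster_sum v X c {1..m} (?g X)) \<le> 2 * e" "norm (cluster_sum v Y c {1..m} (?g Y)) \<le> 2 * e"
          using X Y c by (auto simp: lead_event_def prior_event_def)
        have w: "h \<le> stick_weight v j" using X c by (auto simp: lead_event_def)
        have "stick_weight v j *\<^sub>R (X j - Y j) = cluster_sum v X c {1..m} (?g X) - cluster_sum v Y c {1..m} (?g Y)"
          unfolding 1 2 3 by (simp add: algebra_simps)
        then have "norm (stick_weight v j *\<^sub>R (X j - Y j)) \<le> 4 * e"
          using norm_triangle_ineq4[of "cluster_sum v X c {1..m} (?g X)" "cluster_sum v Y c {1..m} (?g Y)"] n by simp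
        then have "stick_weight v j * dist (X j) (Y j) \<le> 4 * e" using w h by (simp add: dist_norm)
        then have "h * dist (X j) (Y j) \<le> 4 * e" using mult_right_mono[OF w, of "dist (X j) (Y j)"] by simp
        then show ?thesis using h by (simp add: field_simps)
      qed
      show "emeasure P0 (cball x (4 * e / h)) \<le> ?b" for x using e h by (intro ball) auto
      show "cball x (4 * e / h) \<in> sets P0" for x unfolding sets_P0 by simp
    qed (use P0 l in auto)
    then show "emeasure atom_law (Pair v -` lead_event l m e h \<rho>) \<le> ?b ^ K * emeasure atom_law (Pair v -` stick_event l m e h \<rho>)"
      by (simp only: cL)
  qed
  also have "\<dots> = ?b ^ K * (\<integral>\<^sup>+v. emeasure atom_law (Pair v -` stick_event l m e h \<rho>) \<partial>stick_law \<alpha>)"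
    by (rule nn_integral_cmult) (rule T.measurable_emeasure_Pair[OF stick_event_measurable])
  also have "(\<integral>\<^sup>+v. emeasure atom_law (Pair v -` stick_event l m e h \<rho>) \<partial>stick_law \<alpha>) = emeasure prior (stick_event l m e h \<rho>)"
    by (rule T.emeasure_pair_measure_alt[OF stick_event_measurable, symmetric])
  finally show ?thesis .
qed

text \<open>A leader of weight \<open>h\<close> at \<open>p\<close> forces the mass before
  \<open>p\<close> to be at least \<open>h\<close>, hence also every product of factors
  \<open>1 - v j\<close> over some of the \<open>j < p\<close>. So deleting the leading breaks
  changes a remaining mass by no more than the factor \<open>1 / h\<close>.\<close>

lemma stick_event_subset:
  assumes l: "inj_on l {1..K}" "l ` {1..K} \<subseteq> {1..m}" and h: "h > 0" and p: "p = Max (l ` {1..K})"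
  shows "stick_event l m e h \<rho> \<subseteq> free_event (l ` {1..K}) (l ` {1..K} - {p}) p m e h \<rho>"
    and "\<And>x j. x \<in> stick_event l m e h \<rho> \<Longrightarrow> j \<in> l ` {1..K} - {p} \<Longrightarrow> h \<le> 1 - fst x j"
proof -
  let ?L = "l ` {1..K}"
  define Z where "Z = ?L - {p}"
  have pL: "p \<in> ?L" unfolding p using K by (intro Max_in) auto
  have Lp: "z \<le> p" if "z \<in> ?L" for z unfolding p using that by (intro Max_ge) auto
  have Zp: "z < p" if "z \<in> Z" for z using Lp[of z] that by (auto simp: Z_def)
  have pm: "1 \<le> p" "p \<le> m" using pL l by auto
  have main: "x \<in> free_event ?L Z p m e h \<rho> \<and> (\<forall>j\<in>Z. h \<le> 1 - fst x j)" if x: "x \<in> stick_event l m e h \<rho>" for x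
  proof -
    define v where "v = fst x"
    have v: "0 < v j \<and> v j < 1" if "j \<ge> 1" for j using x that by (auto simp: stick_event_def v_def)
    have z01: "0 \<le> zeroed Z v j \<and> zeroed Z v j \<le> 1" if "j \<ge> 1" for j using v[of j] that by (auto simp: zeroed_def less_imp_le)
    have r0: "stick_rem v k > 0" for k using v by (intro stick_rem_pos) auto
    have rz0: "stick_rem (zeroed Z v) k > 0" for k using v by (intro stick_rem_pos) (auto simp: zeroed_def)
    have wp: "h \<le> stick_weight v p" using pL x by (auto simp: stick_event_def v_def)
    also have "stick_weight v p \<le> stick_rem v (p - 1)" using v[of p] pm r0[of "p - 1"] by (simp add: stick_weight_eq mult_left_le_one_le)
    finally have rp: "h \<le> stick_rem v (p - 1)" .
    have hz: "h \<le> (\<Prod>j\<in>{1..k} \<inter> Z. 1 - v j)" for k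
    proof -
      have "stick_rem v (p - 1) \<le> (\<Prod>j\<in>{1..k} \<inter> Z. 1 - v j)" unfolding stick_rem_def
      proof (rule prod_subset_ge)
        show "{1..k} \<inter> Z \<subseteq> {1..p - 1}"
        proof
          fix j assume "j \<in> {1..k} \<inter> Z"
          then show "j \<in> {1..p - 1}" using Zp[of j] by auto
        qed
      qed (use v in \<open>auto simp: less_imp_le\<close>)
      then show ?thesis using rp by simp
    qed
    have rh: "h * stick_rem (zeroed Z v) k \<le> stick_rem v k" for k
      using mult_right_mono[OF hz[of k], of "stick_rem (zeroed Z v) k"] rz0[of k]
        stick_rem_zeroed[of v k Z] by (simp add: mult_ac)
    have rge: "stick_rem v k \<le> stick_rem (zeroed Z v) k" for k
    proof -
      have "(\<Prod>j\<in>{1..k} \<inter> Z. 1 - v j) \<le> 1" using v by (intro prod_le_1) (auto simp: less_imp_le)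
      then show ?thesis using rz0[of k] stick_rem_zeroed[of v k Z] by (simp add: mult_left_le)
    qed
    have 1: "stick_weight (zeroed Z v) k * U (snd x k) \<le> e / h" if k: "k \<in> {1..m} - ?L" for k
    proof -
      have kz: "zeroed Z v k = v k" using k by (auto simp: zeroed_def Z_def)
      have k1: "k \<ge> 1" using k by auto
      have "h * stick_weight (zeroed Z v) k \<le> stick_weight v k"
        using mult_left_mono[OF rh[of "k - 1"], of "v k"] v[OF k1] k1 kz by (simp add: stick_weight_eq mult_ac)
      then have "h * stick_weight (zeroed Z v) k * U (snd x k) \<le> stick_weight v k * U (snd x k)"
        using U_nn by (intro mult_right_mono) auto
      also have "\<dots> \<le> e" using x k by (auto simp: stick_event_def v_def)
      finally show ?thesis using h by (simp add: field_simps)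
    qed
    have 2: "stick_rem (zeroed Z v) m \<le> e / h"
    proof -
      have "stick_rem v m \<le> e" using x by (auto simp: stick_event_def v_def)
      then have "h * stick_rem (zeroed Z v) m \<le> e" using rh[of m] by linarith
      then show ?thesis using h by (simp add: field_simps)
    qed
    have 3: "h \<le> stick_rem (zeroed Z v) (p - 1)" using rge[of "p - 1"] rp by linarith
    have 4: "\<rho> < 1 - v p" if "p = K"
    proof -
      have "\<rho> < stick_rem v p" using x that by (auto simp: stick_event_def v_def)
      also have "\<dots> = stick_rem v (p - 1) * (1 - v p)" using pm by (simp add: stick_rem_eq)
      also have "\<dots> \<le> 1 * (1 - v p)" using v pm by (intro mult_right_mono stick_rem_le_1) (auto simp: less_imp_le)
      finally show ?thesis by simp
    qed
    have 5: "h \<le> 1 - v j" if "j \<in> Z" for j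
    proof -
      have j: "1 \<le> j" using that l by (auto simp: Z_def)
      have "stick_rem v (p - 1) \<le> stick_rem v j"
        using v Zp[OF that] by (intro stick_rem_antimono) (auto simp: less_imp_le)
      also have "\<dots> = stick_rem v (j - 1) * (1 - v j)" using j by (simp add: stick_rem_eq)
      also have "\<dots> \<le> 1 * (1 - v j)" using v j by (intro mult_right_mono stick_rem_le_1) (auto simp: less_imp_le)
      finally show ?thesis using rp by simp
    qed
    have "x \<in> space prior" using x by (auto simp: stick_event_def)
    moreover have "\<forall>j. 1 \<le> j \<and> j \<notin> Z \<longrightarrow> 0 < v j \<and> v j < 1" using v by simp
    ultimately have "x \<in> free_event ?L Z p m e h \<rho>"
      unfolding free_event_def mem_Collect_eq v_def[symmetric] using 1 2 3 4 by (intro conjI ballI impI)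
    then show ?thesis using 5 unfolding v_def[symmetric] by simp
  qed
  show "stick_event l m e h \<rho> \<subseteq> free_event (l ` {1..K}) (l ` {1..K} - {p}) p m e h \<rho>"
    using main unfolding Z_def by blast
  show "h \<le> 1 - fst x j" if "x \<in> stick_event l m e h \<rho>" "j \<in> l ` {1..K} - {p}" for x j
    using main[OF that(1)] that(2) unfolding Z_def by blast
qed

text \<open>Uses the stability of stick breaking with all atoms frozen. Only \<open>K - 1\<close>
  leading sticks are confined; the last one, \<open>p\<close>, is left to the free event, where it
  accounts for the exponent \<alpha>. The tolerance in \<open>s\<close> is \<open>4 * e\<close>,
  twice that of a single cluster mass, since two configurations are compared.\<close>

lemma emeasure_stick_event:
  assumes l: "inj_on l {1..K}" "l ` {1..K} \<subseteq> {1..m}" and e: "e > 0" and h: "0 < h" "h \<le> 1"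
    and p: "p = Max (l ` {1..K})" and s: "s = 2 * (real K * (4 * e)) * (4 / h) ^ (K + 2)"
  shows "emeasure prior (stick_event l m e h \<rho>) \<le>
    ennreal (2 * s * \<alpha> / h) ^ (K - 1) * emeasure prior (free_event (l ` {1..K}) (l ` {1..K} - {p}) p m e h \<rho>)"
proof -
  let ?L = "l ` {1..K}" and ?b = "ennreal (2 * s * \<alpha> / h)"
  let ?F = "free_event ?L (?L - {p}) p m e h \<rho>"
  have cL: "card ?L = K" using l by (simp add: card_image)
  have pL: "p \<in> ?L" unfolding p using K by (intro Max_in) auto
  have cZ: "card (?L - {p}) = K - 1" using pL cL by (simp add: card_Diff_singleton)
  have s0: "s \<ge> 0" using e h by (simp add: s)
  have "emeasure prior (stick_event l m e h \<rho>) = (\<integral>\<^sup>+\<theta>. emeasure (stick_law \<alpha>) ((\<lambda>v. (v, \<theta>)) -` stick_event l m e h \<rho>) \<partial>atom_law)"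
    by (rule ST.emeasure_pair_measure_alt2[OF stick_event_measurable])
  also have "\<dots> \<le> (\<integral>\<^sup>+\<theta>. ?b ^ (K - 1) * emeasure (stick_law \<alpha>) ((\<lambda>v. (v, \<theta>)) -` ?F) \<partial>atom_law)"
  proof (rule nn_integral_mono)
    fix \<theta> assume \<theta>: "\<theta> \<in> space atom_law"
    have "emeasure (stick_law \<alpha>) ((\<lambda>v. (v, \<theta>)) -` stick_event l m e h \<rho>) \<le> ?b ^ card (?L - {p}) * emeasure (stick_law \<alpha>) ((\<lambda>v. (v, \<theta>)) -` ?F)"
    proof (rule emeasure_PiM_diameter_bound[where T = "\<lambda>_ x. {v. \<bar>v - x\<bar> \<le> s \<and> 1 - v \<ge> h}"])
      show "(\<lambda>v. (v, \<theta>)) -` stick_event l m e h \<rho> \<in> sets (stick_law \<alpha>)" "(\<lambda>v. (v, \<theta>)) -` ?F \<in> sets (stick_law \<alpha>)"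
        by (rule sets_Pair2[OF stick_event_measurable], rule sets_Pair2[OF free_event_measurable])
      show "(\<lambda>v. (v, \<theta>)) -` stick_event l m e h \<rho> \<subseteq> (\<lambda>v. (v, \<theta>)) -` ?F"
        using stick_event_subset(1)[OF l h(1) p, of e \<rho>] by auto
      show "Y \<in> (\<lambda>v. (v, \<theta>)) -` ?F" if X: "X \<in> (\<lambda>v. (v, \<theta>)) -` stick_event l m e h \<rho>"
        and Y: "Y \<in> space (stick_law \<alpha>)" and XY: "\<And>i. i \<notin> ?L - {p} \<Longrightarrow> X i = Y i" for X Y
      proof -
        have XF: "(X, \<theta>) \<in> ?F" using X stick_event_subset(1)[OF l h(1) p, of e \<rho>] by auto
        have "zeroed (?L - {p}) Y = zeroed (?L - {p}) X" using XY by (auto simp: zeroed_def fun_eq_iff)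
        moreover have Xp: "X p = Y p" using XY[of p] by auto
        moreover have "0 < Y j \<and> Y j < 1" if "1 \<le> j" "j \<notin> ?L - {p}" for j
        proof -
          have "0 < X j \<and> X j < 1" using XF that unfolding free_event_def by simp
          then show ?thesis using XY[OF that(2)] by simp
        qed
        moreover have "p = K \<longrightarrow> \<rho> < 1 - Y p" using XF unfolding Xp[symmetric] by (simp only: free_event_def mem_Collect_eq fst_conv) (elim conjE, assumption)
        ultimately show ?thesis using XF Y \<theta> unfolding free_event_def by (simp add: space_pair_measure)
      qed
      show "Y j \<in> {v. \<bar>v - X j\<bar> \<le> s \<and> 1 - v \<ge> h}" if X: "X \<in> (\<lambda>v. (v, \<theta>)) -` stick_event l m e h \<rho>"
        and Y: "Y \<in> (\<lambda>v. (v, \<theta>)) -` stick_event l m e h \<rho>" and XY: "\<And>i. i \<notin> ?L - {p} \<Longrightarrow> X i = Y i"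
        and j: "j \<in> ?L - {p}" for X Y j
      proof -
        have "h \<le> 1 - Y j" using stick_event_subset(2)[OF l h(1) p, of "(Y, \<theta>)" e \<rho> j] Y j by simp
        moreover have "\<bar>Y j - X j\<bar> \<le> 2 * (real (card {1..K}) * (4 * e)) * (4 / h) ^ (card {1..K} + 2)"
        proof (rule stick_diameter[where l = l and N = "\<lambda>c. {k \<in> {1..m} - ?L. \<theta> k \<in> V c}" and m = m])
          show "disjoint_family_on (\<lambda>c. {k \<in> {1..m} - ?L. \<theta> k \<in> V c}) {1..K}"
            using V_dis by (fastforce simp: disjoint_family_on_def)
          show "\<bar>(stick_weight Y (l c) + (\<Sum>k\<in>{k \<in> {1..m} - ?L. \<theta> k \<in> V c}. stick_weight Y k)) -
            (stick_weight X (l c) + (\<Sum>k\<in>{k \<in> {1..m} - ?L. \<theta> k \<in> V c}. stick_weight X k))\<bar> \<le> 4 * e" if c: "c \<in> {1..K}" for c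
          proof -
            have *: "cluster_sum W \<theta> c ({1..m} - ?L) (\<lambda>_. 1) = (\<Sum>k\<in>{k \<in> {1..m} - ?L. \<theta> k \<in> V c}. stick_weight W k)" for W
              unfolding cluster_sum_def by (rule sum.mono_neutral_cong_right) (auto simp: indicator_def)
            have "\<bar>stick_weight W (l c) + (\<Sum>k\<in>{k \<in> {1..m} - ?L. \<theta> k \<in> V c}. stick_weight W k) - ws c\<bar> \<le> 2 * e"
              if "W \<in> (\<lambda>v. (v, \<theta>)) -` stick_event l m e h \<rho>" for W
            proof -
              have "\<bar>stick_weight W (l c) + cluster_sum W \<theta> c ({1..m} - ?L) (\<lambda>_. 1) - ws c\<bar> \<le> 2 * e"
                using that c by (simp only: stick_event_def mem_Collect_eq fst_conv snd_conv vimage_eq simp_thms Ball_def)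
              then show ?thesis by (simp only: *)
            qed
            from this[OF X] this[OF Y] show ?thesis by linarith
          qed
          show "h \<le> stick_weight Y i" if "i \<in> ?L" for i
            using that Y unfolding stick_event_def by auto
          show "0 < Y i \<and> Y i < 1" "0 < X i \<and> X i < 1" if "i \<in> {1..m}" for i
            using X Y that by (auto simp: stick_event_def)
          show "Y i = X i" if "i \<notin> ?L - {p}" for i using XY[OF that] by simp
          show "p = Max ?L" by (rule p)
          show "j \<in> ?L - {p}" by (rule j)
        qed (use l h K in auto)
        ultimately show ?thesis by (simp add: s)
      qed
      show "emeasure (beta_distribution 1 \<alpha>) {v. \<bar>v - x\<bar> \<le> s \<and> 1 - v \<ge> h} \<le> ?b" for x
        by (rule beta_interval_upper[OF al h s0])
    qed (use prob_space_beta[OF al] l in auto)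
    then show "emeasure (stick_law \<alpha>) ((\<lambda>v. (v, \<theta>)) -` stick_event l m e h \<rho>) \<le> ?b ^ (K - 1) * emeasure (stick_law \<alpha>) ((\<lambda>v. (v, \<theta>)) -` ?F)"
      by (simp only: cZ)
  qed
  also have "\<dots> = ?b ^ (K - 1) * (\<integral>\<^sup>+\<theta>. emeasure (stick_law \<alpha>) ((\<lambda>v. (v, \<theta>)) -` ?F) \<partial>atom_law)"
    by (rule nn_integral_cmult) (rule ST.measurable_emeasure_Pair2[OF free_event_measurable])
  also have "(\<integral>\<^sup>+\<theta>. emeasure (stick_law \<alpha>) ((\<lambda>v. (v, \<theta>)) -` ?F) \<partial>atom_law) = emeasure prior ?F"
    by (rule ST.emeasure_pair_measure_alt2[OF free_event_measurable, symmetric])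
  finally show ?thesis .
qed

text \<open>Pigeonhole: each cluster has mass at least \<open>w0 / 2\<close> among the first
  \<open>m\<close> pieces, so these cannot all be lighter than \<open>w0 / (4 * m)\<close>.\<close>

lemma prior_event_subset:
  assumes m: "1 \<le> m" and wmin: "\<And>c. c \<in> {1..K} \<Longrightarrow> w0 \<le> ws c" "0 < w0" and e: "4 * e \<le> w0" and h: "h = w0 / (4 * real m)"
  shows "prior_event m e \<rho> \<subseteq> (\<Union>l\<in>{1..K} \<rightarrow>\<^sub>E {1..m}. lead_event l m e h \<rho>)"
proof
  fix x assume x: "x \<in> prior_event m e \<rho>"
  define v where "v = fst x"
  define \<theta> where "\<theta> = snd x"
  have v: "0 < v j \<and> v j < 1" if "j \<ge> 1" for j using x that by (auto simp: prior_event_def v_def)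
  have w0: "0 \<le> stick_weight v k" if "k \<ge> 1" for k
  proof -
    have "stick_rem v (k - 1) > 0" using v by (intro stick_rem_pos) auto
    then show ?thesis using v[OF that] that by (simp add: stick_weight_eq)
  qed
  have "\<exists>k. k \<in> {1..m} \<and> \<theta> k \<in> V c \<and> h \<le> stick_weight v k" if c: "c \<in> {1..K}" for c
  proof (rule ccontr)
    assume *: "\<nexists>k. k \<in> {1..m} \<and> \<theta> k \<in> V c \<and> h \<le> stick_weight v k"
    have *: "indicator (V c) (\<theta> k) * stick_weight v k \<le> h" if "k \<in> {1..m}" for k
    proof (cases "\<theta> k \<in> V c")
      case True
      then have "\<not> h \<le> stick_weight v k" using that * by blast
      then show ?thesis using True by simp
    next
      case False
      then show ?thesis using wmin(2) by (simp add: h)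
    qed
    have "cluster_sum v \<theta> c {1..m} (\<lambda>_. 1) \<le> (\<Sum>k\<in>{1..m}. h)"
      unfolding cluster_sum_def using * by (intro sum_mono) auto
    also have "\<dots> = w0 / 4" using m by (simp add: h)
    finally have "cluster_sum v \<theta> c {1..m} (\<lambda>_. 1::real) \<le> w0 / 4" .
    moreover have "\<bar>cluster_sum v \<theta> c {1..m} (\<lambda>_. 1) - ws c\<bar> \<le> 2 * e"
      using x c unfolding prior_event_def v_def \<theta>_def by simp
    ultimately show False using wmin(1)[OF c] wmin(2) e by linarith
  qed
  then have "\<exists>l. \<forall>c\<in>{1..K}. l c \<in> {1..m} \<and> \<theta> (l c) \<in> V c \<and> h \<le> stick_weight v (l c)"
    by (intro bchoice) blast
  then obtain l where l: "\<And>c. c \<in> {1..K} \<Longrightarrow> l c \<in> {1..m} \<and> \<theta> (l c) \<in> V c \<and> h \<le> stick_weight v (l c)" by blast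
  define l' where "l' = restrict l {1..K}"
  have "l' \<in> {1..K} \<rightarrow>\<^sub>E {1..m}" using l by (auto simp: l'_def)
  moreover have "x \<in> lead_event l' m e h \<rho>"
    using x l unfolding lead_event_def v_def \<theta>_def l'_def by (auto simp: prior_event_def)
  ultimately show "x \<in> (\<Union>l\<in>{1..K} \<rightarrow>\<^sub>E {1..m}. lead_event l m e h \<rho>)" by blast
qed

lemma lead_event_empty:
  assumes "\<not> inj_on l {1..K}"
  shows "lead_event l m e h \<rho> = {}"
proof -
  obtain c d where cd: "c \<in> {1..K}" "d \<in> {1..K}" "c \<noteq> d" "l c = l d" using assms by (auto simp: inj_on_def)
  have "V c \<inter> V d = {}" using V_dis cd by (auto simp: disjoint_family_on_def)
  moreover have "snd x (l c) \<in> V c \<and> snd x (l c) \<in> V d" if "x \<in> lead_event l m e h \<rho>" for x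
  proof -
    have "\<forall>c\<in>{1..K}. snd x (l c) \<in> V c" using that by (auto simp: lead_event_def)
    from bspec[OF this cd(1)] bspec[OF this cd(2)] show ?thesis by (simp add: cd(4))
  qed
  ultimately show ?thesis by auto
qed

text \<open>Union bound over the choices of leaders. The exponent of \<open>e\<close> collects the
  dimension for each leading atom, 1 for each leading stick but the last, and \<alpha> from the free
  stick. The many small pieces cost only powers of \<open>m\<close>, which will later be a tiny
  power of \<open>n\<close>.\<close>

lemma emeasure_prior_event:
  "\<exists>C\<ge>0. \<exists>M e0. e0 > 0 \<and> (\<forall>m e \<rho>. 1 \<le> m \<longrightarrow> 0 < e \<longrightarrow> e \<le> e0 \<longrightarrow> 0 < \<rho> \<longrightarrow> \<rho> \<le> 1 \<longrightarrow>
     emeasure prior (prior_event m e \<rho>) \<le>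
       ennreal (C * real m powr M * e powr (real (K - 1) + \<alpha> + real (K * DIM('a))) * (e / \<rho>) powr (1/4)))"
proof -
  obtain C3 where C3: "C3 \<ge> 0" and fb: "\<forall>L p m e h \<rho>. finite L \<longrightarrow> card L = K \<longrightarrow> L \<subseteq> {1..m} \<longrightarrow> p = Max L \<longrightarrow> 0 < e \<longrightarrow> 0 < h \<longrightarrow> h \<le> 1 \<longrightarrow>
     0 < \<rho> \<longrightarrow> \<rho> \<le> 1 \<longrightarrow>
     emeasure prior (free_event L (L - {p}) p m e h \<rho>) \<le> ennreal (C3 * (e / h\<^sup>2) powr \<alpha> * (e / h\<^sup>2 / \<rho>) powr (1/4))"
    using free_event_bound by (elim exE conjE)
  define w0 where "w0 = Min (ws ` {1..K})"
  have w0: "0 < w0" "w0 \<le> 1" "\<And>c. c \<in> {1..K} \<Longrightarrow> w0 \<le> ws c"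
  proof -
    have "w0 \<in> ws ` {1..K}" unfolding w0_def using K by (intro Min_in) auto
    then show "0 < w0" "w0 \<le> 1" using ws by auto
    show "w0 \<le> ws c" if "c \<in> {1..K}" for c unfolding w0_def using that by (intro Min_le) auto
  qed
  let ?D = "DIM('a)"
  \<comment> \<open>Counts the powers of \<open>4 / h\<close>: from the balls around the atoms, from
    the stick diameters, and \<open>K\<close> for the number of choices of leaders. \<open>M\<close>
    adds the powers hidden in \<open>e / h\<^sup>2\<close>. As \<open>4 / h\<close> is a multiple of
    \<open>m\<close>, they become powers of \<open>m\<close>.\<close>
  define M1 where "M1 = ?D * K + (K + 3) * (K - 1) + K"
  define M where "M = real M1 + (2 * \<alpha> + 1/2)"
  define N where "N = real (K - 1) + \<alpha> + real (K * ?D)"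
  define C1 where "C1 = Cb ^ K * (4 * real K * \<alpha>) ^ (K - 1) * C3"
  have C1: "C1 \<ge> 0" using Cb al C3 by (simp add: C1_def)
  have "emeasure prior (prior_event m e \<rho>) \<le> ennreal (C1 * (16 / w0) powr M * real m powr M * e powr N * (e / \<rho>) powr (1/4))"
    if m: "1 \<le> m" and e: "0 < e" "e \<le> w0 / 4" and \<rho>: "0 < \<rho>" "\<rho> \<le> 1" for m e \<rho>
  proof -
    define h where "h = w0 / (4 * real m)"
    define X where "X = 4 / h"
    have m1: "1 \<le> real m" using m by simp
    have "w0 \<le> 4 * real m" using w0(2) m1 by linarith
    then have h: "0 < h" "h \<le> 1" using w0(1) m1 by (auto simp: h_def)
    have X: "X = 16 * real m / w0" using w0 m by (simp add: X_def h_def)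
    have "real m * w0 \<le> 16 * real m" using mult_left_mono[OF w0(2), of "real m"] m1 by linarith
    then have Xm: "real m \<le> X" unfolding X using w0(1) by (simp add: pos_le_divide_eq)
    have X1: "X \<ge> 1" using Xm m by linarith
    define s where "s = 2 * (real K * (4 * e)) * (4 / h) ^ (K + 2)"
    have s0: "s \<ge> 0" using e h by (simp add: s_def)
    define Bl where "Bl = (Cb * (4 * e / h) ^ ?D) ^ K * (2 * s * \<alpha> / h) ^ (K - 1) * (C3 * (e / h\<^sup>2) powr \<alpha> * (e / h\<^sup>2 / \<rho>) powr (1/4))"
    have eh: "0 \<le> Cb * (4 * e / h) ^ ?D" "0 \<le> 2 * s * \<alpha> / h" using Cb e h s0 al by auto
    have each: "emeasure prior (lead_event l m e h \<rho>) \<le> ennreal Bl" if l: "l \<in> {1..K} \<rightarrow>\<^sub>E {1..m}" for l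
    proof (cases "inj_on l {1..K}")
      case False
      then show ?thesis by (simp add: lead_event_empty)
    next
      case True
      have lm: "l ` {1..K} \<subseteq> {1..m}" using l by auto
      let ?p = "Max (l ` {1..K})"
      have "emeasure prior (lead_event l m e h \<rho>) \<le> ennreal (Cb * (4 * e / h) ^ ?D) ^ K * emeasure prior (stick_event l m e h \<rho>)"
        by (rule emeasure_lead_event[OF True lm e(1) h(1)])
      also have "\<dots> \<le> ennreal (Cb * (4 * e / h) ^ ?D) ^ K * (ennreal (2 * s * \<alpha> / h) ^ (K - 1) *
           emeasure prior (free_event (l ` {1..K}) (l ` {1..K} - {?p}) ?p m e h \<rho>))"
        by (rule mult_left_mono[OF emeasure_stick_event[OF True lm e(1) h refl s_def]]) simp
      also have "\<dots> \<le> ennreal (Cb * (4 * e / h) ^ ?D) ^ K * (ennreal (2 * s * \<alpha> / h) ^ (K - 1) *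
           ennreal (C3 * (e / h\<^sup>2) powr \<alpha> * (e / h\<^sup>2 / \<rho>) powr (1/4)))"
      proof (intro mult_left_mono)
        show "emeasure prior (free_event (l ` {1..K}) (l ` {1..K} - {?p}) ?p m e h \<rho>) \<le>
           ennreal (C3 * (e / h\<^sup>2) powr \<alpha> * (e / h\<^sup>2 / \<rho>) powr (1/4))"
          using fb[rule_format, of "l ` {1..K}" m ?p e h \<rho>] lm e h \<rho> card_image[OF True] by simp
      qed auto
      also have "\<dots> = ennreal Bl"
      proof -
        have "ennreal a ^ K * (ennreal b ^ (K - 1) * ennreal c) = ennreal (a ^ K * b ^ (K - 1) * c)"
          if "a \<ge> 0" "b \<ge> 0" "c \<ge> 0" for a b c
          using that by (simp add: ennreal_power ennreal_mult mult.assoc)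
        from this[OF eh] show ?thesis unfolding Bl_def using C3 by simp
      qed
      finally show ?thesis .
    qed
    have Bl_le: "real m ^ K * Bl \<le> C1 * X powr M * e powr N * (e / \<rho>) powr (1/4)"
    proof -
      define y where "y = e * X ^ 2"
      have y: "e / h\<^sup>2 \<le> y" using e h by (simp add: y_def X_def power2_eq_square field_simps)
      have ehp: "e / h\<^sup>2 > 0" "y > 0" using e h X1 by (auto simp: y_def)
      have yr: "e / h\<^sup>2 / \<rho> \<le> y / \<rho>" using y \<rho> by (intro divide_right_mono) auto
      have p3: "(e / h\<^sup>2) powr \<alpha> * (e / h\<^sup>2 / \<rho>) powr (1/4) \<le> y powr \<alpha> * (y / \<rho>) powr (1/4)"
      proof (intro mult_mono powr_mono2)
        show "0 \<le> e / h\<^sup>2 / \<rho>" using e \<rho> by simp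
      qed (use y yr ehp al in \<open>simp_all add: less_imp_le\<close>)
      have X2: "X ^ 2 = X powr 2" using X1 by simp
      have ya: "y powr \<alpha> = e powr \<alpha> * X powr (2 * \<alpha>)"
        unfolding y_def X2 by (simp only: powr_mult powr_powr)
      have yb: "(y / \<rho>) powr (1/4) = (e / \<rho>) powr (1/4) * X powr (1/2)"
      proof -
        have "y / \<rho> = (e / \<rho>) * X powr 2" unfolding y_def X2 by (simp only: times_divide_eq_left)
        then show ?thesis by (simp only: powr_mult powr_powr) simp
      qed
      have p1: "(Cb * (4 * e / h) ^ ?D) ^ K = Cb ^ K * e ^ (?D * K) * X ^ (?D * K)"
      proof -
        have "4 * e / h = e * X" by (simp add: X_def)
        then show ?thesis by (simp add: power_mult_distrib power_mult)
      qed
      have p2: "(2 * s * \<alpha> / h) ^ (K - 1) = (4 * real K * \<alpha>) ^ (K - 1) * e ^ (K - 1) * X ^ ((K + 3) * (K - 1))"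
      proof -
        have "2 * s * \<alpha> / h = (4 * real K * \<alpha>) * e * (X ^ (K + 2) * X)" unfolding s_def X_def by simp
        also have "X ^ (K + 2) * X = X ^ (K + 3)" by (simp add: power_add power2_eq_square power3_eq_cube)
        finally show ?thesis by (simp only: power_mult_distrib power_mult)
      qed
      have mK: "real m ^ K \<le> X ^ K" using Xm by (intro power_mono) auto
      have Bl0: "Bl \<ge> 0" using eh C3 by (simp add: Bl_def)
      have "real m ^ K * Bl \<le> X ^ K * ((Cb ^ K * e ^ (?D * K) * X ^ (?D * K)) * ((4 * real K * \<alpha>) ^ (K - 1) * e ^ (K - 1) * X ^ ((K + 3) * (K - 1))) *
          (C3 * (y powr \<alpha> * (y / \<rho>) powr (1/4))))"
      proof (intro mult_mono mK)
        show "Bl \<le> (Cb ^ K * e ^ (?D * K) * X ^ (?D * K)) * ((4 * real K * \<alpha>) ^ (K - 1) * e ^ (K - 1) * X ^ ((K + 3) * (K - 1))) *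
          (C3 * (y powr \<alpha> * (y / \<rho>) powr (1/4)))"
        proof -
          have "Bl = (Cb ^ K * e ^ (?D * K) * X ^ (?D * K)) * ((4 * real K * \<alpha>) ^ (K - 1) * e ^ (K - 1) * X ^ ((K + 3) * (K - 1))) *
            (C3 * ((e / h\<^sup>2) powr \<alpha> * (e / h\<^sup>2 / \<rho>) powr (1/4)))"
            unfolding Bl_def p1 p2 by (simp only: mult.assoc)
          moreover have "0 \<le> (Cb ^ K * e ^ (?D * K) * X ^ (?D * K)) * ((4 * real K * \<alpha>) ^ (K - 1) * e ^ (K - 1) * X ^ ((K + 3) * (K - 1)))"
            using Cb e X1 al by (intro mult_nonneg_nonneg zero_le_power) auto
          ultimately show ?thesis by (simp only:) (intro mult_left_mono p3 C3)
        qed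
        show "0 \<le> X ^ K" using X1 by simp
      qed (rule Bl0)
      also have "\<dots> = C1 * (X ^ M1 * X powr (2 * \<alpha>) * X powr (1/2)) * (e ^ (?D * K) * e ^ (K - 1) * e powr \<alpha>) * (e / \<rho>) powr (1/4)"
        unfolding ya yb M1_def C1_def power_add by (simp only: mult_ac)
      also have "X ^ M1 * X powr (2 * \<alpha>) * X powr (1/2) = X powr M"
      proof -
        have "X ^ M1 = X powr real M1" using powr_realpow[of X M1] X1 by simp
        then show ?thesis unfolding M_def powr_add by (simp only: mult.assoc)
      qed
      also have "e ^ (?D * K) * e ^ (K - 1) * e powr \<alpha> = e powr N"
      proof -
        have "e ^ (?D * K) = e powr real (K * ?D)" "e ^ (K - 1) = e powr real (K - 1)"
          using powr_realpow[OF e(1), of "K * ?D"] powr_realpow[OF e(1), of "K - 1"] by (simp_all only: mult.commute)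
        then show ?thesis unfolding N_def powr_add by (simp only: mult_ac)
      qed
      finally show ?thesis .
    qed
    have "emeasure prior (prior_event m e \<rho>) \<le> emeasure prior (\<Union>l\<in>{1..K} \<rightarrow>\<^sub>E {1..m}. lead_event l m e h \<rho>)"
    proof (rule emeasure_mono)
      show "prior_event m e \<rho> \<subseteq> (\<Union>l\<in>{1..K} \<rightarrow>\<^sub>E {1..m}. lead_event l m e h \<rho>)"
        by (rule prior_event_subset[OF m w0(3) w0(1) _ h_def]) (use e in auto)
      show "(\<Union>l\<in>{1..K} \<rightarrow>\<^sub>E {1..m}. lead_event l m e h \<rho>) \<in> sets prior"
        by (intro sets.finite_UN finite_PiE lead_event_measurable) auto
    qed
    also have "\<dots> \<le> (\<Sum>l\<in>{1..K} \<rightarrow>\<^sub>E {1..m}. emeasure prior (lead_event l m e h \<rho>))"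
    proof (rule emeasure_subadditive_finite)
      show "finite ({1..K} \<rightarrow>\<^sub>E {1..m})" by (rule finite_PiE) auto
      show "(\<lambda>l. lead_event l m e h \<rho>) ` ({1..K} \<rightarrow>\<^sub>E {1..m}) \<subseteq> sets prior"
        by (rule image_subsetI) (rule lead_event_measurable)
    qed
    also have "\<dots> \<le> (\<Sum>l\<in>{1..K} \<rightarrow>\<^sub>E {1..m}. ennreal Bl)" by (intro sum_mono each)
    also have "\<dots> = ennreal (real m ^ K * Bl)"
      by (simp add: card_PiE ennreal_mult' ennreal_of_nat_eq_real_of_nat ennreal_power)
    also have "\<dots> \<le> ennreal (C1 * X powr M * e powr N * (e / \<rho>) powr (1/4))"
      by (rule ennreal_leI[OF Bl_le])
    also have "X powr M = (16 / w0) powr M * real m powr M"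
      unfolding X using w0 by (subst powr_mult[symmetric]) auto
    finally show ?thesis by (simp only: mult_ac)
  qed
  moreover have "0 \<le> C1 * (16 / w0) powr M" using C1 by simp
  ultimately show ?thesis using w0(1) unfolding N_def
    by (intro exI[of _ "C1 * (16 / w0) powr M"] conjI exI[of _ M] exI[of _ "w0 / 4"]) auto
qed

end

subsection \<open>Identification by bounded statistics\<close>

lemma integral_lborel_shift:
  fixes g :: "'a::euclidean_space \<Rightarrow> real"
  assumes [measurable]: "g \<in> borel_measurable borel"
  shows "(\<integral>x. g x \<partial>lborel) = (\<integral>x. g (x + \<theta>) \<partial>lborel)"
proof -
  have "(\<integral>x. g x \<partial>lborel) = (\<integral>x. g x \<partial>distr lborel borel ((+) \<theta>))"
    using lborel_distr_plus[of \<theta>] by simp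
  also have "\<dots> = (\<integral>x. g (\<theta> + x) \<partial>lborel)" by (rule integral_distr) auto
  finally show ?thesis by (simp add: add.commute)
qed

lemma nn_integral_lborel_shift:
  fixes g :: "'a::euclidean_space \<Rightarrow> ennreal"
  assumes [measurable]: "g \<in> borel_measurable borel"
  shows "(\<integral>\<^sup>+x. g (x - \<theta>) \<partial>lborel) = (\<integral>\<^sup>+x. g x \<partial>lborel)"
proof -
  have "(\<integral>\<^sup>+x. g x \<partial>lborel) = (\<integral>\<^sup>+x. g x \<partial>distr lborel borel ((+) (- \<theta>)))"
    using lborel_distr_plus[of "- \<theta>"] by simp
  also have "\<dots> = (\<integral>\<^sup>+x. g (- \<theta> + x) \<partial>lborel)" by (rule nn_integral_distr) auto
  finally show ?thesis by simp
qed

lemma probability_densityD: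
  assumes "probability_density f"
  shows "f \<in> borel_measurable borel" "\<And>x. 0 \<le> f x" "(\<integral>\<^sup>+x. ennreal (f x) \<partial>lborel) = 1"
    "integrable lborel f" "(\<integral>x. f x \<partial>lborel) = 1"
proof -
  show f: "f \<in> borel_measurable borel" "\<And>x. 0 \<le> f x" "(\<integral>\<^sup>+x. ennreal (f x) \<partial>lborel) = 1"
    using assms by (auto simp: probability_density_def)
  show "integrable lborel f" using f by (intro integrableI_nonneg) auto
  show "(\<integral>x. f x \<partial>lborel) = 1" using f by (subst integral_eq_nn_integral) auto
qed

section \<open>Functionals of an atom that bounded statistics can estimate\<close>

lemma integrable_bounded_times_density:
  fixes f :: "'a::euclidean_space \<Rightarrow> real"
  assumes f: "probability_density f" and g: "g \<in> borel_measurable borel" "\<And>x. \<bar>g x\<bar> \<le> B"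
  shows "integrable lborel (\<lambda>x. g x * f x)"
proof (rule Bochner_Integration.integrable_bound)
  show "integrable lborel (\<lambda>x. B * f x)" using probability_densityD[OF f] by auto
  show "(\<lambda>x. g x * f x) \<in> borel_measurable lborel" using g(1) probability_densityD(1)[OF f] by simp
  show "AE x in lborel. norm (g x * f x) \<le> norm (B * f x)"
    using g(2) probability_densityD(2)[OF f]
    by (intro AE_I2) (auto simp: abs_mult intro!: mult_right_mono order_trans[OF g(2)])
qed

text \<open>\<open>\<psi> \<theta>\<close> is the mean of a bounded statistic under the component
  located at \<theta>. By linearity the mean of \<open>\<psi>\<close> under a mixing measure is the
  mean of this statistic under the mixture, so exponential inequalities for bounded variables apply
  to it.\<close>

definition observable :: "('a::euclidean_space \<Rightarrow> real) \<Rightarrow> ('a \<Rightarrow> real) \<Rightarrow> bool" where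
  "observable f \<psi> \<longleftrightarrow> (\<exists>g B. g \<in> borel_measurable borel \<and> (\<forall>x. \<bar>g x\<bar> \<le> B) \<and>
     (\<forall>\<theta>. (\<integral>x. g x * f (x - \<theta>) \<partial>lborel) = \<psi> \<theta>))"

lemma observableI:
  fixes f :: "'a::euclidean_space \<Rightarrow> real"
  assumes f: "probability_density f" and g: "g \<in> borel_measurable borel" "\<And>x. \<bar>g x\<bar> \<le> B"
    and \<psi>: "\<And>\<theta>. (\<integral>x. g (x + \<theta>) * f x \<partial>lborel) = \<psi> \<theta>"
  shows "observable f \<psi>"
proof -
  have "(\<integral>x. g x * f (x - \<theta>) \<partial>lborel) = \<psi> \<theta>" for \<theta>
    using integral_lborel_shift[of "\<lambda>x. g x * f (x - \<theta>)" \<theta>] \<psi>[of \<theta>] g probability_densityD(1)[OF f] by simp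
  then show ?thesis using g unfolding observable_def by blast
qed

lemma observableD:
  fixes f :: "'a::euclidean_space \<Rightarrow> real"
  assumes f: "probability_density f" and o: "observable f \<psi>"
  obtains g B where "g \<in> borel_measurable borel" "\<And>x. \<bar>g x\<bar> \<le> B" "\<And>\<theta>. (\<integral>x. g (x + \<theta>) * f x \<partial>lborel) = \<psi> \<theta>"
proof -
  obtain g B where g: "g \<in> borel_measurable borel" "\<forall>x. \<bar>g x\<bar> \<le> B" "\<forall>\<theta>. (\<integral>x. g x * f (x - \<theta>) \<partial>lborel) = \<psi> \<theta>"
    using o unfolding observable_def by blast
  have "(\<integral>x. g (x + \<theta>) * f x \<partial>lborel) = \<psi> \<theta>" for \<theta>
    using integral_lborel_shift[of "\<lambda>x. g x * f (x - \<theta>)" \<theta>] g probability_densityD(1)[OF f] by simp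
  with g that show ?thesis by blast
qed

lemma observable_lincomb:
  fixes f :: "'a::euclidean_space \<Rightarrow> real"
  assumes f: "probability_density f" and "observable f \<psi>" "observable f \<phi>"
  shows "observable f (\<lambda>\<theta>. a * \<psi> \<theta> + b * \<phi> \<theta>)"
proof -
  obtain g B where g: "g \<in> borel_measurable borel" "\<And>x. \<bar>g x\<bar> \<le> B" "\<And>\<theta>. (\<integral>x. g (x + \<theta>) * f x \<partial>lborel) = \<psi> \<theta>"
    using observableD[OF assms(1,2)] by blast
  obtain h C where h: "h \<in> borel_measurable borel" "\<And>x. \<bar>h x\<bar> \<le> C" "\<And>\<theta>. (\<integral>x. h (x + \<theta>) * f x \<partial>lborel) = \<phi> \<theta>"
    using observableD[OF assms(1,3)] by blast
  show ?thesis
  proof (rule observableI[OF f])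
    show "(\<lambda>x. a * g x + b * h x) \<in> borel_measurable borel" using g h by simp
    show "\<bar>a * g x + b * h x\<bar> \<le> \<bar>a\<bar> * B + \<bar>b\<bar> * C" for x
      using g(2)[of x] h(2)[of x] by (intro order_trans[OF abs_triangle_ineq] add_mono) (auto simp: abs_mult mult_left_mono)
    fix \<theta>
    have "integrable lborel (\<lambda>x. g (x + \<theta>) * f x)" "integrable lborel (\<lambda>x. h (x + \<theta>) * f x)"
      using g h by (auto intro!: integrable_bounded_times_density[OF f])
    then have "(\<integral>x. a * (g (x + \<theta>) * f x) + b * (h (x + \<theta>) * f x) \<partial>lborel) = a * \<psi> \<theta> + b * \<phi> \<theta>"
      by (simp add: g(3) h(3))
    then show "(\<integral>x. (a * g (x + \<theta>) + b * h (x + \<theta>)) * f x \<partial>lborel) = a * \<psi> \<theta> + b * \<phi> \<theta>"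
      by (simp add: algebra_simps)
  qed
qed

text \<open>At frequency 0 the integral is 1, and dominated convergence gives continuity
  there.\<close>

lemma cos_transform_pos:
  fixes f :: "'a::euclidean_space \<Rightarrow> real"
  assumes f: "probability_density f"
  shows "\<exists>t0>0. \<forall>t. norm t \<le> t0 \<longrightarrow> (\<integral>x. cos (t \<bullet> x) * f x \<partial>lborel) > 0"
proof (rule ccontr)
  assume "\<not> ?thesis"
  then have "\<exists>t::'a. norm t \<le> 1 / real (Suc n) \<and> (\<integral>x. cos (t \<bullet> x) * f x \<partial>lborel) \<le> 0" for n
    by (metis of_nat_0_less_iff zero_less_Suc zero_less_divide_1_iff not_le)
  then obtain t :: "nat \<Rightarrow> 'a" where t: "\<And>n. norm (t n) \<le> 1 / real (Suc n)" "\<And>n. (\<integral>x. cos (t n \<bullet> x) * f x \<partial>lborel) \<le> 0"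
    by metis
  have t0: "t \<longlonglongrightarrow> 0"
  proof (rule Lim_null_comparison)
    show "\<forall>\<^sub>F n in sequentially. norm (t n) \<le> inverse (real (Suc n))" using t(1) by (simp add: inverse_eq_divide)
    show "(\<lambda>n. inverse (real (Suc n))) \<longlonglongrightarrow> 0" by (rule LIMSEQ_inverse_real_of_nat)
  qed
  have "(\<lambda>n. \<integral>x. cos (t n \<bullet> x) * f x \<partial>lborel) \<longlonglongrightarrow> (\<integral>x. f x \<partial>lborel)"
  proof (rule integral_dominated_convergence[where w = f])
    show "AE x in lborel. (\<lambda>n. cos (t n \<bullet> x) * f x) \<longlonglongrightarrow> f x"
    proof (rule AE_I2)
      fix x
      have "(\<lambda>n. cos (t n \<bullet> x) * f x) \<longlonglongrightarrow> cos (0 \<bullet> x) * f x" by (intro tendsto_intros t0)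
      then show "(\<lambda>n. cos (t n \<bullet> x) * f x) \<longlonglongrightarrow> f x" by simp
    qed
    show "AE x in lborel. norm (cos (t n \<bullet> x) * f x) \<le> f x" for n
      using probability_densityD(2)[OF f] by (intro AE_I2) (auto simp: abs_mult mult_left_le_one_le)
  qed (use probability_densityD[OF f] in auto)
  then have "(\<integral>x. f x \<partial>lborel) \<le> 0" using t(2) by (intro LIMSEQ_le_const2) auto
  then show False using probability_densityD(5)[OF f] by simp
qed

text \<open>\<open>r\<close> bounds the norms of the frequencies. It has to be tracked through
  products, because deconvolution is available only at frequencies where the transform of
  \<open>f\<close> is known not to vanish.\<close>

inductive trig_poly :: "real \<Rightarrow> ('a::euclidean_space \<Rightarrow> real) \<Rightarrow> bool" for r :: real where
  cos: "norm t \<le> r \<Longrightarrow> trig_poly r (\<lambda>\<theta>. cos (t \<bullet> \<theta>))"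
| sin: "norm t \<le> r \<Longrightarrow> trig_poly r (\<lambda>\<theta>. sin (t \<bullet> \<theta>))"
| lincomb: "trig_poly r \<psi> \<Longrightarrow> trig_poly r \<phi> \<Longrightarrow> trig_poly r (\<lambda>\<theta>. a * \<psi> \<theta> + b * \<phi> \<theta>)"

text \<open>Averaging over the kernel maps the cosine and sine at frequency \<open>t\<close> to a
  rotated and scaled pair with coefficients \<open>c\<close> and \<open>s\<close>. The determinant
  \<open>c\<^sup>2 + s\<^sup>2\<close> is positive, so the inverse matrix, whose entries appear in
  \<open>e\<close>, recovers the pair from bounded statistics.\<close>

lemma trig_poly_observable:
  fixes f :: "'a::euclidean_space \<Rightarrow> real"
  assumes f: "probability_density f" and pos: "\<And>t. norm t \<le> r \<Longrightarrow> (\<integral>x. cos (t \<bullet> x) * f x \<partial>lborel) > 0"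
    and "trig_poly r \<psi>"
  shows "observable f \<psi>"
  using assms(3)
proof induction
  case (lincomb \<psi> \<phi> a b)
  then show ?case by (intro observable_lincomb[OF f])
next
  note fm = probability_densityD(1)[OF f]
  have base: "observable f (\<lambda>\<theta>. cos (t \<bullet> \<theta>)) \<and> observable f (\<lambda>\<theta>. sin (t \<bullet> \<theta>))" if t: "norm t \<le> r" for t
  proof -
    define c where "c = (\<integral>x. cos (t \<bullet> x) * f x \<partial>lborel)"
    define s where "s = (\<integral>x. sin (t \<bullet> x) * f x \<partial>lborel)"
    have c: "c > 0" using pos[OF t] by (simp add: c_def)
    then have D: "c\<^sup>2 + s\<^sup>2 > 0" by (simp add: add_pos_nonneg)
    have i: "integrable lborel (\<lambda>x. cos (t \<bullet> x) * f x)" "integrable lborel (\<lambda>x. sin (t \<bullet> x) * f x)"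
      by (auto intro!: integrable_bounded_times_density[OF f, where B = 1])
    have 1: "observable f (\<lambda>\<theta>. cos (t \<bullet> \<theta>) * c - sin (t \<bullet> \<theta>) * s)"
    proof (rule observableI[OF f, where g = "\<lambda>x. cos (t \<bullet> x)" and B = 1])
      fix \<theta>
      have "(\<integral>x. cos (t \<bullet> (x + \<theta>)) * f x \<partial>lborel) =
         (\<integral>x. cos (t \<bullet> \<theta>) * (cos (t \<bullet> x) * f x) - sin (t \<bullet> \<theta>) * (sin (t \<bullet> x) * f x) \<partial>lborel)"
        by (intro Bochner_Integration.integral_cong) (auto simp: inner_add_right cos_add algebra_simps)
      then show "(\<integral>x. cos (t \<bullet> (x + \<theta>)) * f x \<partial>lborel) = cos (t \<bullet> \<theta>) * c - sin (t \<bullet> \<theta>) * s"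
        using i by (simp add: c_def s_def)
    qed auto
    have 2: "observable f (\<lambda>\<theta>. sin (t \<bullet> \<theta>) * c + cos (t \<bullet> \<theta>) * s)"
    proof (rule observableI[OF f, where g = "\<lambda>x. sin (t \<bullet> x)" and B = 1])
      fix \<theta>
      have "(\<integral>x. sin (t \<bullet> (x + \<theta>)) * f x \<partial>lborel) =
         (\<integral>x. sin (t \<bullet> \<theta>) * (cos (t \<bullet> x) * f x) + cos (t \<bullet> \<theta>) * (sin (t \<bullet> x) * f x) \<partial>lborel)"
        by (intro Bochner_Integration.integral_cong) (auto simp: inner_add_right sin_add algebra_simps)
      then show "(\<integral>x. sin (t \<bullet> (x + \<theta>)) * f x \<partial>lborel) = sin (t \<bullet> \<theta>) * c + cos (t \<bullet> \<theta>) * s"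
        using i by (simp add: c_def s_def)
    qed auto
    have e: "c / (c\<^sup>2 + s\<^sup>2) * (C * c - S * s) + s / (c\<^sup>2 + s\<^sup>2) * (S * c + C * s) = C"
      "c / (c\<^sup>2 + s\<^sup>2) * (S * c + C * s) + (- s / (c\<^sup>2 + s\<^sup>2)) * (C * c - S * s) = S" for C S
    proof -
      have "c * (C * c - S * s) + s * (S * c + C * s) = C * (c\<^sup>2 + s\<^sup>2)"
        "c * (S * c + C * s) + - s * (C * c - S * s) = S * (c\<^sup>2 + s\<^sup>2)"
        by (simp_all add: power2_eq_square algebra_simps)
      then show "c / (c\<^sup>2 + s\<^sup>2) * (C * c - S * s) + s / (c\<^sup>2 + s\<^sup>2) * (S * c + C * s) = C"
        "c / (c\<^sup>2 + s\<^sup>2) * (S * c + C * s) + (- s / (c\<^sup>2 + s\<^sup>2)) * (C * c - S * s) = S"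
        using D c unfolding times_divide_eq_left add_divide_distrib[symmetric] by simp_all
    qed
    show ?thesis
      using observable_lincomb[OF f 1 2, of "c / (c\<^sup>2 + s\<^sup>2)" "s / (c\<^sup>2 + s\<^sup>2)"]
        observable_lincomb[OF f 2 1, of "c / (c\<^sup>2 + s\<^sup>2)" "- s / (c\<^sup>2 + s\<^sup>2)"] unfolding e by simp
  qed
  {
    case (cos t)
    then show ?case using base by blast
  next
    case (sin t)
    then show ?case using base by blast
  }
qed

lemma trig_poly_mono: "trig_poly r \<psi> \<Longrightarrow> r \<le> s \<Longrightarrow> trig_poly s \<psi>"
  by (induction rule: trig_poly.induct) (auto intro: trig_poly.intros)

lemma trig_poly_const:
  assumes "r \<ge> 0" shows "trig_poly r (\<lambda>_. c)"
proof -
  have "trig_poly r (\<lambda>\<theta>. cos (0 \<bullet> \<theta>))" using assms by (intro trig_poly.cos) simp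
  from trig_poly.lincomb[OF this this, of c 0] show ?thesis by simp
qed

lemma trig_poly_scale: "trig_poly r \<psi> \<Longrightarrow> trig_poly r (\<lambda>\<theta>. c * \<psi> \<theta>)"
  using trig_poly.lincomb[of r \<psi> \<psi> c 0] by simp

lemma trig_poly_add: "trig_poly r \<psi> \<Longrightarrow> trig_poly r \<phi> \<Longrightarrow> trig_poly r (\<lambda>\<theta>. \<psi> \<theta> + \<phi> \<theta>)"
  using trig_poly.lincomb[of r \<psi> \<phi> 1 1] by simp

lemma trig_poly_diff: "trig_poly r \<psi> \<Longrightarrow> trig_poly r \<phi> \<Longrightarrow> trig_poly r (\<lambda>\<theta>. \<psi> \<theta> - \<phi> \<theta>)"
  using trig_poly.lincomb[of r \<psi> \<phi> 1 "-1"] by simp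

lemma trig_poly_sum:
  "finite A \<Longrightarrow> r \<ge> 0 \<Longrightarrow> (\<And>i. i \<in> A \<Longrightarrow> trig_poly r (\<psi> i)) \<Longrightarrow> trig_poly r (\<lambda>\<theta>. \<Sum>i\<in>A. \<psi> i \<theta>)"
  by (induction A rule: finite_induct) (auto intro: trig_poly_const trig_poly_add)

text \<open>Product-to-sum formulas: frequencies are added and subtracted, so their bounds
  add.\<close>

lemma trig_poly_mult_base:
  assumes t: "norm t \<le> r" and "trig_poly s \<phi>"
  shows "trig_poly (r + s) (\<lambda>\<theta>. cos (t \<bullet> \<theta>) * \<phi> \<theta>) \<and> trig_poly (r + s) (\<lambda>\<theta>. sin (t \<bullet> \<theta>) * \<phi> \<theta>)"
  using assms(2)
proof induction
  case (cos u)
  have n: "norm (t + u) \<le> r + s" "norm (t - u) \<le> r + s"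
    using norm_triangle_ineq[of t u] norm_triangle_ineq4[of t u] cos t by auto
  have e: "(\<lambda>\<theta>. cos (t \<bullet> \<theta>) * cos (u \<bullet> \<theta>)) = (\<lambda>\<theta>. 1/2 * cos ((t + u) \<bullet> \<theta>) + 1/2 * cos ((t - u) \<bullet> \<theta>))"
    "(\<lambda>\<theta>. sin (t \<bullet> \<theta>) * cos (u \<bullet> \<theta>)) = (\<lambda>\<theta>. 1/2 * sin ((t + u) \<bullet> \<theta>) + 1/2 * sin ((t - u) \<bullet> \<theta>))"
    by (auto simp: inner_add_left inner_diff_left cos_add cos_diff sin_add sin_diff fun_eq_iff add_divide_distrib diff_divide_distrib)
  show ?case unfolding e by (intro conjI trig_poly.intros n)
next
  case (sin u)
  have n: "norm (t + u) \<le> r + s" "norm (t - u) \<le> r + s"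
    using norm_triangle_ineq[of t u] norm_triangle_ineq4[of t u] sin t by auto
  have e: "(\<lambda>\<theta>. cos (t \<bullet> \<theta>) * sin (u \<bullet> \<theta>)) = (\<lambda>\<theta>. 1/2 * sin ((t + u) \<bullet> \<theta>) + (-1/2) * sin ((t - u) \<bullet> \<theta>))"
    "(\<lambda>\<theta>. sin (t \<bullet> \<theta>) * sin (u \<bullet> \<theta>)) = (\<lambda>\<theta>. (-1/2) * cos ((t + u) \<bullet> \<theta>) + 1/2 * cos ((t - u) \<bullet> \<theta>))"
    by (auto simp: inner_add_left inner_diff_left cos_add cos_diff sin_add sin_diff fun_eq_iff add_divide_distrib diff_divide_distrib)
  show ?case unfolding e by (intro conjI trig_poly.intros n)
next
  case (lincomb \<psi> \<phi> a b)
  have e: "(\<lambda>\<theta>. cos (t \<bullet> \<theta>) * (a * \<psi> \<theta> + b * \<phi> \<theta>)) = (\<lambda>\<theta>. a * (cos (t \<bullet> \<theta>) * \<psi> \<theta>) + b * (cos (t \<bullet> \<theta>) * \<phi> \<theta>))"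
    "(\<lambda>\<theta>. sin (t \<bullet> \<theta>) * (a * \<psi> \<theta> + b * \<phi> \<theta>)) = (\<lambda>\<theta>. a * (sin (t \<bullet> \<theta>) * \<psi> \<theta>) + b * (sin (t \<bullet> \<theta>) * \<phi> \<theta>))"
    by (auto simp: algebra_simps)
  show ?case unfolding e using lincomb by (auto intro!: trig_poly.lincomb)
qed

lemma trig_poly_mult:
  assumes "trig_poly r \<psi>" "trig_poly s \<phi>"
  shows "trig_poly (r + s) (\<lambda>\<theta>. \<psi> \<theta> * \<phi> \<theta>)"
  using assms(1)
proof induction
  case (lincomb \<psi>1 \<psi>2 a b)
  have "(\<lambda>\<theta>. (a * \<psi>1 \<theta> + b * \<psi>2 \<theta>) * \<phi> \<theta>) = (\<lambda>\<theta>. a * (\<psi>1 \<theta> * \<phi> \<theta>) + b * (\<psi>2 \<theta> * \<phi> \<theta>))"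
    by (auto simp: algebra_simps)
  then show ?case using lincomb by (auto intro!: trig_poly.lincomb)
qed (use trig_poly_mult_base[OF _ assms(2)] in blast)+

lemma trig_poly_prod:
  "finite A \<Longrightarrow> r \<ge> 0 \<Longrightarrow> (\<And>i. i \<in> A \<Longrightarrow> trig_poly r (\<psi> i)) \<Longrightarrow> trig_poly (real (card A) * r) (\<lambda>\<theta>. \<Prod>i\<in>A. \<psi> i \<theta>)"
proof (induction A rule: finite_induct)
  case (insert i A)
  have "trig_poly (r + real (card A) * r) (\<lambda>\<theta>. \<psi> i \<theta> * (\<Prod>i\<in>A. \<psi> i \<theta>))"
    using insert by (intro trig_poly_mult) auto
  then show ?case using insert by (simp add: algebra_simps)
qed (auto intro: trig_poly_const)

lemma trig_poly_bounded: "trig_poly r \<psi> \<Longrightarrow> \<exists>B. \<forall>\<theta>. \<bar>\<psi> \<theta>\<bar> \<le> B"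
proof (induction rule: trig_poly.induct)
  case (lincomb \<psi> \<phi> a b)
  then obtain B C where "\<forall>\<theta>. \<bar>\<psi> \<theta>\<bar> \<le> B" "\<forall>\<theta>. \<bar>\<phi> \<theta>\<bar> \<le> C" by blast
  then have "\<bar>a * \<psi> \<theta> + b * \<phi> \<theta>\<bar> \<le> \<bar>a\<bar> * B + \<bar>b\<bar> * C" for \<theta>
    by (intro order_trans[OF abs_triangle_ineq] add_mono) (auto simp: abs_mult mult_left_mono)
  then show ?case by blast
qed (auto intro!: exI[of _ 1])

lemma trig_poly_Lipschitz: "trig_poly r \<psi> \<Longrightarrow> \<exists>L\<ge>0. \<forall>\<theta> \<theta>'. \<bar>\<psi> \<theta> - \<psi> \<theta>'\<bar> \<le> L * norm (\<theta> - \<theta>')"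
proof (induction rule: trig_poly.induct)
  case (cos t)
  have "\<bar>cos (t \<bullet> \<theta>) - cos (t \<bullet> \<theta>')\<bar> \<le> norm t * norm (\<theta> - \<theta>')" for \<theta> \<theta>'
  proof -
    have "\<bar>cos (t \<bullet> \<theta>) - cos (t \<bullet> \<theta>')\<bar> \<le> 2 * \<bar>sin ((t \<bullet> \<theta>' - t \<bullet> \<theta>) / 2)\<bar>"
      unfolding cos_diff_cos abs_mult using abs_sin_le_one mult_right_mono[OF abs_sin_le_one, of "\<bar>sin ((t \<bullet> \<theta>' - t \<bullet> \<theta>) / 2)\<bar>"] by simp
    also have "\<dots> \<le> \<bar>t \<bullet> \<theta>' - t \<bullet> \<theta>\<bar>" using abs_sin_x_le_abs_x[of "(t \<bullet> \<theta>' - t \<bullet> \<theta>) / 2"] by simp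
    also have "\<dots> = \<bar>t \<bullet> (\<theta> - \<theta>')\<bar>" by (simp add: inner_diff_right abs_minus_commute)
    also have "\<dots> \<le> norm t * norm (\<theta> - \<theta>')" by (rule Cauchy_Schwarz_ineq2)
    finally show ?thesis .
  qed
  then show ?case by (intro exI[of _ "norm t"]) auto
next
  case (sin t)
  have "\<bar>sin (t \<bullet> \<theta>) - sin (t \<bullet> \<theta>')\<bar> \<le> norm t * norm (\<theta> - \<theta>')" for \<theta> \<theta>'
  proof -
    have "\<bar>sin (t \<bullet> \<theta>) - sin (t \<bullet> \<theta>')\<bar> \<le> 2 * \<bar>sin ((t \<bullet> \<theta> - t \<bullet> \<theta>') / 2)\<bar>"
      unfolding sin_diff_sin abs_mult using mult_left_mono[OF abs_cos_le_one, of "\<bar>sin ((t \<bullet> \<theta> - t \<bullet> \<theta>') / 2)\<bar>"] by simp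
    also have "\<dots> \<le> \<bar>t \<bullet> \<theta> - t \<bullet> \<theta>'\<bar>" using abs_sin_x_le_abs_x[of "(t \<bullet> \<theta> - t \<bullet> \<theta>') / 2"] by simp
    also have "\<dots> = \<bar>t \<bullet> (\<theta> - \<theta>')\<bar>" by (simp add: inner_diff_right)
    also have "\<dots> \<le> norm t * norm (\<theta> - \<theta>')" by (rule Cauchy_Schwarz_ineq2)
    finally show ?thesis .
  qed
  then show ?case by (intro exI[of _ "norm t"]) auto
next
  case (lincomb \<psi> \<phi> a b)
  then obtain L M where L: "L \<ge> 0" "\<And>\<theta> \<theta>'. \<bar>\<psi> \<theta> - \<psi> \<theta>'\<bar> \<le> L * norm (\<theta> - \<theta>')"
    and M: "M \<ge> 0" "\<And>\<theta> \<theta>'. \<bar>\<phi> \<theta> - \<phi> \<theta>'\<bar> \<le> M * norm (\<theta> - \<theta>')" by blast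
  have "\<bar>(a * \<psi> \<theta> + b * \<phi> \<theta>) - (a * \<psi> \<theta>' + b * \<phi> \<theta>')\<bar> \<le> (\<bar>a\<bar> * L + \<bar>b\<bar> * M) * norm (\<theta> - \<theta>')" for \<theta> \<theta>'
  proof -
    have "\<bar>(a * \<psi> \<theta> + b * \<phi> \<theta>) - (a * \<psi> \<theta>' + b * \<phi> \<theta>')\<bar> = \<bar>a * (\<psi> \<theta> - \<psi> \<theta>') + b * (\<phi> \<theta> - \<phi> \<theta>')\<bar>"
      by (simp add: algebra_simps)
    also have "\<dots> \<le> \<bar>a\<bar> * (L * norm (\<theta> - \<theta>')) + \<bar>b\<bar> * (M * norm (\<theta> - \<theta>'))"
      using L(2)[of \<theta> \<theta>'] M(2)[of \<theta> \<theta>'] by (intro order_trans[OF abs_triangle_ineq] add_mono) (auto simp: abs_mult mult_left_mono)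
    finally show ?thesis by (simp add: algebra_simps)
  qed
  then show ?case using L M by (intro exI[of _ "\<bar>a\<bar> * L + \<bar>b\<bar> * M"]) auto
qed

lemma trig_poly_measurable: "trig_poly r \<psi> \<Longrightarrow> \<psi> \<in> borel_measurable borel"
  by (induction rule: trig_poly.induct) auto

text \<open>Trigonometric stand-in for \<open>s\<^sup>2\<close> times the squared distance: each
  summand is four times the squared sine of half the scaled coordinate difference.\<close>

definition trig_dist :: "real \<Rightarrow> 'a::euclidean_space \<Rightarrow> 'a \<Rightarrow> real" where
  "trig_dist s c \<theta> = (\<Sum>i\<in>Basis. 2 - 2 * cos (s * ((\<theta> - c) \<bullet> i)))"

lemma trig_poly_component:
  assumes s: "0 \<le> s" and i: "i \<in> Basis"
  shows "trig_poly s (\<lambda>\<theta>. cos (s * ((\<theta> - c) \<bullet> i)))" "trig_poly s (\<lambda>\<theta>. sin (s * ((\<theta> - c) \<bullet> i)))"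
proof -
  have n: "norm (s *\<^sub>R i) \<le> s" using s i by simp
  have sc: "(s *\<^sub>R i) \<bullet> \<theta> = s * (\<theta> \<bullet> i)" for \<theta> by (simp add: inner_commute)
  have e: "(\<lambda>\<theta>. cos (s * ((\<theta> - c) \<bullet> i))) =
      (\<lambda>\<theta>. cos (s * (c \<bullet> i)) * cos ((s *\<^sub>R i) \<bullet> \<theta>) + sin (s * (c \<bullet> i)) * sin ((s *\<^sub>R i) \<bullet> \<theta>))"
    "(\<lambda>\<theta>. sin (s * ((\<theta> - c) \<bullet> i))) =
      (\<lambda>\<theta>. cos (s * (c \<bullet> i)) * sin ((s *\<^sub>R i) \<bullet> \<theta>) + (- sin (s * (c \<bullet> i))) * cos ((s *\<^sub>R i) \<bullet> \<theta>))"
    unfolding sc by (auto simp: inner_diff_left right_diff_distrib cos_diff sin_diff fun_eq_iff)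
  show "trig_poly s (\<lambda>\<theta>. cos (s * ((\<theta> - c) \<bullet> i)))" "trig_poly s (\<lambda>\<theta>. sin (s * ((\<theta> - c) \<bullet> i)))"
    unfolding e by (intro trig_poly.intros n)+
qed

lemma trig_poly_trig_dist: "0 \<le> s \<Longrightarrow> trig_poly s (trig_dist s c)"
  unfolding trig_dist_def
  by (intro trig_poly_sum trig_poly_diff trig_poly_const trig_poly_scale trig_poly_component) auto

lemma sin_minus_self: "\<bar>sin y - y\<bar> \<le> (y::real)\<^sup>2 / 2"
  using Maclaurin_sin_bound[of y 2] by (simp add: numeral_2_eq_2 sin_coeff_def lessThan_Suc)

lemma two_minus_two_cos: "2 - 2 * cos (y::real) = 4 * (sin (y / 2))\<^sup>2"
  using cos_double_sin[of "y / 2"] by simp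

text \<open>The bound on \<open>s * norm (\<theta> - c)\<close> keeps the arguments away from the
  other zeros of the periodic summands: for arguments at most 1 in absolute value the sine is at
  least half of its argument.\<close>

lemma trig_dist_lower:
  assumes s: "0 \<le> s" and n: "s * norm (\<theta> - c) \<le> 2"
  shows "s\<^sup>2 / 4 * (norm (\<theta> - c))\<^sup>2 \<le> trig_dist s c \<theta>"
proof -
  have "(norm (\<theta> - c))\<^sup>2 = (\<Sum>i\<in>Basis. ((\<theta> - c) \<bullet> i)\<^sup>2)"
    unfolding power2_norm_eq_inner by (subst euclidean_inner) (simp add: power2_eq_square)
  then have "s\<^sup>2 / 4 * (norm (\<theta> - c))\<^sup>2 = (\<Sum>i\<in>Basis. s\<^sup>2 / 4 * ((\<theta> - c) \<bullet> i)\<^sup>2)"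
    by (simp only: sum_distrib_left)
  also have "\<dots> \<le> trig_dist s c \<theta>"
    unfolding trig_dist_def
  proof (rule sum_mono)
    fix i :: 'a assume i: "i \<in> Basis"
    define y where "y = s * ((\<theta> - c) \<bullet> i)"
    have "\<bar>(\<theta> - c) \<bullet> i\<bar> \<le> norm (\<theta> - c)" using i by (rule Basis_le_norm)
    then have "s * \<bar>(\<theta> - c) \<bullet> i\<bar> \<le> s * norm (\<theta> - c)" using s by (intro mult_left_mono)
    then have "\<bar>y\<bar> \<le> 2" using n s unfolding y_def abs_mult by simp
    then have z: "\<bar>y / 2\<bar> \<le> 1" by simp
    have "(y / 2)\<^sup>2 \<le> \<bar>y / 2\<bar>" using z mult_left_le[of "\<bar>y / 2\<bar>" "\<bar>y / 2\<bar>"] by (simp add: power2_eq_square abs_mult[symmetric])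
    then have "\<bar>y / 2\<bar> / 2 \<le> \<bar>sin (y / 2)\<bar>" using sin_minus_self[of "y / 2"] by linarith
    then have "(\<bar>y / 2\<bar> / 2)\<^sup>2 \<le> \<bar>sin (y / 2)\<bar>\<^sup>2" by (intro power_mono) auto
    then have "y\<^sup>2 / 4 \<le> 4 * (sin (y / 2))\<^sup>2" by (simp add: power_divide)
    then show "s\<^sup>2 / 4 * ((\<theta> - c) \<bullet> i)\<^sup>2 \<le> 2 - 2 * cos (s * ((\<theta> - c) \<bullet> i))"
      unfolding two_minus_two_cos y_def[symmetric] by (simp add: y_def power_mult_distrib)
  qed
  finally show ?thesis .
qed

lemma trig_dist_nonneg: "trig_dist s c \<theta> \<ge> 0"
  unfolding trig_dist_def by (intro sum_nonneg) (auto simp: cos_le_one)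

lemma trig_dist_self [simp]: "trig_dist s c c = 0"
  by (simp add: trig_dist_def)

text \<open>
  All the information that is extracted from the data is a finite family of bounded statistics whose
  expectations are trigonometric polynomials in the parameter: \<open>U\<close> vanishes to second order exactly at the
  true atoms, and the other ones agree with the indicators and the first moments of the clusters up to \<open>O(U)\<close>.
\<close>

lemma trig_identification:
  fixes f :: "'a::euclidean_space \<Rightarrow> real" and ts :: "nat \<Rightarrow> 'a"
  assumes f: "probability_density f" and bnd: "bounded \<Theta>" and K: "K \<ge> 1"
    and inj: "inj_on ts {1..K}" and ts: "\<And>c. c \<in> {1..K} \<Longrightarrow> ts c \<in> \<Theta>"
  shows "\<exists>U u q r0 C. 0 < r0 \<and> r0 \<le> 1 \<and> C > 0 \<and> disjoint_family_on (\<lambda>c. ball (ts c) r0) {1..K} \<and>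
     observable f U \<and> U \<in> borel_measurable borel \<and> (\<forall>\<theta>. 0 \<le> U \<theta> \<and> U \<theta> \<le> C) \<and>
     (\<forall>c\<in>{1..K}. U (ts c) = 0) \<and>
     (\<forall>\<theta>\<in>\<Theta>. \<exists>c\<in>{1..K}. (norm (\<theta> - ts c))\<^sup>2 \<le> C * U \<theta>) \<and>
     (\<forall>c\<in>{1..K}. observable f (u c) \<and> (\<forall>d\<in>{1..K}. u c (ts d) = of_bool (d = c)) \<and> u c \<in> borel_measurable borel \<and>
        (\<forall>\<theta>\<in>\<Theta>. \<bar>u c \<theta> - indicator (ball (ts c) r0) \<theta>\<bar> \<le> C * U \<theta>)) \<and>
     (\<forall>c\<in>{1..K}. \<forall>i\<in>Basis. observable f (q c i) \<and> (\<forall>d\<in>{1..K}. q c i (ts d) = 0) \<and> q c i \<in> borel_measurable borel \<and>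
        (\<forall>\<theta>\<in>\<Theta>. \<bar>q c i \<theta> - indicator (ball (ts c) r0) \<theta> * ((\<theta> - ts c) \<bullet> i)\<bar> \<le> C * U \<theta>))"
proof -
  obtain t0 where t0: "t0 > 0" "\<And>t. norm t \<le> t0 \<Longrightarrow> (\<integral>x. cos (t \<bullet> x) * f x \<partial>lborel) > 0"
    using cos_transform_pos[OF f] by blast
  obtain B where B: "B > 0" "\<And>x. x \<in> \<Theta> \<Longrightarrow> norm x \<le> B" using bnd bounded_pos by blast
  \<comment> \<open>The first bound makes \<open>trig_dist_lower\<close> applicable on all of
    \<open>\<Theta>\<close> around every centre. The second keeps the highest frequency used below
    within the range where deconvolution works.\<close>
  define s where "s = min (1 / B) (t0 / (2 * real K + 1))"
  have s: "s > 0" using B t0 by (simp add: s_def)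
  have sB: "s * (2 * B) \<le> 2"
  proof -
    have "s * B \<le> 1 / B * B" using B by (intro mult_right_mono) (auto simp: s_def)
    then show ?thesis using B by simp
  qed
  have sK: "(2 * real K + 1) * s \<le> t0"
  proof -
    have "(2 * real K + 1) * s \<le> (2 * real K + 1) * (t0 / (2 * real K + 1))" by (intro mult_left_mono) (auto simp: s_def)
    then show ?thesis by (simp add: add_nonneg_eq_0_iff)
  qed
  have obs: "observable f \<psi>" if "trig_poly r \<psi>" "r \<le> (2 * real K + 1) * s" for r \<psi>
    using that t0 sK by (intro trig_poly_observable[OF f _ that(1)]) auto
  have dB: "s * norm (\<theta> - ts c) \<le> 2" if "\<theta> \<in> \<Theta>" "c \<in> {1..K}" for \<theta> c
  proof -
    have "norm (\<theta> - ts c) \<le> 2 * B" using B(2)[OF that(1)] B(2)[OF ts[OF that(2)]] norm_triangle_ineq4[of \<theta> "ts c"] by linarith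
    then have "s * norm (\<theta> - ts c) \<le> s * (2 * B)" using s by (intro mult_left_mono) auto
    then show ?thesis using sB by linarith
  qed
  have "\<exists>r0>0. r0 \<le> 1 \<and> (\<forall>c\<in>{1..K}. \<forall>d\<in>{1..K}. c \<noteq> d \<longrightarrow> 2 * r0 \<le> norm (ts c - ts d))"
  proof -
    \<comment> \<open>Half the smallest distance between centres, capped at 1: the balls become
      disjoint and displacements inside them are at most 1.\<close>
    define S where "S = insert 1 ((\<lambda>(c, d). norm (ts c - ts d) / 2) ` {x \<in> {1..K} \<times> {1..K}. fst x \<noteq> snd x})"
    have fS: "finite S" unfolding S_def by (intro finite.insertI finite_imageI finite_Collect_conjI) auto
    have pd: "norm (ts c - ts d) / 2 > 0" if "c \<in> {1..K}" "d \<in> {1..K}" "c \<noteq> d" for c d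
      using inj_onD[OF inj _ that(1,2)] that(3) by auto
    have pS: "x > 0" if "x \<in> S" for x
    proof -
      from that consider "x = 1" | y where "x = norm (ts (fst y) - ts (snd y)) / 2" "y \<in> {1..K} \<times> {1..K}" "fst y \<noteq> snd y"
        unfolding S_def by (elim insertE imageE) (simp_all add: case_prod_beta')
      then show ?thesis
      proof cases
        case (2 y)
        then show ?thesis using pd[of "fst y" "snd y"] by (metis mem_Times_iff)
      qed simp
    qed
    have "Min S \<in> S" using fS by (intro Min_in) (auto simp: S_def)
    then have "Min S > 0" using pS by blast
    moreover have "Min S \<le> 1" using fS by (intro Min_le) (auto simp: S_def)
    moreover have "2 * Min S \<le> norm (ts c - ts d)" if "c \<in> {1..K}" "d \<in> {1..K}" "c \<noteq> d" for c d
    proof -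
      have "norm (ts c - ts d) / 2 \<in> S" unfolding S_def using that
        by (intro insertI2 image_eqI[where x = "(c, d)"]) auto
      then have "Min S \<le> norm (ts c - ts d) / 2" using fS by (intro Min_le)
      then show ?thesis by simp
    qed
    ultimately show ?thesis by (intro exI[of _ "Min S"] conjI ballI impI)
  qed
  then obtain r0 where r0: "r0 > 0" "r0 \<le> 1"
    and r0': "\<forall>c\<in>{1..K}. \<forall>d\<in>{1..K}. c \<noteq> d \<longrightarrow> 2 * r0 \<le> norm (ts c - ts d)" by (elim exE conjE)
  have sep: "2 * r0 \<le> norm (ts c - ts d)" if "c \<in> {1..K}" "d \<in> {1..K}" "c \<noteq> d" for c d
    using r0' that by blast
  have other: "r0 \<le> norm (\<theta> - ts d)" if "\<theta> \<in> ball (ts c) r0" "c \<in> {1..K}" "d \<in> {1..K}" "d \<noteq> c" for \<theta> c d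
  proof -
    have "norm (ts c - ts d) \<le> norm (ts c - \<theta>) + norm (\<theta> - ts d)" using norm_triangle_ineq[of "ts c - \<theta>" "\<theta> - ts d"] by simp
    moreover have "norm (ts c - \<theta>) < r0" using that(1) by (simp add: dist_norm)
    moreover have "2 * r0 \<le> norm (ts c - ts d)" using that by (intro sep) auto
    ultimately show ?thesis by linarith
  qed
  have dis: "disjoint_family_on (\<lambda>c. ball (ts c) r0) {1..K}"
    unfolding disjoint_family_on_def
  proof (intro ballI impI)
    fix c d assume cd: "c \<in> {1..K}" "d \<in> {1..K}" "c \<noteq> d"
    have "\<theta> \<notin> ball (ts d) r0" if "\<theta> \<in> ball (ts c) r0" for \<theta>
      using other[OF that cd(1,2)] cd(3) by (simp add: dist_norm norm_minus_commute)
    then show "ball (ts c) r0 \<inter> ball (ts d) r0 = {}" by blast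
  qed
  define D where "D c = trig_dist s (ts c)" for c
  \<comment> \<open>Near one centre the factors belonging to the others are bounded below, so the
    product behaves there like a single squared distance.\<close>
  define U where "U \<theta> = (\<Prod>c\<in>{1..K}. D c \<theta>)" for \<theta>
  define N where "N c = (\<Prod>d\<in>{1..K} - {c}. D d (ts c))" for c
  define Q where "Q c \<theta> = (1 / N c) * (\<Prod>d\<in>{1..K} - {c}. D d \<theta>)" for c \<theta>
  \<comment> \<open>\<open>Q c\<close> interpolates: 1 at \<open>ts c\<close>, 0 at the other
    centres. Near \<open>ts c\<close> its error is only of first order; as
    \<open>u c = 1 - (1 - Q c)\<^sup>2\<close>, the error is squared and becomes
    \<open>O(U)\<close>.\<close>
  define u where "u c \<theta> = 2 * Q c \<theta> - Q c \<theta> * Q c \<theta>" for c \<theta>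
  define q where "q c i \<theta> = (1 / s) * (sin (s * ((\<theta> - ts c) \<bullet> i)) * Q c \<theta>)" for c i \<theta>
  define a where "a = s\<^sup>2 / 4 * r0\<^sup>2"
  have a: "a > 0" using s r0 by (simp add: a_def)
  have D0: "D c \<theta> \<ge> 0" for c \<theta> by (simp add: D_def trig_dist_nonneg)
  have Dl: "s\<^sup>2 / 4 * (norm (\<theta> - ts c))\<^sup>2 \<le> D c \<theta>" if "\<theta> \<in> \<Theta>" "c \<in> {1..K}" for c \<theta>
    unfolding D_def using dB[OF that] s by (intro trig_dist_lower) auto
  have Da: "a \<le> D c \<theta>" if "\<theta> \<in> \<Theta>" "c \<in> {1..K}" "r0 \<le> norm (\<theta> - ts c)" for c \<theta>
  proof -
    have "r0\<^sup>2 \<le> (norm (\<theta> - ts c))\<^sup>2" using that r0 by (intro power_mono) auto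
    then have "a \<le> s\<^sup>2 / 4 * (norm (\<theta> - ts c))\<^sup>2" unfolding a_def using s by (intro mult_left_mono) auto
    then show ?thesis using Dl[OF that(1,2)] by linarith
  qed
  have Npos: "N c > 0" if c: "c \<in> {1..K}" for c
    unfolding N_def
  proof (rule prod_pos)
    fix d assume d: "d \<in> {1..K} - {c}"
    have "r0 \<le> norm (ts c - ts d)" using d c r0(1) by (intro other[of "ts c" c d]) auto
    then have "a \<le> D d (ts c)" using d c by (intro Da ts) auto
    then show "0 < D d (ts c)" using a by linarith
  qed
  have QU: "D c \<theta> * (N c * Q c \<theta>) = U \<theta>" if "c \<in> {1..K}" for c \<theta>
  proof -
    have "U \<theta> = D c \<theta> * (\<Prod>d\<in>{1..K} - {c}. D d \<theta>)" unfolding U_def using that by (intro prod.remove) auto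
    moreover have "N c * Q c \<theta> = (\<Prod>d\<in>{1..K} - {c}. D d \<theta>)" unfolding Q_def using Npos[OF that] by simp
    ultimately show ?thesis by simp
  qed
  have Q0: "Q c \<theta> \<ge> 0" if "c \<in> {1..K}" for c \<theta>
    unfolding Q_def using Npos[OF that] D0 by (intro mult_nonneg_nonneg prod_nonneg) auto
  have Qc: "Q c (ts c) = 1" if "c \<in> {1..K}" for c using Npos[OF that] unfolding Q_def N_def[symmetric] by simp
  have Qd: "Q c (ts d) = 0" if "c \<in> {1..K}" "d \<in> {1..K}" "d \<noteq> c" for c d
  proof -
    have "(\<Prod>e\<in>{1..K} - {c}. D e (ts d)) = 0" using that by (intro prod_zero) (auto simp: D_def intro!: bexI[of _ d])
    then show ?thesis by (simp add: Q_def)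
  qed
  have tD: "trig_poly s (D c)" for c unfolding D_def using s by (intro trig_poly_trig_dist) simp
  have tU: "trig_poly (real K * s) U" unfolding U_def[abs_def] using trig_poly_prod[of "{1..K}" s D] tD s by simp
  have tQ: "trig_poly (real K * s) (Q c)" if "c \<in> {1..K}" for c
  proof -
    have "trig_poly (real (card ({1..K} - {c})) * s) (\<lambda>\<theta>. \<Prod>d\<in>{1..K} - {c}. D d \<theta>)"
      using tD s by (intro trig_poly_prod) auto
    then have "trig_poly (real K * s) (\<lambda>\<theta>. \<Prod>d\<in>{1..K} - {c}. D d \<theta>)"
      by (rule trig_poly_mono) (use that s in auto)
    then show ?thesis unfolding Q_def[abs_def] by (rule trig_poly_scale)
  qed
  have tu: "trig_poly (2 * real K * s) (u c)" if "c \<in> {1..K}" for c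
  proof -
    have "trig_poly (2 * real K * s) (\<lambda>\<theta>. Q c \<theta> * Q c \<theta>)" using trig_poly_mult[OF tQ[OF that] tQ[OF that]] by (simp add: algebra_simps)
    moreover have "trig_poly (2 * real K * s) (\<lambda>\<theta>. 2 * Q c \<theta>)"
      using s by (intro trig_poly_scale trig_poly_mono[OF tQ[OF that]]) (simp add: mult_right_mono)
    ultimately show ?thesis unfolding u_def[abs_def] by (intro trig_poly_diff)
  qed
  have tq: "trig_poly ((1 + real K) * s) (q c i)" if "c \<in> {1..K}" "i \<in> Basis" for c i
  proof -
    have "trig_poly (s + real K * s) (\<lambda>\<theta>. sin (s * ((\<theta> - ts c) \<bullet> i)) * Q c \<theta>)"
      using s that by (intro trig_poly_mult trig_poly_component tQ) auto
    then show ?thesis unfolding q_def[abs_def] by (intro trig_poly_scale) (simp add: algebra_simps)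
  qed
  obtain BU where BU: "\<And>\<theta>. \<bar>U \<theta>\<bar> \<le> BU" using trig_poly_bounded[OF tU] by blast
  have "\<exists>BQ LQ. BQ \<ge> 0 \<and> LQ \<ge> 0 \<and> (\<forall>c\<in>{1..K}. (\<forall>\<theta>. Q c \<theta> \<le> BQ) \<and> (\<forall>\<theta> \<theta>'. \<bar>Q c \<theta> - Q c \<theta>'\<bar> \<le> LQ * norm (\<theta> - \<theta>')))"
  proof -
    have "\<exists>b. \<forall>c\<in>{1..K}. \<forall>\<theta>. \<bar>Q c \<theta>\<bar> \<le> b c" using trig_poly_bounded[OF tQ] by (intro bchoice) blast
    then obtain b where b: "\<And>c \<theta>. c \<in> {1..K} \<Longrightarrow> \<bar>Q c \<theta>\<bar> \<le> b c" by blast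
    have "\<exists>l. \<forall>c\<in>{1..K}. l c \<ge> 0 \<and> (\<forall>\<theta> \<theta>'. \<bar>Q c \<theta> - Q c \<theta>'\<bar> \<le> l c * norm (\<theta> - \<theta>'))"
      using trig_poly_Lipschitz[OF tQ] by (intro bchoice) blast
    then obtain l where l: "\<And>c. c \<in> {1..K} \<Longrightarrow> l c \<ge> 0" "\<And>c \<theta> \<theta>'. c \<in> {1..K} \<Longrightarrow> \<bar>Q c \<theta> - Q c \<theta>'\<bar> \<le> l c * norm (\<theta> - \<theta>')" by blast
    have b0: "b c \<ge> 0" if "c \<in> {1..K}" for c using b[OF that, of 0] by linarith
    have bs: "b c \<le> sum b {1..K}" if "c \<in> {1..K}" for c using that b0 by (intro member_le_sum) auto
    have ls: "l c \<le> sum l {1..K}" if "c \<in> {1..K}" for c using that l(1) by (intro member_le_sum) auto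
    show ?thesis
    proof (intro exI conjI ballI allI)
      show "0 \<le> sum b {1..K}" using b0 by (intro sum_nonneg) auto
      show "0 \<le> sum l {1..K}" using l(1) by (intro sum_nonneg) auto
      fix c assume c: "c \<in> {1..K}"
      show "Q c \<theta> \<le> sum b {1..K}" for \<theta> using b[OF c, of \<theta>] bs[OF c] by linarith
      show "\<bar>Q c \<theta> - Q c \<theta>'\<bar> \<le> sum l {1..K} * norm (\<theta> - \<theta>')" for \<theta> \<theta>'
        using l(2)[OF c, of \<theta> \<theta>'] ls[OF c] by (meson mult_right_mono norm_ge_zero order_trans)
    qed
  qed
  then obtain BQ LQ where BQ: "BQ \<ge> 0" "\<And>c \<theta>. c \<in> {1..K} \<Longrightarrow> Q c \<theta> \<le> BQ"
    and LQ: "LQ \<ge> 0" "\<And>c \<theta> \<theta>'. c \<in> {1..K} \<Longrightarrow> \<bar>Q c \<theta> - Q c \<theta>'\<bar> \<le> LQ * norm (\<theta> - \<theta>')" by blast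
  define n0 where "n0 = Min (N ` {1..K})"
  have n0: "n0 > 0" "\<And>c. c \<in> {1..K} \<Longrightarrow> n0 \<le> N c"
  proof -
    have "n0 \<in> N ` {1..K}" unfolding n0_def using K by (intro Min_in) auto
    then show "n0 > 0" using Npos by auto
    show "n0 \<le> N c" if "c \<in> {1..K}" for c unfolding n0_def using that by (intro Min_le) auto
  qed
  define C1 where "C1 = 1 / (a * n0)"
  have C1: "C1 > 0" using a n0 by (simp add: C1_def)
  \<comment> \<open>Off the ball about \<open>ts c\<close> the one factor of \<open>U\<close> that
    is missing in \<open>Q c\<close> is bounded below, so \<open>Q c\<close> itself is
    \<open>O(U)\<close> there.\<close>
  have far: "Q c \<theta> \<le> C1 * U \<theta>" if "\<theta> \<in> \<Theta>" "c \<in> {1..K}" "\<theta> \<notin> ball (ts c) r0" for c \<theta>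
  proof -
    have "a \<le> D c \<theta>" using that by (intro Da) (auto simp: dist_norm norm_minus_commute)
    then have "a * (n0 * Q c \<theta>) \<le> D c \<theta> * (N c * Q c \<theta>)"
      using n0 Q0[OF that(2)] that a D0 by (intro mult_mono mult_right_mono) auto
    then show ?thesis using QU[OF that(2)] a n0 by (simp add: C1_def field_simps)
  qed
  define C2 where "C2 = 4 / s\<^sup>2 * (1 / a ^ (K - 1))"
  have C2: "C2 > 0" using s a by (simp add: C2_def)
  have near: "(norm (\<theta> - ts c))\<^sup>2 \<le> C2 * U \<theta>" if "\<theta> \<in> \<Theta>" "c \<in> {1..K}" "\<theta> \<in> ball (ts c) r0" for c \<theta>
  proof -
    have "(\<Prod>d\<in>{1..K} - {c}. a) \<le> (\<Prod>d\<in>{1..K} - {c}. D d \<theta>)"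
      using that a by (intro prod_mono) (auto intro!: Da other[of \<theta> c])
    then have "a ^ (K - 1) \<le> (\<Prod>d\<in>{1..K} - {c}. D d \<theta>)" using that by simp
    then have "(s\<^sup>2 / 4 * (norm (\<theta> - ts c))\<^sup>2) * a ^ (K - 1) \<le> D c \<theta> * (\<Prod>d\<in>{1..K} - {c}. D d \<theta>)"
      using Dl[OF that(1,2)] D0 a by (intro mult_mono) auto
    also have "\<dots> = U \<theta>" unfolding U_def using that by (intro prod.remove[symmetric]) auto
    finally show ?thesis using s a by (simp add: C2_def field_simps)
  qed
  have U0: "U \<theta> \<ge> 0" for \<theta> unfolding U_def using D0 by (intro prod_nonneg) auto
  \<comment> \<open>Sum of all the constants that the estimates below produce, so that one
    \<open>C\<close> serves for every one of them.\<close>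
  define C where "C = max BU 1 + C1 * (2 + BQ) + C1 / s + C2 * LQ\<^sup>2 + C2 * (LQ + s) + C2 + (2 * B)\<^sup>2 * (1 / a ^ K)"
  have nnC: "0 \<le> C1 * (2 + BQ)" "0 \<le> C1 / s" "0 \<le> C2 * LQ\<^sup>2" "0 \<le> C2 * (LQ + s)" "0 \<le> C2" "0 \<le> (2 * B)\<^sup>2 * (1 / a ^ K)"
    using C1 C2 BQ LQ s a B by auto
  have CC: "BU \<le> C" "0 < C" "C1 * (2 + BQ) \<le> C" "C1 / s \<le> C" "C2 * LQ\<^sup>2 \<le> C" "C2 * (LQ + s) \<le> C" "C2 \<le> C" "(2 * B)\<^sup>2 * (1 / a ^ K) \<le> C"
    unfolding C_def using nnC by linarith+
  have CU: "c * U \<theta> \<le> C * U \<theta>" if "c \<le> C" for c \<theta> using that U0 by (rule mult_right_mono)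
  have uu: "\<bar>u c \<theta> - indicator (ball (ts c) r0) \<theta>\<bar> \<le> C * U \<theta>" if c: "c \<in> {1..K}" and th: "\<theta> \<in> \<Theta>" for c \<theta>
  proof (cases "\<theta> \<in> ball (ts c) r0")
    case True
    have "u c \<theta> - 1 = - (Q c \<theta> - Q c (ts c))\<^sup>2" unfolding Qc[OF c] u_def by (simp add: power2_eq_square algebra_simps)
    then have "\<bar>u c \<theta> - 1\<bar> = \<bar>Q c \<theta> - Q c (ts c)\<bar>\<^sup>2" by simp
    also have "\<dots> \<le> (LQ * norm (\<theta> - ts c))\<^sup>2" using LQ(2)[OF c] by (intro power_mono) auto
    also have "\<dots> = LQ\<^sup>2 * (norm (\<theta> - ts c))\<^sup>2" by (simp add: power_mult_distrib)
    also have "\<dots> \<le> LQ\<^sup>2 * (C2 * U \<theta>)" using near[OF th c True] by (intro mult_left_mono) auto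
    also have "\<dots> = (C2 * LQ\<^sup>2) * U \<theta>" by simp
    also have "\<dots> \<le> C * U \<theta>" by (rule CU[OF CC(5)])
    finally show ?thesis using True by simp
  next
    case False
    have "\<bar>u c \<theta>\<bar> \<le> 2 * Q c \<theta> + Q c \<theta> * Q c \<theta>" unfolding u_def using Q0[OF c] abs_triangle_ineq4[of "2 * Q c \<theta>" "Q c \<theta> * Q c \<theta>"] by simp
    also have "\<dots> \<le> 2 * Q c \<theta> + BQ * Q c \<theta>" using BQ(2)[OF c] Q0[OF c] by (intro add_left_mono mult_right_mono) auto
    also have "\<dots> = (2 + BQ) * Q c \<theta>" by (simp add: algebra_simps)
    also have "\<dots> \<le> (2 + BQ) * (C1 * U \<theta>)" using far[OF th c False] BQ by (intro mult_left_mono) auto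
    also have "\<dots> = (C1 * (2 + BQ)) * U \<theta>" by simp
    also have "\<dots> \<le> C * U \<theta>" by (rule CU[OF CC(3)])
    finally show ?thesis using False by simp
  qed
  have qq: "\<bar>q c i \<theta> - indicator (ball (ts c) r0) \<theta> * ((\<theta> - ts c) \<bullet> i)\<bar> \<le> C * U \<theta>"
    if c: "c \<in> {1..K}" and i: "i \<in> Basis" and th: "\<theta> \<in> \<Theta>" for c i \<theta>
  proof (cases "\<theta> \<in> ball (ts c) r0")
    case True
    define x where "x = (\<theta> - ts c) \<bullet> i"
    define n where "n = norm (\<theta> - ts c)"
    have xn: "\<bar>x\<bar> \<le> n" unfolding x_def n_def using i by (rule Basis_le_norm)
    \<comment> \<open>Two errors of second order: a sine that is small times the first-order error
      of \<open>Q c\<close>, and the deviation of the sine from its argument.\<close>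
    have e: "q c i \<theta> - x = (1 / s) * (sin (s * x) * (Q c \<theta> - Q c (ts c))) + (1 / s) * (sin (s * x) - s * x)"
      unfolding Qc[OF c] q_def x_def[symmetric] using s by (simp add: field_simps)
    have 1: "\<bar>sin (s * x) * (Q c \<theta> - Q c (ts c))\<bar> \<le> (s * n) * (LQ * n)"
    proof -
      have "\<bar>sin (s * x)\<bar> \<le> \<bar>s * x\<bar>" by (rule abs_sin_x_le_abs_x)
      also have "\<dots> = s * \<bar>x\<bar>" using s by (simp add: abs_mult)
      also have "\<dots> \<le> s * n" using xn s by (intro mult_left_mono) auto
      finally have "\<bar>sin (s * x)\<bar> \<le> s * n" .
      moreover have "\<bar>Q c \<theta> - Q c (ts c)\<bar> \<le> LQ * n" unfolding n_def by (rule LQ(2)[OF c])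
      ultimately show ?thesis unfolding abs_mult by (intro mult_mono) auto
    qed
    have 2: "\<bar>sin (s * x) - s * x\<bar> \<le> (s * n)\<^sup>2"
    proof -
      have "\<bar>s * x\<bar> \<le> s * n" using mult_left_mono[OF xn, of s] s by (simp add: abs_mult)
      then have "(s * x)\<^sup>2 \<le> (s * n)\<^sup>2" using power_mono[of "\<bar>s * x\<bar>" "s * n" 2] by simp
      then show ?thesis using sin_minus_self[of "s * x"] zero_le_power2[of "s * x"] by linarith
    qed
    have "\<bar>q c i \<theta> - x\<bar> \<le> (1 / s) * ((s * n) * (LQ * n)) + (1 / s) * (s * n)\<^sup>2"
    proof -
      have m: "\<bar>(1 / s) * t\<bar> = (1 / s) * \<bar>t\<bar>" for t using s by (simp add: abs_mult)
      show ?thesis unfolding e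
        by (intro order_trans[OF abs_triangle_ineq] add_mono; unfold m; intro mult_left_mono 1 2) (use s in auto)
    qed
    also have "\<dots> = (LQ + s) * n\<^sup>2" using s by (simp add: power2_eq_square field_simps)
    also have "\<dots> \<le> (LQ + s) * (C2 * U \<theta>)" using near[OF th c True] LQ s unfolding n_def by (intro mult_left_mono) auto
    also have "\<dots> = (C2 * (LQ + s)) * U \<theta>" by simp
    also have "\<dots> \<le> C * U \<theta>" by (rule CU[OF CC(6)])
    finally show ?thesis using True by (simp add: x_def)
  next
    case False
    have "\<bar>q c i \<theta>\<bar> = (1 / s) * (\<bar>sin (s * ((\<theta> - ts c) \<bullet> i))\<bar> * Q c \<theta>)" unfolding q_def abs_mult using s Q0[OF c] by simp
    also have "\<dots> \<le> (1 / s) * (1 * (C1 * U \<theta>))" using far[OF th c False] s Q0[OF c] by (intro mult_left_mono mult_mono) auto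
    also have "\<dots> = (C1 / s) * U \<theta>" by simp
    also have "\<dots> \<le> C * U \<theta>" by (rule CU[OF CC(4)])
    finally show ?thesis using False by simp
  qed
  have nr: "\<exists>c\<in>{1..K}. (norm (\<theta> - ts c))\<^sup>2 \<le> C * U \<theta>" if th: "\<theta> \<in> \<Theta>" for \<theta>
  proof (cases "\<exists>c\<in>{1..K}. \<theta> \<in> ball (ts c) r0")
    case True
    then obtain c where c: "c \<in> {1..K}" "\<theta> \<in> ball (ts c) r0" by blast
    have "(norm (\<theta> - ts c))\<^sup>2 \<le> C * U \<theta>" using near[OF th c] CU[OF CC(7), of \<theta>] by linarith
    then show ?thesis using c by blast
  next
    case False
    have "(\<Prod>d\<in>{1..K}. a) \<le> U \<theta>" unfolding U_def
      using False th a by (intro prod_mono) (auto intro!: Da simp: dist_norm norm_minus_commute not_less)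
    then have aU: "1 \<le> (1 / a ^ K) * U \<theta>" using a by (simp add: field_simps)
    have K1: "1 \<in> {1..K}" using K by simp
    have "norm (\<theta> - ts 1) \<le> 2 * B" using B(2)[OF th] B(2)[OF ts[OF K1]] norm_triangle_ineq4[of \<theta> "ts 1"] by linarith
    then have "(norm (\<theta> - ts 1))\<^sup>2 \<le> (2 * B)\<^sup>2 * 1" using power_mono[of "norm (\<theta> - ts 1)" "2 * B" 2] by simp
    also have "\<dots> \<le> (2 * B)\<^sup>2 * ((1 / a ^ K) * U \<theta>)" using aU by (intro mult_left_mono) auto
    also have "\<dots> = ((2 * B)\<^sup>2 * (1 / a ^ K)) * U \<theta>" by simp
    also have "\<dots> \<le> C * U \<theta>" by (rule CU[OF CC(8)])
    finally show ?thesis using K1 by blast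
  qed
  have r1: "real K * s \<le> (2 * real K + 1) * s" "2 * real K * s \<le> (2 * real K + 1) * s" "(1 + real K) * s \<le> (2 * real K + 1) * s"
    using s by (intro mult_right_mono; simp)+
  show ?thesis
  proof (rule exI[of _ U], rule exI[of _ u], rule exI[of _ q], rule exI[of _ r0], rule exI[of _ C], intro conjI allI ballI)
    show "U (ts c) = 0" if "c \<in> {1..K}" for c using QU[OF that, of "ts c"] by (simp add: D_def)
    show "u c (ts d) = of_bool (d = c)" if "c \<in> {1..K}" "d \<in> {1..K}" for c d
      using that Qc Qd by (cases "d = c") (auto simp: u_def)
    show "q c i (ts d) = 0" if "c \<in> {1..K}" "d \<in> {1..K}" for c d i
      using that Qd by (cases "d = c") (auto simp: q_def)
    show "U \<theta> \<le> C" for \<theta> using BU[of \<theta>] CC(1) by linarith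
    show "0 < r0" "r0 \<le> 1" by (rule r0)+
    show "0 < C" by (rule CC(2))
    show "disjoint_family_on (\<lambda>c. ball (ts c) r0) {1..K}" by (rule dis)
    show "observable f U" by (rule obs[OF tU r1(1)])
    show "U \<in> borel_measurable borel" by (rule trig_poly_measurable[OF tU])
    show "0 \<le> U \<theta>" for \<theta> by (rule U0)
    show "\<exists>c\<in>{1..K}. (norm (\<theta> - ts c))\<^sup>2 \<le> C * U \<theta>" if "\<theta> \<in> \<Theta>" for \<theta> by (rule nr[OF that])
    show "observable f (u c)" if "c \<in> {1..K}" for c by (rule obs[OF tu[OF that] r1(2)])
    show "u c \<in> borel_measurable borel" if "c \<in> {1..K}" for c by (rule trig_poly_measurable[OF tu[OF that]])
    show "\<bar>u c \<theta> - indicator (ball (ts c) r0) \<theta>\<bar> \<le> C * U \<theta>" if "c \<in> {1..K}" "\<theta> \<in> \<Theta>" for c \<theta> by (rule uu[OF that])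
    show "observable f (q c i)" if "c \<in> {1..K}" "i \<in> Basis" for c i by (rule obs[OF tq[OF that] r1(3)])
    show "q c i \<in> borel_measurable borel" if "c \<in> {1..K}" "i \<in> Basis" for c i by (rule trig_poly_measurable[OF tq[OF that]])
    show "\<bar>q c i \<theta> - indicator (ball (ts c) r0) \<theta> * ((\<theta> - ts c) \<bullet> i)\<bar> \<le> C * U \<theta>"
      if "c \<in> {1..K}" "i \<in> Basis" "\<theta> \<in> \<Theta>" for c i \<theta> by (rule qq[OF that])
  qed
qed

subsection \<open>Likelihood ratios and the evidence\<close>

lemma norm_frechet_le_nabla:
  fixes g :: "real ^ 'd \<Rightarrow> real"
  assumes "g differentiable (at x)"
  shows "\<bar>frechet_derivative g (at x) h\<bar> \<le> norm (nabla g x) * norm h"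
proof -
  have lin: "linear (frechet_derivative g (at x))" by (rule linear_frechet_derivative[OF assms])
  have "frechet_derivative g (at x) h = frechet_derivative g (at x) (\<Sum>i\<in>UNIV. (h $ i) *\<^sub>R axis i 1)"
    by (simp add: basis_expansion[of h, unfolded scalar_mult_eq_scaleR])
  also have "\<dots> = (\<Sum>i\<in>UNIV. (h $ i) * frechet_derivative g (at x) (axis i 1))"
    using lin by (simp add: linear_sum linear_scale)
  also have "\<dots> = h \<bullet> nabla g x" by (simp add: inner_vec_def nabla_def)
  also have "\<bar>h \<bullet> nabla g x\<bar> \<le> norm h * norm (nabla g x)" by (rule Cauchy_Schwarz_ineq2)
  finally show ?thesis by (simp add: mult.commute)
qed

lemma abs_exp_minus_one_le: "\<bar>exp t - 1\<bar> \<le> \<bar>t\<bar> * exp \<bar>t::real\<bar>"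
proof (cases "t \<ge> 0")
  case True
  have "(1 - t) * exp t \<le> exp (- t) * exp t"
    using exp_ge_add_one_self[of "- t"] by (intro mult_right_mono) auto
  then have "exp t - 1 \<le> t * exp t" by (simp add: exp_minus left_diff_distrib)
  then show ?thesis using True by simp
next
  case False
  have "1 + t \<le> exp t" by (rule exp_ge_add_one_self)
  moreover have "exp t < 1" using False by simp
  ultimately have "\<bar>exp t - 1\<bar> \<le> \<bar>t\<bar>" by linarith
  also have "\<dots> \<le> \<bar>t\<bar> * exp \<bar>t\<bar>" using mult_left_mono[of 1 "exp \<bar>t\<bar>" "\<bar>t\<bar>"] by simp
  finally show ?thesis .
qed

lemma powr_add_le:
  fixes a b g :: real
  assumes "a \<ge> 0" "b \<ge> 0" "g \<ge> 0"
  shows "(a + b) powr g \<le> 2 powr g * (a powr g + b powr g)"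
proof -
  have "(a + b) powr g \<le> (2 * max a b) powr g" using assms by (intro powr_mono2) auto
  also have "\<dots> = 2 powr g * (max a b) powr g" by (rule powr_mult)
  also have "(max a b) powr g \<le> a powr g + b powr g" by (auto simp: max_def)
  finally show ?thesis by simp
qed

text \<open>Integrates the gradient bound for \<open>ln f\<close> between the two arguments, inside
  a ball of radius \<open>norm x + B\<close>. The outcome is that all shifts by vectors of norm at
  most \<open>B\<close> dominate each other up to a weight that depends on \<open>x\<close> only and
  whose moments are governed by the exponential integrability of \<open>f\<close>.\<close>

lemma log_Lipschitz_ratio:
  fixes f :: "real ^ 'd \<Rightarrow> real"
  assumes diff: "f differentiable_on UNIV" and pos: "\<And>x. 0 < f x" and g: "\<gamma> \<ge> 0" and R: "R > 0"
    and grad: "\<And>x. norm (nabla (\<lambda>y. ln (f y)) x) \<le> R * (1 + norm x) powr \<gamma>" and B: "B \<ge> 0"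
  shows "\<exists>C\<ge>1. \<exists>b>0. \<forall>x \<theta> \<theta>'. norm \<theta> \<le> B \<longrightarrow> norm \<theta>' \<le> B \<longrightarrow>
     \<bar>f (x - \<theta>) - f (x - \<theta>')\<bar> \<le> norm (\<theta> - \<theta>') * (C * exp (b * norm x powr \<gamma>)) * f (x - \<theta>') \<and>
     f (x - \<theta>) \<le> C * exp (b * norm x powr \<gamma>) * f (x - \<theta>')"
proof -
  define a0 where "a0 = R * (2 powr \<gamma> * (1 + B) powr \<gamma>)"
  define a1 where "a1 = R * 2 powr \<gamma>"
  have a: "a0 \<ge> 0" "a1 > 0" using R by (auto simp: a0_def a1_def)
  \<comment> \<open>In \<open>2 * B + 1\<close> the term \<open>2 * B\<close> bounds the distance of
    the two shifts, and the 1 absorbs the prefactor through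
    \<open>\<Lambda> \<le> exp \<Lambda>\<close>.\<close>
  define C where "C = exp ((2 * B + 1) * a0)"
  define b where "b = (2 * B + 1) * a1"
  have C: "C \<ge> 1" using a B by (simp add: C_def)
  have b: "b > 0" using a B by (simp add: b_def)
  have "\<bar>f (x - \<theta>) - f (x - \<theta>')\<bar> \<le> norm (\<theta> - \<theta>') * (C * exp (b * norm x powr \<gamma>)) * f (x - \<theta>') \<and>
     f (x - \<theta>) \<le> C * exp (b * norm x powr \<gamma>) * f (x - \<theta>')" if th: "norm \<theta> \<le> B" "norm \<theta>' \<le> B" for x \<theta> \<theta>'
  proof -
    define \<Lambda> where "\<Lambda> = a0 + a1 * norm x powr \<gamma>"
    have L0: "\<Lambda> \<ge> 0" using a by (simp add: \<Lambda>_def)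
    have W: "C * exp (b * norm x powr \<gamma>) = exp ((2 * B + 1) * \<Lambda>)"
      by (simp add: C_def b_def \<Lambda>_def exp_add[symmetric] algebra_simps)
    let ?g = "\<lambda>y. ln (f y)"
    have gd: "?g differentiable (at y)" for y
    proof -
      have "f differentiable (at y)" using diff by (simp add: differentiable_on_def)
      then obtain D where "(f has_derivative D) (at y)" unfolding differentiable_def by blast
      then have "(?g has_derivative (\<lambda>h. D h * inverse (f y))) (at y)" using pos[of y]
        by (rule_tac derivative_eq_intros) (auto simp: field_simps)
      then show ?thesis unfolding differentiable_def by blast
    qed
    have "norm (?g (x - \<theta>) - ?g (x - \<theta>')) \<le> \<Lambda> * norm ((x - \<theta>) - (x - \<theta>'))"
    proof (rule differentiable_bound[where S = "cball 0 (norm x + B)"])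
      show "(?g has_derivative frechet_derivative ?g (at y)) (at y within cball 0 (norm x + B))" for y
        using gd[of y] frechet_derivative_works has_derivative_at_withinI by blast
      show "onorm (frechet_derivative ?g (at y)) \<le> \<Lambda>" if y: "y \<in> cball 0 (norm x + B)" for y
      proof (rule onorm_le)
        fix h
        have "\<bar>frechet_derivative ?g (at y) h\<bar> \<le> norm (nabla ?g y) * norm h" by (rule norm_frechet_le_nabla[OF gd])
        also have "\<dots> \<le> \<Lambda> * norm h"
        proof (rule mult_right_mono)
          have "norm (nabla ?g y) \<le> R * (1 + norm y) powr \<gamma>" by (rule grad)
          also have "\<dots> \<le> R * ((1 + B) + norm x) powr \<gamma>" using y R g by (intro mult_left_mono powr_mono2) auto
          also have "\<dots> \<le> R * (2 powr \<gamma> * ((1 + B) powr \<gamma> + norm x powr \<gamma>))" using R B g by (intro mult_left_mono powr_add_le) auto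
          also have "\<dots> = \<Lambda>" by (simp add: \<Lambda>_def a0_def a1_def algebra_simps)
          finally show "norm (nabla ?g y) \<le> \<Lambda>" .
        qed simp
        finally show "norm (frechet_derivative ?g (at y) h) \<le> \<Lambda> * norm h" by simp
      qed
      show "x - \<theta> \<in> cball 0 (norm x + B)" "x - \<theta>' \<in> cball 0 (norm x + B)"
        using norm_triangle_ineq4[of x \<theta>] norm_triangle_ineq4[of x \<theta>'] th by auto
    qed auto
    moreover define t where "t = ?g (x - \<theta>) - ?g (x - \<theta>')"
    ultimately have t: "\<bar>t\<bar> \<le> \<Lambda> * norm (\<theta> - \<theta>')" by (simp add: norm_minus_commute)
    have "norm (\<theta> - \<theta>') \<le> 2 * B" using norm_triangle_ineq4[of \<theta> \<theta>'] th by simp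
    then have "\<Lambda> * norm (\<theta> - \<theta>') \<le> \<Lambda> * (2 * B)" using L0 by (intro mult_left_mono) auto
    then have t2: "\<bar>t\<bar> \<le> 2 * B * \<Lambda>" using t by (simp add: mult_ac)
    have ft: "f (x - \<theta>) = exp t * f (x - \<theta>')" using pos[of "x - \<theta>"] pos[of "x - \<theta>'"] by (simp add: t_def exp_diff)
    have L1: "\<Lambda> \<le> exp \<Lambda>" using exp_ge_add_one_self[of \<Lambda>] by linarith
    have "\<bar>exp t - 1\<bar> \<le> \<bar>t\<bar> * exp \<bar>t\<bar>" by (rule abs_exp_minus_one_le)
    also have "\<dots> \<le> (\<Lambda> * norm (\<theta> - \<theta>')) * exp (2 * B * \<Lambda>)" using t t2 L0 by (intro mult_mono) auto
    also have "\<dots> \<le> (exp \<Lambda> * norm (\<theta> - \<theta>')) * exp (2 * B * \<Lambda>)" using L1 by (intro mult_right_mono) auto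
    also have "\<dots> = norm (\<theta> - \<theta>') * exp ((2 * B + 1) * \<Lambda>)" by (simp add: exp_add algebra_simps)
    finally have 1: "\<bar>exp t - 1\<bar> \<le> norm (\<theta> - \<theta>') * exp ((2 * B + 1) * \<Lambda>)" .
    have "f (x - \<theta>) - f (x - \<theta>') = (exp t - 1) * f (x - \<theta>')" by (simp add: ft algebra_simps)
    then have "\<bar>f (x - \<theta>) - f (x - \<theta>')\<bar> = \<bar>exp t - 1\<bar> * f (x - \<theta>')" using pos[of "x - \<theta>'"] by (simp add: abs_mult)
    also have "\<dots> \<le> norm (\<theta> - \<theta>') * exp ((2 * B + 1) * \<Lambda>) * f (x - \<theta>')"
      using 1 pos[of "x - \<theta>'"] by (intro mult_right_mono) auto
    finally have A: "\<bar>f (x - \<theta>) - f (x - \<theta>')\<bar> \<le> norm (\<theta> - \<theta>') * exp ((2 * B + 1) * \<Lambda>) * f (x - \<theta>')" .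
    have "exp t \<le> exp ((2 * B + 1) * \<Lambda>)" using t2 L0 by (simp add: algebra_simps)
    then have "f (x - \<theta>) \<le> exp ((2 * B + 1) * \<Lambda>) * f (x - \<theta>')"
      unfolding ft using pos[of "x - \<theta>'"] by (intro mult_right_mono) auto
    with A show ?thesis unfolding W by simp
  qed
  then show ?thesis using C b by blast
qed

section \<open>Second moment method for the evidence\<close>

lemma nn_integral_iid_prod:
  assumes Q: "prob_space Q" and u: "u \<in> borel_measurable Q"
  shows "(\<integral>\<^sup>+X. (\<Prod>i = 1..n. u (X i)) \<partial>(\<Pi>\<^sub>M i\<in>{1::nat..}. Q)) = (\<integral>\<^sup>+x. u x \<partial>Q) ^ n"
  by (subst nn_integral_PiM_prod) (use Q u in auto)

text \<open>The integrated likelihood ratio has mean 1 under the truth. Its second moment is an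
  average, over two independent draws from \<open>N\<close>, of \<open>n\<close>-th powers of the
  correlation in \<open>var\<close>, hence at most \<open>(1 + d) ^ n\<close>. So the variance is
  small as soon as \<open>n * d\<close> is, and Chebyshev with distance 1/2 yields the factor
  4.\<close>

lemma evidence_chebyshev:
  fixes r :: "'w \<Rightarrow> 'x \<Rightarrow> ennreal"
  assumes N: "prob_space N" and Q: "prob_space Q"
    and r: "(\<lambda>(\<omega>, x). r \<omega> x) \<in> borel_measurable (N \<Otimes>\<^sub>M Q)"
    and mean: "AE \<omega> in N. (\<integral>\<^sup>+x. r \<omega> x \<partial>Q) = 1"
    and var: "AE \<omega> in N. AE \<omega>' in N. (\<integral>\<^sup>+x. r \<omega> x * r \<omega>' x \<partial>Q) \<le> ennreal (1 + d)" and d: "d \<ge> 0"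
  shows "measure (\<Pi>\<^sub>M i\<in>{1::nat..}. Q) {X \<in> space (\<Pi>\<^sub>M i\<in>{1::nat..}. Q). (\<integral>\<^sup>+\<omega>. (\<Prod>i = 1..n. r \<omega> (X i)) \<partial>N) < 1/2}
    \<le> 4 * ((1 + d) ^ n - 1)"
proof -
  let ?QI = "\<Pi>\<^sub>M i\<in>{1::nat..}. Q"
  interpret N: prob_space N by fact
  interpret Q: prob_space Q by fact
  interpret QI: prob_space ?QI by (intro prob_space_PiM Q)
  interpret P: pair_sigma_finite N ?QI ..
  interpret P': pair_sigma_finite ?QI N ..
  have comp: "(\<lambda>z. r (fst z) (snd z i)) \<in> borel_measurable (N \<Otimes>\<^sub>M ?QI)" if "i \<ge> 1" for i
  proof -
    have "(\<lambda>z. (fst z, snd z i)) \<in> N \<Otimes>\<^sub>M ?QI \<rightarrow>\<^sub>M N \<Otimes>\<^sub>M Q"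
      using that by (intro measurable_Pair measurable_fst measurable_compose[OF measurable_snd] measurable_component_singleton) auto
    from measurable_compose[OF this r] show ?thesis by simp
  qed
  define F where "F \<omega> X = (\<Prod>i = 1..n. r \<omega> (X i))" for \<omega> X
  have Fm: "(\<lambda>z. F (fst z) (snd z)) \<in> borel_measurable (N \<Otimes>\<^sub>M ?QI)"
    unfolding F_def by (intro borel_measurable_prod_ennreal comp) auto
  have Fm': "(\<lambda>z. F (snd z) (fst z)) \<in> borel_measurable (?QI \<Otimes>\<^sub>M N)"
    using measurable_compose[OF measurable_pair_swap'[of ?QI N] Fm] by (simp add: case_prod_beta')
  have rm: "r \<omega> \<in> borel_measurable Q" if "\<omega> \<in> space N" for \<omega>
    using measurable_compose[OF measurable_Pair1'[OF that] r] by simp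
  define z where "z X = (\<integral>\<^sup>+\<omega>. F \<omega> X \<partial>N)" for X
  have zm [measurable]: "z \<in> borel_measurable ?QI"
    unfolding z_def using N.borel_measurable_nn_integral[of "\<lambda>X \<omega>. F \<omega> X" ?QI] Fm' by (simp add: case_prod_beta')
  have Fub: "(\<integral>\<^sup>+X. (\<integral>\<^sup>+\<omega>. G \<omega> X \<partial>N) \<partial>?QI) = (\<integral>\<^sup>+\<omega>. (\<integral>\<^sup>+X. G \<omega> X \<partial>?QI) \<partial>N)"
    if "(\<lambda>z. G (fst z) (snd z)) \<in> borel_measurable (N \<Otimes>\<^sub>M ?QI)" for G
    using P.Fubini[OF that] by simp
  have F1: "(\<integral>\<^sup>+X. F \<omega> X \<partial>?QI) = (\<integral>\<^sup>+x. r \<omega> x \<partial>Q) ^ n" if "\<omega> \<in> space N" for \<omega>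
    unfolding F_def by (rule nn_integral_iid_prod[OF Q rm[OF that]])
  have E1: "(\<integral>\<^sup>+X. z X \<partial>?QI) = 1"
  proof -
    have "(\<integral>\<^sup>+X. z X \<partial>?QI) = (\<integral>\<^sup>+\<omega>. (\<integral>\<^sup>+X. F \<omega> X \<partial>?QI) \<partial>N)" unfolding z_def by (rule Fub[OF Fm])
    also have "\<dots> = (\<integral>\<^sup>+\<omega>. 1 \<partial>N)"
      by (rule nn_integral_cong_AE, use mean AE_space in eventually_elim) (simp only: F1 power_one)
    finally show ?thesis using N.emeasure_space_1 by simp
  qed
  have E2: "(\<integral>\<^sup>+X. z X * z X \<partial>?QI) \<le> ennreal ((1 + d) ^ n)"
  proof -
    have s2: "(\<lambda>w. F (fst w) (snd w)) \<in> borel_measurable (N \<Otimes>\<^sub>M ?QI)" by (rule Fm)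
    have Fw: "(\<lambda>X. F \<omega> X) \<in> borel_measurable ?QI" if "\<omega> \<in> space N" for \<omega>
      using measurable_compose[OF measurable_Pair1'[OF that] Fm] by simp
    have FX: "(\<lambda>\<omega>. F \<omega> X) \<in> borel_measurable N" if "X \<in> space ?QI" for X
      using measurable_compose[OF measurable_Pair2'[OF that] Fm] by simp
    have zz: "(\<lambda>w. F (fst w) (snd w) * z (snd w)) \<in> borel_measurable (N \<Otimes>\<^sub>M ?QI)"
      by (intro borel_measurable_times_ennreal Fm measurable_compose[OF measurable_snd zm])
    have "(\<integral>\<^sup>+X. z X * z X \<partial>?QI) = (\<integral>\<^sup>+X. (\<integral>\<^sup>+\<omega>. F \<omega> X * z X \<partial>N) \<partial>?QI)"
    proof (rule nn_integral_cong)
      fix X assume X: "X \<in> space ?QI"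
      have "(\<integral>\<^sup>+\<omega>. F \<omega> X * z X \<partial>N) = (\<integral>\<^sup>+\<omega>. F \<omega> X \<partial>N) * z X" by (rule nn_integral_multc[OF FX[OF X]])
      then show "z X * z X = (\<integral>\<^sup>+\<omega>. F \<omega> X * z X \<partial>N)" by (simp add: z_def)
    qed
    also have "\<dots> = (\<integral>\<^sup>+\<omega>. (\<integral>\<^sup>+X. F \<omega> X * z X \<partial>?QI) \<partial>N)" by (rule Fub[OF zz])
    also have "\<dots> = (\<integral>\<^sup>+\<omega>. (\<integral>\<^sup>+\<omega>'. (\<integral>\<^sup>+X. F \<omega> X * F \<omega>' X \<partial>?QI) \<partial>N) \<partial>N)"
    proof (rule nn_integral_cong)
      fix \<omega> assume w: "\<omega> \<in> space N"
      have "(\<integral>\<^sup>+X. F \<omega> X * z X \<partial>?QI) = (\<integral>\<^sup>+X. (\<integral>\<^sup>+\<omega>'. F \<omega> X * F \<omega>' X \<partial>N) \<partial>?QI)"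
        by (rule nn_integral_cong) (simp add: z_def nn_integral_cmult[OF FX])
      also have "\<dots> = (\<integral>\<^sup>+\<omega>'. (\<integral>\<^sup>+X. F \<omega> X * F \<omega>' X \<partial>?QI) \<partial>N)"
        by (rule Fub) (intro borel_measurable_times_ennreal Fm measurable_compose[OF measurable_snd Fw[OF w]])
      finally show "(\<integral>\<^sup>+X. F \<omega> X * z X \<partial>?QI) = (\<integral>\<^sup>+\<omega>'. (\<integral>\<^sup>+X. F \<omega> X * F \<omega>' X \<partial>?QI) \<partial>N)" .
    qed
    also have "\<dots> \<le> (\<integral>\<^sup>+\<omega>. (\<integral>\<^sup>+\<omega>'. ennreal ((1 + d) ^ n) \<partial>N) \<partial>N)"
    proof (rule nn_integral_mono_AE, use var AE_space in eventually_elim)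
      case (elim \<omega>)
      note w = elim(2)
      show ?case
      proof (rule nn_integral_mono_AE, use elim(1) AE_space in eventually_elim)
        case (elim \<omega>')
        have "(\<integral>\<^sup>+X. F \<omega> X * F \<omega>' X \<partial>?QI) = (\<integral>\<^sup>+X. (\<Prod>i = 1..n. (\<lambda>x. r \<omega> x * r \<omega>' x) (X i)) \<partial>?QI)"
          by (simp add: F_def prod.distrib)
        also have "\<dots> = (\<integral>\<^sup>+x. r \<omega> x * r \<omega>' x \<partial>Q) ^ n"
          by (rule nn_integral_iid_prod[OF Q]) (intro borel_measurable_times_ennreal rm w elim(2))
        also have "\<dots> \<le> ennreal (1 + d) ^ n" by (rule power_mono[OF elim(1)]) simp
        also have "\<dots> = ennreal ((1 + d) ^ n)" using d by (intro ennreal_power) simp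
        finally show ?case .
      qed
    qed
    also have "\<dots> = ennreal ((1 + d) ^ n)" using N.emeasure_space_1 by simp
    finally show ?thesis .
  qed
  have zfin: "AE X in ?QI. z X \<noteq> \<infinity>" by (rule nn_integral_noteq_infinite[OF zm]) (simp only: E1, simp)
  define y where "y X = enn2real (z X)" for X
  have ym: "y \<in> borel_measurable ?QI" unfolding y_def by measurable
  have ysq: "(\<lambda>X. (y X)\<^sup>2) \<in> borel_measurable ?QI" by (intro borel_measurable_power ym)
  have y0: "AE X in ?QI. 0 \<le> y X" "AE X in ?QI. 0 \<le> (y X)\<^sup>2" by (auto simp: y_def)
  have y1: "(\<integral>\<^sup>+X. ennreal (y X) \<partial>?QI) = 1"
    unfolding E1[symmetric] y_def by (rule nn_integral_cong_AE, use zfin in eventually_elim) (auto simp: less_top)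
  have y2: "(\<integral>\<^sup>+X. ennreal ((y X)\<^sup>2) \<partial>?QI) \<le> ennreal ((1 + d) ^ n)"
  proof -
    have "(\<integral>\<^sup>+X. ennreal ((y X)\<^sup>2) \<partial>?QI) = (\<integral>\<^sup>+X. z X * z X \<partial>?QI)"
      by (rule nn_integral_cong_AE, use zfin in eventually_elim) (auto simp: less_top y_def power2_eq_square ennreal_mult)
    then show ?thesis using E2 by simp
  qed
  have yi: "integrable ?QI y" by (rule integrableI_nonneg[OF ym y0(1)]) (simp only: y1, simp)
  have yi2: "integrable ?QI (\<lambda>X. (y X)\<^sup>2)"
    by (rule integrableI_nonneg[OF ysq y0(2)]) (rule le_less_trans[OF y2], simp)
  have ey: "QI.expectation y = 1" unfolding integral_eq_nn_integral[OF ym y0(1)] y1 by simp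
  have ey2: "QI.expectation (\<lambda>X. (y X)\<^sup>2) \<le> (1 + d) ^ n"
    unfolding integral_eq_nn_integral[OF ysq y0(2)] using y2 d by (intro enn2real_leI) auto
  have var: "QI.variance y \<le> (1 + d) ^ n - 1" using QI.variance_eq[OF yi yi2] ey ey2 by simp
  have "measure ?QI {X \<in> space ?QI. z X < 1/2} \<le> measure ?QI {X \<in> space ?QI. 1/2 \<le> \<bar>y X - QI.expectation y\<bar>}"
  proof (rule QI.finite_measure_mono)
    show "{X \<in> space ?QI. z X < 1/2} \<subseteq> {X \<in> space ?QI. 1/2 \<le> \<bar>y X - QI.expectation y\<bar>}"
    proof safe
      fix X assume "z X < 1/2"
      moreover have "(1/2 :: ennreal) = ennreal (1/2)" using divide_ennreal[of 1 2] by simp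
      ultimately have "z X \<le> ennreal (1/2)" by (simp only: less_imp_le)
      then have "y X \<le> 1/2" unfolding y_def by (rule enn2real_leI[rotated]) simp
      then show "1/2 \<le> \<bar>y X - QI.expectation y\<bar>" unfolding ey by simp
    qed
    show "{X \<in> space ?QI. 1/2 \<le> \<bar>y X - QI.expectation y\<bar>} \<in> sets ?QI" using ym by measurable
  qed
  also have "\<dots> \<le> QI.variance y / (1/2)\<^sup>2" by (rule QI.Chebyshev_inequality[OF ym yi2]) simp
  also have "\<dots> \<le> 4 * ((1 + d) ^ n - 1)" using var by (simp add: power2_eq_square)
  finally show ?thesis by (simp add: z_def F_def)
qed

text \<open>The excess over 1 is the integral of \<open>(p - s) * (p' - s) / s\<close>, which is
  quadratic in \<open>e\<close>: the linear terms cancel since all three functions have integral 1.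
  The inequality \<open>pt\<close> is arranged without subtraction because it is integrated in
  \<open>ennreal\<close>.\<close>

lemma chi_square_bound:
  fixes p p' s W :: "'a \<Rightarrow> real"
  assumes [measurable]: "p \<in> borel_measurable M" "p' \<in> borel_measurable M" "s \<in> borel_measurable M" "W \<in> borel_measurable M"
    and nn: "\<And>x. 0 \<le> p x" "\<And>x. 0 \<le> p' x" and s: "\<And>x. 0 < s x"
    and ip: "(\<integral>\<^sup>+x. ennreal (p x) \<partial>M) = 1" "(\<integral>\<^sup>+x. ennreal (p' x) \<partial>M) = 1" "(\<integral>\<^sup>+x. ennreal (s x) \<partial>M) = 1"
    and cl: "\<And>x. \<bar>p x - s x\<bar> \<le> e * W x * s x" "\<And>x. \<bar>p' x - s x\<bar> \<le> e * W x * s x"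
    and W: "(\<integral>\<^sup>+x. ennreal ((W x)\<^sup>2 * s x) \<partial>M) = ennreal m" and m: "m \<ge> 0"
  shows "(\<integral>\<^sup>+x. ennreal (p x * p' x / s x) \<partial>M) \<le> ennreal (1 + e\<^sup>2 * m)"
proof -
  have pt: "p x * p' x / s x + s x \<le> p x + p' x + e\<^sup>2 * ((W x)\<^sup>2 * s x)" for x
  proof -
    have "(p x - s x) * (p' x - s x) \<le> \<bar>p x - s x\<bar> * \<bar>p' x - s x\<bar>" by (simp add: abs_mult[symmetric])
    also have "\<dots> \<le> (e * W x * s x) * (e * W x * s x)"
      using cl[of x] by (intro mult_mono) (auto intro: order_trans[OF abs_ge_zero])
    finally have "p x * p' x + s x * s x \<le> (p x + p' x) * s x + (e * W x * s x) * (e * W x * s x)"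
      by (simp add: algebra_simps)
    then have "(p x * p' x + s x * s x) / s x \<le> ((p x + p' x) * s x + (e * W x * s x) * (e * W x * s x)) / s x"
      using s[of x] by (intro divide_right_mono) auto
    then show ?thesis using s[of x] by (simp add: add_divide_distrib power2_eq_square mult_ac)
  qed
  have "(\<integral>\<^sup>+x. ennreal (p x * p' x / s x) \<partial>M) + 1 = (\<integral>\<^sup>+x. ennreal (p x * p' x / s x) + ennreal (s x) \<partial>M)"
    by (subst nn_integral_add) (auto simp: ip)
  also have "\<dots> \<le> (\<integral>\<^sup>+x. ennreal (p x) + ennreal (p' x) + ennreal (e\<^sup>2) * ennreal ((W x)\<^sup>2 * s x) \<partial>M)"
  proof (rule nn_integral_mono)
    fix x
    have "ennreal (p x * p' x / s x) + ennreal (s x) = ennreal (p x * p' x / s x + s x)"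
      using nn s[of x] by (intro ennreal_plus[symmetric]) (auto simp: less_imp_le)
    also have "\<dots> \<le> ennreal (p x + p' x + e\<^sup>2 * ((W x)\<^sup>2 * s x))" by (intro ennreal_leI pt)
    also have "\<dots> = ennreal (p x) + ennreal (p' x) + ennreal (e\<^sup>2) * ennreal ((W x)\<^sup>2 * s x)"
      using nn[of x] s[of x] by (simp add: ennreal_mult less_imp_le)
    finally show "ennreal (p x * p' x / s x) + ennreal (s x) \<le> ennreal (p x) + ennreal (p' x) + ennreal (e\<^sup>2) * ennreal ((W x)\<^sup>2 * s x)" .
  qed
  also have "\<dots> = 1 + 1 + ennreal (e\<^sup>2) * ennreal m"
    by (subst nn_integral_add, simp, simp, subst nn_integral_add, simp, simp, subst nn_integral_cmult) (auto simp: ip W)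
  also have "\<dots> = ennreal (1 + e\<^sup>2 * m) + 1"
    using m by (simp add: ennreal_mult add_ac)
  finally have "1 + (\<integral>\<^sup>+x. ennreal (p x * p' x / s x) \<partial>M) \<le> 1 + ennreal (1 + e\<^sup>2 * m)" by (simp add: add.commute)
  then show ?thesis by (simp add: ennreal_add_left_cancel_le)
qed

section \<open>Decay of the mass remaining on the stick\<close>

lemma nn_integral_stick_rem:
  assumes al: "\<alpha> > 0"
  shows "(\<integral>\<^sup>+v. ennreal (stick_rem v m) \<partial>stick_law \<alpha>) = ennreal ((\<alpha> / (\<alpha> + 1)) ^ m)"
proof -
  have "(\<integral>\<^sup>+v. ennreal (stick_rem v m) \<partial>stick_law \<alpha>) = (\<integral>\<^sup>+v. (\<Prod>j = 1..m. ennreal (1 - v j)) \<partial>stick_law \<alpha>)"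
  proof (rule nn_integral_cong_AE, use AE_stick_law[OF al] in eventually_elim)
    case (elim v)
    have "(\<Prod>j = 1..m. ennreal (1 - v j)) = ennreal (\<Prod>j = 1..m. 1 - v j)"
      using elim by (intro prod_ennreal) (auto simp: less_imp_le)
    then show ?case by (simp only: stick_rem_def)
  qed
  also have "\<dots> = (\<Prod>j = 1..m. \<integral>\<^sup>+v. ennreal (1 - v) \<partial>beta_distribution 1 \<alpha>)"
    by (rule nn_integral_PiM_prod) (use prob_space_beta[OF al] in auto)
  also have "\<dots> = ennreal ((\<alpha> / (\<alpha> + 1)) ^ m)" using al by (simp add: nn_integral_beta_one_minus ennreal_power)
  finally show ?thesis .
qed

lemma stick_rem_tail:
  assumes al: "\<alpha> > 0" and e: "e > 0"
  shows "emeasure (stick_law \<alpha>) {v \<in> space (stick_law \<alpha>). stick_rem v m > e} \<le> ennreal ((\<alpha> / (\<alpha> + 1)) ^ m / e)"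
proof -
  have "emeasure (stick_law \<alpha>) {v \<in> space (stick_law \<alpha>). stick_rem v m > e} =
      (\<integral>\<^sup>+v. indicator {v \<in> space (stick_law \<alpha>). stick_rem v m > e} v \<partial>stick_law \<alpha>)"
    by (rule nn_integral_indicator[symmetric]) measurable
  also have "\<dots> \<le> (\<integral>\<^sup>+v. ennreal (1 / e) * ennreal (stick_rem v m) \<partial>stick_law \<alpha>)"
    by (intro nn_integral_mono) (use e in \<open>auto simp: indicator_def ennreal_mult'[symmetric] intro!: ennreal_leI[of 1, simplified]\<close>)
  also have "\<dots> = ennreal (1 / e) * ennreal ((\<alpha> / (\<alpha> + 1)) ^ m)"
    unfolding nn_integral_stick_rem[OF al, symmetric]
    by (rule nn_integral_cmult) (rule measurable_compose[OF stick_rem_measurable measurable_ennreal])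
  also have "\<dots> = ennreal ((\<alpha> / (\<alpha> + 1)) ^ m / e)" using al e by (simp add: ennreal_mult[symmetric])
  finally show ?thesis .
qed

text \<open>The infimum over \<open>m\<close> has an integral below every
  \<open>(\<alpha> / (\<alpha> + 1)) ^ m\<close>, so it vanishes almost surely; monotonicity makes
  the infimum a limit.\<close>

lemma AE_stick_rem_tendsto:
  assumes al: "\<alpha> > 0"
  shows "AE v in stick_law \<alpha>. (\<lambda>m. stick_rem v m) \<longlonglongrightarrow> 0"
proof -
  let ?I = "\<lambda>v. INF m. ennreal (stick_rem v m)"
  have g: "0 \<le> \<alpha> / (\<alpha> + 1)" "\<alpha> / (\<alpha> + 1) < 1" using al by auto
  have "(\<integral>\<^sup>+v. ?I v \<partial>stick_law \<alpha>) \<le> ennreal ((\<alpha> / (\<alpha> + 1)) ^ m)" for m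
    unfolding nn_integral_stick_rem[OF al, symmetric] by (intro nn_integral_mono INF_lower) simp
  moreover have "(\<lambda>m. ennreal ((\<alpha> / (\<alpha> + 1)) ^ m)) \<longlonglongrightarrow> ennreal 0"
    using LIMSEQ_realpow_zero[OF g] by (intro tendsto_ennrealI)
  ultimately have "(\<integral>\<^sup>+v. ?I v \<partial>stick_law \<alpha>) \<le> ennreal 0" by (intro LIMSEQ_le_const) auto
  moreover have "?I \<in> borel_measurable (stick_law \<alpha>)"
    by (intro borel_measurable_INF measurable_compose[OF stick_rem_measurable measurable_ennreal]) auto
  ultimately have "AE v in stick_law \<alpha>. ?I v = 0" by (subst nn_integral_0_iff_AE[symmetric]) simp_all
  with AE_stick_law[OF al] show ?thesis
  proof eventually_elim
    case (elim v)
    have dec: "decseq (\<lambda>m. ennreal (stick_rem v m))"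
      using elim(1) by (intro antimonoI ennreal_leI stick_rem_antimono) (auto simp: less_imp_le)
    have pos: "stick_rem v m > 0" for m using elim(1) by (intro stick_rem_pos) auto
    have "(\<lambda>m. ennreal (stick_rem v m)) \<longlonglongrightarrow> ennreal 0" using LIMSEQ_INF[OF dec] elim(2) by simp
    then show ?case using pos by (subst (asm) tendsto_ennreal_iff) (auto simp: less_imp_le)
  qed
qed

lemma stick_weight_sums:
  assumes "(\<lambda>m. stick_rem v m) \<longlonglongrightarrow> 0"
  shows "(\<lambda>k. stick_weight v (Suc k)) sums 1"
proof -
  have "(\<Sum>k<m. stick_weight v (Suc k)) = 1 - stick_rem v m" for m
  proof -
    have "(\<Sum>k<m. stick_weight v (Suc k)) = (\<Sum>k = 1..m. stick_weight v k)"
      by (rule sum.reindex_bij_witness[of _ "\<lambda>k. k - 1" Suc]) auto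
    then show ?thesis by (simp only: sum_stick_weight)
  qed
  moreover have "(\<lambda>m. 1 - stick_rem v m) \<longlonglongrightarrow> 1 - 0" by (intro tendsto_intros assms)
  ultimately show ?thesis by (simp add: sums_def)
qed

locale dpm =
  fixes f :: "'a::euclidean_space \<Rightarrow> real" and \<alpha> :: real and P0 :: "'a measure" and \<Theta> :: "'a set"
    and K :: nat and ws :: "nat \<Rightarrow> real" and ts :: "nat \<Rightarrow> 'a" and F :: real
  assumes f: "probability_density f" and fF: "\<And>x. 0 < f x \<and> f x < F" and al: "\<alpha> > 0"
    and P0: "prob_space P0" and sets_P0 [measurable_cong]: "sets P0 = sets borel" and P0_\<Theta>: "AE \<theta> in P0. \<theta> \<in> \<Theta>"
    and bnd: "bounded \<Theta>" and K: "K \<ge> 1" and ws_pos: "\<And>c. c \<in> {1..K} \<Longrightarrow> 0 < ws c"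
    and ws_sum: "(\<Sum>c = 1..K. ws c) = 1" and ts: "\<And>c. c \<in> {1..K} \<Longrightarrow> ts c \<in> \<Theta>" and inj: "inj_on ts {1..K}"
begin

abbreviation atom_law :: "(nat \<Rightarrow> 'a) measure" where "atom_law \<equiv> \<Pi>\<^sub>M k\<in>{1..}. P0"
abbreviation "prior \<equiv> stick_law \<alpha> \<Otimes>\<^sub>M atom_law"

lemma space_P0 [simp]: "space P0 = UNIV"
  using sets_eq_imp_space_eq[OF sets_P0] by simp

lemma f_meas [measurable]: "f \<in> borel_measurable borel"
  by (rule probability_densityD(1)[OF f])

lemma f_pos: "0 < f x" and f_lt: "f x < F"
  using fF by auto

sublocale S: prob_space "stick_law \<alpha>" by (intro prob_space_PiM prob_space_beta al)
sublocale T: prob_space atom_law by (intro prob_space_PiM P0)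
sublocale ST: pair_prob_space "stick_law \<alpha>" atom_law ..

lemma prob_prior: "prob_space prior"
  by (intro prob_space_pair S.prob_space_axioms T.prob_space_axioms)

text \<open>Properties shared by almost all draws from the prior. Pointwise estimates are proved for
  regular \<open>\<omega>\<close> and brought into integrals by \<open>AE_regular\<close>.\<close>

definition regular :: "(nat \<Rightarrow> real) \<times> (nat \<Rightarrow> 'a) \<Rightarrow> bool" where
  "regular \<omega> \<longleftrightarrow> (\<forall>j\<ge>1. 0 < fst \<omega> j \<and> fst \<omega> j < 1) \<and> (\<lambda>m. stick_rem (fst \<omega>) m) \<longlonglongrightarrow> 0 \<and> (\<forall>j\<ge>1. snd \<omega> j \<in> \<Theta>)"

lemma AE_fst: 
  assumes "AE v in stick_law \<alpha>. P v" shows "AE \<omega> in prior. P (fst \<omega>)"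
proof -
  have "AE v in distr prior (stick_law \<alpha>) fst. P v" unfolding T.distr_pair_fst by (rule assms)
  then show ?thesis by (rule AE_distrD[rotated]) measurable
qed

lemma AE_snd:
  assumes "AE \<theta> in atom_law. P \<theta>" shows "AE \<omega> in prior. P (snd \<omega>)"
proof -
  have "AE \<theta> in atom_law. AE v in stick_law \<alpha>. P \<theta>" using assms by eventually_elim simp
  obtain N where N: "N \<in> null_sets atom_law" "{\<theta> \<in> space atom_law. \<not> P \<theta>} \<subseteq> N" using assms by (auto elim!: AE_E3 simp: eventually_ae_filter)
  have "space (stick_law \<alpha>) \<times> N \<in> null_sets prior"
  proof (rule null_setsI)
    have Ns: "N \<in> sets atom_law" using N(1) by (rule null_setsD2)
    then show "space (stick_law \<alpha>) \<times> N \<in> sets prior" by (rule pair_measureI[OF sets.top])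
    show "emeasure prior (space (stick_law \<alpha>) \<times> N) = 0"
      unfolding T.emeasure_pair_measure_Times[OF sets.top Ns] null_setsD1[OF N(1)] by simp
  qed
  moreover have "{\<omega> \<in> space prior. \<not> P (snd \<omega>)} \<subseteq> space (stick_law \<alpha>) \<times> N" using N(2) by (auto simp: space_pair_measure)
  ultimately show ?thesis unfolding eventually_ae_filter by blast
qed

lemma AE_regular: "AE \<omega> in prior. regular \<omega>"
proof -
  have "AE \<theta> in atom_law. \<theta> j \<in> \<Theta>" if "j \<ge> 1" for j
    by (rule AE_PiM_component[of _ "\<lambda>_. P0"]) (use that P0 P0_\<Theta> in auto)
  then have "AE \<theta> in atom_law. j \<ge> 1 \<longrightarrow> \<theta> j \<in> \<Theta>" for j by (cases "j \<ge> 1") auto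
  then have "AE \<theta> in atom_law. \<forall>j\<ge>1. \<theta> j \<in> \<Theta>" by (simp add: AE_all_countable)
  from AE_snd[OF this] AE_fst[OF AE_stick_law[OF al]] AE_fst[OF AE_stick_rem_tendsto[OF al]]
  show ?thesis by eventually_elim (simp add: regular_def)
qed

text \<open>As an \<open>ennreal\<close> series the mixture density is measurable and may be
  integrated termwise without any convergence argument. The \<open>Suc\<close> reflects that sticks
  are numbered from 1.\<close>

definition dens :: "(nat \<Rightarrow> real) \<times> (nat \<Rightarrow> 'a) \<Rightarrow> 'a \<Rightarrow> ennreal" where
  "dens \<omega> x = (\<Sum>k. ennreal (stick_weight (fst \<omega>) (Suc k)) * ennreal (f (x - snd \<omega> (Suc k))))"

definition true_dens :: "'a \<Rightarrow> real" where
  "true_dens x = (\<Sum>c = 1..K. ws c * f (x - ts c))"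

lemma true_dens_pos: "0 < true_dens x"
  unfolding true_dens_def using K ws_pos f_pos by (intro sum_pos) auto

lemma true_dens_meas [measurable]: "true_dens \<in> borel_measurable borel"
  unfolding true_dens_def by measurable

lemma nn_integral_shift_density: "(\<integral>\<^sup>+x. ennreal (f (x - \<theta>)) \<partial>lborel) = 1"
  using nn_integral_lborel_shift[of "\<lambda>x. ennreal (f x)" \<theta>] probability_densityD(3)[OF f] by simp

lemma nn_integral_true_dens: "(\<integral>\<^sup>+x. ennreal (true_dens x) \<partial>lborel) = 1"
proof -
  have "(\<integral>\<^sup>+x. ennreal (true_dens x) \<partial>lborel) = (\<integral>\<^sup>+x. (\<Sum>c = 1..K. ennreal (ws c) * ennreal (f (x - ts c))) \<partial>lborel)"
  proof (rule nn_integral_cong)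
    fix x
    have "(\<Sum>c = 1..K. ennreal (ws c) * ennreal (f (x - ts c))) = (\<Sum>c = 1..K. ennreal (ws c * f (x - ts c)))"
      using ws_pos f_pos by (intro sum.cong refl ennreal_mult[symmetric]) (auto intro: less_imp_le)
    also have "\<dots> = ennreal (true_dens x)"
      unfolding true_dens_def using ws_pos f_pos by (intro sum_ennreal mult_nonneg_nonneg) (auto intro: less_imp_le)
    finally show "ennreal (true_dens x) = (\<Sum>c = 1..K. ennreal (ws c) * ennreal (f (x - ts c)))" by simp
  qed
  also have "\<dots> = (\<Sum>c = 1..K. ennreal (ws c))"
    by (subst nn_integral_sum) (auto simp: nn_integral_cmult nn_integral_shift_density)
  also have "\<dots> = ennreal (\<Sum>c = 1..K. ws c)" using ws_pos by (intro sum_ennreal) (auto intro: less_imp_le)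
  finally show ?thesis unfolding ws_sum by simp
qed

abbreviation "Q \<equiv> density lborel (\<lambda>x. ennreal (true_dens x))"

lemma prob_Q: "prob_space Q"
  by (intro prob_spaceI) (simp add: emeasure_density nn_integral_true_dens)

lemma regular_weight_pos: "regular \<omega> \<Longrightarrow> k \<ge> 1 \<Longrightarrow> 0 < stick_weight (fst \<omega>) k"
  by (auto simp: regular_def stick_weight_eq intro!: mult_pos_pos stick_rem_pos)

lemma regular_weight_sums: "regular \<omega> \<Longrightarrow> (\<lambda>k. stick_weight (fst \<omega>) (Suc k)) sums 1"
  by (simp add: regular_def stick_weight_sums)

lemma regular_weight_suminf_ennreal:
  assumes "regular \<omega>" shows "(\<Sum>k. ennreal (stick_weight (fst \<omega>) (Suc k))) = 1"
proof -
  have "(\<Sum>k. ennreal (stick_weight (fst \<omega>) (Suc k))) = ennreal 1"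
    by (rule suminf_ennreal_eq) (use regular_weight_pos[OF assms] regular_weight_sums[OF assms] in \<open>auto intro: less_imp_le\<close>)
  then show ?thesis by simp
qed

lemma component_measurable: "(\<lambda>\<omega>. snd \<omega> k) \<in> borel_measurable prior"
  by (rule measurable_compose[OF measurable_snd measurable_PiM_component_any[OF sets_P0]])

lemma weight_measurable: "(\<lambda>\<omega>. stick_weight (fst \<omega>) k) \<in> borel_measurable prior"
  by (rule measurable_compose[OF measurable_fst stick_weight_measurable])

lemma kernel_measurable: "(\<lambda>z. ennreal (f (snd z - snd (fst z) k))) \<in> borel_measurable (prior \<Otimes>\<^sub>M borel)"
  by (intro measurable_compose[OF _ measurable_ennreal] measurable_compose[OF _ f_meas] borel_measurable_diff
      measurable_compose[OF measurable_fst component_measurable] measurable_snd)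

lemma dens_measurable: "(\<lambda>z. dens (fst z) (snd z)) \<in> borel_measurable (prior \<Otimes>\<^sub>M borel)"
  unfolding dens_def
  by (intro borel_measurable_suminf_order borel_measurable_times_ennreal kernel_measurable
      measurable_compose[OF _ measurable_ennreal] measurable_compose[OF measurable_fst weight_measurable])

section \<open>The mixture density of a random measure\<close>

lemma nn_integral_dens:
  assumes "g \<in> borel_measurable borel"
  shows "(\<integral>\<^sup>+x. g x * dens \<omega> x \<partial>lborel) =
     (\<Sum>k. ennreal (stick_weight (fst \<omega>) (Suc k)) * (\<integral>\<^sup>+x. g x * ennreal (f (x - snd \<omega> (Suc k))) \<partial>lborel))"
proof -
  note assms[measurable]
  have "(\<integral>\<^sup>+x. g x * dens \<omega> x \<partial>lborel) =
     (\<integral>\<^sup>+x. (\<Sum>k. ennreal (stick_weight (fst \<omega>) (Suc k)) * (g x * ennreal (f (x - snd \<omega> (Suc k))))) \<partial>lborel)"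
    unfolding dens_def ennreal_suminf_cmult[symmetric] by (simp only: mult.left_commute)
  also have "\<dots> = (\<Sum>k. (\<integral>\<^sup>+x. ennreal (stick_weight (fst \<omega>) (Suc k)) * (g x * ennreal (f (x - snd \<omega> (Suc k)))) \<partial>lborel))"
    by (rule nn_integral_suminf) measurable
  also have "\<dots> = (\<Sum>k. ennreal (stick_weight (fst \<omega>) (Suc k)) * (\<integral>\<^sup>+x. g x * ennreal (f (x - snd \<omega> (Suc k))) \<partial>lborel))"
    by (intro suminf_cong nn_integral_cmult) measurable
  finally show ?thesis .
qed

lemma nn_integral_dens_1: "regular \<omega> \<Longrightarrow> (\<integral>\<^sup>+x. dens \<omega> x \<partial>lborel) = 1"
  using nn_integral_dens[of "\<lambda>_. 1" \<omega>] by (simp add: nn_integral_shift_density regular_weight_suminf_ennreal)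

lemma dens_real:
  assumes r: "regular \<omega>"
  shows "summable (\<lambda>k. stick_weight (fst \<omega>) (Suc k) * f (x - snd \<omega> (Suc k)))"
    and "dens \<omega> x = ennreal (\<Sum>k. stick_weight (fst \<omega>) (Suc k) * f (x - snd \<omega> (Suc k)))"
proof -
  have w: "0 \<le> stick_weight (fst \<omega>) (Suc k)" for k using regular_weight_pos[OF r, of "Suc k"] by simp
  show s: "summable (\<lambda>k. stick_weight (fst \<omega>) (Suc k) * f (x - snd \<omega> (Suc k)))"
  proof (rule summable_comparison_test'[where N = 0])
    show "summable (\<lambda>k. stick_weight (fst \<omega>) (Suc k) * F)"
      using regular_weight_sums[OF r] by (intro summable_mult2) (rule sums_summable)
    show "norm (stick_weight (fst \<omega>) (Suc k) * f (x - snd \<omega> (Suc k))) \<le> stick_weight (fst \<omega>) (Suc k) * F" for k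
      using w[of k] f_pos[of "x - snd \<omega> (Suc k)"] f_lt[of "x - snd \<omega> (Suc k)"] by (simp add: abs_mult mult_left_mono)
  qed
  have "dens \<omega> x = (\<Sum>k. ennreal (stick_weight (fst \<omega>) (Suc k) * f (x - snd \<omega> (Suc k))))"
    unfolding dens_def using w f_pos by (intro suminf_cong ennreal_mult[symmetric]) (auto intro: less_imp_le)
  also have "\<dots> = ennreal (\<Sum>k. stick_weight (fst \<omega>) (Suc k) * f (x - snd \<omega> (Suc k)))"
    using w f_pos s by (intro suminf_ennreal2) (auto intro: less_imp_le mult_nonneg_nonneg)
  finally show "dens \<omega> x = ennreal (\<Sum>k. stick_weight (fst \<omega>) (Suc k) * f (x - snd \<omega> (Suc k)))" .
qed

text \<open>Inverts stick breaking for the true weights: the share of component \<open>k\<close> in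
  what is left from \<open>k\<close> on. At \<open>K\<close> the share is 1, an end point of the
  beta law, where an interval of radius \<epsilon> has probability of order
  \<open>\<epsilon> powr \<alpha>\<close> instead of \<epsilon>.\<close>

definition true_stick :: "nat \<Rightarrow> real" where
  "true_stick k = ws k / (\<Sum>j = k..K. ws j)"

lemma tail_sum_pos: "k \<in> {1..K} \<Longrightarrow> 0 < (\<Sum>j = k..K. ws j)"
  using ws_pos by (intro sum_pos) auto

lemma true_stick_range: "k \<in> {1..K} \<Longrightarrow> 0 < true_stick k \<and> true_stick k \<le> 1 \<and> (k < K \<longrightarrow> true_stick k < 1)"
proof -
  assume k: "k \<in> {1..K}"
  have e: "(\<Sum>j = k..K. ws j) = ws k + (\<Sum>j = Suc k..K. ws j)" using k by (simp add: sum.atLeast_Suc_atMost)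
  have "0 \<le> (\<Sum>j = Suc k..K. ws j)" using ws_pos k by (intro sum_nonneg) (auto intro: less_imp_le)
  moreover have "0 < (\<Sum>j = Suc k..K. ws j)" if "k < K" using ws_pos that by (intro sum_pos) auto
  ultimately show ?thesis using ws_pos[OF k] tail_sum_pos[OF k] unfolding true_stick_def by (auto simp: e field_simps)
qed

lemma true_stick_K: "true_stick K = 1"
  using ws_pos[of K] K by (simp add: true_stick_def)

lemma stick_rem_true: "k \<le> K \<Longrightarrow> stick_rem true_stick k = (\<Sum>j = Suc k..K. ws j)"
proof (induction k)
  case 0
  then show ?case using ws_sum by simp
next
  case (Suc k)
  have e: "(\<Sum>j = Suc k..K. ws j) = ws (Suc k) + (\<Sum>j = Suc (Suc k)..K. ws j)" using Suc by (simp add: sum.atLeast_Suc_atMost)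
  have p: "0 < (\<Sum>j = Suc k..K. ws j)" using Suc by (intro tail_sum_pos) auto
  have "stick_rem true_stick (Suc k) = (\<Sum>j = Suc k..K. ws j) * (1 - ws (Suc k) / (\<Sum>j = Suc k..K. ws j))"
  proof -
    have "stick_rem true_stick k = (\<Sum>j = Suc k..K. ws j)" using Suc by simp
    moreover have "true_stick (Suc k) = ws (Suc k) / (\<Sum>j = Suc k..K. ws j)" by (rule true_stick_def)
    ultimately show ?thesis by (simp only: stick_rem_Suc)
  qed
  also have "\<dots> = (\<Sum>j = Suc k..K. ws j) - ws (Suc k)" using p by (simp add: right_diff_distrib)
  finally show ?case using e by simp
qed

lemma stick_weight_true: "k \<in> {1..K} \<Longrightarrow> stick_weight true_stick k = ws k"
proof -
  assume k: "k \<in> {1..K}"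
  have "Suc (k - 1) = k" "k - 1 \<le> K" using k by auto
  then have "stick_rem true_stick (k - 1) = (\<Sum>j = k..K. ws j)" using stick_rem_true[of "k - 1"] by (simp only:)
  then have "stick_weight true_stick k = true_stick k * (\<Sum>j = k..K. ws j)" using k by (simp add: stick_weight_eq)
  then show ?thesis using tail_sum_pos[OF k] by (simp add: true_stick_def)
qed

text \<open>Nothing is asked of later sticks and atoms: as the \<open>K\<close>-th proportion is
  close to 1, they carry mass \<open>O(\<epsilon>)\<close> only, and their kernels are dominated by
  that of a true atom. The rectangle form lets the prior probability factor.\<close>

definition near_event :: "real \<Rightarrow> ((nat \<Rightarrow> real) \<times> (nat \<Rightarrow> 'a)) set" where
  "near_event \<epsilon> = {v \<in> space (stick_law \<alpha>). \<forall>k\<in>{1..K}. \<bar>v k - true_stick k\<bar> \<le> \<epsilon>} \<times>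
     {\<theta> \<in> space atom_law. \<forall>k\<in>{1..K}. \<theta> k \<in> ball (ts k) \<epsilon>}"

lemma near_sets: "{v \<in> space (stick_law \<alpha>). \<forall>k\<in>{1..K}. \<bar>v k - true_stick k\<bar> \<le> \<epsilon>} \<in> sets (stick_law \<alpha>)"
  "{\<theta> \<in> space atom_law. \<forall>k\<in>{1..K}. \<theta> k \<in> ball (ts k) \<epsilon>} \<in> sets atom_law"
proof -
  show "{v \<in> space (stick_law \<alpha>). \<forall>k\<in>{1..K}. \<bar>v k - true_stick k\<bar> \<le> \<epsilon>} \<in> sets (stick_law \<alpha>)"
    supply stick_law_component[measurable] by measurable
  show "{\<theta> \<in> space atom_law. \<forall>k\<in>{1..K}. \<theta> k \<in> ball (ts k) \<epsilon>} \<in> sets atom_law"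
  proof (rule sets.sets_Collect_finite_All')
    fix k
    have "(\<lambda>\<theta>. \<theta> k) -` ball (ts k) \<epsilon> \<inter> space atom_law \<in> sets atom_law"
      by (rule measurable_sets[OF measurable_PiM_component_any[OF sets_P0]]) simp
    moreover have "(\<lambda>\<theta>. \<theta> k) -` ball (ts k) \<epsilon> \<inter> space atom_law = {\<theta> \<in> space atom_law. \<theta> k \<in> ball (ts k) \<epsilon>}" by auto
    ultimately show "{\<theta> \<in> space atom_law. \<theta> k \<in> ball (ts k) \<epsilon>} \<in> sets atom_law" by simp
  qed (use K in auto)
qed

lemma near_event_measurable: "near_event \<epsilon> \<in> sets prior"
  unfolding near_event_def using near_sets by (rule pair_measureI)

lemma emeasure_near_event:
  assumes thick: "\<And>c \<epsilon>. c \<in> {1..K} \<Longrightarrow> 0 < \<epsilon> \<Longrightarrow> \<epsilon> \<le> 1 \<Longrightarrow> ennreal (c0 * \<epsilon> ^ DIM('a)) \<le> emeasure P0 (ball (ts c) \<epsilon>)"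
    and c0: "c0 > 0"
  shows "\<exists>c>0. \<forall>\<epsilon>. 0 < \<epsilon> \<longrightarrow> \<epsilon> \<le> 1 \<longrightarrow>
     ennreal (c * \<epsilon> powr (real (K - 1) + \<alpha> + real (K * DIM('a)))) \<le> emeasure prior (near_event \<epsilon>)"
proof -
  define ex where "ex k = (if k = K then \<alpha> else 1)" for k
  have "\<exists>c>0. \<forall>\<epsilon>\<in>{0<..1}. ennreal (c * \<epsilon> powr ex k) \<le> emeasure (beta_distribution 1 \<alpha>) {v. \<bar>v - true_stick k\<bar> \<le> \<epsilon>}" if k: "k \<in> {1..K}" for k
  proof (cases "k = K")
    case False
    then obtain c where c: "c > 0" "\<forall>\<epsilon>\<in>{0<..1}. ennreal (c * \<epsilon>) \<le> emeasure (beta_distribution 1 \<alpha>) {v. \<bar>v - true_stick k\<bar> \<le> \<epsilon>}"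
      using beta_interval_lower[OF al, of "true_stick k"] true_stick_range[OF k] k by auto
    then show ?thesis using False by (intro exI[of _ c]) (auto simp: ex_def)
  next
    case True
    have "ennreal (1 * \<epsilon> powr ex k) \<le> emeasure (beta_distribution 1 \<alpha>) {v. \<bar>v - true_stick k\<bar> \<le> \<epsilon>}" if e: "\<epsilon> \<in> {0<..1}" for \<epsilon>
    proof -
      have "ennreal (\<epsilon> powr \<alpha>) = emeasure (beta_distribution 1 \<alpha>) {v. 1 - v \<le> \<epsilon>}" using beta_upper_tail[OF al] e by simp
      also have "\<dots> \<le> emeasure (beta_distribution 1 \<alpha>) {v. \<bar>v - true_stick k\<bar> \<le> \<epsilon>}"
        by (rule emeasure_mono_AE, use AE_beta[OF al] in eventually_elim) (use True true_stick_K in auto)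
      finally show ?thesis using True by (simp add: ex_def)
    qed
    then show ?thesis by (intro exI[of _ 1]) auto
  qed
  then have "\<exists>c. \<forall>k\<in>{1..K}. c k > 0 \<and> (\<forall>\<epsilon>\<in>{0<..1}. ennreal (c k * \<epsilon> powr ex k) \<le> emeasure (beta_distribution 1 \<alpha>) {v. \<bar>v - true_stick k\<bar> \<le> \<epsilon>})"
    by (intro bchoice) blast
  then obtain c where cc0: "\<forall>k\<in>{1..K}. c k > 0 \<and> (\<forall>\<epsilon>\<in>{0<..1}. ennreal (c k * \<epsilon> powr ex k) \<le> emeasure (beta_distribution 1 \<alpha>) {v. \<bar>v - true_stick k\<bar> \<le> \<epsilon>})"
    by (elim exE)
  have c: "c k > 0" "0 < \<epsilon> \<Longrightarrow> \<epsilon> \<le> 1 \<Longrightarrow> ennreal (c k * \<epsilon> powr ex k) \<le> emeasure (beta_distribution 1 \<alpha>) {v. \<bar>v - true_stick k\<bar> \<le> \<epsilon>}"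
    if "k \<in> {1..K}" for k \<epsilon>
    using bspec[OF cc0 that] by auto
  define cc where "cc = (\<Prod>k = 1..K. c k) * c0 ^ K"
  have cc: "cc > 0" unfolding cc_def using c(1) c0 by (intro mult_pos_pos prod_pos zero_less_power) auto
  have "ennreal (cc * \<epsilon> powr (real (K - 1) + \<alpha> + real (K * DIM('a)))) \<le> emeasure prior (near_event \<epsilon>)" if e: "0 < \<epsilon>" "\<epsilon> \<le> 1" for \<epsilon>
  proof -
    have A: "emeasure (stick_law \<alpha>) {v \<in> space (stick_law \<alpha>). \<forall>k\<in>{1..K}. \<bar>v k - true_stick k\<bar> \<le> \<epsilon>} =
       (\<Prod>k = 1..K. emeasure (beta_distribution 1 \<alpha>) {v. \<bar>v - true_stick k\<bar> \<le> \<epsilon>})"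
    proof -
      have "emeasure (stick_law \<alpha>) {v \<in> space (stick_law \<alpha>). \<forall>k\<in>{1..K}. \<bar>v k - true_stick k\<bar> \<le> \<epsilon>} =
        (\<integral>\<^sup>+v. indicator {v \<in> space (stick_law \<alpha>). \<forall>k\<in>{1..K}. \<bar>v k - true_stick k\<bar> \<le> \<epsilon>} v \<partial>stick_law \<alpha>)"
        by (rule nn_integral_indicator[symmetric]) (rule near_sets)
      also have "\<dots> = (\<integral>\<^sup>+v. (\<Prod>k = 1..K. indicator {v. \<bar>v - true_stick k\<bar> \<le> \<epsilon>} (v k)) \<partial>stick_law \<alpha>)"
      proof (rule nn_integral_cong)
        fix v assume v: "v \<in> space (stick_law \<alpha>)"
        show "indicator {v \<in> space (stick_law \<alpha>). \<forall>k\<in>{1..K}. \<bar>v k - true_stick k\<bar> \<le> \<epsilon>} v =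
           (\<Prod>k = 1..K. indicator {v. \<bar>v - true_stick k\<bar> \<le> \<epsilon>} (v k) :: ennreal)"
        proof (cases "\<forall>k\<in>{1..K}. \<bar>v k - true_stick k\<bar> \<le> \<epsilon>")
          case False
          then have "(\<Prod>k = 1..K. indicator {v. \<bar>v - true_stick k\<bar> \<le> \<epsilon>} (v k) :: ennreal) = 0"
            by (intro prod_zero) (auto simp: indicator_def)
          then show ?thesis using False by simp
        qed (use v in simp)
      qed
      also have "\<dots> = (\<Prod>k = 1..K. \<integral>\<^sup>+v. indicator {v. \<bar>v - true_stick k\<bar> \<le> \<epsilon>} v \<partial>beta_distribution 1 \<alpha>)"
        by (rule nn_integral_PiM_prod) (use prob_space_beta[OF al] in auto)
      also have "\<dots> = (\<Prod>k = 1..K. emeasure (beta_distribution 1 \<alpha>) {v. \<bar>v - true_stick k\<bar> \<le> \<epsilon>})"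
        by (intro prod.cong refl nn_integral_indicator) simp
      finally show ?thesis .
    qed
    have B: "emeasure atom_law {\<theta> \<in> space atom_law. \<forall>k\<in>{1..K}. \<theta> k \<in> ball (ts k) \<epsilon>} = (\<Prod>k = 1..K. emeasure P0 (ball (ts k) \<epsilon>))"
    proof -
      have bm: "ball (ts k) \<epsilon> \<in> sets P0" for k unfolding sets_P0 by simp
      have "emeasure atom_law {\<theta> \<in> space atom_law. \<forall>k\<in>{1..K}. \<theta> k \<in> ball (ts k) \<epsilon>} =
        (\<integral>\<^sup>+\<theta>. indicator {\<theta> \<in> space atom_law. \<forall>k\<in>{1..K}. \<theta> k \<in> ball (ts k) \<epsilon>} \<theta> \<partial>atom_law)"
        by (rule nn_integral_indicator[symmetric]) (rule near_sets)
      also have "\<dots> = (\<integral>\<^sup>+\<theta>. (\<Prod>k = 1..K. indicator (ball (ts k) \<epsilon>) (\<theta> k)) \<partial>atom_law)"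
      proof (rule nn_integral_cong)
        fix \<theta> assume t: "\<theta> \<in> space atom_law"
        show "indicator {\<theta> \<in> space atom_law. \<forall>k\<in>{1..K}. \<theta> k \<in> ball (ts k) \<epsilon>} \<theta> =
           (\<Prod>k = 1..K. indicator (ball (ts k) \<epsilon>) (\<theta> k) :: ennreal)"
        proof (cases "\<forall>k\<in>{1..K}. \<theta> k \<in> ball (ts k) \<epsilon>")
          case False
          then have "(\<Prod>k = 1..K. indicator (ball (ts k) \<epsilon>) (\<theta> k) :: ennreal) = 0"
            by (intro prod_zero) (auto simp: indicator_def)
          then show ?thesis using False by simp
        qed (use t in simp)
      qed
      also have "\<dots> = (\<Prod>k = 1..K. \<integral>\<^sup>+\<theta>. indicator (ball (ts k) \<epsilon>) \<theta> \<partial>P0)"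
        by (rule nn_integral_PiM_prod) (use P0 bm in \<open>auto intro!: borel_measurable_indicator\<close>)
      also have "\<dots> = (\<Prod>k = 1..K. emeasure P0 (ball (ts k) \<epsilon>))"
        by (intro prod.cong refl nn_integral_indicator bm)
      finally show ?thesis .
    qed
    have pw: "(\<Prod>k = 1..K. \<epsilon> powr ex k) = \<epsilon> powr (real (K - 1) + \<alpha>)"
    proof -
      have "(\<Prod>k = 1..K. \<epsilon> powr ex k) = \<epsilon> powr (\<Sum>k = 1..K. ex k)" using e by (simp add: powr_sum)
      also have "(\<Sum>k = 1..K. ex k) = ex K + (\<Sum>k\<in>{1..K} - {K}. ex k)" using K by (intro sum.remove) auto
      also have "(\<Sum>k\<in>{1..K} - {K}. ex k) = (\<Sum>k\<in>{1..K} - {K}. 1)" by (intro sum.cong) (auto simp: ex_def)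
      also have "ex K + (\<Sum>k\<in>{1..K} - {K}. 1) = real (K - 1) + \<alpha>" using K by (simp add: ex_def)
      finally show ?thesis .
    qed
    have e1: "\<epsilon> ^ (DIM('a) * K) = \<epsilon> powr real (K * DIM('a))"
      using powr_realpow[OF e(1), of "K * DIM('a)"] by (simp only: mult.commute)
    have "ennreal (cc * \<epsilon> powr (real (K - 1) + \<alpha> + real (K * DIM('a)))) =
       ennreal ((\<Prod>k = 1..K. c k * \<epsilon> powr ex k) * (c0 * \<epsilon> ^ DIM('a)) ^ K)"
      unfolding cc_def prod.distrib pw power_mult_distrib power_mult[symmetric] e1 powr_add by (simp only: mult_ac)
    also have "\<dots> = (\<Prod>k = 1..K. ennreal (c k * \<epsilon> powr ex k)) * (\<Prod>k = 1..K. ennreal (c0 * \<epsilon> ^ DIM('a)))"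
    proof -
      have c0': "0 \<le> c k * \<epsilon> powr ex k" if "k \<in> {1..K}" for k using c(1)[OF that] by simp
      have 1: "(\<Prod>k = 1..K. ennreal (c k * \<epsilon> powr ex k)) = ennreal (\<Prod>k = 1..K. c k * \<epsilon> powr ex k)"
        using c0' by (intro prod_ennreal)
      have 2: "(\<Prod>k = 1..K. ennreal (c0 * \<epsilon> ^ DIM('a))) = ennreal ((c0 * \<epsilon> ^ DIM('a)) ^ K)"
        using c0 e by (simp add: ennreal_power)
      show ?thesis unfolding 1 2
      proof (rule ennreal_mult)
        show "0 \<le> (\<Prod>k = 1..K. c k * \<epsilon> powr ex k)" by (rule prod_nonneg) (rule c0')
        show "0 \<le> (c0 * \<epsilon> ^ DIM('a)) ^ K" using c0 e by simp
      qed
    qed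
    also have "\<dots> \<le> (\<Prod>k = 1..K. emeasure (beta_distribution 1 \<alpha>) {v. \<bar>v - true_stick k\<bar> \<le> \<epsilon>}) * (\<Prod>k = 1..K. emeasure P0 (ball (ts k) \<epsilon>))"
      using e by (intro mult_mono prod_mono_ennreal c(2) thick) auto
    also have "\<dots> = emeasure prior (near_event \<epsilon>)"
      unfolding near_event_def A[symmetric] B[symmetric] by (rule T.emeasure_pair_measure_Times[OF near_sets, symmetric])
    finally show ?thesis .
  qed
  then show ?thesis using cc by blast
qed

text \<open>Each stick adds at most \<epsilon> to the error, since both the remaining mass and the
  factor that multiplies the old error are at most 1.\<close>

lemma near_weights:
  assumes r: "regular \<omega>" and n: "\<omega> \<in> near_event \<epsilon>" and k: "k \<le> K"
  shows "\<bar>stick_rem (fst \<omega>) k - stick_rem true_stick k\<bar> \<le> real k * \<epsilon>"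
  using k
proof (induction k)
  case (Suc k)
  let ?v = "fst \<omega>"
  have v: "0 < ?v (Suc k) \<and> ?v (Suc k) < 1" using r by (auto simp: regular_def)
  have d: "\<bar>?v (Suc k) - true_stick (Suc k)\<bar> \<le> \<epsilon>" using n Suc by (auto simp: near_event_def)
  have t01: "0 \<le> stick_rem true_stick k" "stick_rem true_stick k \<le> 1"
  proof -
    have r: "0 \<le> true_stick j \<and> true_stick j \<le> 1" if "j \<in> {1..k}" for j using true_stick_range[of j] that Suc by (auto intro: less_imp_le)
    show "stick_rem true_stick k \<le> 1" using r by (rule stick_rem_le_1)
    show "0 \<le> stick_rem true_stick k" unfolding stick_rem_def using r by (intro prod_nonneg) auto
  qed
  have "stick_rem ?v (Suc k) - stick_rem true_stick (Suc k) =
     (stick_rem ?v k - stick_rem true_stick k) * (1 - ?v (Suc k)) + stick_rem true_stick k * (true_stick (Suc k) - ?v (Suc k))"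
    by (simp add: stick_rem_Suc algebra_simps)
  also have "\<bar>\<dots>\<bar> \<le> \<bar>stick_rem ?v k - stick_rem true_stick k\<bar> * 1 + 1 * \<epsilon>"
    using v d t01 by (intro order_trans[OF abs_triangle_ineq] add_mono; unfold abs_mult; intro mult_mono) auto
  also have "\<dots> \<le> real (Suc k) * \<epsilon>" using Suc by (simp add: algebra_simps)
  finally show ?case .
qed simp

text \<open>Three errors are added: in the first \<open>K\<close> weights, in their positions, and
  the whole mass behind them. All are measured relative to \<open>true_dens\<close>, as the
  chi-square bound requires; this works because a single true kernel is at most
  \<open>true_dens x / w0\<close>.\<close>

lemma near_dens:
  assumes dom: "\<And>x \<theta> \<theta>'. \<theta> \<in> \<Theta> \<Longrightarrow> \<theta>' \<in> \<Theta> \<Longrightarrow>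
       \<bar>f (x - \<theta>) - f (x - \<theta>')\<bar> \<le> norm (\<theta> - \<theta>') * W x * f (x - \<theta>') \<and> f (x - \<theta>) \<le> W x * f (x - \<theta>')"
  shows "\<exists>C\<ge>0. \<forall>\<epsilon> \<omega> x. 0 < \<epsilon> \<longrightarrow> regular \<omega> \<longrightarrow> \<omega> \<in> near_event \<epsilon> \<longrightarrow>
     \<bar>(\<Sum>k. stick_weight (fst \<omega>) (Suc k) * f (x - snd \<omega> (Suc k))) - true_dens x\<bar> \<le> C * \<epsilon> * W x * true_dens x"
proof -
  define w0 where "w0 = Min (ws ` {1..K})"
  have w0: "0 < w0" "\<And>c. c \<in> {1..K} \<Longrightarrow> w0 \<le> ws c"
  proof -
    have "w0 \<in> ws ` {1..K}" unfolding w0_def using K by (intro Min_in) auto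
    then show "0 < w0" using ws_pos by auto
    show "w0 \<le> ws c" if "c \<in> {1..K}" for c unfolding w0_def using that by (intro Min_le) auto
  qed
  have ws1: "ws c \<le> 1" if "c \<in> {1..K}" for c
    unfolding ws_sum[symmetric] using that ws_pos by (intro member_le_sum) (auto intro: less_imp_le)
  define C where "C = real K * ((2 * real K + 1) / w0) + real K / w0"
  have C: "C \<ge> 0" using w0 by (simp add: C_def)
  have "\<bar>(\<Sum>k. stick_weight (fst \<omega>) (Suc k) * f (x - snd \<omega> (Suc k))) - true_dens x\<bar> \<le> C * \<epsilon> * W x * true_dens x"
    if e: "0 < \<epsilon>" and r: "regular \<omega>" and n: "\<omega> \<in> near_event \<epsilon>" for \<epsilon> \<omega> x
  proof -
    define w where "w k = stick_weight (fst \<omega>) k" for k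
    define th where "th k = snd \<omega> k" for k
    have thT: "th k \<in> \<Theta>" if "k \<ge> 1" for k using r that by (auto simp: regular_def th_def)
    have wp: "0 < w k" if "k \<ge> 1" for k unfolding w_def using regular_weight_pos[OF r that] .
    have W0: "0 \<le> W x" using dom[OF ts ts, of 1 1 x] K f_pos[of "x - ts 1"] by (simp add: zero_le_mult_iff)
    have ft: "f (x - ts c) \<le> true_dens x / w0" if c: "c \<in> {1..K}" for c
    proof -
      have "w0 * f (x - ts c) \<le> ws c * f (x - ts c)" using w0(2)[OF c] f_pos by (intro mult_right_mono) (auto intro: less_imp_le)
      also have "\<dots> \<le> true_dens x" unfolding true_dens_def using c ws_pos f_pos
        by (intro member_le_sum[where f = "\<lambda>c. ws c * f (x - ts c)"]) (auto intro!: mult_nonneg_nonneg less_imp_le)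
      finally show ?thesis using w0 by (simp add: field_simps)
    qed
    have dw: "\<bar>w k - ws k\<bar> \<le> 2 * real K * \<epsilon>" if k: "k \<in> {1..K}" for k
    proof -
      have "\<bar>stick_rem (fst \<omega>) (k - 1) - stick_rem true_stick (k - 1)\<bar> \<le> real (k - 1) * \<epsilon>"
        using near_weights[OF r n, of "k - 1"] k by auto
      also have "\<dots> \<le> real K * \<epsilon>" using k e by (intro mult_right_mono) auto
      finally have 1: "\<bar>stick_rem (fst \<omega>) (k - 1) - stick_rem true_stick (k - 1)\<bar> \<le> real K * \<epsilon>" .
      have "\<bar>stick_rem (fst \<omega>) k - stick_rem true_stick k\<bar> \<le> real k * \<epsilon>" using near_weights[OF r n, of k] k by auto
      also have "\<dots> \<le> real K * \<epsilon>" using k e by (intro mult_right_mono) auto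
      finally have 2: "\<bar>stick_rem (fst \<omega>) k - stick_rem true_stick k\<bar> \<le> real K * \<epsilon>" .
      have "ws k = stick_rem true_stick (k - 1) - stick_rem true_stick k"
        using stick_weight_true[OF k] k by (simp add: stick_weight_eq_diff)
      moreover have "w k = stick_rem (fst \<omega>) (k - 1) - stick_rem (fst \<omega>) k" using k by (simp add: w_def stick_weight_eq_diff)
      ultimately show ?thesis using 1 2 by linarith
    qed
    have remK: "stick_rem (fst \<omega>) K \<le> real K * \<epsilon>"
      using near_weights[OF r n, of K] stick_rem_true[of K] by simp
    have head: "\<bar>w k * f (x - th k) - ws k * f (x - ts k)\<bar> \<le> ((2 * real K + 1) / w0) * \<epsilon> * W x * true_dens x" if k: "k \<in> {1..K}" for k
    proof -
      have tk: "th k \<in> \<Theta>" "ts k \<in> \<Theta>" using thT ts k by auto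
      have nk: "norm (th k - ts k) \<le> \<epsilon>" 
      proof -
        have "snd \<omega> k \<in> ball (ts k) \<epsilon>" using n k unfolding near_event_def by auto
        then show ?thesis by (simp add: th_def dist_norm norm_minus_commute less_imp_le)
      qed
      have "w k * f (x - th k) - ws k * f (x - ts k) = (w k - ws k) * f (x - th k) + ws k * (f (x - th k) - f (x - ts k))"
        by (simp add: algebra_simps)
      also have "\<bar>\<dots>\<bar> \<le> (2 * real K * \<epsilon>) * (W x * f (x - ts k)) + 1 * (\<epsilon> * W x * f (x - ts k))"
      proof (intro order_trans[OF abs_triangle_ineq] add_mono; unfold abs_mult; intro mult_mono)
        show "\<bar>w k - ws k\<bar> \<le> 2 * real K * \<epsilon>" by (rule dw[OF k])
        show "\<bar>f (x - th k)\<bar> \<le> W x * f (x - ts k)" using dom[OF tk, of x] f_pos[of "x - th k"] by simp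
        show "\<bar>ws k\<bar> \<le> 1" using ws1[OF k] ws_pos[OF k] by simp
        have "\<bar>f (x - th k) - f (x - ts k)\<bar> \<le> norm (th k - ts k) * W x * f (x - ts k)" using dom[OF tk, of x] by simp
        also have "\<dots> \<le> \<epsilon> * W x * f (x - ts k)" using nk W0 f_pos by (intro mult_right_mono) (auto intro: less_imp_le)
        finally show "\<bar>f (x - th k) - f (x - ts k)\<bar> \<le> \<epsilon> * W x * f (x - ts k)" .
      qed (use e in auto)
      also have "\<dots> = (2 * real K + 1) * \<epsilon> * W x * f (x - ts k)" by (simp add: algebra_simps)
      also have "\<dots> \<le> (2 * real K + 1) * \<epsilon> * W x * (true_dens x / w0)" using ft[OF k] e W0 by (intro mult_left_mono) auto
      finally show ?thesis by (simp add: field_simps)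
    qed
    have tail0: "0 \<le> (\<Sum>k. w (Suc (k + K)) * f (x - th (Suc (k + K))))"
      using dens_real(1)[OF r, of x] wp f_pos unfolding w_def[symmetric] th_def[symmetric]
      by (intro suminf_nonneg summable_ignore_initial_segment[where f = "\<lambda>k. w (Suc k) * f (x - th (Suc k))"]) (auto intro: less_imp_le mult_nonneg_nonneg)
    \<comment> \<open>The later atoms may lie anywhere in \<open>\<Theta>\<close>. Each kernel is
      compared with that of the first true atom, which costs a factor \<open>W x\<close>, while
      their total weight is at most \<open>K * \<epsilon>\<close>.\<close>
    have tail: "(\<Sum>k. w (Suc (k + K)) * f (x - th (Suc (k + K)))) \<le> real K * \<epsilon> * (W x * (true_dens x / w0))"
    proof -
      have sw: "(\<lambda>k. w (Suc k)) sums 1" using regular_weight_sums[OF r] by (simp add: w_def)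
      have "(\<Sum>k<K. w (Suc k)) = 1 - stick_rem (fst \<omega>) K"
      proof -
        have "(\<Sum>k<K. w (Suc k)) = (\<Sum>k = 1..K. w k)" by (rule sum.reindex_bij_witness[of _ "\<lambda>k. k - 1" Suc]) auto
        then show ?thesis by (simp only: w_def sum_stick_weight)
      qed
      then have s1: "(\<lambda>k. w (Suc (k + K))) sums stick_rem (fst \<omega>) K"
        using sums_split_initial_segment[OF sw, of K] by simp
      have K1: "1 \<in> {1..K}" using K by simp
      define b where "b = W x * (true_dens x / w0)"
      have fb: "f (x - th k) \<le> b" if "k \<ge> 1" for k
      proof -
        have "f (x - th k) \<le> W x * f (x - ts 1)" using dom[OF thT[OF that] ts[OF K1], of x] by simp
        also have "\<dots> \<le> b" unfolding b_def using ft[OF K1] W0 by (intro mult_left_mono)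
        finally show ?thesis .
      qed
      have "(\<Sum>k. w (Suc (k + K)) * f (x - th (Suc (k + K)))) \<le> (\<Sum>k. w (Suc (k + K)) * b)"
      proof (rule suminf_le)
        show "w (Suc (k + K)) * f (x - th (Suc (k + K))) \<le> w (Suc (k + K)) * b" for k
          using fb wp by (intro mult_left_mono) (auto intro: less_imp_le)
        show "summable (\<lambda>k. w (Suc (k + K)) * f (x - th (Suc (k + K))))"
          using dens_real(1)[OF r, of x] unfolding w_def[symmetric] th_def[symmetric]
          by (rule summable_ignore_initial_segment[where f = "\<lambda>k. w (Suc k) * f (x - th (Suc k))"])
        show "summable (\<lambda>k. w (Suc (k + K)) * b)" using sums_summable[OF s1] by (rule summable_mult2)
      qed
      also have "\<dots> = stick_rem (fst \<omega>) K * b" using s1 by (simp add: suminf_mult2[symmetric] sums_iff)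
      also have "\<dots> \<le> real K * \<epsilon> * b"
        unfolding b_def using remK W0 true_dens_pos[of x] w0 by (intro mult_right_mono mult_nonneg_nonneg divide_nonneg_nonneg) (auto intro: less_imp_le)
      finally show ?thesis by (simp only: b_def)
    qed
    have split: "(\<Sum>k. w (Suc k) * f (x - th (Suc k))) = (\<Sum>k. w (Suc (k + K)) * f (x - th (Suc (k + K)))) + (\<Sum>k<K. w (Suc k) * f (x - th (Suc k)))"
      using suminf_split_initial_segment[OF dens_real(1)[OF r, of x], of K] by (simp add: w_def th_def)
    have hd: "(\<Sum>k<K. w (Suc k) * f (x - th (Suc k))) = (\<Sum>k = 1..K. w k * f (x - th k))"
      by (rule sum.reindex_bij_witness[of _ "\<lambda>k. k - 1" Suc]) auto
    have "\<bar>(\<Sum>k = 1..K. w k * f (x - th k)) - true_dens x\<bar> = \<bar>\<Sum>k = 1..K. (w k * f (x - th k) - ws k * f (x - ts k))\<bar>"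
      by (simp add: true_dens_def sum_subtractf)
    also have "\<dots> \<le> (\<Sum>k = 1..K. ((2 * real K + 1) / w0) * \<epsilon> * W x * true_dens x)"
      by (rule order_trans[OF sum_abs]) (rule sum_mono[OF head])
    also have "\<dots> = real K * (((2 * real K + 1) / w0) * \<epsilon> * W x * true_dens x)" by simp
    finally have "\<bar>(\<Sum>k. w (Suc k) * f (x - th (Suc k))) - true_dens x\<bar> \<le>
       real K * (((2 * real K + 1) / w0) * \<epsilon> * W x * true_dens x) + real K * \<epsilon> * (W x * (true_dens x / w0))"
      unfolding split hd using tail tail0 by linarith
    also have "\<dots> = C * \<epsilon> * W x * true_dens x" by (simp add: C_def algebra_simps)
    finally show ?thesis by (simp only: w_def th_def)
  qed
  then show ?thesis using C by blast
qed

text \<open>The prior is conditioned on \<open>near_event \<epsilon>\<close>. By the second moment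
  method the conditional evidence is at least 1/2 with high probability once
  \<open>n * \<epsilon>\<^sup>2\<close> is small; undoing the conditioning multiplies by the prior
  probability of the event.\<close>

lemma evidence_lower_bound:
  assumes dom: "\<And>x \<theta> \<theta>'. \<theta> \<in> \<Theta> \<Longrightarrow> \<theta>' \<in> \<Theta> \<Longrightarrow>
       \<bar>f (x - \<theta>) - f (x - \<theta>')\<bar> \<le> norm (\<theta> - \<theta>') * W x * f (x - \<theta>') \<and> f (x - \<theta>) \<le> W x * f (x - \<theta>')"
    and Wm [measurable]: "W \<in> borel_measurable borel" and Wfin: "(\<integral>\<^sup>+x. ennreal ((W x)\<^sup>2 * true_dens x) \<partial>lborel) < \<infinity>"
    and thick: "\<And>c \<epsilon>. c \<in> {1..K} \<Longrightarrow> 0 < \<epsilon> \<Longrightarrow> \<epsilon> \<le> 1 \<Longrightarrow> ennreal (c0 * \<epsilon> ^ DIM('a)) \<le> emeasure P0 (ball (ts c) \<epsilon>)"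
    and c0: "c0 > 0"
  shows "\<exists>c>0. \<exists>C\<ge>0. \<forall>n \<epsilon>. 0 < \<epsilon> \<longrightarrow> \<epsilon> \<le> 1 \<longrightarrow>
     measure (\<Pi>\<^sub>M i\<in>{1::nat..}. Q) {X \<in> space (\<Pi>\<^sub>M i\<in>{1::nat..}. Q).
        (\<integral>\<^sup>+\<omega>. (\<Prod>i = 1..n. dens \<omega> (X i) / ennreal (true_dens (X i))) \<partial>prior) <
          ennreal (c * \<epsilon> powr (real (K - 1) + \<alpha> + real (K * DIM('a))))} \<le> 4 * ((1 + C * \<epsilon>\<^sup>2) ^ n - 1)"
proof -
  obtain c where c: "c > 0" and cb: "\<forall>\<epsilon>. 0 < \<epsilon> \<longrightarrow> \<epsilon> \<le> 1 \<longrightarrow>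
     ennreal (c * \<epsilon> powr (real (K - 1) + \<alpha> + real (K * DIM('a)))) \<le> emeasure prior (near_event \<epsilon>)"
  proof -
    have "\<exists>c>0. \<forall>\<epsilon>. 0 < \<epsilon> \<longrightarrow> \<epsilon> \<le> 1 \<longrightarrow>
       ennreal (c * \<epsilon> powr (real (K - 1) + \<alpha> + real (K * DIM('a)))) \<le> emeasure prior (near_event \<epsilon>)"
    proof (rule emeasure_near_event[of c0])
      show "ennreal (c0 * \<epsilon> ^ DIM('a)) \<le> emeasure P0 (ball (ts c) \<epsilon>)" if "c \<in> {1..K}" "0 < \<epsilon>" "\<epsilon> \<le> 1" for c \<epsilon>
        by (rule thick[OF that])
    qed (rule c0)
    then show ?thesis using that by (elim exE conjE)
  qed
  obtain C where C: "C \<ge> 0" and nd: "\<forall>\<epsilon> \<omega> x. 0 < \<epsilon> \<longrightarrow> regular \<omega> \<longrightarrow> \<omega> \<in> near_event \<epsilon> \<longrightarrow>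
     \<bar>(\<Sum>k. stick_weight (fst \<omega>) (Suc k) * f (x - snd \<omega> (Suc k))) - true_dens x\<bar> \<le> C * \<epsilon> * W x * true_dens x"
  proof -
    have "\<exists>C\<ge>0. \<forall>\<epsilon> \<omega> x. 0 < \<epsilon> \<longrightarrow> regular \<omega> \<longrightarrow> \<omega> \<in> near_event \<epsilon> \<longrightarrow>
       \<bar>(\<Sum>k. stick_weight (fst \<omega>) (Suc k) * f (x - snd \<omega> (Suc k))) - true_dens x\<bar> \<le> C * \<epsilon> * W x * true_dens x"
      by (rule near_dens) (rule dom)
    then show ?thesis using that by (elim exE conjE)
  qed
  obtain m where m: "m \<ge> 0" "(\<integral>\<^sup>+x. ennreal ((W x)\<^sup>2 * true_dens x) \<partial>lborel) = ennreal m"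
    using Wfin by (cases "\<integral>\<^sup>+x. ennreal ((W x)\<^sup>2 * true_dens x) \<partial>lborel") auto
  define N where "N = real (K - 1) + \<alpha> + real (K * DIM('a))"
  let ?QI = "\<Pi>\<^sub>M i\<in>{1::nat..}. Q"
  interpret QI: prob_space ?QI by (intro prob_space_PiM prob_Q)
  define r where "r \<omega> x = dens \<omega> x / ennreal (true_dens x)" for \<omega> x
  have rm: "(\<lambda>(\<omega>, x). r \<omega> x) \<in> borel_measurable (prior \<Otimes>\<^sub>M borel)"
    unfolding r_def case_prod_beta'
    by (intro borel_measurable_divide_ennreal dens_measurable measurable_compose[OF measurable_snd] measurable_compose[OF true_dens_meas measurable_ennreal])
  have dr: "dens \<omega> x / ennreal (true_dens x) * ennreal (true_dens x) = dens \<omega> x" for \<omega> x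
    using true_dens_pos[of x] by (simp add: ennreal_divide_times ennreal_times_divide[symmetric] mult_divide_eq_ennreal)
  have main: "measure ?QI {X \<in> space ?QI. (\<integral>\<^sup>+\<omega>. (\<Prod>i = 1..n. r \<omega> (X i)) \<partial>prior) < ennreal (c / 2 * \<epsilon> powr N)} \<le> 4 * ((1 + (C\<^sup>2 * m) * \<epsilon>\<^sup>2) ^ n - 1)"
    if e: "0 < \<epsilon>" "\<epsilon> \<le> 1" for n \<epsilon>
  proof -
    have Bm: "near_event \<epsilon> \<in> sets prior" by (rule near_event_measurable)
    have Bl: "ennreal (c * \<epsilon> powr N) \<le> emeasure prior (near_event \<epsilon>)" using cb e by (simp add: N_def)
    have B0: "emeasure prior (near_event \<epsilon>) \<noteq> 0"
    proof
      assume "emeasure prior (near_event \<epsilon>) = 0"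
      then have "c * \<epsilon> powr N \<le> 0" using Bl by (simp add: ennreal_eq_0_iff)
      then show False using c e by (simp add: mult_le_0_iff not_le)
    qed
    have Bf: "emeasure prior (near_event \<epsilon>) \<noteq> \<infinity>" unfolding infinity_ennreal_def
      by (rule finite_measure.emeasure_finite[OF prob_space.finite_measure[OF prob_prior]])
    define NN where "NN = uniform_measure prior (near_event \<epsilon>)"
    have pN: "prob_space NN" unfolding NN_def by (rule prob_space_uniform_measure[OF B0 Bf])
    have AEN: "AE \<omega> in NN. regular \<omega> \<and> \<omega> \<in> near_event \<epsilon> \<and> \<omega> \<in> space prior"
      unfolding NN_def using AE_regular AE_space by (intro AE_uniform_measureI Bm) (auto elim: eventually_elim2)
    have rm': "(\<lambda>(\<omega>, x). r \<omega> x) \<in> borel_measurable (NN \<Otimes>\<^sub>M Q)"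
    proof -
      have "sets (NN \<Otimes>\<^sub>M Q) = sets (prior \<Otimes>\<^sub>M borel)" by (intro sets_pair_measure_cong) (auto simp: NN_def)
      then show ?thesis using rm measurable_cong_sets by blast
    qed
    have dq: "(\<integral>\<^sup>+x. g x \<partial>Q) = (\<integral>\<^sup>+x. ennreal (true_dens x) * g x \<partial>lborel)" if "g \<in> borel_measurable borel" for g
      using that by (intro nn_integral_density) auto
    have rmw: "r \<omega> \<in> borel_measurable borel" if "\<omega> \<in> space prior" for \<omega>
      using measurable_compose[OF measurable_Pair1'[OF that] rm] by simp
    have mean: "(\<integral>\<^sup>+x. r \<omega> x \<partial>Q) = 1" if "regular \<omega>" "\<omega> \<in> space prior" for \<omega>
    proof -
      have "(\<integral>\<^sup>+x. r \<omega> x \<partial>Q) = (\<integral>\<^sup>+x. ennreal (true_dens x) * r \<omega> x \<partial>lborel)" by (rule dq[OF rmw[OF that(2)]])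
      also have "\<dots> = (\<integral>\<^sup>+x. dens \<omega> x \<partial>lborel)" unfolding r_def by (intro nn_integral_cong) (simp only: dr mult.commute[of "ennreal (true_dens _)"])
      finally show ?thesis using nn_integral_dens_1[OF that(1)] by simp
    qed
    define p where "p \<omega> x = (\<Sum>k. stick_weight (fst \<omega>) (Suc k) * f (x - snd \<omega> (Suc k)))" for \<omega> x
    have var: "(\<integral>\<^sup>+x. r \<omega> x * r \<omega>' x \<partial>Q) \<le> ennreal (1 + (C * \<epsilon>)\<^sup>2 * m)"
      if w: "regular \<omega>" "\<omega> \<in> near_event \<epsilon>" "\<omega> \<in> space prior" and w': "regular \<omega>'" "\<omega>' \<in> near_event \<epsilon>" "\<omega>' \<in> space prior" for \<omega> \<omega>'
    proof -
      have pd: "dens \<omega> x = ennreal (p \<omega> x)" "dens \<omega>' x = ennreal (p \<omega>' x)" for x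
        unfolding p_def using dens_real(2)[OF w(1)] dens_real(2)[OF w'(1)] by auto
      have pn: "0 \<le> p \<omega> x" if "regular \<omega>" for \<omega> x unfolding p_def
        using dens_real(1)[OF that, of x] regular_weight_pos[OF that] f_pos by (intro suminf_nonneg) (auto intro: less_imp_le mult_nonneg_nonneg)
      have pm: "p \<omega> \<in> borel_measurable borel" for \<omega> unfolding p_def by (intro borel_measurable_suminf) auto
      have "(\<integral>\<^sup>+x. r \<omega> x * r \<omega>' x \<partial>Q) = (\<integral>\<^sup>+x. ennreal (true_dens x) * (r \<omega> x * r \<omega>' x) \<partial>lborel)"
        by (rule dq) (intro borel_measurable_times_ennreal rmw w w')
      also have "\<dots> = (\<integral>\<^sup>+x. ennreal (p \<omega> x * p \<omega>' x / true_dens x) \<partial>lborel)"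
      proof (rule nn_integral_cong)
        fix x
        have s: "true_dens x > 0" by (rule true_dens_pos)
        have rr: "r \<omega> x = ennreal (p \<omega> x / true_dens x)" "r \<omega>' x = ennreal (p \<omega>' x / true_dens x)"
          unfolding r_def pd using pn w(1) w'(1) s by (auto simp: divide_ennreal)
        have "ennreal (true_dens x) * (r \<omega> x * r \<omega>' x) = ennreal (true_dens x * (p \<omega> x / true_dens x * (p \<omega>' x / true_dens x)))"
        proof -
          have n: "0 \<le> p \<omega> x / true_dens x" "0 \<le> p \<omega>' x / true_dens x"
            using pn[OF w(1), of x] pn[OF w'(1), of x] s by simp_all
          show ?thesis unfolding rr
            using n less_imp_le[OF s] by (simp only: ennreal_mult mult_nonneg_nonneg)
        qed
        also have "true_dens x * (p \<omega> x / true_dens x * (p \<omega>' x / true_dens x)) = p \<omega> x * p \<omega>' x / true_dens x" using s by simp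
        finally show "ennreal (true_dens x) * (r \<omega> x * r \<omega>' x) = ennreal (p \<omega> x * p \<omega>' x / true_dens x)" .
      qed
      also have "\<dots> \<le> ennreal (1 + (C * \<epsilon>)\<^sup>2 * m)"
      proof (rule chi_square_bound[where W = W])
        show "(\<integral>\<^sup>+x. ennreal (p \<omega> x) \<partial>lborel) = 1" unfolding pd(1)[symmetric] by (rule nn_integral_dens_1[OF w(1)])
        show "(\<integral>\<^sup>+x. ennreal (p \<omega>' x) \<partial>lborel) = 1" unfolding pd(2)[symmetric] by (rule nn_integral_dens_1[OF w'(1)])
        show "\<bar>p \<omega> x - true_dens x\<bar> \<le> C * \<epsilon> * W x * true_dens x" "\<bar>p \<omega>' x - true_dens x\<bar> \<le> C * \<epsilon> * W x * true_dens x" for x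
          unfolding p_def using nd e w w' by blast+
        show "p \<omega> \<in> borel_measurable lborel" "p \<omega>' \<in> borel_measurable lborel" using pm by simp_all
        show "0 \<le> p \<omega> x" "0 \<le> p \<omega>' x" for x using pn w w' by auto
        show "(\<integral>\<^sup>+x. ennreal ((W x)\<^sup>2 * true_dens x) \<partial>lborel) = ennreal m" "0 \<le> m" by (rule m)+
        show "0 < true_dens x" for x by (rule true_dens_pos)
        show "(\<integral>\<^sup>+x. ennreal (true_dens x) \<partial>lborel) = 1" by (rule nn_integral_true_dens)
      qed (use Wm true_dens_meas in simp_all)
      finally show ?thesis .
    qed
    have ev: "measure ?QI {X \<in> space ?QI. (\<integral>\<^sup>+\<omega>. (\<Prod>i = 1..n. r \<omega> (X i)) \<partial>NN) < 1/2} \<le> 4 * ((1 + (C * \<epsilon>)\<^sup>2 * m) ^ n - 1)"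
    proof (rule evidence_chebyshev[OF pN prob_Q rm'])
      show "AE \<omega> in NN. (\<integral>\<^sup>+x. r \<omega> x \<partial>Q) = 1" using AEN by eventually_elim (simp add: mean)
      show "AE \<omega> in NN. AE \<omega>' in NN. (\<integral>\<^sup>+x. r \<omega> x * r \<omega>' x \<partial>Q) \<le> ennreal (1 + (C * \<epsilon>)\<^sup>2 * m)"
        using AEN
      proof eventually_elim
        case (elim \<omega>)
        note w = elim
        show ?case using AEN by eventually_elim (use w in \<open>auto intro!: var\<close>)
      qed
    qed (use m in simp)
    have Fmm: "(\<lambda>\<omega>. \<Prod>i = 1..n. r \<omega> (X i)) \<in> borel_measurable prior" for X
    proof (intro borel_measurable_prod_ennreal)
      fix i
      show "(\<lambda>\<omega>. r \<omega> (X i)) \<in> borel_measurable prior"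
        using measurable_compose[OF measurable_Pair2'[of "X i" borel prior] rm] by simp
    qed
    have ge: "ennreal (c / 2 * \<epsilon> powr N) \<le> (\<integral>\<^sup>+\<omega>. (\<Prod>i = 1..n. r \<omega> (X i)) \<partial>prior)"
      if "\<not> (\<integral>\<^sup>+\<omega>. (\<Prod>i = 1..n. r \<omega> (X i)) \<partial>NN) < 1/2" for X
    proof -
      let ?G = "\<lambda>\<omega>. \<Prod>i = 1..n. r \<omega> (X i)"
      have half: "(1/2 :: ennreal) = ennreal (1/2)" using divide_ennreal[of 1 2] by simp
      have "ennreal (c / 2 * \<epsilon> powr N) = ennreal (1/2) * ennreal (c * \<epsilon> powr N)"
        using c by (subst ennreal_mult[symmetric]) auto
      also have "\<dots> \<le> (\<integral>\<^sup>+\<omega>. ?G \<omega> \<partial>NN) * emeasure prior (near_event \<epsilon>)"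
        using that Bl by (intro mult_mono) (auto simp: half not_less)
      also have "\<dots> = (\<integral>\<^sup>+\<omega>. ?G \<omega> * indicator (near_event \<epsilon>) \<omega> \<partial>prior)"
      proof -
        have dm: "a / b * b = a" if "b \<noteq> 0" "b \<noteq> \<infinity>" for a b :: ennreal
          using that by (simp add: ennreal_divide_times ennreal_divide_self less_top)
        show ?thesis unfolding NN_def nn_integral_uniform_measure[OF Fmm Bm] by (rule dm[OF B0 Bf])
      qed
      also have "\<dots> \<le> (\<integral>\<^sup>+\<omega>. ?G \<omega> \<partial>prior)" by (intro nn_integral_mono) (auto simp: indicator_def)
      finally show ?thesis .
    qed
    have Xm: "{X \<in> space ?QI. (\<integral>\<^sup>+\<omega>. (\<Prod>i = 1..n. r \<omega> (X i)) \<partial>NN) < 1/2} \<in> sets ?QI"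
    proof -
      interpret NN: prob_space NN by (rule pN)
      have comp: "(\<lambda>z. r (snd z) (fst z i)) \<in> borel_measurable (?QI \<Otimes>\<^sub>M NN)" if "i \<in> {1..n}" for i
      proof -
        have "(\<lambda>z. (snd z, fst z i)) \<in> ?QI \<Otimes>\<^sub>M NN \<rightarrow>\<^sub>M NN \<Otimes>\<^sub>M Q"
          using that by (intro measurable_Pair measurable_snd measurable_compose[OF measurable_fst] measurable_component_singleton) auto
        from measurable_compose[OF this rm'] show ?thesis by simp
      qed
      have "(\<lambda>z. \<Prod>i = 1..n. r (snd z) (fst z i)) \<in> borel_measurable (?QI \<Otimes>\<^sub>M NN)" by (intro borel_measurable_prod_ennreal comp)
      then have "(\<lambda>X. \<integral>\<^sup>+\<omega>. (\<Prod>i = 1..n. r \<omega> (X i)) \<partial>NN) \<in> borel_measurable ?QI"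
        using NN.borel_measurable_nn_integral[of "\<lambda>X \<omega>. \<Prod>i = 1..n. r \<omega> (X i)" ?QI] by (simp add: case_prod_beta')
      then show ?thesis by measurable
    qed
    have "measure ?QI {X \<in> space ?QI. (\<integral>\<^sup>+\<omega>. (\<Prod>i = 1..n. r \<omega> (X i)) \<partial>prior) < ennreal (c / 2 * \<epsilon> powr N)} \<le>
       measure ?QI {X \<in> space ?QI. (\<integral>\<^sup>+\<omega>. (\<Prod>i = 1..n. r \<omega> (X i)) \<partial>NN) < 1/2}"
      using ge by (intro QI.finite_measure_mono Xm) (auto simp: not_less[symmetric])
    also note ev
    finally show ?thesis by (simp add: power_mult_distrib mult_ac)
  qed
  show ?thesis
  proof (rule exI[of _ "c / 2"], rule conjI)
    show "\<exists>C\<ge>0. \<forall>n \<epsilon>. 0 < \<epsilon> \<longrightarrow> \<epsilon> \<le> 1 \<longrightarrow>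
     measure ?QI {X \<in> space ?QI. (\<integral>\<^sup>+\<omega>. (\<Prod>i = 1..n. dens \<omega> (X i) / ennreal (true_dens (X i))) \<partial>prior) <
          ennreal (c / 2 * \<epsilon> powr (real (K - 1) + \<alpha> + real (K * DIM('a))))} \<le> 4 * ((1 + C * \<epsilon>\<^sup>2) ^ n - 1)"
      using main m(1) unfolding r_def N_def by (intro exI[of _ "C\<^sup>2 * m"]) simp
  qed (use c in simp)
qed

end

subsection \<open>Posterior law of the allocations\<close>

lemma nn_integral_count_space_Suc:
  "(\<integral>\<^sup>+k. g k \<partial>count_space {1::nat..}) = (\<Sum>k. g (Suc k))"
proof -
  have "bij_betw Suc UNIV {1::nat..}" by (rule bij_betw_byWitness[where f' = "\<lambda>k. k - 1"]) auto
  then have "(\<integral>\<^sup>+k. g (Suc k) \<partial>count_space UNIV) = (\<integral>\<^sup>+k. g k \<partial>count_space {1::nat..})"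
    by (rule nn_integral_bij_count_space)
  then show ?thesis by (simp add: nn_integral_count_space_nat)
qed

text \<open>Distributivity of a finite product over infinite sums, read off from the product
  integral for counting measures. It expresses the independence of the labels.\<close>

lemma nn_integral_count_space_PiE:
  fixes u :: "nat \<Rightarrow> nat \<Rightarrow> ennreal"
  shows "(\<integral>\<^sup>+k. (\<Prod>i = 1..n. u i (k i)) \<partial>count_space ({1..n} \<rightarrow>\<^sub>E {1::nat..})) = (\<Prod>i = 1..n. \<integral>\<^sup>+j. u i j \<partial>count_space {1::nat..})"
proof -
  interpret product_sigma_finite "\<lambda>_::nat. count_space {1::nat..}"
    by (intro product_sigma_finite.intro sigma_finite_measure_count_space_countable countableI_type)
  have "PiM {1..n} (\<lambda>_::nat. count_space {1::nat..}) = count_space ({1..n} \<rightarrow>\<^sub>E {1::nat..})"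
    by (rule count_space_PiM_finite) auto
  then show ?thesis using product_nn_integral_prod[of "{1..n}" u] by simp
qed

lemma mixture_atomic_measure:
  fixes f :: "'a::euclidean_space \<Rightarrow> real"
  assumes f: "f \<in> borel_measurable borel" "\<And>x. 0 \<le> f x"
  shows "mixture f (atomic_measure I w \<theta>) x = enn2real (\<integral>\<^sup>+k. ennreal (w k) * ennreal (f (x - \<theta> k)) \<partial>count_space I)"
proof -
  have m: "\<theta> \<in> measurable (point_measure I (\<lambda>k. ennreal (w k))) borel"
    by (simp add: measurable_def sets_point_measure space_point_measure)
  have "mixture f (atomic_measure I w \<theta>) x = (\<integral>k. f (x - \<theta> k) \<partial>point_measure I (\<lambda>k. ennreal (w k)))"
    unfolding mixture_def atomic_measure_def by (rule integral_distr[OF m]) (use f in measurable)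
  also have "\<dots> = enn2real (\<integral>\<^sup>+k. ennreal (f (x - \<theta> k)) \<partial>point_measure I (\<lambda>k. ennreal (w k)))"
    by (rule integral_eq_nn_integral) (auto simp: measurable_def sets_point_measure space_point_measure f)
  also have "(\<integral>\<^sup>+k. ennreal (f (x - \<theta> k)) \<partial>point_measure I (\<lambda>k. ennreal (w k))) =
      (\<integral>\<^sup>+k. ennreal (w k) * ennreal (f (x - \<theta> k)) \<partial>count_space I)"
    unfolding point_measure_def by (rule nn_integral_density) auto
  finally show ?thesis .
qed

lemma exp_moment_bound:
  assumes M: "prob_space M" and g: "g \<in> borel_measurable M" and B: "\<And>x. \<bar>g x\<bar> \<le> B" "B > 0"
    and s: "\<bar>s\<bar> * (2 * B) \<le> 1"
  shows "(\<integral>\<^sup>+x. ennreal (exp (s * (g x - (\<integral>x. g x \<partial>M)))) \<partial>M) \<le> ennreal (exp (4 * s\<^sup>2 * B\<^sup>2))"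
proof -
  interpret prob_space M by fact
  define \<mu> where "\<mu> = (\<integral>x. g x \<partial>M)"
  have gi: "integrable M g" using B by (intro integrable_const_bound[where B = B] AE_I2 g) auto
  have mb: "\<bar>\<mu>\<bar> \<le> B"
  proof -
    have "\<bar>\<mu>\<bar> \<le> (\<integral>x. \<bar>g x\<bar> \<partial>M)" unfolding \<mu>_def by (rule integral_abs_bound)
    also have "\<dots> \<le> (\<integral>x. B \<partial>M)" using gi B by (intro integral_mono) auto
    finally show ?thesis by (simp add: prob_space)
  qed
  have y1: "\<bar>s * (g x - \<mu>)\<bar> \<le> \<bar>s\<bar> * (2 * B)" for x
    unfolding abs_mult using B(1)[of x] mb by (intro mult_left_mono) auto
  \<comment> \<open>\<open>exp y \<le> 1 + y + y\<^sup>2\<close> for \<open>y\<close> of absolute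
    value at most 1; after centring, the linear term integrates to 0.\<close>
  have pt: "exp (s * (g x - \<mu>)) \<le> 1 + s * (g x - \<mu>) + 4 * s\<^sup>2 * B\<^sup>2" for x
  proof -
    define y where "y = s * (g x - \<mu>)"
    have ya: "\<bar>y\<bar> \<le> 1" using y1[of x] s unfolding y_def by linarith
    have "exp y \<le> 1 + y + y\<^sup>2"
    proof (cases "0 \<le> y")
      case True
      then show ?thesis using ya by (intro exp_bound) auto
    next
      case False
      have "exp y \<le> 1 / (1 - y)"
      proof -
        have "1 - y \<le> exp (- y)" using exp_ge_add_one_self[of "- y"] by simp
        then show ?thesis using False by (simp add: exp_minus field_simps)
      qed
      also have "\<dots> \<le> 1 + y + y\<^sup>2"
      proof -
        have "(1 + y + y\<^sup>2) * (1 - y) = 1 - y ^ 3" by (simp add: power2_eq_square power3_eq_cube algebra_simps)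
        moreover have "y ^ 3 \<le> 0" using False by (simp add: power3_eq_cube mult_nonneg_nonpos zero_le_mult_iff)
        ultimately show ?thesis using False by (simp add: pos_divide_le_eq)
      qed
      finally show ?thesis .
    qed
    moreover have "y\<^sup>2 \<le> (\<bar>s\<bar> * (2 * B))\<^sup>2" using power_mono[OF y1[of x], of 2] unfolding y_def by simp
    moreover have "(\<bar>s\<bar> * (2 * B))\<^sup>2 = 4 * s\<^sup>2 * B\<^sup>2" by (simp add: power_mult_distrib)
    ultimately show ?thesis unfolding y_def by linarith
  qed
  have i: "integrable M (\<lambda>x. 1 + s * (g x - \<mu>) + 4 * s\<^sup>2 * B\<^sup>2)" using gi by auto
  have "(\<integral>\<^sup>+x. ennreal (exp (s * (g x - \<mu>))) \<partial>M) \<le> (\<integral>\<^sup>+x. ennreal (1 + s * (g x - \<mu>) + 4 * s\<^sup>2 * B\<^sup>2) \<partial>M)"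
    by (intro nn_integral_mono ennreal_leI pt)
  also have "\<dots> = ennreal (\<integral>x. 1 + s * (g x - \<mu>) + 4 * s\<^sup>2 * B\<^sup>2 \<partial>M)"
    by (rule nn_integral_eq_integral[OF i]) (intro AE_I2 order_trans[OF _ pt], simp)
  also have "(\<integral>x. 1 + s * (g x - \<mu>) + 4 * s\<^sup>2 * B\<^sup>2 \<partial>M) = 1 + 4 * s\<^sup>2 * B\<^sup>2"
    using gi by (simp add: prob_space \<mu>_def[symmetric])
  also have "ennreal (1 + 4 * s\<^sup>2 * B\<^sup>2) \<le> ennreal (exp (4 * s\<^sup>2 * B\<^sup>2))" by (intro ennreal_leI exp_ge_add_one_self)
  finally show ?thesis by (simp only: \<mu>_def)
qed

text \<open>The product of the ratios changes the law of the first \<open>n\<close> observations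
  from \<open>Q\<close> to \<open>M\<close>. So this is an exponential Markov bound under
  \<open>M\<close>, for data whose sum of \<open>g\<close> is off its mean by at least
  \<open>n * \<tau>\<close>; \<open>\<sigma>\<close> is the side of the deviation. \<open>E\<close>
  enters through its indicator and a pointwise inequality only.\<close>

lemma chernoff_product:
  fixes r :: "'x \<Rightarrow> ennreal"
  assumes Q: "prob_space Q" and r: "r \<in> borel_measurable Q" and M: "prob_space M" and MQ: "M = density Q r"
    and g: "g \<in> borel_measurable Q" and B: "\<And>x. \<bar>g x\<bar> \<le> B" "B > 0" and \<tau>: "0 < \<tau>" "\<tau> \<le> B"
    and \<sigma>: "\<bar>\<sigma>\<bar> = 1" and E: "\<And>X. X \<in> E \<Longrightarrow> real n * \<tau> \<le> \<sigma> * ((\<Sum>i = 1..n. g (X i)) - real n * (\<integral>x. g x \<partial>M))"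
  shows "(\<integral>\<^sup>+X. indicator E X * (\<Prod>i = 1..n. r (X i)) \<partial>(\<Pi>\<^sub>M i\<in>{1::nat..}. Q)) \<le> ennreal (exp (- (real n * \<tau>\<^sup>2 / (16 * B\<^sup>2))))"
proof -
  define \<mu> where "\<mu> = (\<integral>x. g x \<partial>M)"
  \<comment> \<open>Minimiser of \<open>- s * \<tau> + 4 * s\<^sup>2 * B\<^sup>2\<close>. The
    assumption \<open>\<tau> \<le> B\<close> keeps it in the range of the exponential moment
    bound.\<close>
  define s where "s = \<tau> / (8 * B\<^sup>2)"
  have s0: "s > 0" using \<tau> B by (simp add: s_def)
  have s2: "\<bar>\<sigma> * s\<bar> * (2 * B) \<le> 1"
  proof -
    have "s * (2 * B) = \<tau> / (4 * B)" using B by (simp add: s_def power2_eq_square)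
    also have "\<dots> \<le> 1" using \<tau> B by simp
    finally show ?thesis using \<sigma> s0 by (simp add: abs_mult)
  qed
  have sq: "(\<sigma> * s)\<^sup>2 = s\<^sup>2"
  proof -
    have "(\<sigma> * s)\<^sup>2 = \<bar>\<sigma>\<bar>\<^sup>2 * s\<^sup>2" by (simp add: power_mult_distrib)
    then show ?thesis using \<sigma> by simp
  qed
  have gM: "g \<in> borel_measurable M" unfolding MQ using g by simp
  define e where "e x = ennreal (exp (\<sigma> * s * (g x - \<mu>)))" for x
  have em: "e \<in> borel_measurable Q" unfolding e_def using g by measurable
  have "(\<integral>\<^sup>+x. r x * e x \<partial>Q) = (\<integral>\<^sup>+x. e x \<partial>M)" unfolding MQ by (rule nn_integral_density[OF r em, symmetric])
  also have "\<dots> \<le> ennreal (exp (4 * (\<sigma> * s)\<^sup>2 * B\<^sup>2))"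
    unfolding e_def \<mu>_def by (rule exp_moment_bound[OF M gM B s2])
  finally have re: "(\<integral>\<^sup>+x. r x * e x \<partial>Q) \<le> ennreal (exp (4 * s\<^sup>2 * B\<^sup>2))" by (simp only: sq)
  have "(\<integral>\<^sup>+X. indicator E X * (\<Prod>i = 1..n. r (X i)) \<partial>(\<Pi>\<^sub>M i\<in>{1::nat..}. Q)) \<le>
     (\<integral>\<^sup>+X. ennreal (exp (- (s * (real n * \<tau>)))) * (\<Prod>i = 1..n. r (X i) * e (X i)) \<partial>(\<Pi>\<^sub>M i\<in>{1::nat..}. Q))"
  proof (rule nn_integral_mono)
    fix X
    show "indicator E X * (\<Prod>i = 1..n. r (X i)) \<le> ennreal (exp (- (s * (real n * \<tau>)))) * (\<Prod>i = 1..n. r (X i) * e (X i))"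
    proof (cases "X \<in> E")
      case True
      have "(\<Prod>i = 1..n. e (X i)) = ennreal (\<Prod>i = 1..n. exp (\<sigma> * s * (g (X i) - \<mu>)))" unfolding e_def by (intro prod_ennreal) simp
      also have "(\<Prod>i = 1..n. exp (\<sigma> * s * (g (X i) - \<mu>))) = exp (s * (\<sigma> * ((\<Sum>i = 1..n. g (X i)) - real n * \<mu>)))"
        by (simp add: exp_sum[symmetric] sum_distrib_left[symmetric] sum_subtractf mult_ac)
      finally have pe: "(\<Prod>i = 1..n. e (X i)) = ennreal (exp (s * (\<sigma> * ((\<Sum>i = 1..n. g (X i)) - real n * \<mu>))))" .
      have "s * (real n * \<tau>) \<le> s * (\<sigma> * ((\<Sum>i = 1..n. g (X i)) - real n * \<mu>))"
        using E[OF True] s0 unfolding \<mu>_def by (intro mult_left_mono) auto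
      then have "1 \<le> exp (- (s * (real n * \<tau>))) * exp (s * (\<sigma> * ((\<Sum>i = 1..n. g (X i)) - real n * \<mu>)))"
        by (simp add: exp_add[symmetric])
      then have "1 \<le> ennreal (exp (- (s * (real n * \<tau>)))) * (\<Prod>i = 1..n. e (X i))"
        unfolding pe by (subst ennreal_mult[symmetric]) auto
      then have "(\<Prod>i = 1..n. r (X i)) * 1 \<le> (\<Prod>i = 1..n. r (X i)) * (ennreal (exp (- (s * (real n * \<tau>)))) * (\<Prod>i = 1..n. e (X i)))"
        by (rule mult_left_mono) simp
      then show ?thesis using True by (simp add: prod.distrib mult_ac)
    qed simp
  qed
  also have "\<dots> = ennreal (exp (- (s * (real n * \<tau>)))) * (\<integral>\<^sup>+X. (\<Prod>i = 1..n. r (X i) * e (X i)) \<partial>(\<Pi>\<^sub>M i\<in>{1::nat..}. Q))"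
  proof (rule nn_integral_cmult, intro borel_measurable_prod_ennreal)
    fix i assume "i \<in> {1..n}"
    then have "(\<lambda>X. X i) \<in> (\<Pi>\<^sub>M i\<in>{1::nat..}. Q) \<rightarrow>\<^sub>M Q" by (intro measurable_component_singleton) auto
    then show "(\<lambda>X. r (X i) * e (X i)) \<in> borel_measurable (\<Pi>\<^sub>M i\<in>{1::nat..}. Q)"
      by (intro borel_measurable_times_ennreal measurable_compose[OF _ r] measurable_compose[OF _ em])
  qed
  also have "\<dots> = ennreal (exp (- (s * (real n * \<tau>)))) * (\<integral>\<^sup>+x. r x * e x \<partial>Q) ^ n"
    by (subst nn_integral_iid_prod[OF Q]) (intro borel_measurable_times_ennreal r em, simp)
  also have "\<dots> \<le> ennreal (exp (- (s * (real n * \<tau>)))) * ennreal (exp (4 * s\<^sup>2 * B\<^sup>2)) ^ n"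
    by (intro mult_left_mono power_mono re) auto
  also have "\<dots> = ennreal (exp (- (s * (real n * \<tau>))) * exp (4 * s\<^sup>2 * B\<^sup>2) ^ n)"
    by (simp add: ennreal_power ennreal_mult)
  also have "exp (- (s * (real n * \<tau>))) * exp (4 * s\<^sup>2 * B\<^sup>2) ^ n = exp (- (real n * \<tau>\<^sup>2 / (16 * B\<^sup>2)))"
  proof -
    have "exp (4 * s\<^sup>2 * B\<^sup>2) ^ n = exp (real n * (4 * s\<^sup>2 * B\<^sup>2))" by (rule exp_of_nat_mult[symmetric])
    moreover have "- (s * (real n * \<tau>)) + real n * (4 * s\<^sup>2 * B\<^sup>2) = - (real n * \<tau>\<^sup>2 / (16 * B\<^sup>2))"
      using B by (simp add: s_def power2_eq_square field_simps)
    ultimately show ?thesis by (simp add: exp_add[symmetric])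
  qed
  finally show ?thesis .
qed

context dpm
begin

section \<open>Posterior masses as quotients of nonnegative integrals\<close>

lemma mixture_dirichlet: "mixture f (dirichlet_process \<omega>) x = enn2real (dens \<omega> x)"
  unfolding dirichlet_process_def dens_def case_prod_beta'
  by (subst mixture_atomic_measure[OF f_meas less_imp_le[OF f_pos]]) (simp only: nn_integral_count_space_Suc)

lemma mixture_true: "mixture f (atomic_measure {1..K} ws ts) x = true_dens x"
proof -
  have "(\<integral>\<^sup>+k. ennreal (ws k) * ennreal (f (x - ts k)) \<partial>count_space {1..K}) = (\<Sum>k = 1..K. ennreal (ws k) * ennreal (f (x - ts k)))"
    by (rule nn_integral_count_space_finite) simp
  also have "\<dots> = (\<Sum>k = 1..K. ennreal (ws k * f (x - ts k)))"
    using ws_pos f_pos by (intro sum.cong refl ennreal_mult[symmetric]) (auto intro: less_imp_le)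
  also have "\<dots> = ennreal (true_dens x)"
    unfolding true_dens_def using ws_pos f_pos by (intro sum_ennreal mult_nonneg_nonneg) (auto intro: less_imp_le)
  finally show ?thesis using true_dens_pos[of x] by (simp add: mixture_atomic_measure f_pos less_imp_le)
qed

lemma dens_le: "regular \<omega> \<Longrightarrow> dens \<omega> x \<le> ennreal F"
proof -
  assume r: "regular \<omega>"
  have "dens \<omega> x \<le> (\<Sum>k. ennreal (stick_weight (fst \<omega>) (Suc k)) * ennreal F)"
    unfolding dens_def using f_lt by (intro suminf_le mult_left_mono ennreal_leI) (auto intro: less_imp_le)
  also have "\<dots> = ennreal F" using ennreal_suminf_multc[of "\<lambda>k. ennreal (stick_weight (fst \<omega>) (Suc k))" "ennreal F"]
    by (simp add: regular_weight_suminf_ennreal[OF r])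
  finally show ?thesis .
qed

definition atom_term :: "(nat \<Rightarrow> real) \<times> (nat \<Rightarrow> 'a) \<Rightarrow> nat \<Rightarrow> 'a \<Rightarrow> ennreal" where
  "atom_term \<omega> k x = ennreal (stick_weight (fst \<omega>) k) * ennreal (f (x - snd \<omega> k))"

lemma dens_eq: "dens \<omega> x = (\<integral>\<^sup>+k. atom_term \<omega> k x \<partial>count_space {1..})"
  by (simp only: nn_integral_count_space_Suc dens_def atom_term_def)

lemma atom_term_measurable: "(\<lambda>z. atom_term (fst z) k (snd z)) \<in> borel_measurable (prior \<Otimes>\<^sub>M borel)"
  unfolding atom_term_def
  by (intro borel_measurable_times_ennreal kernel_measurable measurable_compose[OF _ measurable_ennreal] measurable_compose[OF measurable_fst weight_measurable])

definition num :: "nat \<Rightarrow> (nat \<Rightarrow> 'a) \<Rightarrow> (nat \<Rightarrow> nat) \<Rightarrow> ennreal" where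
  "num n X k = (\<integral>\<^sup>+\<omega>. (\<Prod>i = 1..n. atom_term \<omega> (k i) (X i)) \<partial>prior)"

definition den :: "nat \<Rightarrow> (nat \<Rightarrow> 'a) \<Rightarrow> ennreal" where
  "den n X = (\<integral>\<^sup>+\<omega>. (\<Prod>i = 1..n. dens \<omega> (X i)) \<partial>prior)"

lemma sigma_finite_prior: "sigma_finite_measure prior"
  by (rule prob_space_imp_sigma_finite[OF prob_prior])

lemma F_pos: "F > 0"
  using fF[of 0] by linarith

lemma den_le: "den n X \<le> ennreal (F ^ n)"
proof -
  have "den n X \<le> (\<integral>\<^sup>+\<omega>. ennreal (F ^ n) \<partial>prior)"
    unfolding den_def
  proof (rule nn_integral_mono_AE, use AE_regular in eventually_elim)
    case (elim \<omega>)
    have "(\<Prod>i = 1..n. dens \<omega> (X i)) \<le> (\<Prod>i = 1..n. ennreal F)" by (intro prod_mono_ennreal dens_le elim)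
    also have "\<dots> = ennreal (F ^ n)" using F_pos by (simp add: ennreal_power)
    finally show ?case .
  qed
  then show ?thesis by (simp only: nn_integral_const prob_space.emeasure_space_1[OF prob_prior] mult_1_right)
qed

text \<open>Passage from real integrals to nonnegative ones, where Tonelli is available without
  integrability. It rests on the almost sure nonnegativity of the weights and on the finiteness of
  the mixture density for regular \<open>\<omega>\<close>.\<close>

lemma allocation_mass_eq:
  assumes k: "k \<in> {1..n} \<rightarrow>\<^sub>E {1..}"
  shows "allocation_mass f \<alpha> P0 n X k = enn2real (num n X k) / enn2real (den n X)"
proof -
  have sp: "stick_breaking_prior \<alpha> P0 = prior" by (simp only: stick_breaking_prior_def)
  have am: "(\<lambda>\<omega>. f (X i - snd \<omega> j)) \<in> borel_measurable prior" for i j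
    by (rule measurable_compose[OF _ f_meas]) (intro borel_measurable_diff component_measurable borel_measurable_const)
  have "(\<integral>(v, \<theta>). (\<Prod>i = 1..n. stick_weight v (k i) * f (X i - \<theta> (k i))) \<partial>prior) =
     (\<integral>\<omega>. (\<Prod>i = 1..n. stick_weight (fst \<omega>) (k i) * f (X i - snd \<omega> (k i))) \<partial>prior)"
    by (simp add: case_prod_beta')
  also have "\<dots> = enn2real (\<integral>\<^sup>+\<omega>. ennreal (\<Prod>i = 1..n. stick_weight (fst \<omega>) (k i) * f (X i - snd \<omega> (k i))) \<partial>prior)"
  proof (rule integral_eq_nn_integral)
    show "(\<lambda>\<omega>. \<Prod>i = 1..n. stick_weight (fst \<omega>) (k i) * f (X i - snd \<omega> (k i))) \<in> borel_measurable prior"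
      by (intro borel_measurable_prod borel_measurable_times weight_measurable am)
    show "AE \<omega> in prior. 0 \<le> (\<Prod>i = 1..n. stick_weight (fst \<omega>) (k i) * f (X i - snd \<omega> (k i)))"
      using AE_regular
    proof eventually_elim
      case (elim \<omega>)
      have "0 < stick_weight (fst \<omega>) (k i)" if "i \<in> {1..n}" for i
        using PiE_mem[OF k that] by (intro regular_weight_pos[OF elim]) simp
      then show ?case using f_pos by (intro prod_nonneg mult_nonneg_nonneg) (blast intro: less_imp_le)+
    qed
  qed
  also have "(\<integral>\<^sup>+\<omega>. ennreal (\<Prod>i = 1..n. stick_weight (fst \<omega>) (k i) * f (X i - snd \<omega> (k i))) \<partial>prior) = num n X k"
    unfolding num_def
  proof (rule nn_integral_cong_AE, use AE_regular in eventually_elim)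
    case (elim \<omega>)
    have w: "0 \<le> stick_weight (fst \<omega>) (k i)" if "i \<in> {1..n}" for i
      using PiE_mem[OF k that] by (intro less_imp_le[OF regular_weight_pos[OF elim]]) simp
    have "(\<Prod>i = 1..n. atom_term \<omega> (k i) (X i)) = (\<Prod>i = 1..n. ennreal (stick_weight (fst \<omega>) (k i) * f (X i - snd \<omega> (k i))))"
      unfolding atom_term_def using w f_pos by (intro prod.cong refl ennreal_mult[symmetric]) (auto intro: less_imp_le)
    also have "\<dots> = ennreal (\<Prod>i = 1..n. stick_weight (fst \<omega>) (k i) * f (X i - snd \<omega> (k i)))"
      using w f_pos by (intro prod_ennreal mult_nonneg_nonneg) (auto intro: less_imp_le)
    finally show ?case by simp
  qed
  finally have A: "(\<integral>(v, \<theta>). (\<Prod>i = 1..n. stick_weight v (k i) * f (X i - \<theta> (k i))) \<partial>prior) = enn2real (num n X k)" .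
  have dm: "(\<lambda>\<omega>. dens \<omega> x) \<in> borel_measurable prior" for x
    using measurable_compose[OF measurable_Pair2'[of x borel prior] dens_measurable] by simp
  have "(\<integral>\<omega>. (\<Prod>i = 1..n. mixture f (dirichlet_process \<omega>) (X i)) \<partial>prior) =
     enn2real (\<integral>\<^sup>+\<omega>. ennreal (\<Prod>i = 1..n. enn2real (dens \<omega> (X i))) \<partial>prior)"
    unfolding mixture_dirichlet
  proof (rule integral_eq_nn_integral)
    show "(\<lambda>\<omega>. \<Prod>i = 1..n. enn2real (dens \<omega> (X i))) \<in> borel_measurable prior"
      by (intro borel_measurable_prod borel_measurable_enn2real[OF dm])
    show "AE \<omega> in prior. 0 \<le> (\<Prod>i = 1..n. enn2real (dens \<omega> (X i)))" by (intro AE_I2 prod_nonneg) simp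
  qed
  also have "(\<integral>\<^sup>+\<omega>. ennreal (\<Prod>i = 1..n. enn2real (dens \<omega> (X i))) \<partial>prior) = den n X"
    unfolding den_def
  proof (rule nn_integral_cong_AE, use AE_regular in eventually_elim)
    case (elim \<omega>)
    have "dens \<omega> (X i) < top" for i using dens_le[OF elim, of "X i"] by (rule le_less_trans) simp
    then have "(\<Prod>i = 1..n. dens \<omega> (X i)) = (\<Prod>i = 1..n. ennreal (enn2real (dens \<omega> (X i))))" by (intro prod.cong) auto
    also have "\<dots> = ennreal (\<Prod>i = 1..n. enn2real (dens \<omega> (X i)))" by (intro prod_ennreal) simp
    finally show ?case by simp
  qed
  finally show ?thesis unfolding allocation_mass_def sp A by simp
qed

abbreviation "QI \<equiv> \<Pi>\<^sub>M i\<in>{1::nat..}. Q"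

lemma prob_QI: "prob_space QI"
  by (intro prob_space_PiM prob_Q)

lemma coordinate_measurable: "i \<ge> 1 \<Longrightarrow> (\<lambda>X. X i) \<in> QI \<rightarrow>\<^sub>M borel"
  using measurable_component_singleton[of i "{1..}" "\<lambda>_. Q"] by (simp cong: measurable_cong_sets)

lemma pair_coordinate_measurable:
  assumes h: "(\<lambda>z. h (fst z) (snd z)) \<in> borel_measurable (prior \<Otimes>\<^sub>M borel)" and i: "i \<ge> 1"
  shows "(\<lambda>z. h (snd z) (fst z i)) \<in> borel_measurable (QI \<Otimes>\<^sub>M prior)"
proof -
  have "(\<lambda>z. (snd z, fst z i)) \<in> QI \<Otimes>\<^sub>M prior \<rightarrow>\<^sub>M prior \<Otimes>\<^sub>M borel"
    by (intro measurable_Pair measurable_snd measurable_compose[OF measurable_fst coordinate_measurable[OF i]])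
  from measurable_compose[OF this h] show ?thesis by simp
qed

lemma prod_atom_measurable:
  "(\<lambda>z. \<Prod>i = 1..n. atom_term (snd z) (k i) (fst z i)) \<in> borel_measurable (QI \<Otimes>\<^sub>M prior)"
  by (intro borel_measurable_prod_ennreal pair_coordinate_measurable[where h = "\<lambda>\<omega> x. atom_term \<omega> _ x"] atom_term_measurable) auto

lemma num_measurable: "(\<lambda>X. num n X k) \<in> borel_measurable QI"
proof -
  show ?thesis unfolding num_def
    using sigma_finite_measure.borel_measurable_nn_integral[OF sigma_finite_prior, of "\<lambda>X \<omega>. \<Prod>i = 1..n. atom_term \<omega> (k i) (X i)" QI] prod_atom_measurable[of k n]
    by (simp add: case_prod_beta')
qed

lemma den_measurable: "den n \<in> borel_measurable QI"
proof -
  have "(\<lambda>z. \<Prod>i = 1..n. dens (snd z) (fst z i)) \<in> borel_measurable (QI \<Otimes>\<^sub>M prior)"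
    by (intro borel_measurable_prod_ennreal pair_coordinate_measurable[where h = dens] dens_measurable) auto
  then show ?thesis unfolding den_def
    using sigma_finite_measure.borel_measurable_nn_integral[OF sigma_finite_prior, of "\<lambda>X \<omega>. \<Prod>i = 1..n. dens \<omega> (X i)" QI]
    by (simp add: case_prod_beta')
qed

definition post_num :: "nat \<Rightarrow> (nat \<Rightarrow> nat) set \<Rightarrow> (nat \<Rightarrow> 'a) \<Rightarrow> ennreal" where
  "post_num n E X = (\<integral>\<^sup>+k. num n X k * indicator E k \<partial>count_space ({1..n} \<rightarrow>\<^sub>E {1..}))"

lemma countable_allocations: "countable ({1..n::nat} \<rightarrow>\<^sub>E {1::nat..})"
  by (intro countable_PiE) auto

lemma emeasure_posterior:
  assumes E: "E \<subseteq> {1..n} \<rightarrow>\<^sub>E {1..}"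
  shows "emeasure (allocation_posterior f \<alpha> P0 n X) E =
    (\<integral>\<^sup>+k. ennreal (enn2real (num n X k) / enn2real (den n X)) * indicator E k \<partial>count_space ({1..n} \<rightarrow>\<^sub>E {1..}))"
proof -
  have "emeasure (allocation_posterior f \<alpha> P0 n X) E =
     (\<integral>\<^sup>+k. ennreal (allocation_mass f \<alpha> P0 n X k) * indicator E k \<partial>count_space ({1..n} \<rightarrow>\<^sub>E {1..}))"
    unfolding allocation_posterior_def point_measure_def using E by (intro emeasure_density) auto
  also have "\<dots> = (\<integral>\<^sup>+k. ennreal (enn2real (num n X k) / enn2real (den n X)) * indicator E k \<partial>count_space ({1..n} \<rightarrow>\<^sub>E {1..}))"
    by (intro nn_integral_cong) (simp add: allocation_mass_eq)
  finally show ?thesis .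
qed

text \<open>The label vectors form a countable set, so joint measurability in labels and data
  reduces to measurability in the data for each fixed label vector.\<close>

lemma posterior_measurable:
  assumes E: "E \<subseteq> {1..n} \<rightarrow>\<^sub>E {1..}"
  shows "(\<lambda>X. measure (allocation_posterior f \<alpha> P0 n X) E) \<in> borel_measurable QI"
proof -
  interpret C: sigma_finite_measure "count_space ({1..n::nat} \<rightarrow>\<^sub>E {1::nat..})"
    by (rule sigma_finite_measure_count_space_countable[OF countable_allocations])
  have m: "(\<lambda>X. ennreal (enn2real (num n X k) / enn2real (den n X)) * indicator E k) \<in> borel_measurable QI" for k
    by (intro borel_measurable_times_ennreal borel_measurable_const measurable_compose[OF _ measurable_ennreal]
      borel_measurable_divide borel_measurable_enn2real[OF num_measurable] borel_measurable_enn2real[OF den_measurable])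
  have "(\<lambda>z. ennreal (enn2real (num n (snd z) (fst z)) / enn2real (den n (snd z))) * indicator E (fst z))
      \<in> borel_measurable (count_space ({1..n} \<rightarrow>\<^sub>E {1..}) \<Otimes>\<^sub>M QI)"
    by (rule measurable_pair_measure_countable1[OF countable_allocations]) (simp only: fst_conv snd_conv m)
  from measurable_pair_swap[OF this]
  have "(\<lambda>X. \<integral>\<^sup>+k. ennreal (enn2real (num n X k) / enn2real (den n X)) * indicator E k \<partial>count_space ({1..n} \<rightarrow>\<^sub>E {1..})) \<in> borel_measurable QI"
    unfolding fst_conv snd_conv by (rule C.borel_measurable_nn_integral)
  from borel_measurable_enn2real[OF this] show ?thesis
    unfolding measure_def emeasure_posterior[OF E] .
qed

lemma posterior_le:
  assumes E: "E \<subseteq> {1..n} \<rightarrow>\<^sub>E {1..}" and d: "den n X > 0" and \<epsilon>: "\<epsilon> > 0" and y: "measure (allocation_posterior f \<alpha> P0 n X) E > \<epsilon>"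
  shows "ennreal \<epsilon> * den n X \<le> post_num n E X"
proof -
  have df: "den n X < top" using den_le[of n X] by (rule le_less_trans) simp
  then have dr: "den n X = ennreal (enn2real (den n X))" "0 < enn2real (den n X)" using d by (auto simp: enn2real_positive_iff)
  have "ennreal \<epsilon> \<le> ennreal (measure (allocation_posterior f \<alpha> P0 n X) E)" using y by (intro ennreal_leI) simp
  \<comment> \<open>If the extended measure were infinite, \<open>measure\<close> would return 0;
    the inequality in this direction holds in either case.\<close>
  also have "\<dots> \<le> emeasure (allocation_posterior f \<alpha> P0 n X) E"
    unfolding measure_def by (cases "emeasure (allocation_posterior f \<alpha> P0 n X) E") auto
  finally have "ennreal \<epsilon> * den n X \<le> emeasure (allocation_posterior f \<alpha> P0 n X) E * den n X" by (rule mult_right_mono) simp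
  also have "\<dots> = (\<integral>\<^sup>+k. ennreal (enn2real (num n X k) / enn2real (den n X)) * indicator E k * den n X \<partial>count_space ({1..n} \<rightarrow>\<^sub>E {1..}))"
    unfolding emeasure_posterior[OF E] by (rule nn_integral_multc[symmetric]) simp
  also have "\<dots> \<le> post_num n E X" unfolding post_num_def
  proof (rule nn_integral_mono)
    fix k
    have "ennreal (enn2real (num n X k) / enn2real (den n X)) * den n X = ennreal (enn2real (num n X k) / enn2real (den n X) * enn2real (den n X))"
      by (subst dr(1), subst ennreal_mult) auto
    also have "\<dots> = ennreal (enn2real (num n X k))" using dr(2) by simp
    also have "\<dots> \<le> num n X k" by (cases "num n X k") auto
    finally show "ennreal (enn2real (num n X k) / enn2real (den n X)) * indicator E k * den n X \<le> num n X k * indicator E k"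
      by (auto simp: indicator_def)
  qed
  finally show ?thesis .
qed

definition lik :: "nat \<Rightarrow> (nat \<Rightarrow> 'a) \<Rightarrow> ennreal" where
  "lik n X = (\<Prod>i = 1..n. ennreal (true_dens (X i)))"

text \<open>Given \<open>\<omega>\<close>, the probability that the data lie in \<open>G\<close> and
  the labels in \<open>E\<close>, when the first \<open>n\<close> observations follow the model and
  all later ones the truth: dividing by \<open>true_dens\<close> before integrating under the truth
  amounts to integrating against Lebesgue measure.\<close>

definition alloc_prob :: "nat \<Rightarrow> (nat \<Rightarrow> 'a) set \<Rightarrow> (nat \<Rightarrow> nat) set \<Rightarrow> (nat \<Rightarrow> real) \<times> (nat \<Rightarrow> 'a) \<Rightarrow> ennreal" where
  "alloc_prob n G E \<omega> = (\<integral>\<^sup>+k. (\<integral>\<^sup>+X. indicator G X * (\<Prod>i = 1..n. atom_term \<omega> (k i) (X i) / ennreal (true_dens (X i))) \<partial>QI) * indicator E k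
      \<partial>count_space ({1..n} \<rightarrow>\<^sub>E {1..}))"

lemma ratio_measurable: "(\<lambda>z. atom_term (fst z) k (snd z) / ennreal (true_dens (snd z))) \<in> borel_measurable (prior \<Otimes>\<^sub>M borel)"
  by (intro borel_measurable_divide_ennreal atom_term_measurable measurable_compose[OF measurable_snd measurable_compose[OF true_dens_meas measurable_ennreal]])

lemma prod_ratio_measurable:
  "(\<lambda>z. \<Prod>i = 1..n. atom_term (snd z) (k i) (fst z i) / ennreal (true_dens (fst z i))) \<in> borel_measurable (QI \<Otimes>\<^sub>M prior)"
  by (intro borel_measurable_prod_ennreal pair_coordinate_measurable[where h = "\<lambda>\<omega> x. atom_term \<omega> _ x / ennreal (true_dens x)"] ratio_measurable) auto

lemma prod_divide_lik: "(\<Prod>i = 1..n. a i / ennreal (true_dens (X i))) = (\<Prod>i = 1..n. a i) / lik n X"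
proof (induction n)
  case (Suc n)
  have "a / ennreal s * (b / ennreal t) = a * b / (ennreal s * ennreal t)" if "s > 0" "t > 0" for a b s t
    using that by (simp add: divide_ennreal_def ennreal_mult[symmetric] inverse_ennreal mult_ac)
  moreover have "lik n X = ennreal (\<Prod>i = 1..n. true_dens (X i))" unfolding lik_def using true_dens_pos by (intro prod_ennreal) (auto intro: less_imp_le)
  moreover have "0 < (\<Prod>i = 1..n. true_dens (X i))" using true_dens_pos by (intro prod_pos) auto
  ultimately show ?case using Suc true_dens_pos[of "X (Suc n)"] by (simp add: lik_def mult.commute)
qed (simp add: lik_def)

text \<open>Tonelli moves the data integral inside the prior integral. Thus the expected numerator,
  relative to the true likelihood, is a prior average of model probabilities, which can be bounded
  for one \<open>\<omega>\<close> at a time.\<close>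

lemma nn_integral_post_num:
  assumes G: "G \<in> sets QI"
  shows "(\<integral>\<^sup>+X. indicator G X * (post_num n E X / lik n X) \<partial>QI) = (\<integral>\<^sup>+\<omega>. alloc_prob n G E \<omega> \<partial>prior)"
proof -
  interpret QQ: prob_space QI by (rule prob_QI)
  interpret pp: pair_sigma_finite QI prior by (intro pair_sigma_finite.intro QQ.sigma_finite_measure_axioms sigma_finite_prior)
  let ?C = "count_space ({1..n::nat} \<rightarrow>\<^sub>E {1::nat..})"
  let ?R = "\<lambda>\<omega> k X. \<Prod>i = 1..n. atom_term \<omega> (k i) (X i) / ennreal (true_dens (X i))"
  have m2: "(\<lambda>z. indicator G (fst z) * ?R (snd z) k (fst z)) \<in> borel_measurable (QI \<Otimes>\<^sub>M prior)" for k
    by (intro borel_measurable_times_ennreal prod_ratio_measurable measurable_compose[OF measurable_fst borel_measurable_indicator[OF G]])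
  have mX: "(\<lambda>X. \<integral>\<^sup>+\<omega>. indicator G X * ?R \<omega> k X \<partial>prior) \<in> borel_measurable QI" for k
    using sigma_finite_measure.borel_measurable_nn_integral[OF sigma_finite_prior, of "\<lambda>X \<omega>. indicator G X * ?R \<omega> k X" QI] m2[of k] by (simp add: case_prod_beta')
  have mw: "(\<lambda>\<omega>. \<integral>\<^sup>+X. indicator G X * ?R \<omega> k X \<partial>QI) \<in> borel_measurable prior" for k
    using QQ.borel_measurable_nn_integral[of "\<lambda>\<omega> X. indicator G X * ?R \<omega> k X" prior]
      measurable_compose[OF measurable_pair_swap'[of prior QI] m2[of k]] by (simp add: case_prod_beta')
  have wm: "(\<lambda>\<omega>. ?R \<omega> k X) \<in> borel_measurable prior" if "X \<in> space QI" for k X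
    using measurable_compose[OF measurable_Pair1'[OF that] prod_ratio_measurable[of k n]] by simp
  have am: "(\<lambda>\<omega>. \<Prod>i = 1..n. atom_term \<omega> (k i) (X i)) \<in> borel_measurable prior" if "X \<in> space QI" for k X
    using measurable_compose[OF measurable_Pair1'[OF that] prod_atom_measurable[of k n]] by simp
  have "(\<integral>\<^sup>+X. indicator G X * (post_num n E X / lik n X) \<partial>QI) =
     (\<integral>\<^sup>+X. (\<integral>\<^sup>+k. (\<integral>\<^sup>+\<omega>. indicator G X * ?R \<omega> k X \<partial>prior) * indicator E k \<partial>?C) \<partial>QI)"
  proof (rule nn_integral_cong)
    fix X assume X: "X \<in> space QI"
    have "(\<integral>\<^sup>+\<omega>. indicator G X * ?R \<omega> k X \<partial>prior) = indicator G X * (num n X k / lik n X)" for k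
    proof -
      have "(\<integral>\<^sup>+\<omega>. indicator G X * ?R \<omega> k X \<partial>prior) = indicator G X * (\<integral>\<^sup>+\<omega>. ?R \<omega> k X \<partial>prior)"
        by (rule nn_integral_cmult[OF wm[OF X]])
      also have "(\<integral>\<^sup>+\<omega>. ?R \<omega> k X \<partial>prior) = num n X k / lik n X"
        unfolding prod_divide_lik num_def by (rule nn_integral_divide[OF am[OF X]])
      finally show ?thesis .
    qed
    then have "(\<integral>\<^sup>+k. (\<integral>\<^sup>+\<omega>. indicator G X * ?R \<omega> k X \<partial>prior) * indicator E k \<partial>?C) =
       (\<integral>\<^sup>+k. indicator G X * (num n X k * indicator E k / lik n X) \<partial>?C)"
      by (intro nn_integral_cong) (simp add: divide_ennreal_def mult_ac)
    also have "\<dots> = indicator G X * (\<integral>\<^sup>+k. num n X k * indicator E k / lik n X \<partial>?C)" by (rule nn_integral_cmult) simp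
    also have "(\<integral>\<^sup>+k. num n X k * indicator E k / lik n X \<partial>?C) = post_num n E X / lik n X"
      unfolding post_num_def by (rule nn_integral_divide) simp
    finally show "indicator G X * (post_num n E X / lik n X) = (\<integral>\<^sup>+k. (\<integral>\<^sup>+\<omega>. indicator G X * ?R \<omega> k X \<partial>prior) * indicator E k \<partial>?C)" by simp
  qed
  also have "\<dots> = (\<integral>\<^sup>+k. (\<integral>\<^sup>+X. (\<integral>\<^sup>+\<omega>. indicator G X * ?R \<omega> k X \<partial>prior) * indicator E k \<partial>QI) \<partial>?C)"
    by (rule nn_integral_count_space_nn_integral[OF countable_allocations]) (intro borel_measurable_times_ennreal mX borel_measurable_const)
  also have "\<dots> = (\<integral>\<^sup>+k. (\<integral>\<^sup>+\<omega>. (\<integral>\<^sup>+X. indicator G X * ?R \<omega> k X \<partial>QI) * indicator E k \<partial>prior) \<partial>?C)"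
  proof (rule nn_integral_cong)
    fix k
    have "(\<integral>\<^sup>+X. (\<integral>\<^sup>+\<omega>. indicator G X * ?R \<omega> k X \<partial>prior) * indicator E k \<partial>QI) = (\<integral>\<^sup>+X. (\<integral>\<^sup>+\<omega>. indicator G X * ?R \<omega> k X \<partial>prior) \<partial>QI) * indicator E k"
      by (rule nn_integral_multc[OF mX])
    also have "(\<integral>\<^sup>+X. (\<integral>\<^sup>+\<omega>. indicator G X * ?R \<omega> k X \<partial>prior) \<partial>QI) = (\<integral>\<^sup>+\<omega>. (\<integral>\<^sup>+X. indicator G X * ?R \<omega> k X \<partial>QI) \<partial>prior)"
      using pp.Fubini'[of "\<lambda>X \<omega>. indicator G X * ?R \<omega> k X"] m2[of k] by (simp add: case_prod_beta')
    also have "\<dots> * indicator E k = (\<integral>\<^sup>+\<omega>. (\<integral>\<^sup>+X. indicator G X * ?R \<omega> k X \<partial>QI) * indicator E k \<partial>prior)"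
      by (rule nn_integral_multc[OF mw, symmetric])
    finally show "(\<integral>\<^sup>+X. (\<integral>\<^sup>+\<omega>. indicator G X * ?R \<omega> k X \<partial>prior) * indicator E k \<partial>QI) =
       (\<integral>\<^sup>+\<omega>. (\<integral>\<^sup>+X. indicator G X * ?R \<omega> k X \<partial>QI) * indicator E k \<partial>prior)" .
  qed
  also have "\<dots> = (\<integral>\<^sup>+\<omega>. alloc_prob n G E \<omega> \<partial>prior)" unfolding alloc_prob_def
    by (rule nn_integral_count_space_nn_integral[OF countable_allocations, symmetric]) (intro borel_measurable_times_ennreal mw borel_measurable_const)
  finally show ?thesis .
qed

lemma ratio_measurable2: "(\<lambda>x. atom_term \<omega> k x / ennreal (true_dens x)) \<in> borel_measurable Q"
  unfolding atom_term_def by measurable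

lemma nn_integral_ratio:
  "(\<integral>\<^sup>+x. h x / ennreal (true_dens x) \<partial>Q) = (\<integral>\<^sup>+x. h x \<partial>lborel)" if h: "h \<in> borel_measurable borel"
proof -
  have c: "a * (b / a) = b" if "a \<noteq> 0" "a \<noteq> top" for a b :: ennreal
    using that by (simp add: ennreal_times_divide mult_divide_eq_ennreal mult.commute[of a])
  have "(\<integral>\<^sup>+x. h x / ennreal (true_dens x) \<partial>Q) = (\<integral>\<^sup>+x. ennreal (true_dens x) * (h x / ennreal (true_dens x)) \<partial>lborel)"
    using h by (intro nn_integral_density) auto
  also have "\<dots> = (\<integral>\<^sup>+x. h x \<partial>lborel)"
  proof (rule nn_integral_cong)
    fix x show "ennreal (true_dens x) * (h x / ennreal (true_dens x)) = h x" using true_dens_pos[of x] by (intro c) auto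
  qed
  finally show ?thesis .
qed

lemma atom_term_integral: "(\<integral>\<^sup>+x. atom_term \<omega> k x / ennreal (true_dens x) \<partial>Q) = ennreal (stick_weight (fst \<omega>) k)"
proof -
  have m: "atom_term \<omega> k \<in> borel_measurable borel" unfolding atom_term_def by measurable
  have "(\<integral>\<^sup>+x. atom_term \<omega> k x / ennreal (true_dens x) \<partial>Q) = (\<integral>\<^sup>+x. atom_term \<omega> k x \<partial>lborel)"
    by (rule nn_integral_ratio[OF m])
  also have "\<dots> = ennreal (stick_weight (fst \<omega>) k) * (\<integral>\<^sup>+x. ennreal (f (x - snd \<omega> k)) \<partial>lborel)"
    unfolding atom_term_def by (rule nn_integral_cmult) measurable
  finally show ?thesis by (simp add: nn_integral_shift_density)
qed

lemma alloc_prob_le_weights: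
  "alloc_prob n G E \<omega> \<le> (\<integral>\<^sup>+k. (\<Prod>i = 1..n. ennreal (stick_weight (fst \<omega>) (k i))) * indicator E k \<partial>count_space ({1..n} \<rightarrow>\<^sub>E {1..}))"
  unfolding alloc_prob_def
proof (intro nn_integral_mono mult_right_mono)
  fix k
  have "(\<integral>\<^sup>+X. indicator G X * (\<Prod>i = 1..n. atom_term \<omega> (k i) (X i) / ennreal (true_dens (X i))) \<partial>QI) \<le>
     (\<integral>\<^sup>+X. (\<Prod>i = 1..n. atom_term \<omega> (k i) (X i) / ennreal (true_dens (X i))) \<partial>QI)"
    by (intro nn_integral_mono) (auto simp: indicator_def)
  also have "\<dots> = (\<Prod>i = 1..n. \<integral>\<^sup>+x. atom_term \<omega> (k i) x / ennreal (true_dens x) \<partial>Q)"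
    by (rule nn_integral_PiM_prod) (use prob_Q ratio_measurable2 in auto)
  finally show "(\<integral>\<^sup>+X. indicator G X * (\<Prod>i = 1..n. atom_term \<omega> (k i) (X i) / ennreal (true_dens (X i))) \<partial>QI) \<le>
     (\<Prod>i = 1..n. ennreal (stick_weight (fst \<omega>) (k i)))" by (simp only: atom_term_integral)
qed simp

lemma alloc_prob_le_1: "regular \<omega> \<Longrightarrow> alloc_prob n G E \<omega> \<le> 1"
proof -
  assume r: "regular \<omega>"
  have "alloc_prob n G E \<omega> \<le> (\<integral>\<^sup>+k. (\<Prod>i = 1..n. ennreal (stick_weight (fst \<omega>) (k i))) \<partial>count_space ({1..n} \<rightarrow>\<^sub>E {1..}))"
    by (rule order_trans[OF alloc_prob_le_weights]) (intro nn_integral_mono, auto simp: indicator_def)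
  also have "\<dots> = (\<Prod>i = 1..n. \<integral>\<^sup>+j. ennreal (stick_weight (fst \<omega>) j) \<partial>count_space {1..})"
    by (rule nn_integral_count_space_PiE[where u = "\<lambda>_ j. ennreal (stick_weight (fst \<omega>) j)"])
  also have "\<dots> = 1" by (simp only: nn_integral_count_space_Suc regular_weight_suminf_ennreal[OF r] prod.neutral_const)
  finally show ?thesis .
qed

text \<open>Exponential Markov with parameter 1 for the number of labels above \<open>K\<close>. The
  labels are independent and exceed \<open>K\<close> with probability
  \<open>stick_rem (fst \<omega>) K\<close>, so each contributes
  \<open>1 + (exp 1 - 1) * stick_rem (fst \<omega>) K\<close>; the 2 comes from
  \<open>exp 1 \<le> 3\<close>.\<close>

lemma alloc_prob_few_late:
  assumes r: "regular \<omega>" and rem: "stick_rem (fst \<omega>) K \<le> \<rho>" and E: "\<And>k. k \<in> E \<Longrightarrow> t \<le> (\<Sum>i = 1..n. of_bool (k i > K))"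
  shows "alloc_prob n G E \<omega> \<le> ennreal (exp (2 * \<rho> * real n - t))"
proof -
  let ?w = "\<lambda>j. stick_weight (fst \<omega>) j"
  have w: "0 \<le> ?w j" if "j \<ge> 1" for j using regular_weight_pos[OF r that] by simp
  have "alloc_prob n G E \<omega> \<le> (\<integral>\<^sup>+k. (\<Prod>i = 1..n. ennreal (?w (k i))) * indicator E k \<partial>count_space ({1..n} \<rightarrow>\<^sub>E {1..}))"
    by (rule alloc_prob_le_weights)
  also have "\<dots> \<le> (\<integral>\<^sup>+k. ennreal (exp (- t)) * (\<Prod>i = 1..n. ennreal (?w (k i)) * ennreal (exp (of_bool (k i > K)))) \<partial>count_space ({1..n} \<rightarrow>\<^sub>E {1..}))"
  proof (rule nn_integral_mono)
    fix k
    show "(\<Prod>i = 1..n. ennreal (?w (k i))) * indicator E k \<le> ennreal (exp (- t)) * (\<Prod>i = 1..n. ennreal (?w (k i)) * ennreal (exp (of_bool (k i > K))))"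
    proof (cases "k \<in> E")
      case True
      have "(\<Prod>i = 1..n. ennreal (exp (of_bool (k i > K)))) = ennreal (\<Prod>i = 1..n. exp (of_bool (k i > K)))" by (intro prod_ennreal) simp
      also have "(\<Prod>i = 1..n. exp (of_bool (k i > K)) :: real) = exp (\<Sum>i = 1..n. of_bool (k i > K))" by (simp only: exp_sum finite_atLeastAtMost)
      finally have p: "(\<Prod>i = 1..n. ennreal (exp (of_bool (k i > K)))) = ennreal (exp (\<Sum>i = 1..n. of_bool (k i > K)))" .
      have "1 \<le> exp (- t) * exp (\<Sum>i = 1..n. of_bool (k i > K))" using E[OF True] by (simp add: exp_add[symmetric])
      then have "1 \<le> ennreal (exp (- t)) * (\<Prod>i = 1..n. ennreal (exp (of_bool (k i > K))))"
        unfolding p by (subst ennreal_mult[symmetric]) auto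
      then have "(\<Prod>i = 1..n. ennreal (?w (k i))) * 1 \<le> (\<Prod>i = 1..n. ennreal (?w (k i))) * (ennreal (exp (- t)) * (\<Prod>i = 1..n. ennreal (exp (of_bool (k i > K)))))"
        by (rule mult_left_mono) simp
      then show ?thesis using True by (simp add: prod.distrib mult_ac)
    qed simp
  qed
  also have "\<dots> = ennreal (exp (- t)) * (\<integral>\<^sup>+k. (\<Prod>i = 1..n. ennreal (?w (k i)) * ennreal (exp (of_bool (k i > K)))) \<partial>count_space ({1..n} \<rightarrow>\<^sub>E {1..}))"
    by (rule nn_integral_cmult) simp
  also have "\<dots> = ennreal (exp (- t)) * (\<Prod>i = 1..n. \<integral>\<^sup>+j. ennreal (?w j) * ennreal (exp (of_bool (j > K))) \<partial>count_space {1..})"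
    by (simp only: nn_integral_count_space_PiE[where u = "\<lambda>_ j. ennreal (?w j) * ennreal (exp (of_bool (j > K)))"])
  also have "\<dots> \<le> ennreal (exp (- t)) * (\<Prod>i = 1..n. ennreal (exp (2 * \<rho>)))"
  proof (intro mult_left_mono prod_mono_ennreal)
    have sw: "(\<lambda>k. ?w (Suc k)) sums 1" by (rule regular_weight_sums[OF r])
    have "(\<Sum>k<K. ?w (Suc k)) = (\<Sum>k = 1..K. ?w k)" by (rule sum.reindex_bij_witness[of _ "\<lambda>k. k - 1" Suc]) auto
    then have hd: "(\<Sum>k<K. ?w (Suc k)) = 1 - stick_rem (fst \<omega>) K" by (simp only: sum_stick_weight)
    have s1: "(\<lambda>k. ?w (Suc (k + K))) sums stick_rem (fst \<omega>) K"
      using sums_split_initial_segment[OF sw, of K] hd by simp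
    have s2: "(\<lambda>k. ?w (Suc (k + K)) * exp 1) sums (stick_rem (fst \<omega>) K * exp 1)" by (rule sums_mult2[OF s1])
    have "(\<lambda>k. ?w (Suc (k + K)) * exp (of_bool (Suc (k + K) > K))) sums (stick_rem (fst \<omega>) K * exp 1)" using s2 by simp
    then have "(\<lambda>k. ?w (Suc k) * exp (of_bool (Suc k > K))) sums (stick_rem (fst \<omega>) K * exp 1 + (\<Sum>k<K. ?w (Suc k) * exp (of_bool (Suc k > K))))"
      by (subst sums_iff_shift[of _ K, symmetric]) simp
    moreover have "(\<Sum>k<K. ?w (Suc k) * exp (of_bool (Suc k > K))) = (\<Sum>k<K. ?w (Suc k))" by (intro sum.cong) auto
    ultimately have s3: "(\<lambda>k. ?w (Suc k) * exp (of_bool (Suc k > K))) sums (stick_rem (fst \<omega>) K * exp 1 + (1 - stick_rem (fst \<omega>) K))"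
      by (simp only: hd)
    have "(\<integral>\<^sup>+j. ennreal (?w j) * ennreal (exp (of_bool (j > K))) \<partial>count_space {1..}) = (\<Sum>k. ennreal (?w (Suc k) * exp (of_bool (Suc k > K))))"
      unfolding nn_integral_count_space_Suc using w by (intro suminf_cong ennreal_mult[symmetric]) auto
    also have "\<dots> = ennreal (stick_rem (fst \<omega>) K * exp 1 + (1 - stick_rem (fst \<omega>) K))"
      using w by (intro suminf_ennreal_eq s3) auto
    also have "\<dots> \<le> ennreal (exp (2 * \<rho>))"
    proof (rule ennreal_leI)
      have r0: "0 \<le> stick_rem (fst \<omega>) K" using r by (intro less_imp_le stick_rem_pos) (auto simp: regular_def)
      have "exp 1 \<le> (3::real)" by (rule exp_le)
      then have "stick_rem (fst \<omega>) K * (exp 1 - 1) \<le> stick_rem (fst \<omega>) K * 2" using r0 by (intro mult_left_mono) auto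
      then have "stick_rem (fst \<omega>) K * exp 1 + (1 - stick_rem (fst \<omega>) K) \<le> 1 + 2 * \<rho>" using rem by (simp add: algebra_simps)
      also have "\<dots> \<le> exp (2 * \<rho>)" by (rule exp_ge_add_one_self)
      finally show "stick_rem (fst \<omega>) K * exp 1 + (1 - stick_rem (fst \<omega>) K) \<le> exp (2 * \<rho>)" .
    qed
    finally show "(\<integral>\<^sup>+j. ennreal (?w j) * ennreal (exp (of_bool (j > K))) \<partial>count_space {1..}) \<le> ennreal (exp (2 * \<rho>))" .
  qed simp
  also have "\<dots> = ennreal (exp (- t) * exp (2 * \<rho>) ^ n)" by (simp add: ennreal_power ennreal_mult)
  also have "exp (- t) * exp (2 * \<rho>) ^ n = exp (2 * \<rho> * real n - t)"
    by (simp add: exp_of_nat_mult[symmetric] exp_add[symmetric] mult_ac)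
  finally show ?thesis .
qed

text \<open>Dropping the restriction to \<open>E\<close> leaves the sum over all label vectors,
  which recombines into the likelihood of the mixture. In this form the tests, which see only the
  data, can be applied.\<close>

lemma alloc_prob_le_dens:
  assumes r: "\<omega> \<in> space prior" and G: "G \<in> sets QI"
  shows "alloc_prob n G E \<omega> \<le> (\<integral>\<^sup>+X. indicator G X * (\<Prod>i = 1..n. dens \<omega> (X i) / ennreal (true_dens (X i))) \<partial>QI)"
proof -
  let ?C = "count_space ({1..n::nat} \<rightarrow>\<^sub>E {1::nat..})"
  have m: "(\<lambda>X. indicator G X * (\<Prod>i = 1..n. atom_term \<omega> (k i) (X i) / ennreal (true_dens (X i)))) \<in> borel_measurable QI" for k
  proof (intro borel_measurable_times_ennreal borel_measurable_indicator G borel_measurable_prod_ennreal)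
    fix i assume "i \<in> {1..n}"
    then have "(\<lambda>X. X i) \<in> QI \<rightarrow>\<^sub>M Q" by (intro measurable_component_singleton) auto
    from measurable_compose[OF this ratio_measurable2] show "(\<lambda>X. atom_term \<omega> (k i) (X i) / ennreal (true_dens (X i))) \<in> borel_measurable QI" .
  qed
  have "alloc_prob n G E \<omega> \<le> (\<integral>\<^sup>+k. (\<integral>\<^sup>+X. indicator G X * (\<Prod>i = 1..n. atom_term \<omega> (k i) (X i) / ennreal (true_dens (X i))) \<partial>QI) \<partial>?C)"
    unfolding alloc_prob_def by (intro nn_integral_mono) (auto simp: indicator_def)
  also have "\<dots> = (\<integral>\<^sup>+X. (\<integral>\<^sup>+k. indicator G X * (\<Prod>i = 1..n. atom_term \<omega> (k i) (X i) / ennreal (true_dens (X i))) \<partial>?C) \<partial>QI)"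
    by (rule nn_integral_count_space_nn_integral[OF countable_allocations m, symmetric])
  also have "\<dots> = (\<integral>\<^sup>+X. indicator G X * (\<Prod>i = 1..n. dens \<omega> (X i) / ennreal (true_dens (X i))) \<partial>QI)"
  proof (rule nn_integral_cong)
    fix X
    have "(\<integral>\<^sup>+k. indicator G X * (\<Prod>i = 1..n. atom_term \<omega> (k i) (X i) / ennreal (true_dens (X i))) \<partial>?C) =
       indicator G X * (\<integral>\<^sup>+k. (\<Prod>i = 1..n. atom_term \<omega> (k i) (X i) / ennreal (true_dens (X i))) \<partial>?C)" by (rule nn_integral_cmult) simp
    also have "(\<integral>\<^sup>+k. (\<Prod>i = 1..n. atom_term \<omega> (k i) (X i) / ennreal (true_dens (X i))) \<partial>?C) =
       (\<Prod>i = 1..n. \<integral>\<^sup>+j. atom_term \<omega> j (X i) / ennreal (true_dens (X i)) \<partial>count_space {1..})"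
      by (rule nn_integral_count_space_PiE[where u = "\<lambda>i j. atom_term \<omega> j (X i) / ennreal (true_dens (X i))"])
    also have "\<dots> = (\<Prod>i = 1..n. dens \<omega> (X i) / ennreal (true_dens (X i)))"
      unfolding dens_eq by (intro prod.cong refl nn_integral_divide) simp
    finally show "(\<integral>\<^sup>+k. indicator G X * (\<Prod>i = 1..n. atom_term \<omega> (k i) (X i) / ennreal (true_dens (X i))) \<partial>?C) =
       indicator G X * (\<Prod>i = 1..n. dens \<omega> (X i) / ennreal (true_dens (X i)))" .
  qed
  finally show ?thesis .
qed

end

subsection \<open>Numerator of the posterior\<close>

text \<open>Two replacements at once: \<open>a\<close> by \<open>b\<close>, at the price of
  \<open>C\<close> times the mean of \<open>u\<close>, and the series by its first \<open>m\<close>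
  terms, at the price of the remaining weight, since \<open>b\<close> is bounded by 1.\<close>

lemma weighted_tail_bound:
  fixes w a b u :: "nat \<Rightarrow> real"
  assumes w: "\<And>k. 0 \<le> w k" "w sums 1" and b: "\<And>k. \<bar>b k\<bar> \<le> 1" and ab: "\<And>k. \<bar>a k - b k\<bar> \<le> C * u k"
    and u: "\<And>k. 0 \<le> u k" "\<And>k. u k \<le> C'" and C: "0 \<le> C" and s: "(\<Sum>k. w k * u k) \<le> s"
  shows "\<bar>(\<Sum>k. w k * a k) - (\<Sum>k<m. w k * b k)\<bar> \<le> C * s + (1 - (\<Sum>k<m. w k))"
proof -
  have sw: "summable w" using w(2) by (rule sums_summable)
  have su: "summable (\<lambda>k. w k * u k)"
    by (rule summable_comparison_test'[OF summable_mult2[OF sw, of C']]) (use w u in \<open>auto simp: abs_mult intro!: mult_left_mono\<close>)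
  have sb: "summable (\<lambda>k. w k * b k)"
    by (rule summable_comparison_test'[OF sw]) (use w b in \<open>auto simp: abs_mult intro: mult_left_le\<close>)
  have d: "\<bar>w k * (a k - b k)\<bar> \<le> C * (w k * u k)" for k
    using mult_left_mono[OF ab[of k] w(1)[of k]] w(1)[of k] by (simp add: abs_mult mult_ac)
  have sd: "summable (\<lambda>k. w k * (a k - b k))"
    by (rule summable_comparison_test'[OF summable_mult[OF su, of C]]) (simp add: d)
  have "(\<Sum>k. w k * a k) = (\<Sum>k. w k * (a k - b k) + w k * b k)" by (simp add: algebra_simps)
  also have "\<dots> = (\<Sum>k. w k * (a k - b k)) + (\<Sum>k. w k * b k)" by (rule suminf_add[OF sd sb, symmetric])
  also have "(\<Sum>k. w k * b k) = (\<Sum>k. w (k + m) * b (k + m)) + (\<Sum>k<m. w k * b k)" by (rule suminf_split_initial_segment[OF sb])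
  finally have e: "(\<Sum>k. w k * a k) - (\<Sum>k<m. w k * b k) = (\<Sum>k. w k * (a k - b k)) + (\<Sum>k. w (k + m) * b (k + m))" by simp
  have "\<bar>\<Sum>k. w k * (a k - b k)\<bar> \<le> (\<Sum>k. C * (w k * u k))"
    using norm_suminf_le[of "\<lambda>k. w k * (a k - b k)" "\<lambda>k. C * (w k * u k)"] d summable_mult[OF su, of C] by simp
  also have "\<dots> = C * (\<Sum>k. w k * u k)" by (rule suminf_mult[OF su])
  also have "\<dots> \<le> C * s" using C s by (rule mult_left_mono[rotated])
  finally have 1: "\<bar>\<Sum>k. w k * (a k - b k)\<bar> \<le> C * s" .
  have "\<bar>w (k + m) * b (k + m)\<bar> \<le> w (k + m)" for k using w(1)[of "k + m"] b[of "k + m"] by (simp add: abs_mult mult_left_le)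
  then have "\<bar>\<Sum>k. w (k + m) * b (k + m)\<bar> \<le> (\<Sum>k. w (k + m))"
    using norm_suminf_le[of "\<lambda>k. w (k + m) * b (k + m)" "\<lambda>k. w (k + m)"] summable_ignore_initial_segment[OF sw, of m] by simp
  also have "\<dots> = 1 - (\<Sum>k<m. w k)" using suminf_split_initial_segment[OF sw, of m] sums_unique[OF w(2)] by simp
  finally show ?thesis unfolding e using 1 by linarith
qed

context dpm
begin

section \<open>Means under the mixing measure and tests built from them\<close>

definition pred_mean :: "(nat \<Rightarrow> real) \<times> (nat \<Rightarrow> 'a) \<Rightarrow> ('a \<Rightarrow> real) \<Rightarrow> real" where
  "pred_mean \<omega> \<psi> = (\<Sum>k. stick_weight (fst \<omega>) (Suc k) * \<psi> (snd \<omega> (Suc k)))"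

definition true_mean :: "('a \<Rightarrow> real) \<Rightarrow> real" where
  "true_mean \<psi> = (\<Sum>c = 1..K. ws c * \<psi> (ts c))"

lemma probability_density_shift: "probability_density (\<lambda>x. f (x - \<theta>))"
  unfolding probability_density_def using nn_integral_shift_density f_pos by (auto intro: less_imp_le)

lemma dens_measurable_data [measurable]: "dens \<omega> \<in> borel_measurable borel"
  unfolding dens_def by measurable

lemma integral_true_dens:
  assumes g: "g \<in> borel_measurable borel" "\<And>x. \<bar>g x\<bar> \<le> B" and \<psi>: "\<And>\<theta>. (\<integral>x. g x * f (x - \<theta>) \<partial>lborel) = \<psi> \<theta>"
  shows "(\<integral>x. g x \<partial>Q) = true_mean \<psi>"
proof -
  have i: "integrable lborel (\<lambda>x. g x * f (x - \<theta>))" for \<theta>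
    by (rule integrable_bounded_times_density[OF probability_density_shift g])
  have "(\<integral>x. g x \<partial>Q) = (\<integral>x. true_dens x * g x \<partial>lborel)"
    using g true_dens_pos by (subst integral_density) (auto simp: less_imp_le)
  also have "\<dots> = (\<integral>x. (\<Sum>c = 1..K. ws c * (g x * f (x - ts c))) \<partial>lborel)"
    unfolding true_dens_def sum_distrib_right by (simp only: mult_ac)
  also have "\<dots> = true_mean \<psi>"
    using i by (subst Bochner_Integration.integral_sum) (auto simp: true_mean_def \<psi>)
  finally show ?thesis .
qed

lemma dens_law:
  assumes r: "regular \<omega>"
  shows "prob_space (density lborel (dens \<omega>))" "density lborel (dens \<omega>) = density Q (\<lambda>x. dens \<omega> x / ennreal (true_dens x))"
proof -
  show "prob_space (density lborel (dens \<omega>))"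
    by (intro prob_spaceI) (simp add: emeasure_density nn_integral_dens_1[OF r])
  have c: "a * (b / a) = b" if "a \<noteq> 0" "a \<noteq> top" for a b :: ennreal
    using that by (simp add: ennreal_times_divide mult_divide_eq_ennreal mult.commute[of a])
  have "density Q (\<lambda>x. dens \<omega> x / ennreal (true_dens x)) = density lborel (\<lambda>x. ennreal (true_dens x) * (dens \<omega> x / ennreal (true_dens x)))"
    by (rule density_density_eq) auto
  also have "\<dots> = density lborel (dens \<omega>)"
  proof (intro arg_cong[of _ _ "density lborel"] ext c)
    fix x show "ennreal (true_dens x) \<noteq> 0" using true_dens_pos[of x] by simp
  qed simp
  finally show "density lborel (dens \<omega>) = density Q (\<lambda>x. dens \<omega> x / ennreal (true_dens x))" by simp
qed

lemma integral_dens: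
  assumes r: "regular \<omega>" and g: "g \<in> borel_measurable borel" "\<And>x. \<bar>g x\<bar> \<le> B" and \<psi>: "\<And>\<theta>. (\<integral>x. g x * f (x - \<theta>) \<partial>lborel) = \<psi> \<theta>"
  shows "(\<integral>x. g x \<partial>density lborel (dens \<omega>)) = pred_mean \<omega> \<psi>"
proof -
  let ?w = "\<lambda>k. stick_weight (fst \<omega>) (Suc k)"
  let ?h = "\<lambda>k x. ?w k * (g x * f (x - snd \<omega> (Suc k)))"
  have w: "0 \<le> ?w k" for k using regular_weight_pos[OF r, of "Suc k"] by simp
  have sw: "summable ?w" by (rule sums_summable[OF regular_weight_sums[OF r]])
  have i: "integrable lborel (\<lambda>x. g x * f (x - \<theta>))" for \<theta>
    by (rule integrable_bounded_times_density[OF probability_density_shift g])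
  have i1: "integrable lborel (\<lambda>x. f (x - \<theta>))" for \<theta>
    using integrable_bounded_times_density[OF probability_density_shift, of "\<lambda>_. 1" 1 \<theta>] by simp
  have ih: "integrable lborel (?h k)" for k using i by (intro integrable_mult_right) auto
  note fs = dens_real(1)[OF r] and de = dens_real(2)[OF r]
  have nb: "norm (?h k x) \<le> ?w k * f (x - snd \<omega> (Suc k)) * B" for k x
  proof -
    have "norm (?h k x) = ?w k * f (x - snd \<omega> (Suc k)) * \<bar>g x\<bar>" using w[of k] f_pos[of "x - snd \<omega> (Suc k)"] by (simp add: abs_mult)
    also have "\<dots> \<le> ?w k * f (x - snd \<omega> (Suc k)) * B" using w[of k] f_pos[of "x - snd \<omega> (Suc k)"] g(2) by (intro mult_left_mono) auto
    finally show ?thesis .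
  qed
  have f1: "(\<integral>x. f (x - \<theta>) \<partial>lborel) = 1" for \<theta>
    using nn_integral_shift_density[of \<theta>] f_pos by (subst integral_eq_nn_integral) (auto intro: less_imp_le)
  have "(\<integral>x. g x \<partial>density lborel (dens \<omega>)) = (\<integral>x. (\<Sum>k. ?w k * f (x - snd \<omega> (Suc k))) * g x \<partial>lborel)"
    unfolding de by (subst integral_density) (use g w f_pos in \<open>auto intro!: suminf_nonneg fs mult_nonneg_nonneg AE_I2 less_imp_le[OF f_pos]\<close>)
  also have "\<dots> = (\<integral>x. (\<Sum>k. ?h k x) \<partial>lborel)"
    using suminf_mult2[OF fs] by (simp add: mult_ac)
  also have "\<dots> = (\<Sum>k. \<integral>x. ?h k x \<partial>lborel)"
  proof (rule integral_suminf[OF ih])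
    show "AE x in lborel. summable (\<lambda>k. norm (?h k x))"
      by (intro AE_I2 summable_comparison_test'[OF summable_mult2[OF fs, of _ B]]) (use nb in simp)
    show "summable (\<lambda>k. \<integral>x. norm (?h k x) \<partial>lborel)"
    proof (rule summable_comparison_test'[OF summable_mult2[OF sw, of B]])
      fix k
      have "(\<integral>x. norm (?h k x) \<partial>lborel) \<le> (\<integral>x. ?w k * f (x - snd \<omega> (Suc k)) * B \<partial>lborel)"
        using ih nb i1 by (intro integral_mono) auto
      also have "\<dots> = ?w k * B" by (simp add: f1)
      finally show "norm (\<integral>x. norm (?h k x) \<partial>lborel) \<le> ?w k * B" by simp
    qed
  qed
  finally show ?thesis by (simp add: pred_mean_def \<psi>)
qed

definition typical_data :: "nat \<Rightarrow> real \<Rightarrow> ('a \<Rightarrow> real) \<Rightarrow> real \<Rightarrow> (nat \<Rightarrow> 'a) set" where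
  "typical_data n \<tau> g \<mu> = {X \<in> space QI. \<bar>(\<Sum>i = 1..n. g (X i)) - real n * \<mu>\<bar> \<le> real n * \<tau>}"

lemma typical_data_sets:
  assumes g [measurable]: "g \<in> borel_measurable borel"
  shows "typical_data n \<tau> g \<mu> \<in> sets QI"
proof -
  have "(\<lambda>X. \<Sum>i = 1..n. g (X i)) \<in> borel_measurable QI"
    by (intro borel_measurable_sum measurable_compose[OF coordinate_measurable g]) auto
  then show ?thesis unfolding typical_data_def by measurable
qed

lemma emeasure_atypical:
  assumes g: "g \<in> borel_measurable borel" "\<And>x. \<bar>g x\<bar> \<le> B" "B > 0" and \<tau>: "0 < \<tau>" "\<tau> \<le> B"
  shows "emeasure QI (space QI - typical_data n \<tau> g (\<integral>x. g x \<partial>Q)) \<le> ennreal (2 * exp (- (real n * \<tau>\<^sup>2 / (16 * B\<^sup>2))))"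
proof -
  define \<mu> where "\<mu> = (\<integral>x. g x \<partial>Q)"
  have gQ: "g \<in> borel_measurable Q" using g by simp
  define A where "A \<sigma> = {X. real n * \<tau> \<le> \<sigma> * ((\<Sum>i = 1..n. g (X i)) - real n * \<mu>)}" for \<sigma> :: real
  have A: "(\<integral>\<^sup>+X. indicator (A \<sigma>) X \<partial>QI) \<le> ennreal (exp (- (real n * \<tau>\<^sup>2 / (16 * B\<^sup>2))))" if "\<bar>\<sigma>\<bar> = 1" for \<sigma>
    using chernoff_product[OF prob_Q _ prob_Q _ gQ g(2,3) \<tau> that, of "\<lambda>_. 1" "A \<sigma>" n]
    by (simp add: A_def \<mu>_def density_1)
  have Am: "A \<sigma> \<inter> space QI \<in> sets QI" for \<sigma>
  proof -
    have "(\<lambda>X. \<Sum>i = 1..n. g (X i)) \<in> borel_measurable QI"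
      by (intro borel_measurable_sum measurable_compose[OF coordinate_measurable g(1)]) auto
    then have "{X \<in> space QI. real n * \<tau> \<le> \<sigma> * ((\<Sum>i = 1..n. g (X i)) - real n * \<mu>)} \<in> sets QI" by measurable
    then show ?thesis by (simp only: A_def Collect_conj_eq Int_commute Collect_mem_eq)
  qed
  have E: "emeasure QI (A \<sigma> \<inter> space QI) \<le> ennreal (exp (- (real n * \<tau>\<^sup>2 / (16 * B\<^sup>2))))" if "\<bar>\<sigma>\<bar> = 1" for \<sigma>
  proof -
    have "emeasure QI (A \<sigma> \<inter> space QI) = (\<integral>\<^sup>+X. indicator (A \<sigma> \<inter> space QI) X \<partial>QI)" by (rule nn_integral_indicator[OF Am, symmetric])
    also have "\<dots> \<le> (\<integral>\<^sup>+X. indicator (A \<sigma>) X \<partial>QI)" by (intro nn_integral_mono) (auto simp: indicator_def)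
    finally show ?thesis using A[OF that] by (rule order_trans)
  qed
  have "space QI - typical_data n \<tau> g \<mu> \<subseteq> (A 1 \<inter> space QI) \<union> (A (-1) \<inter> space QI)"
    unfolding typical_data_def A_def by (auto simp: abs_if not_le split: if_splits)
  then have "emeasure QI (space QI - typical_data n \<tau> g \<mu>) \<le> emeasure QI ((A 1 \<inter> space QI) \<union> (A (-1) \<inter> space QI))"
    by (intro emeasure_mono sets.Un Am)
  also have "\<dots> \<le> emeasure QI (A 1 \<inter> space QI) + emeasure QI (A (-1) \<inter> space QI)" by (rule emeasure_subadditive[OF Am Am])
  also have "\<dots> \<le> ennreal (exp (- (real n * \<tau>\<^sup>2 / (16 * B\<^sup>2)))) + ennreal (exp (- (real n * \<tau>\<^sup>2 / (16 * B\<^sup>2))))"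
    by (intro add_mono E) auto
  also have "\<dots> = ennreal (2 * exp (- (real n * \<tau>\<^sup>2 / (16 * B\<^sup>2))))" by (simp add: ennreal_plus[symmetric] del: ennreal_plus)
  finally show ?thesis unfolding \<mu>_def .
qed

text \<open>On \<open>G\<close> the empirical mean is within \<tau> of its true value. If the value
  predicted by \<open>\<omega>\<close> is more than \<open>2 * \<tau>\<close> away from the truth,
  such data deviate from the prediction by at least \<tau>, which is exponentially unlikely under
  \<open>\<omega>\<close>.\<close>

lemma alloc_prob_atypical:
  assumes \<omega>: "\<omega> \<in> space prior" and r: "regular \<omega>" and G: "G \<in> sets QI" "G \<subseteq> typical_data n \<tau> g (true_mean \<psi>)"
    and g: "g \<in> borel_measurable borel" "\<And>x. \<bar>g x\<bar> \<le> B" "B > 0" and \<psi>: "\<And>\<theta>. (\<integral>x. g x * f (x - \<theta>) \<partial>lborel) = \<psi> \<theta>"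
    and \<tau>: "0 < \<tau>" "\<tau> \<le> B" and far: "\<bar>pred_mean \<omega> \<psi> - true_mean \<psi>\<bar> > 2 * \<tau>"
  shows "alloc_prob n G E \<omega> \<le> ennreal (exp (- (real n * \<tau>\<^sup>2 / (16 * B\<^sup>2))))"
proof -
  define \<sigma> :: real where "\<sigma> = (if pred_mean \<omega> \<psi> > true_mean \<psi> then -1 else 1)"
  have "\<sigma> * (true_mean \<psi> - pred_mean \<omega> \<psi>) \<ge> 2 * \<tau>" using far by (auto simp: \<sigma>_def)
  then have s: "real n * (2 * \<tau>) \<le> real n * (\<sigma> * (true_mean \<psi> - pred_mean \<omega> \<psi>))" by (rule mult_left_mono) simp
  have "alloc_prob n G E \<omega> \<le> (\<integral>\<^sup>+X. indicator G X * (\<Prod>i = 1..n. dens \<omega> (X i) / ennreal (true_dens (X i))) \<partial>QI)"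
    by (rule alloc_prob_le_dens[OF \<omega> G(1)])
  also have "\<dots> \<le> ennreal (exp (- (real n * \<tau>\<^sup>2 / (16 * B\<^sup>2))))"
  proof (rule chernoff_product[OF prob_Q _ dens_law[OF r] _ g(2,3) \<tau>])
    show "\<bar>\<sigma>\<bar> = 1" by (simp add: \<sigma>_def)
    fix X assume "X \<in> G"
    then have "\<bar>(\<Sum>i = 1..n. g (X i)) - real n * true_mean \<psi>\<bar> \<le> real n * \<tau>" using G(2) by (auto simp: typical_data_def)
    then have "\<sigma> * ((\<Sum>i = 1..n. g (X i)) - real n * true_mean \<psi>) \<ge> - (real n * \<tau>)" by (auto simp: \<sigma>_def)
    then show "real n * \<tau> \<le> \<sigma> * ((\<Sum>i = 1..n. g (X i)) - real n * (\<integral>x. g x \<partial>density lborel (dens \<omega>)))"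
      unfolding integral_dens[OF r g(1,2) \<psi>] using s by (simp add: algebra_simps)
  qed (use g in auto)
  finally show ?thesis .
qed

lemma truncated_mean:
  assumes r: "regular \<omega>" and U: "\<And>\<theta>. 0 \<le> U \<theta> \<and> U \<theta> \<le> C" and s: "pred_mean \<omega> U \<le> s" and C: "C \<ge> 0"
    and b: "\<And>\<theta>. \<bar>b \<theta>\<bar> \<le> 1" and ab: "\<And>\<theta>. \<theta> \<in> \<Theta> \<Longrightarrow> \<bar>a \<theta> - b \<theta>\<bar> \<le> C * U \<theta>"
  shows "\<bar>pred_mean \<omega> a - (\<Sum>k = 1..m. stick_weight (fst \<omega>) k * b (snd \<omega> k))\<bar> \<le> C * s + stick_rem (fst \<omega>) m"
proof -
  let ?w = "\<lambda>k. stick_weight (fst \<omega>) (Suc k)"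
  have w: "0 \<le> ?w k" for k using regular_weight_pos[OF r, of "Suc k"] by simp
  have "\<bar>(\<Sum>k. ?w k * a (snd \<omega> (Suc k))) - (\<Sum>k<m. ?w k * b (snd \<omega> (Suc k)))\<bar> \<le> C * s + (1 - (\<Sum>k<m. ?w k))"
  proof (rule weighted_tail_bound[OF w regular_weight_sums[OF r]])
    show "\<bar>a (snd \<omega> (Suc k)) - b (snd \<omega> (Suc k))\<bar> \<le> C * U (snd \<omega> (Suc k))" for k
      using r by (intro ab) (simp add: regular_def)
    show "(\<Sum>k. ?w k * U (snd \<omega> (Suc k))) \<le> s" using s by (simp only: pred_mean_def)
  qed (use b U C in auto)
  moreover have "(\<Sum>k<m. ?w k * b (snd \<omega> (Suc k))) = (\<Sum>k = 1..m. stick_weight (fst \<omega>) k * b (snd \<omega> k))"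
    unfolding One_nat_def by (rule sum.atLeast1_atMost_eq[symmetric])
  moreover have "(\<Sum>k<m. ?w k) = 1 - stick_rem (fst \<omega>) m"
    unfolding sum_stick_weight[symmetric] One_nat_def by (rule sum.atLeast1_atMost_eq[symmetric])
  ultimately show ?thesis unfolding pred_mean_def by simp
qed

text \<open>Agreement of the statistics is turned into constraints on the first \<open>m\<close>
  pieces. In \<open>2 * C + 3\<close> the term \<open>2 * C\<close> pays for replacing a statistic
  by an indicator or a displacement, 2 is the tolerance of the statistic and 1 the remaining mass.
  The dimension comes from bounding the norm by the sum of the coordinates.\<close>

lemma near_truth:
  assumes r: "regular \<omega>" and U: "\<And>\<theta>. 0 \<le> U \<theta> \<and> U \<theta> \<le> C" and s: "pred_mean \<omega> U \<le> 2 * \<tau>" and C: "C > 0" and r0: "r0 \<le> 1"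
    and u: "\<And>\<theta>. \<theta> \<in> \<Theta> \<Longrightarrow> \<bar>u \<theta> - indicator (ball t r0) \<theta>\<bar> \<le> C * U \<theta>" and us: "\<bar>pred_mean \<omega> u - p\<bar> \<le> 2 * \<tau>"
    and q: "\<And>i \<theta>. i \<in> Basis \<Longrightarrow> \<theta> \<in> \<Theta> \<Longrightarrow> \<bar>q i \<theta> - indicator (ball t r0) \<theta> * ((\<theta> - t) \<bullet> i)\<bar> \<le> C * U \<theta>"
    and qs: "\<And>i. i \<in> Basis \<Longrightarrow> \<bar>pred_mean \<omega> (q i)\<bar> \<le> 2 * \<tau>"
    and rem: "stick_rem (fst \<omega>) m \<le> \<tau>"
  shows "k \<in> {1..m} \<Longrightarrow> stick_weight (fst \<omega>) k * U (snd \<omega> k) \<le> real DIM('a) * (2 * C + 3) * \<tau>"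
    and "\<bar>(\<Sum>k = 1..m. (indicator (ball t r0) (snd \<omega> k) * stick_weight (fst \<omega>) k) *\<^sub>R 1) - p\<bar> \<le> real DIM('a) * (2 * C + 3) * \<tau>"
    and "norm (\<Sum>k = 1..m. (indicator (ball t r0) (snd \<omega> k) * stick_weight (fst \<omega>) k) *\<^sub>R (snd \<omega> k - t)) \<le> real DIM('a) * (2 * C + 3) * \<tau>"
proof -
  have "0 \<le> stick_rem (fst \<omega>) m" using r by (intro less_imp_le stick_rem_pos) (auto simp: regular_def)
  then have \<tau>: "\<tau> \<ge> 0" using rem by simp
  have D: "real DIM('a) \<ge> 1" using DIM_positive[where 'a = 'a] by linarith
  have e: "(2 * C + 3) * \<tau> \<le> real DIM('a) * (2 * C + 3) * \<tau>" "2 * \<tau> \<le> (2 * C + 3) * \<tau>"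
    using mult_right_mono[OF D, of "(2 * C + 3) * \<tau>"] \<tau> C by (auto simp: mult.assoc intro!: mult_right_mono)
  have w: "0 \<le> stick_weight (fst \<omega>) k" if "k \<ge> 1" for k using regular_weight_pos[OF r that] by simp
  show "stick_weight (fst \<omega>) k * U (snd \<omega> k) \<le> real DIM('a) * (2 * C + 3) * \<tau>" if k: "k \<in> {1..m}"
  proof -
    let ?t = "\<lambda>j. stick_weight (fst \<omega>) (Suc j) * U (snd \<omega> (Suc j))"
    have t0: "0 \<le> ?t j" for j using w[of "Suc j"] U by simp
    have "summable ?t"
      by (rule summable_comparison_test'[OF summable_mult2[OF sums_summable[OF regular_weight_sums[OF r]], of C]])
        (use w U in \<open>auto simp: abs_mult intro!: mult_left_mono\<close>)
    then have "?t (k - 1) \<le> (\<Sum>j. ?t j)" using sum_le_suminf[of ?t "{k - 1}"] t0 by simp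
    also have "\<dots> \<le> 2 * \<tau>" using s by (simp only: pred_mean_def)
    finally show ?thesis using e k by simp
  qed
  have "\<bar>pred_mean \<omega> u - (\<Sum>k = 1..m. stick_weight (fst \<omega>) k * indicator (ball t r0) (snd \<omega> k))\<bar> \<le> C * (2 * \<tau>) + stick_rem (fst \<omega>) m"
    by (rule truncated_mean[OF r U s]) (use C u in \<open>auto simp: indicator_def\<close>)
  then have "\<bar>(\<Sum>k = 1..m. stick_weight (fst \<omega>) k * indicator (ball t r0) (snd \<omega> k)) - p\<bar> \<le> (2 * C + 3) * \<tau>"
    using us rem by (simp add: algebra_simps abs_le_iff)
  then show "\<bar>(\<Sum>k = 1..m. (indicator (ball t r0) (snd \<omega> k) * stick_weight (fst \<omega>) k) *\<^sub>R 1) - p\<bar> \<le> real DIM('a) * (2 * C + 3) * \<tau>"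
    using e(1) by (simp add: mult.commute)
  let ?v = "\<Sum>k = 1..m. (indicator (ball t r0) (snd \<omega> k) * stick_weight (fst \<omega>) k) *\<^sub>R (snd \<omega> k - t)"
  have vi: "\<bar>?v \<bullet> i\<bar> \<le> (2 * C + 3) * \<tau>" if i: "i \<in> Basis" for i
  proof -
    have "\<bar>pred_mean \<omega> (q i) - (\<Sum>k = 1..m. stick_weight (fst \<omega>) k * (indicator (ball t r0) (snd \<omega> k) * ((snd \<omega> k - t) \<bullet> i)))\<bar>
        \<le> C * (2 * \<tau>) + stick_rem (fst \<omega>) m"
    proof (rule truncated_mean[OF r U s])
      fix \<theta>
      have "\<bar>(\<theta> - t) \<bullet> i\<bar> \<le> dist t \<theta>" using Basis_le_norm[OF i, of "\<theta> - t"] by (simp add: dist_norm norm_minus_commute)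
      then show "\<bar>indicator (ball t r0) \<theta> * ((\<theta> - t) \<bullet> i)\<bar> \<le> 1" using r0 by (auto simp: indicator_def)
    qed (use C q[OF i] in auto)
    moreover have "?v \<bullet> i = (\<Sum>k = 1..m. stick_weight (fst \<omega>) k * (indicator (ball t r0) (snd \<omega> k) * ((snd \<omega> k - t) \<bullet> i)))"
      by (simp add: inner_sum_left mult_ac)
    ultimately show ?thesis using qs[OF i] rem by (simp add: algebra_simps abs_le_iff)
  qed
  have "norm ?v \<le> (\<Sum>i\<in>Basis. \<bar>?v \<bullet> i\<bar>)" by (rule norm_le_l1)
  also have "\<dots> \<le> of_nat (card (Basis :: 'a set)) * ((2 * C + 3) * \<tau>)" by (rule sum_bounded_above[OF vi])
  finally show "norm ?v \<le> real DIM('a) * (2 * C + 3) * \<tau>" by (simp add: mult.assoc)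
qed

end

context dpm
begin

text \<open>The condition puts \<theta> within \<open>sqrt (C / y)\<close> of some true atom. For
  radii up to 1 the power \<open>DIM('a)\<close> of the radius is weakened to the first power, which
  gives the exponent 1/2 in every dimension.\<close>

lemma emeasure_small_separation:
  assumes ball: "\<And>x s. s \<ge> 0 \<Longrightarrow> emeasure P0 (cball x s) \<le> ennreal (Cb * s ^ DIM('a))" and Cb: "Cb \<ge> 0" and C: "C > 0"
    and U: "U \<in> borel_measurable borel" and sep: "\<And>\<theta>. \<theta> \<in> \<Theta> \<Longrightarrow> \<exists>c\<in>{1..K}. (norm (\<theta> - ts c))\<^sup>2 \<le> C * U \<theta>" and y: "y > 0"
  shows "emeasure P0 {\<theta>. U \<theta> * y \<le> 1} \<le> ennreal (damp (sqrt C * max 1 (real K * Cb)) (1/2) y)"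
proof -
  interpret P: prob_space P0 by (rule P0)
  have yp: "y powr - (1/2) = 1 / sqrt y" using y by (simp add: powr_minus_divide powr_half_sqrt)
  have le1: "emeasure P0 {\<theta>. U \<theta> * y \<le> 1} \<le> 1" by (rule P.emeasure_le_1)
  have "emeasure P0 {\<theta>. U \<theta> * y \<le> 1} \<le> ennreal (sqrt C * max 1 (real K * Cb) * y powr - (1/2))"
  proof (cases "y \<le> C")
    case True
    have "1 \<le> sqrt C / sqrt y" using True y by simp
    also have "\<dots> \<le> sqrt C * max 1 (real K * Cb) * y powr - (1/2)" unfolding yp using C y by (simp add: divide_right_mono)
    finally have "1 \<le> ennreal (sqrt C * max 1 (real K * Cb) * y powr - (1/2))" using ennreal_leI by fastforce
    then show ?thesis by (rule order_trans[OF le1])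
  next
    case False
    define s where "s = sqrt (C / y)"
    have s: "0 \<le> s" "s \<le> 1" using False C y by (auto simp: s_def)
    have "AE \<theta> in P0. \<theta> \<in> {\<theta>. U \<theta> * y \<le> 1} \<longrightarrow> \<theta> \<in> (\<Union>c\<in>{1..K}. cball (ts c) s)"
      using P0_\<Theta>
    proof eventually_elim
      case (elim \<theta>)
      show ?case
      proof
        assume "\<theta> \<in> {\<theta>. U \<theta> * y \<le> 1}"
        then have u: "U \<theta> \<le> 1 / y" using y by (simp add: pos_le_divide_eq)
        obtain c where c: "c \<in> {1..K}" "(norm (\<theta> - ts c))\<^sup>2 \<le> C * U \<theta>" using sep[OF elim] by blast
        have "C * U \<theta> \<le> C / y" using mult_left_mono[OF u, of C] C by simp
        then have "norm (\<theta> - ts c) \<le> s" unfolding s_def using c(2) by (intro real_le_rsqrt) simp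
        then show "\<theta> \<in> (\<Union>c\<in>{1..K}. cball (ts c) s)" using c(1) by (auto simp: dist_norm norm_minus_commute)
      qed
    qed
    then have "emeasure P0 {\<theta>. U \<theta> * y \<le> 1} \<le> emeasure P0 (\<Union>c\<in>{1..K}. cball (ts c) s)"
      by (rule emeasure_mono_AE) (simp add: sets_P0)
    also have "\<dots> \<le> (\<Sum>c\<in>{1..K}. emeasure P0 (cball (ts c) s))"
      by (rule emeasure_subadditive_finite) (auto simp: sets_P0)
    also have "\<dots> \<le> (\<Sum>c\<in>{1..K}. ennreal (Cb * s))"
    proof (rule sum_mono, rule order_trans[OF ball[OF s(1)]], rule ennreal_leI)
      fix c
      have "s ^ DIM('a) \<le> s ^ 1" using s DIM_positive[where 'a = 'a] by (intro power_decreasing) auto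
      then show "Cb * s ^ DIM('a) \<le> Cb * s" using Cb by (intro mult_left_mono) auto
    qed
    also have "\<dots> = ennreal (real K * (Cb * s))" using Cb s by (simp add: ennreal_of_nat_eq_real_of_nat ennreal_mult)
    also have "\<dots> \<le> ennreal (sqrt C * max 1 (real K * Cb) * y powr - (1/2))"
    proof (rule ennreal_leI)
      have "real K * (Cb * s) = sqrt C * (real K * Cb) * (1 / sqrt y)" by (simp add: s_def real_sqrt_divide)
      also have "\<dots> \<le> sqrt C * max 1 (real K * Cb) * (1 / sqrt y)" using C y by (intro mult_right_mono mult_left_mono) auto
      finally show "real K * (Cb * s) \<le> sqrt C * max 1 (real K * Cb) * y powr - (1/2)" by (simp only: yp)
    qed
    finally show ?thesis .
  qed
  then show ?thesis using le1 by (simp add: damp_def min_def)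
qed

lemma emeasure_stick_tail:
  assumes e: "e > 0"
  shows "{\<omega> \<in> space prior. stick_rem (fst \<omega>) m > e} \<in> sets prior"
    and "emeasure prior {\<omega> \<in> space prior. stick_rem (fst \<omega>) m > e} \<le> ennreal ((\<alpha> / (\<alpha> + 1)) ^ m / e)"
proof -
  let ?A = "{v \<in> space (stick_law \<alpha>). stick_rem v m > e}"
  have A: "?A \<in> sets (stick_law \<alpha>)" by measurable
  have eq: "{\<omega> \<in> space prior. stick_rem (fst \<omega>) m > e} = fst -` ?A \<inter> space prior" by (auto simp: space_pair_measure)
  show "{\<omega> \<in> space prior. stick_rem (fst \<omega>) m > e} \<in> sets prior" unfolding eq by (rule measurable_sets[OF measurable_fst A])
  have "emeasure prior (fst -` ?A \<inter> space prior) = emeasure (distr prior (stick_law \<alpha>) fst) ?A"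
    by (rule emeasure_distr[OF measurable_fst A, symmetric])
  also have "\<dots> = emeasure (stick_law \<alpha>) ?A" by (simp only: T.distr_pair_fst)
  also have "\<dots> \<le> ennreal ((\<alpha> / (\<alpha> + 1)) ^ m / e)" by (rule stick_rem_tail[OF al e])
  finally show "emeasure prior {\<omega> \<in> space prior. stick_rem (fst \<omega>) m > e} \<le> ennreal ((\<alpha> / (\<alpha> + 1)) ^ m / e)" unfolding eq .
qed

text \<open>Every summand of the bound belongs to one way in which \<open>\<omega>\<close> can
  behave. The set \<open>G\<close> of typical data is fixed before \<open>E\<close> and
  \<open>t\<close>, so it depends on the statistics and the scale \<tau> only.\<close>

lemma expected_alloc_prob:
  assumes ball: "\<And>x s. s \<ge> 0 \<Longrightarrow> emeasure P0 (cball x s) \<le> ennreal (Cb * s ^ DIM('a))" and Cb: "Cb \<ge> 0"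
  shows "\<exists>L\<ge>0. \<exists>B>0. \<exists>C\<ge>0. \<exists>M \<tau>0. \<tau>0 > 0 \<and> (\<forall>n m \<tau> \<rho>. 1 \<le> m \<longrightarrow> 0 < \<tau> \<longrightarrow> \<tau> \<le> \<tau>0 \<longrightarrow> 0 < \<rho> \<longrightarrow> \<rho> \<le> 1 \<longrightarrow>
     (\<exists>G\<in>sets QI. emeasure QI (space QI - G) \<le> ennreal (L * exp (- (real n * \<tau>\<^sup>2 / (16 * B\<^sup>2)))) \<and>
       (\<forall>E t. (\<forall>k\<in>E. t \<le> (\<Sum>i = 1..n. of_bool (k i > K))) \<longrightarrow> (\<integral>\<^sup>+\<omega>. alloc_prob n G E \<omega> \<partial>prior) \<le>
          ennreal (C * real m powr M * \<tau> powr (real (K - 1) + \<alpha> + real (K * DIM('a))) * (\<tau> / \<rho>) powr (1/4)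
            + (\<alpha> / (\<alpha> + 1)) ^ m / \<tau> + exp (2 * \<rho> * real n - t) + exp (- (real n * \<tau>\<^sup>2 / (16 * B\<^sup>2)))))))"
proof -
  obtain U u q r0 C where r0: "0 < r0" "r0 \<le> 1" and C: "C > 0" and dis: "disjoint_family_on (\<lambda>c. ball (ts c) r0) {1..K}"
    and Uo: "observable f U" and Um: "U \<in> borel_measurable borel" and U: "\<forall>\<theta>. 0 \<le> U \<theta> \<and> U \<theta> \<le> C" and Ut: "\<forall>c\<in>{1..K}. U (ts c) = 0"
    and sep: "\<forall>\<theta>\<in>\<Theta>. \<exists>c\<in>{1..K}. (norm (\<theta> - ts c))\<^sup>2 \<le> C * U \<theta>"
    and u: "\<forall>c\<in>{1..K}. observable f (u c) \<and> (\<forall>d\<in>{1..K}. u c (ts d) = of_bool (d = c)) \<and> u c \<in> borel_measurable borel \<and>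
        (\<forall>\<theta>\<in>\<Theta>. \<bar>u c \<theta> - indicator (ball (ts c) r0) \<theta>\<bar> \<le> C * U \<theta>)"
    and q: "\<forall>c\<in>{1..K}. \<forall>i\<in>Basis. observable f (q c i) \<and> (\<forall>d\<in>{1..K}. q c i (ts d) = 0) \<and> q c i \<in> borel_measurable borel \<and>
        (\<forall>\<theta>\<in>\<Theta>. \<bar>q c i \<theta> - indicator (ball (ts c) r0) \<theta> * ((\<theta> - ts c) \<bullet> i)\<bar> \<le> C * U \<theta>)"
    by (rule exE[OF trig_identification[OF f bnd K inj ts]], assumption) (elim exE conjE)
  \<comment> \<open>The size of this family depends only on \<open>K\<close> and the dimension, so a
    union bound over the statistics costs a constant factor.\<close>
  define \<Psi> where "\<Psi> = insert U (u ` {1..K} \<union> (\<lambda>(c, i). q c i) ` ({1..K} \<times> Basis))"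
  have fin: "finite \<Psi>" and ne: "\<Psi> \<noteq> {}" by (auto simp: \<Psi>_def)
  have \<Psi>U: "U \<in> \<Psi>" and \<Psi>u: "\<And>c. c \<in> {1..K} \<Longrightarrow> u c \<in> \<Psi>" and \<Psi>q: "\<And>c i. c \<in> {1..K} \<Longrightarrow> i \<in> Basis \<Longrightarrow> q c i \<in> \<Psi>"
    by (auto simp: \<Psi>_def)
  have obs: "\<forall>\<psi>\<in>\<Psi>. observable f \<psi>" using Uo u q by (auto simp: \<Psi>_def)
  have "\<forall>\<psi>\<in>\<Psi>. \<exists>p. fst p \<in> borel_measurable borel \<and> (\<forall>x. \<bar>fst p x\<bar> \<le> snd p) \<and> (\<forall>\<theta>. (\<integral>x. fst p x * f (x - \<theta>) \<partial>lborel) = \<psi> \<theta>)"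
    using obs unfolding observable_def by (simp add: split_paired_Ex)
  from bchoice[OF this] obtain p where p: "\<forall>\<psi>\<in>\<Psi>. fst (p \<psi>) \<in> borel_measurable borel \<and> (\<forall>x. \<bar>fst (p \<psi>) x\<bar> \<le> snd (p \<psi>)) \<and>
      (\<forall>\<theta>. (\<integral>x. fst (p \<psi>) x * f (x - \<theta>) \<partial>lborel) = \<psi> \<theta>)" ..
  define g where "g \<psi> = fst (p \<psi>)" for \<psi>
  define B where "B = 1 + (\<Sum>\<psi>\<in>\<Psi>. \<bar>snd (p \<psi>)\<bar>)"
  have B1: "B \<ge> 1" by (simp add: B_def sum_nonneg)
  then have B0: "B > 0" by simp
  have gm: "g \<psi> \<in> borel_measurable borel" and g\<psi>: "\<And>\<theta>. (\<integral>x. g \<psi> x * f (x - \<theta>) \<partial>lborel) = \<psi> \<theta>" if "\<psi> \<in> \<Psi>" for \<psi>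
    using p that by (auto simp: g_def)
  have gB: "\<bar>g \<psi> x\<bar> \<le> B" if "\<psi> \<in> \<Psi>" for \<psi> x
  proof -
    have "\<bar>g \<psi> x\<bar> \<le> \<bar>snd (p \<psi>)\<bar>" using p that unfolding g_def by (meson abs_ge_self order_trans)
    also have "\<dots> \<le> (\<Sum>\<psi>\<in>\<Psi>. \<bar>snd (p \<psi>)\<bar>)" using that fin by (intro member_le_sum) auto
    finally show ?thesis by (simp add: B_def)
  qed
  have tU: "true_mean U = 0" using Ut by (simp add: true_mean_def)
  have tu: "true_mean (u c) = ws c" if "c \<in> {1..K}" for c
  proof -
    have "true_mean (u c) = (\<Sum>d = 1..K. if d = c then ws d else 0)"
      unfolding true_mean_def using u that by (intro sum.cong) auto
    then show ?thesis using that by simp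
  qed
  have tq: "true_mean (q c i) = 0" if "c \<in> {1..K}" "i \<in> Basis" for c i using q that by (simp add: true_mean_def)
  have ws1: "ws c \<le> 1" if "c \<in> {1..K}" for c
    using member_le_sum[of c "{1..K}" ws] that ws_pos ws_sum by (simp add: less_imp_le)
  interpret DP: dp_prior \<alpha> P0 U "\<lambda>c. ball (ts c) r0" K ws ts Cb "sqrt C * max 1 (real K * Cb)"
  proof (rule dp_prior.intro)
    show "\<alpha> > 0" by (rule al)
    show "prob_space P0" by (rule P0)
    show "sets P0 = sets borel" by (rule sets_P0)
    show "Cb \<ge> 0" by (rule Cb)
    show "sqrt C * max 1 (real K * Cb) \<ge> 0" using C by (intro mult_nonneg_nonneg) auto
    show "emeasure P0 (cball x s) \<le> ennreal (Cb * s ^ DIM('a))" if "s \<ge> 0" for x s by (rule ball[OF that])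
    show "U \<in> borel_measurable borel" by (rule Um)
    show "ball (ts c) r0 \<in> sets borel" for c by simp
    show "disjoint_family_on (\<lambda>c. ball (ts c) r0) {1..K}" by (rule dis)
    show "K \<ge> 1" by (rule K)
    show "U \<theta> \<ge> 0" for \<theta> using U by blast
    show "0 < ws c \<and> ws c \<le> 1" if "c \<in> {1..K}" for c using ws_pos[OF that] ws1[OF that] by blast
    show "emeasure P0 {\<theta>. U \<theta> * y \<le> 1} \<le> ennreal (damp (sqrt C * max 1 (real K * Cb)) (1/2) y)" if "y > 0" for y
      using sep by (intro emeasure_small_separation[OF ball Cb C Um _ that]) auto
  qed
  obtain C1 M e0 where C1: "C1 \<ge> 0" and e0: "e0 > 0" and ev: "\<forall>m e \<rho>. 1 \<le> m \<longrightarrow> 0 < e \<longrightarrow> e \<le> e0 \<longrightarrow> 0 < \<rho> \<longrightarrow> \<rho> \<le> 1 \<longrightarrow>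
     emeasure prior (DP.prior_event m e \<rho>) \<le>
       ennreal (C1 * real m powr M * e powr (real (K - 1) + \<alpha> + real (K * DIM('a))) * (e / \<rho>) powr (1/4))"
    using DP.emeasure_prior_event by (elim exE conjE)
  define N where "N = real (K - 1) + \<alpha> + real (K * DIM('a))"
  define k0 where "k0 = real DIM('a) * (2 * C + 3)"
  have k0: "k0 > 0" using C by (simp add: k0_def)
  define C2 where "C2 = C1 * k0 powr N * k0 powr (1/4)"
  have C2: "C2 \<ge> 0" using C1 by (simp add: C2_def)
  define L where "L = 2 * real (card \<Psi>)"
  define \<tau>0 where "\<tau>0 = min 1 (e0 / k0)"
  have \<tau>0: "\<tau>0 > 0" using e0 k0 by (simp add: \<tau>0_def)
  have main: "\<exists>G\<in>sets QI. emeasure QI (space QI - G) \<le> ennreal (L * exp (- (real n * \<tau>\<^sup>2 / (16 * B\<^sup>2)))) \<and>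
       (\<forall>E t. (\<forall>k\<in>E. t \<le> (\<Sum>i = 1..n. of_bool (k i > K))) \<longrightarrow> (\<integral>\<^sup>+\<omega>. alloc_prob n G E \<omega> \<partial>prior) \<le>
          ennreal (C2 * real m powr M * \<tau> powr N * (\<tau> / \<rho>) powr (1/4)
            + (\<alpha> / (\<alpha> + 1)) ^ m / \<tau> + exp (2 * \<rho> * real n - t) + exp (- (real n * \<tau>\<^sup>2 / (16 * B\<^sup>2)))))"
    if m: "1 \<le> m" and \<tau>: "0 < \<tau>" "\<tau> \<le> \<tau>0" and \<rho>: "0 < \<rho>" "\<rho> \<le> 1" for n m \<tau> \<rho>
  proof -
    define x where "x = exp (- (real n * \<tau>\<^sup>2 / (16 * B\<^sup>2)))"
    have \<tau>B: "\<tau> \<le> B" using \<tau> B1 by (simp add: \<tau>0_def)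
    define G where "G = (\<Inter>\<psi>\<in>\<Psi>. typical_data n \<tau> (g \<psi>) (true_mean \<psi>))"
    have Tm: "typical_data n \<tau> (g \<psi>) (true_mean \<psi>) \<in> sets QI" if "\<psi> \<in> \<Psi>" for \<psi> by (rule typical_data_sets[OF gm[OF that]])
    have G: "G \<in> sets QI" unfolding G_def using fin ne Tm by (intro sets.finite_INT) auto
    have "emeasure QI (space QI - G) \<le> emeasure QI (\<Union>\<psi>\<in>\<Psi>. space QI - typical_data n \<tau> (g \<psi>) (true_mean \<psi>))"
      using fin Tm by (intro emeasure_mono sets.finite_UN) (auto simp: G_def)
    also have "\<dots> \<le> (\<Sum>\<psi>\<in>\<Psi>. emeasure QI (space QI - typical_data n \<tau> (g \<psi>) (true_mean \<psi>)))"
      using fin Tm by (intro emeasure_subadditive_finite) auto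
    also have "\<dots> \<le> (\<Sum>\<psi>\<in>\<Psi>. ennreal (2 * x))"
    proof (rule sum_mono)
      fix \<psi> assume \<psi>: "\<psi> \<in> \<Psi>"
      show "emeasure QI (space QI - typical_data n \<tau> (g \<psi>) (true_mean \<psi>)) \<le> ennreal (2 * x)"
        using emeasure_atypical[OF gm[OF \<psi>] gB[OF \<psi>] B0 \<tau>(1) \<tau>B, of n]
        unfolding x_def integral_true_dens[OF gm[OF \<psi>] gB[OF \<psi>] g\<psi>[OF \<psi>]] .
    qed
    also have "\<dots> = ennreal (L * x)" by (simp add: L_def ennreal_of_nat_eq_real_of_nat ennreal_mult[symmetric] x_def mult_ac)
    finally have 1: "emeasure QI (space QI - G) \<le> ennreal (L * x)" .
    define e where "e = k0 * \<tau>"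
    have e: "0 < e" "e \<le> e0"
    proof -
      show "0 < e" using k0 \<tau> by (simp add: e_def)
      have "\<tau> \<le> e0 / k0" using \<tau> by (simp add: \<tau>0_def)
      then show "e \<le> e0" using k0 by (simp add: e_def pos_le_divide_eq mult.commute)
    qed
    let ?R = "{\<omega> \<in> space prior. stick_rem (fst \<omega>) m > \<tau>}"
    have 2: "(\<integral>\<^sup>+\<omega>. alloc_prob n G E \<omega> \<partial>prior) \<le> ennreal (C2 * real m powr M * \<tau> powr N * (\<tau> / \<rho>) powr (1/4)
            + (\<alpha> / (\<alpha> + 1)) ^ m / \<tau> + exp (2 * \<rho> * real n - t) + x)"
      if E: "\<forall>k\<in>E. t \<le> (\<Sum>i = 1..n. of_bool (k i > K))" for E t
    proof -
      have "(\<integral>\<^sup>+\<omega>. alloc_prob n G E \<omega> \<partial>prior) \<le>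
         (\<integral>\<^sup>+\<omega>. indicator (DP.prior_event m e \<rho>) \<omega> + indicator ?R \<omega> + ennreal (exp (2 * \<rho> * real n - t)) + ennreal x \<partial>prior)"
      proof (rule nn_integral_mono_AE, use AE_regular AE_space in eventually_elim)
        case (elim \<omega>)
        note r = elim(1) and sp = elim(2)
        let ?s = "indicator (DP.prior_event m e \<rho>) \<omega> + indicator ?R \<omega> + ennreal (exp (2 * \<rho> * real n - t)) + ennreal x"
        \<comment> \<open>In the cases \<open>far\<close> and \<open>small\<close> the model
          probability itself is exponentially controlled. In the cases \<open>tail\<close> and
          \<open>near\<close> it is bounded by 1 and the prior probability of the case is what
          counts.\<close>
        consider (far) \<psi> where "\<psi> \<in> \<Psi>" "\<bar>pred_mean \<omega> \<psi> - true_mean \<psi>\<bar> > 2 * \<tau>" | (tail) "stick_rem (fst \<omega>) m > \<tau>"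
          | (small) "stick_rem (fst \<omega>) K \<le> \<rho>"
          | (near) "\<forall>\<psi>\<in>\<Psi>. \<bar>pred_mean \<omega> \<psi> - true_mean \<psi>\<bar> \<le> 2 * \<tau>" "stick_rem (fst \<omega>) m \<le> \<tau>" "stick_rem (fst \<omega>) K > \<rho>"
          by (meson not_le)
        then show "alloc_prob n G E \<omega> \<le> ?s"
        proof cases
          case far
          have "alloc_prob n G E \<omega> \<le> ennreal x" unfolding x_def
            by (rule alloc_prob_atypical[OF sp r G _ gm gB B0 g\<psi> \<tau>(1) \<tau>B far(2)]) (use far(1) in \<open>auto simp: G_def\<close>)
          then show ?thesis by (rule order_trans) simp
        next
          case tail
          have "alloc_prob n G E \<omega> \<le> indicator ?R \<omega>" using alloc_prob_le_1[OF r, of n G E] tail sp by simp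
          also have "\<dots> \<le> ?s" by (simp add: add.assoc add_increasing)
          finally show ?thesis .
        next
          case small
          have "alloc_prob n G E \<omega> \<le> ennreal (exp (2 * \<rho> * real n - t))" by (rule alloc_prob_few_late[OF r small]) (use E in blast)
          then show ?thesis by (rule order_trans) (simp add: add.assoc add_increasing)
        next
          case near
          have nU: "pred_mean \<omega> U \<le> 2 * \<tau>" using near(1) \<Psi>U tU by fastforce
          have nu: "\<bar>pred_mean \<omega> (u c) - ws c\<bar> \<le> 2 * \<tau>" if "c \<in> {1..K}" for c using near(1) \<Psi>u[OF that] tu[OF that] by fastforce
          have nq: "\<bar>pred_mean \<omega> (q c i)\<bar> \<le> 2 * \<tau>" if "c \<in> {1..K}" "i \<in> Basis" for c i using near(1) \<Psi>q[OF that] tq[OF that] by fastforce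
          have nt: "k \<in> {1..m} \<longrightarrow> stick_weight (fst \<omega>) k * U (snd \<omega> k) \<le> e"
            "\<bar>(\<Sum>k = 1..m. (indicator (ball (ts c) r0) (snd \<omega> k) * stick_weight (fst \<omega>) k) *\<^sub>R 1) - ws c\<bar> \<le> e"
            "norm (\<Sum>k = 1..m. (indicator (ball (ts c) r0) (snd \<omega> k) * stick_weight (fst \<omega>) k) *\<^sub>R (snd \<omega> k - ts c)) \<le> e"
            if c: "c \<in> {1..K}" for c k
          proof -
            have uc: "\<bar>u c \<theta> - indicator (ball (ts c) r0) \<theta>\<bar> \<le> C * U \<theta>" if "\<theta> \<in> \<Theta>" for \<theta> using u c that by blast
            have qc: "\<bar>q c i \<theta> - indicator (ball (ts c) r0) \<theta> * ((\<theta> - ts c) \<bullet> i)\<bar> \<le> C * U \<theta>" if "i \<in> Basis" "\<theta> \<in> \<Theta>" for i \<theta>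
              using q c that by blast
            note nt = near_truth[OF r U[rule_format] nU C r0(2) uc nu[OF c] qc nq[OF c] near(2), folded k0_def, folded e_def]
            show "k \<in> {1..m} \<longrightarrow> stick_weight (fst \<omega>) k * U (snd \<omega> k) \<le> e" using nt(1) by blast
            show "\<bar>(\<Sum>k = 1..m. (indicator (ball (ts c) r0) (snd \<omega> k) * stick_weight (fst \<omega>) k) *\<^sub>R 1) - ws c\<bar> \<le> e" by (rule nt(2))
            show "norm (\<Sum>k = 1..m. (indicator (ball (ts c) r0) (snd \<omega> k) * stick_weight (fst \<omega>) k) *\<^sub>R (snd \<omega> k - ts c)) \<le> e" by (rule nt(3))
          qed
          have "1 \<le> k0"
          proof -
            have "1 * 1 \<le> k0" unfolding k0_def using C DIM_positive[where 'a = 'a] by (intro mult_mono) auto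
            then show ?thesis by simp
          qed
          then have "\<tau> \<le> e" using \<tau> mult_right_mono[of 1 k0 \<tau>] by (simp add: e_def)
          then have re: "stick_rem (fst \<omega>) m \<le> e" using near(2) by simp
          have "1 \<in> {1..K}" using K by simp
          have "\<omega> \<in> DP.prior_event m e \<rho>"
            unfolding DP.prior_event_def DP.cluster_sum_def mem_Collect_eq
          proof (intro conjI ballI allI)
            show "\<omega> \<in> space prior" by (rule sp)
            show "j \<ge> 1 \<longrightarrow> 0 < fst \<omega> j \<and> fst \<omega> j < 1" for j using r by (simp add: regular_def)
            show "stick_weight (fst \<omega>) k * U (snd \<omega> k) \<le> e" if "k \<in> {1..m}" for k using nt(1)[OF \<open>1 \<in> {1..K}\<close>] that by blast
            show "\<bar>(\<Sum>k = 1..m. (indicator (ball (ts c) r0) (snd \<omega> k) * stick_weight (fst \<omega>) k) *\<^sub>R 1) - ws c\<bar> \<le> 2 * e" if "c \<in> {1..K}" for c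
              using nt(2)[OF that] e(1) by linarith
            show "norm (\<Sum>k = 1..m. (indicator (ball (ts c) r0) (snd \<omega> k) * stick_weight (fst \<omega>) k) *\<^sub>R (snd \<omega> k - ts c)) \<le> 2 * e" if "c \<in> {1..K}" for c
              using nt(3)[OF that] e(1) by linarith
            show "stick_rem (fst \<omega>) m \<le> e" by (rule re)
            show "\<rho> < stick_rem (fst \<omega>) K" by (rule near(3))
          qed
          then have "alloc_prob n G E \<omega> \<le> indicator (DP.prior_event m e \<rho>) \<omega>" using alloc_prob_le_1[OF r, of n G E] by simp
          then show ?thesis by (rule order_trans) (simp add: add.assoc)
        qed
      qed
      also have "\<dots> = emeasure prior (DP.prior_event m e \<rho>) + emeasure prior ?R + ennreal (exp (2 * \<rho> * real n - t)) + ennreal x"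
        using emeasure_stick_tail(1)[OF \<tau>(1), of m] DP.prior_event_measurable[of m e \<rho>] prob_space.emeasure_space_1[OF prob_prior]
        by (simp only: nn_integral_add nn_integral_indicator nn_integral_const borel_measurable_indicator borel_measurable_const borel_measurable_add mult_1_right)
      also have "\<dots> \<le> ennreal (C2 * real m powr M * \<tau> powr N * (\<tau> / \<rho>) powr (1/4)) + ennreal ((\<alpha> / (\<alpha> + 1)) ^ m / \<tau>) + ennreal (exp (2 * \<rho> * real n - t)) + ennreal x"
      proof (intro add_mono order_refl)
        have "emeasure prior (DP.prior_event m e \<rho>) \<le> ennreal (C1 * real m powr M * e powr N * (e / \<rho>) powr (1/4))"
          using ev[rule_format, OF m e \<rho>] unfolding N_def .
        also have "C1 * real m powr M * e powr N * (e / \<rho>) powr (1/4) = C2 * real m powr M * \<tau> powr N * (\<tau> / \<rho>) powr (1/4)"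
          using powr_mult[of k0 "\<tau> / \<rho>" "1/4"] k0 \<tau> \<rho> by (simp add: C2_def e_def powr_mult)
        finally show "emeasure prior (DP.prior_event m e \<rho>) \<le> ennreal (C2 * real m powr M * \<tau> powr N * (\<tau> / \<rho>) powr (1/4))" .
        show "emeasure prior ?R \<le> ennreal ((\<alpha> / (\<alpha> + 1)) ^ m / \<tau>)" by (rule emeasure_stick_tail(2)[OF \<tau>(1)])
      qed
      also have "\<dots> = ennreal (C2 * real m powr M * \<tau> powr N * (\<tau> / \<rho>) powr (1/4) + (\<alpha> / (\<alpha> + 1)) ^ m / \<tau> + exp (2 * \<rho> * real n - t) + x)"
        using C2 al \<tau> by (simp add: x_def ennreal_plus[symmetric] del: ennreal_plus)
      finally show ?thesis .
    qed
    show ?thesis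
    proof (rule bexI[of _ G])
      show "emeasure QI (space QI - G) \<le> ennreal (L * exp (- (real n * \<tau>\<^sup>2 / (16 * B\<^sup>2)))) \<and>
       (\<forall>E t. (\<forall>k\<in>E. t \<le> (\<Sum>i = 1..n. of_bool (k i > K))) \<longrightarrow> (\<integral>\<^sup>+\<omega>. alloc_prob n G E \<omega> \<partial>prior) \<le>
          ennreal (C2 * real m powr M * \<tau> powr N * (\<tau> / \<rho>) powr (1/4)
            + (\<alpha> / (\<alpha> + 1)) ^ m / \<tau> + exp (2 * \<rho> * real n - t) + exp (- (real n * \<tau>\<^sup>2 / (16 * B\<^sup>2)))))"
        using 1 2 unfolding x_def by blast
    qed (rule G)
  qed
  have L0: "L \<ge> 0" by (simp add: L_def)
  show ?thesis
    apply (rule exI[of _ L], rule conjI[OF L0], rule exI[of _ B], rule conjI[OF B0], rule exI[of _ C2], rule conjI[OF C2],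
        rule exI[of _ M], rule exI[of _ \<tau>0], rule conjI[OF \<tau>0])
    using main unfolding N_def by blast
qed

end

subsection \<open>Convergence\<close>

lemma powr_times_exp_decay:
  assumes b: "b > 0" and c: "c > 0"
  shows "(\<lambda>n. real n powr a * exp (- (c * real n powr b))) \<longlonglongrightarrow> 0"
proof -
  \<comment> \<open>An integer number of factors \<open>n powr b\<close> large enough to dominate
    \<open>n powr a\<close>; for negative \<open>a\<close> it is 0.\<close>
  define k where "k = nat \<lceil>a / b\<rceil>"
  have "a / b \<le> real k" unfolding k_def by (rule real_nat_ceiling_ge)
  then have k: "a \<le> b * real k" using b by (simp add: pos_divide_le_eq mult.commute)
  have y: "filterlim (\<lambda>n. c * real n powr b) at_top sequentially"
    by (rule filterlim_tendsto_pos_mult_at_top[OF tendsto_const c])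
      (rule filterlim_compose[OF real_powr_at_top[OF b] filterlim_real_sequentially])
  have "(\<lambda>n. (1 / c ^ k) * ((c * real n powr b) ^ k / exp (c * real n powr b))) \<longlonglongrightarrow> (1 / c ^ k) * 0"
    by (intro tendsto_mult tendsto_const filterlim_compose[OF tendsto_power_div_exp_0 y])
  then have lim: "(\<lambda>n. (1 / c ^ k) * ((c * real n powr b) ^ k / exp (c * real n powr b))) \<longlonglongrightarrow> 0" by simp
  show ?thesis
  proof (rule tendsto_sandwich[OF _ _ tendsto_const lim])
    show "\<forall>\<^sub>F n in sequentially. 0 \<le> real n powr a * exp (- (c * real n powr b))" by simp
    show "\<forall>\<^sub>F n in sequentially. real n powr a * exp (- (c * real n powr b)) \<le> (1 / c ^ k) * ((c * real n powr b) ^ k / exp (c * real n powr b))"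
      using eventually_ge_at_top[of 1]
    proof eventually_elim
      case (elim n)
      have "real n powr a \<le> real n powr (b * real k)" using elim k by (intro powr_mono) auto
      also have "\<dots> = (real n powr b) ^ k" using elim by (simp add: powr_powr[symmetric] powr_realpow)
      finally have "real n powr a * exp (- (c * real n powr b)) \<le> (real n powr b) ^ k * exp (- (c * real n powr b))" by (rule mult_right_mono) simp
      also have "\<dots> = (1 / c ^ k) * ((c * real n powr b) ^ k / exp (c * real n powr b))"
        using c by (simp add: power_mult_distrib exp_minus field_simps)
      finally show ?case .
    qed
  qed
qed

lemma powr_neg_tendsto: "s > 0 \<Longrightarrow> (\<lambda>n. real n powr - s) \<longlonglongrightarrow> 0"
  using tendsto_neg_powr[OF _ filterlim_real_sequentially, of "- s"] by simp

context dpm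
begin

lemma evidence_eq: "(\<integral>\<^sup>+\<omega>. (\<Prod>i = 1..n. dens \<omega> (X i) / ennreal (true_dens (X i))) \<partial>prior) = den n X / lik n X"
proof -
  have dm: "(\<lambda>\<omega>. dens \<omega> x) \<in> borel_measurable prior" for x
    using measurable_compose[OF measurable_Pair2'[of x borel prior] dens_measurable] by simp
  show ?thesis unfolding prod_divide_lik den_def
    by (rule nn_integral_divide) (intro borel_measurable_prod_ennreal dm)
qed

lemma lik_measurable: "lik n \<in> borel_measurable QI"
  unfolding lik_def
  by (intro borel_measurable_prod_ennreal measurable_compose[OF coordinate_measurable measurable_compose[OF true_dens_meas measurable_ennreal]]) auto

text \<open>Markov for the numerator: where the data are typical and the evidence relative to the
  true likelihood is at least \<open>a\<close>, a posterior probability above \<open>e\<close>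
  forces the relative numerator to be at least \<open>e * a\<close>. All other data are charged to
  \<open>g\<close> or to the evidence term.\<close>

lemma posterior_prob_bound:
  assumes E: "E \<subseteq> {1..n} \<rightarrow>\<^sub>E {1..}" and G: "G \<in> sets QI" "emeasure QI (space QI - G) \<le> ennreal g" "g \<ge> 0"
    and I: "(\<integral>\<^sup>+\<omega>. alloc_prob n G E \<omega> \<partial>prior) \<le> ennreal I" "I \<ge> 0" and a: "a > 0" and e: "e > 0"
  shows "measure QI {X \<in> space QI. measure (allocation_posterior f \<alpha> P0 n X) E > e} \<le>
    g + measure QI {X \<in> space QI. (\<integral>\<^sup>+\<omega>. (\<Prod>i = 1..n. dens \<omega> (X i) / ennreal (true_dens (X i))) \<partial>prior) < ennreal a} + I / (e * a)"
proof -
  interpret QQ: prob_space QI by (rule prob_QI)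
  let ?Y = "{X \<in> space QI. measure (allocation_posterior f \<alpha> P0 n X) E > e}"
  let ?B = "{X \<in> space QI. den n X / lik n X < ennreal a}"
  have Y: "?Y \<in> sets QI" by (rule borel_measurable_less[OF borel_measurable_const posterior_measurable[OF E]])
  have B: "?B \<in> sets QI"
    by (rule borel_measurable_less[OF borel_measurable_divide_ennreal[OF den_measurable lik_measurable] borel_measurable_const])
  define S where "S = (?Y \<inter> G) - ?B"
  have S: "S \<in> sets QI" unfolding S_def by (intro sets.Int sets.Diff Y G(1) B)
  have "ennreal (e * a) * emeasure QI S = (\<integral>\<^sup>+X. ennreal (e * a) * indicator S X \<partial>QI)"
    using S by (rule nn_integral_cmult_indicator[symmetric])
  also have "\<dots> \<le> (\<integral>\<^sup>+X. indicator G X * (post_num n E X / lik n X) \<partial>QI)"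
  proof (rule nn_integral_mono)
    fix X assume X: "X \<in> space QI"
    show "ennreal (e * a) * indicator S X \<le> indicator G X * (post_num n E X / lik n X)"
    proof (cases "X \<in> S")
      case True
      have y: "measure (allocation_posterior f \<alpha> P0 n X) E > e" and XG: "X \<in> G" and d: "ennreal a \<le> den n X / lik n X"
        using True X by (auto simp: S_def not_less)
      have "0 < ennreal a" using a by simp
      then have "0 < den n X / lik n X" using d by (rule less_le_trans)
      then have "den n X > 0" by (rule contrapos_pp) (simp add: not_less)
      then have "ennreal e * den n X \<le> post_num n E X" by (rule posterior_le[OF E _ e y])
      then have "ennreal e * den n X / lik n X \<le> post_num n E X / lik n X" by (rule divide_right_mono_ennreal)
      moreover have "ennreal (e * a) \<le> ennreal e * (den n X / lik n X)" using d e a by (simp add: ennreal_mult mult_left_mono)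
      ultimately have "ennreal (e * a) \<le> post_num n E X / lik n X" by (simp add: ennreal_times_divide)
      then show ?thesis using True XG by simp
    qed simp
  qed
  also have "\<dots> \<le> ennreal I" unfolding nn_integral_post_num[OF G(1)] by (rule I(1))
  finally have "ennreal (e * a * measure QI S) \<le> ennreal I" using e a
    by (simp only: QQ.emeasure_eq_measure[of S] ennreal_mult[symmetric] measure_nonneg mult_nonneg_nonneg less_imp_le)
  then have "e * a * measure QI S \<le> I" using I(2) by (simp add: ennreal_le_iff)
  then have mS: "measure QI S \<le> I / (e * a)" using e a by (simp add: pos_le_divide_eq mult.commute)
  have mG: "measure QI (space QI - G) \<le> g" using G(2,3) unfolding QQ.emeasure_eq_measure by (simp only: ennreal_le_iff)
  have Gc: "space QI - G \<in> sets QI" using G(1) by (rule sets.compl_sets)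
  have "measure QI ?Y \<le> measure QI ((space QI - G) \<union> ?B \<union> S)"
    by (intro QQ.finite_measure_mono sets.Un Gc B S) (auto simp: S_def)
  also have "\<dots> \<le> measure QI ((space QI - G) \<union> ?B) + measure QI S"
    by (intro measure_Un_le sets.Un Gc B S)
  also have "measure QI ((space QI - G) \<union> ?B) \<le> measure QI (space QI - G) + measure QI ?B"
    by (intro measure_Un_le Gc B)
  finally have "measure QI ?Y \<le> g + measure QI ?B + I / (e * a)" using mS mG by linarith
  then show ?thesis unfolding evidence_eq .
qed

lemma posterior_allocation_tendsto:
  assumes ball: "\<And>x s. s \<ge> 0 \<Longrightarrow> emeasure P0 (cball x s) \<le> ennreal (Cb * s ^ DIM('a))" and Cb: "Cb \<ge> 0"
    and dom: "\<And>x \<theta> \<theta>'. \<theta> \<in> \<Theta> \<Longrightarrow> \<theta>' \<in> \<Theta> \<Longrightarrow>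
       \<bar>f (x - \<theta>) - f (x - \<theta>')\<bar> \<le> norm (\<theta> - \<theta>') * W x * f (x - \<theta>') \<and> f (x - \<theta>) \<le> W x * f (x - \<theta>')"
    and Wm: "W \<in> borel_measurable borel" and Wfin: "(\<integral>\<^sup>+x. ennreal ((W x)\<^sup>2 * true_dens x) \<partial>lborel) < \<infinity>"
    and thick: "\<And>c \<epsilon>. c \<in> {1..K} \<Longrightarrow> 0 < \<epsilon> \<Longrightarrow> \<epsilon> \<le> 1 \<Longrightarrow> ennreal (c0 * \<epsilon> ^ DIM('a)) \<le> emeasure P0 (ball (ts c) \<epsilon>)"
    and c0: "c0 > 0" and \<delta>: "\<delta> > 0" and e: "e > 0"
  shows "(\<lambda>n. measure QI {X \<in> space QI. measure (allocation_posterior f \<alpha> P0 n X)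
     {c \<in> {1..n} \<rightarrow>\<^sub>E {1..}. 1 / real n * (\<Sum>i = 1..n. of_bool (c i > K)) > 1 / real n powr (1 / 2 - \<delta>)} > e}) \<longlonglongrightarrow> 0"
proof -
  define N where "N = real (K - 1) + \<alpha> + real (K * DIM('a))"
  have N: "N \<ge> 0" using al by (simp add: N_def)
  obtain c C where c: "c > 0" and C: "C \<ge> 0" and ev: "\<forall>n \<epsilon>. 0 < \<epsilon> \<longrightarrow> \<epsilon> \<le> 1 \<longrightarrow>
     measure QI {X \<in> space QI. (\<integral>\<^sup>+\<omega>. (\<Prod>i = 1..n. dens \<omega> (X i) / ennreal (true_dens (X i))) \<partial>prior) <
          ennreal (c * \<epsilon> powr N)} \<le> 4 * ((1 + C * \<epsilon>\<^sup>2) ^ n - 1)"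
  proof -
    have "\<exists>c>0. \<exists>C\<ge>0. \<forall>n \<epsilon>. 0 < \<epsilon> \<longrightarrow> \<epsilon> \<le> 1 \<longrightarrow>
     measure QI {X \<in> space QI. (\<integral>\<^sup>+\<omega>. (\<Prod>i = 1..n. dens \<omega> (X i) / ennreal (true_dens (X i))) \<partial>prior) <
          ennreal (c * \<epsilon> powr N)} \<le> 4 * ((1 + C * \<epsilon>\<^sup>2) ^ n - 1)"
      unfolding N_def by (rule evidence_lower_bound[OF dom Wm Wfin thick c0])
    then show ?thesis using that by (elim exE conjE)
  qed
  obtain L B C2 M \<tau>0 where L: "L \<ge> 0" and B: "B > 0" and C2: "C2 \<ge> 0" and \<tau>0: "\<tau>0 > 0" and num: "\<forall>n m \<tau> \<rho>. 1 \<le> m \<longrightarrow> 0 < \<tau> \<longrightarrow> \<tau> \<le> \<tau>0 \<longrightarrow> 0 < \<rho> \<longrightarrow> \<rho> \<le> 1 \<longrightarrow>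
     (\<exists>G\<in>sets QI. emeasure QI (space QI - G) \<le> ennreal (L * exp (- (real n * \<tau>\<^sup>2 / (16 * B\<^sup>2)))) \<and>
       (\<forall>E t. (\<forall>k\<in>E. t \<le> (\<Sum>i = 1..n. of_bool (k i > K))) \<longrightarrow> (\<integral>\<^sup>+\<omega>. alloc_prob n G E \<omega> \<partial>prior) \<le>
          ennreal (C2 * real m powr M * \<tau> powr N * (\<tau> / \<rho>) powr (1/4)
            + (\<alpha> / (\<alpha> + 1)) ^ m / \<tau> + exp (2 * \<rho> * real n - t) + exp (- (real n * \<tau>\<^sup>2 / (16 * B\<^sup>2))))))"
    by (rule exE[OF expected_alloc_prob[OF ball Cb]], assumption) (elim exE conjE, unfold N_def)
  define E where "E n = {c \<in> {1..n} \<rightarrow>\<^sub>E {1..}. 1 / real n * (\<Sum>i = 1..n. of_bool (c i > K)) > 1 / real n powr (1 / 2 - \<delta>)}" for n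
  \<comment> \<open>The cap at 1/4 keeps \<rho> at most 1 when \<delta> is large. Lowering the
    exponent only lowers the threshold, so the bound covers the original event.\<close>
  define d1 where "d1 = min \<delta> (1/4)"
  have d1: "0 < d1" "d1 \<le> 1/4" "d1 \<le> \<delta>" using \<delta> by (auto simp: d1_def)
  \<comment> \<open>Margin by which \<tau> and \<epsilon> miss \<open>n powr - (1/2)\<close>, and at
    the same time the growth exponent of \<open>m\<close>. It is so small that all losses together
    stay below \<open>d1 / 8\<close>, against a gain of \<open>d1 / 4\<close>.\<close>
  define d where "d = d1 / (8 * (2 * N + \<bar>M\<bar> + 1))"
  have d0: "d > 0" using d1 N by (simp add: d_def)
  have "d1 / (8 * q) * q = d1 / 8" if "q \<noteq> 0" for q using that by simp
  from this[of "2 * N + \<bar>M\<bar> + 1"] have dM: "d * (2 * N + \<bar>M\<bar> + 1) = d1 / 8" using N unfolding d_def by linarith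
  have d14: "d < 1/4"
  proof -
    have "d * 1 \<le> d * (2 * N + \<bar>M\<bar> + 1)" using d0 N by (intro mult_left_mono) auto
    then show ?thesis using dM d1 by simp
  qed
  \<comment> \<open>Balance of exponents of \<open>n\<close>: \<open>d * \<bar>M\<bar>\<close> from
    the power of \<open>m\<close>, \<open>2 * N * d\<close> from
    \<open>(\<tau> / \<epsilon>) powr N\<close>, and the negative \<open>(d - d1) / 4\<close> from
    \<open>(\<tau> / \<rho>) powr (1/4)\<close>.\<close>
  define \<kappa> where "\<kappa> = - (d * \<bar>M\<bar> + 2 * N * d + (d - d1) / 4)"
  have \<kappa>: "\<kappa> > 0"
  proof -
    have "d * \<bar>M\<bar> + 2 * N * d + d = d1 / 8" using dM by (simp add: algebra_simps)
    then show ?thesis unfolding \<kappa>_def using d0 d1 by simp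
  qed
  define \<beta> where "\<beta> = 1 / (16 * B\<^sup>2)"
  have \<beta>: "\<beta> > 0" using B by (simp add: \<beta>_def)
  define \<nu> where "\<nu> = - ln (\<alpha> / (\<alpha> + 1))"
  have \<nu>: "\<nu> > 0" using al by (simp add: \<nu>_def)
  define K3 where "K3 = C2 * 2 powr \<bar>M\<bar> * 4 powr (1/4)"
  \<comment> \<open>In order: atypical data, failure of the evidence bound, and the four parts of
    the numerator, each divided by the evidence, that is, multiplied by
    \<open>n powr (N * (1/2 + d))\<close>.\<close>
  define h where "h n = L * (real n powr 0 * exp (- (\<beta> * real n powr (2 * d)))) + 4 * (exp (C * real n powr - (2 * d)) - 1)
     + (K3 * real n powr - \<kappa> + real n powr (1/2 - d + N * (1/2 + d)) * exp (- (\<nu> * real n powr d))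
        + real n powr (N * (1/2 + d)) * exp (- (1/2 * real n powr (1/2 + d1)))
        + real n powr (N * (1/2 + d)) * exp (- (\<beta> * real n powr (2 * d)))) / (e * c)" for n :: nat
  have "h \<longlonglongrightarrow> L * 0 + 4 * (exp (C * 0) - 1) + (K3 * 0 + 0 + 0 + 0) / (e * c)"
    unfolding h_def
    by (intro tendsto_intros powr_times_exp_decay powr_neg_tendsto) (use d0 d1 \<kappa> \<beta> \<nu> e c in auto)
  then have h: "h \<longlonglongrightarrow> 0" by simp
  have ev_\<tau>: "\<forall>\<^sub>F n in sequentially. real n powr (d - 1/2) < \<tau>0"
    using order_tendstoD(2)[OF powr_neg_tendsto[of "1/2 - d"] \<tau>0] d14 by simp
  have bound: "\<forall>\<^sub>F n in sequentially. measure QI {X \<in> space QI. measure (allocation_posterior f \<alpha> P0 n X) (E n) > e} \<le> h n"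
    using ev_\<tau> eventually_ge_at_top[of 1]
  proof eventually_elim
    case (elim n)
    define z where "z = real n"
    have z: "z \<ge> 1" "z > 0" using elim by (auto simp: z_def)
    have zz: "z * z powr s = z powr (1 + s)" for s using z by (simp add: powr_add)
    \<comment> \<open>With these scales \<open>n * \<tau>\<^sup>2\<close> grows like
      \<open>n powr (2 * d)\<close>, so the test errors vanish exponentially, while
      \<open>n * \<epsilon>\<^sup>2\<close> decays like \<open>n powr - (2 * d)\<close>, so the
      variance of the evidence vanishes. The product \<open>2 * \<rho> * n\<close> is half of
      \<open>t\<close>, and \<open>m\<close> of order \<open>n powr d\<close> makes the truncated
      mass negligible.\<close>
    define \<tau> where "\<tau> = z powr (d - 1/2)"
    define \<rho> where "\<rho> = z powr (d1 - 1/2) / 4"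
    define \<epsilon> where "\<epsilon> = z powr (- 1/2 - d)"
    define t where "t = z powr (1/2 + d1)"
    define m where "m = nat \<lceil>z powr d\<rceil>"
    have zd: "1 \<le> z powr d" using z d0 by (simp add: ge_one_powr_ge_zero)
    have m: "1 \<le> m" "z powr d \<le> real m" "real m \<le> 2 * z powr d"
      using zd unfolding m_def by linarith+
    have \<tau>: "0 < \<tau>" "\<tau> \<le> \<tau>0" using z elim by (auto simp: \<tau>_def z_def)
    have \<rho>: "0 < \<rho>" "\<rho> \<le> 1"
    proof -
      show "0 < \<rho>" using z by (simp add: \<rho>_def)
      have "z powr (d1 - 1/2) \<le> z powr 0" using z d1 by (intro powr_mono) auto
      then show "\<rho> \<le> 1" using z by (simp add: \<rho>_def)
    qed
    have \<epsilon>: "0 < \<epsilon>" "\<epsilon> \<le> 1"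
    proof -
      show "0 < \<epsilon>" using z by (simp add: \<epsilon>_def)
      have "z powr (- 1/2 - d) \<le> z powr 0" using z d0 by (intro powr_mono) auto
      then show "\<epsilon> \<le> 1" using z by (simp add: \<epsilon>_def)
    qed
    have \<epsilon>N: "\<epsilon> powr N = z powr (- (N * (1/2 + d)))" unfolding \<epsilon>_def powr_powr by (rule arg_cong[of _ _ "\<lambda>s. z powr s"]) (simp add: algebra_simps)
    have n\<tau>: "real n * \<tau>\<^sup>2 / (16 * B\<^sup>2) = \<beta> * z powr (2 * d)"
    proof -
      have "\<tau>\<^sup>2 = z powr (2 * d - 1)" unfolding \<tau>_def power2_eq_square powr_add[symmetric] by (rule arg_cong[of _ _ "\<lambda>s. z powr s"]) simp
      then have "real n * \<tau>\<^sup>2 = z powr (2 * d)" using zz[of "2 * d - 1"] by (simp add: z_def)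
      then show ?thesis by (simp add: \<beta>_def)
    qed
    define x where "x = exp (- (\<beta> * z powr (2 * d)))"
    define I where "I = C2 * real m powr M * \<tau> powr N * (\<tau> / \<rho>) powr (1/4) + (\<alpha> / (\<alpha> + 1)) ^ m / \<tau> + exp (2 * \<rho> * real n - t) + x"
    have I0: "I \<ge> 0" using C2 \<tau> al by (simp add: I_def x_def)
    obtain G where G: "G \<in> sets QI" "emeasure QI (space QI - G) \<le> ennreal (L * x)" and GE: "\<And>E t. (\<forall>k\<in>E. t \<le> (\<Sum>i = 1..n. of_bool (k i > K))) \<Longrightarrow>
       (\<integral>\<^sup>+\<omega>. alloc_prob n G E \<omega> \<partial>prior) \<le> ennreal (C2 * real m powr M * \<tau> powr N * (\<tau> / \<rho>) powr (1/4)
            + (\<alpha> / (\<alpha> + 1)) ^ m / \<tau> + exp (2 * \<rho> * real n - t) + x)"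
      using num[rule_format, OF m(1) \<tau> \<rho>, of n] unfolding n\<tau> x_def by blast
    have Et: "\<forall>k\<in>E n. t \<le> (\<Sum>i = 1..n. of_bool (k i > K))"
    proof
      fix k assume "k \<in> E n"
      then have k: "1 / z powr (1/2 - \<delta>) < 1 / z * (\<Sum>i = 1..n. of_bool (k i > K))" by (simp add: E_def z_def)
      have "t \<le> z powr (1 + - (1/2 - \<delta>))" unfolding t_def using z d1 by (intro powr_mono) auto
      also have "\<dots> = z * (1 / z powr (1/2 - \<delta>))" unfolding zz[symmetric] powr_minus_divide ..
      also have "\<dots> \<le> z * (1 / z * (\<Sum>i = 1..n. of_bool (k i > K)))" using k z by (intro mult_left_mono) auto
      also have "\<dots> = (\<Sum>i = 1..n. of_bool (k i > K))" using z by simp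
      finally show "t \<le> (\<Sum>i = 1..n. of_bool (k i > K))" .
    qed
    have "measure QI {X \<in> space QI. measure (allocation_posterior f \<alpha> P0 n X) (E n) > e} \<le>
       L * x + measure QI {X \<in> space QI. (\<integral>\<^sup>+\<omega>. (\<Prod>i = 1..n. dens \<omega> (X i) / ennreal (true_dens (X i))) \<partial>prior) < ennreal (c * \<epsilon> powr N)} + I / (e * (c * \<epsilon> powr N))"
    proof (rule posterior_prob_bound[OF _ G _ _ I0 _ e])
      show "E n \<subseteq> {1..n} \<rightarrow>\<^sub>E {1..}" by (auto simp: E_def)
      show "0 \<le> L * x" using L by (simp add: x_def)
      show "(\<integral>\<^sup>+\<omega>. alloc_prob n G (E n) \<omega> \<partial>prior) \<le> ennreal I" unfolding I_def by (rule GE[OF Et])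
      show "0 < c * \<epsilon> powr N" using c \<epsilon> by simp
    qed
    also have "\<dots> \<le> L * x + 4 * (exp (C * z powr - (2 * d)) - 1) + I / (e * (c * \<epsilon> powr N))"
    proof (intro add_mono order_refl)
      have "\<epsilon>\<^sup>2 = z powr (-1 + - (2 * d))" unfolding \<epsilon>_def power2_eq_square powr_add[symmetric] by (rule arg_cong[of _ _ "\<lambda>s. z powr s"]) simp
      then have ne: "real n * \<epsilon>\<^sup>2 = z powr - (2 * d)" using zz[of "-1 + - (2 * d)"] by (simp add: z_def)
      have "(1 + C * \<epsilon>\<^sup>2) ^ n \<le> exp (C * \<epsilon>\<^sup>2) ^ n" using C exp_ge_add_one_self by (intro power_mono) auto
      also have "\<dots> = exp (C * z powr - (2 * d))" unfolding exp_of_nat_mult[symmetric] ne[symmetric] by (simp add: mult_ac)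
      finally have "4 * ((1 + C * \<epsilon>\<^sup>2) ^ n - 1) \<le> 4 * (exp (C * z powr - (2 * d)) - 1)" by simp
      then show "measure QI {X \<in> space QI. (\<integral>\<^sup>+\<omega>. (\<Prod>i = 1..n. dens \<omega> (X i) / ennreal (true_dens (X i))) \<partial>prior) < ennreal (c * \<epsilon> powr N)}
          \<le> 4 * (exp (C * z powr - (2 * d)) - 1)"
        by (rule order_trans[OF ev[rule_format, OF \<epsilon>]])
    qed
    also have "I / (e * (c * \<epsilon> powr N)) = I * z powr (N * (1/2 + d)) / (e * c)"
      unfolding \<epsilon>N powr_minus_divide by simp
    also have "\<dots> \<le> (K3 * z powr - \<kappa> + z powr (1/2 - d + N * (1/2 + d)) * exp (- (\<nu> * z powr d))
        + z powr (N * (1/2 + d)) * exp (- (1/2 * z powr (1/2 + d1))) + z powr (N * (1/2 + d)) * x) / (e * c)"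
    proof (rule divide_right_mono)
      let ?y = "z powr (N * (1/2 + d))"
      have 1: "C2 * real m powr M * \<tau> powr N * (\<tau> / \<rho>) powr (1/4) * ?y \<le> K3 * z powr - \<kappa>"
      proof -
        have "real m powr M \<le> real m powr \<bar>M\<bar>" using m by (intro powr_mono) auto
        also have "\<dots> \<le> (2 * z powr d) powr \<bar>M\<bar>" using m by (intro powr_mono2) auto
        also have "\<dots> = 2 powr \<bar>M\<bar> * z powr (d * \<bar>M\<bar>)" by (simp add: powr_mult powr_powr)
        finally have mM: "real m powr M \<le> 2 powr \<bar>M\<bar> * z powr (d * \<bar>M\<bar>)" .
        have "\<tau> / \<rho> = 4 * z powr (d - d1)"
        proof -
          have "\<tau> = z powr (d - d1) * z powr (d1 - 1/2)" unfolding \<tau>_def powr_add[symmetric] by simp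
          then show ?thesis using z by (simp add: \<rho>_def)
        qed
        then have tr: "(\<tau> / \<rho>) powr (1/4) = 4 powr (1/4) * z powr ((d - d1) * (1/4))" by (simp add: powr_mult powr_powr)
        have "C2 * real m powr M * \<tau> powr N * (\<tau> / \<rho>) powr (1/4) * ?y \<le>
           C2 * (2 powr \<bar>M\<bar> * z powr (d * \<bar>M\<bar>)) * \<tau> powr N * (\<tau> / \<rho>) powr (1/4) * ?y"
          using mM C2 by (intro mult_right_mono mult_left_mono) auto
        also have "\<dots> = K3 * (z powr (d * \<bar>M\<bar>) * z powr ((d - 1/2) * N) * z powr ((d - d1) * (1/4)) * ?y)"
          unfolding tr by (simp add: \<tau>_def powr_powr K3_def mult_ac)
        also have "z powr (d * \<bar>M\<bar>) * z powr ((d - 1/2) * N) * z powr ((d - d1) * (1/4)) * ?y = z powr - \<kappa>"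
          unfolding powr_add[symmetric] \<kappa>_def by (rule arg_cong[of _ _ "\<lambda>s. z powr s"]) (simp add: algebra_simps)
        finally show ?thesis .
      qed
      have 2: "(\<alpha> / (\<alpha> + 1)) ^ m / \<tau> * ?y \<le> z powr (1/2 - d + N * (1/2 + d)) * exp (- (\<nu> * z powr d))"
      proof -
        have g0: "0 < \<alpha> / (\<alpha> + 1)" using al by simp
        have "(\<alpha> / (\<alpha> + 1)) ^ m = exp (- \<nu>) ^ m" using g0 by (simp add: \<nu>_def)
        also have "\<dots> = exp (real m * - \<nu>)" by (rule exp_of_nat_mult[symmetric])
        also have "\<dots> \<le> exp (- (\<nu> * z powr d))" using mult_left_mono[OF m(2), of \<nu>] \<nu> by (simp add: mult.commute)
        finally have g: "(\<alpha> / (\<alpha> + 1)) ^ m \<le> exp (- (\<nu> * z powr d))" .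
        have "(\<alpha> / (\<alpha> + 1)) ^ m / \<tau> * ?y = ?y / \<tau> * (\<alpha> / (\<alpha> + 1)) ^ m" by simp
        also have "\<dots> \<le> ?y / \<tau> * exp (- (\<nu> * z powr d))" using \<tau> g by (intro mult_left_mono) auto
        also have "?y / \<tau> = z powr (1/2 - d + N * (1/2 + d))"
          unfolding \<tau>_def powr_diff[symmetric] by (rule arg_cong[of _ _ "\<lambda>s. z powr s"]) simp
        finally show ?thesis .
      qed
      have 3: "exp (2 * \<rho> * real n - t) * ?y = ?y * exp (- (1/2 * z powr (1/2 + d1)))"
      proof -
        have "z * z powr (d1 - 1/2) = z powr (1/2 + d1)" unfolding zz by (rule arg_cong[of _ _ "\<lambda>s. z powr s"]) simp
        then have "2 * \<rho> * real n - t = - (1/2 * z powr (1/2 + d1))" by (simp add: \<rho>_def t_def z_def mult_ac)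
        then show ?thesis by (simp add: mult.commute)
      qed
      have "I * ?y = C2 * real m powr M * \<tau> powr N * (\<tau> / \<rho>) powr (1/4) * ?y + (\<alpha> / (\<alpha> + 1)) ^ m / \<tau> * ?y + exp (2 * \<rho> * real n - t) * ?y + x * ?y"
        unfolding I_def by (simp only: distrib_right)
      then show "I * ?y \<le> K3 * z powr - \<kappa> + z powr (1/2 - d + N * (1/2 + d)) * exp (- (\<nu> * z powr d))
        + ?y * exp (- (1/2 * z powr (1/2 + d1))) + ?y * x"
        using 1 2 3 by (simp only: mult.commute[of x])
      show "0 \<le> e * c" using e c by simp
    qed
    finally show ?case using z by (simp add: h_def x_def z_def)
  qed
  have "(\<lambda>n. measure QI {X \<in> space QI. measure (allocation_posterior f \<alpha> P0 n X) (E n) > e}) \<longlonglongrightarrow> 0"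
    by (rule tendsto_sandwich[OF _ bound tendsto_const h]) simp
  then show ?thesis unfolding E_def .
qed

end

section \<open>Ball probabilities under the base measure and the final assembly\<close>

lemma emeasure_density_bounded_cball:
  fixes x :: "'a::euclidean_space"
  assumes P0: "P0 = density lborel (\<lambda>\<theta>. ennreal (p \<theta>))" and p: "p \<in> borel_measurable borel" "\<And>\<theta>. p \<theta> \<le> b" and s: "s \<ge> 0" and b: "b \<ge> 0"
  shows "emeasure P0 (cball x s) \<le> ennreal (b * unit_ball_vol (DIM('a)) * s ^ DIM('a))"
proof -
  have "emeasure P0 (cball x s) = (\<integral>\<^sup>+\<theta>. ennreal (p \<theta>) * indicator (cball x s) \<theta> \<partial>lborel)"
    unfolding P0 using p(1) by (intro emeasure_density) auto
  also have "\<dots> \<le> (\<integral>\<^sup>+\<theta>. ennreal b * indicator (cball x s) \<theta> \<partial>lborel)"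
    using p(2) by (intro nn_integral_mono mult_right_mono ennreal_leI) auto
  also have "\<dots> = ennreal b * emeasure lborel (cball x s)" by (rule nn_integral_cmult_indicator) simp
  also have "\<dots> = ennreal (b * unit_ball_vol (DIM('a)) * s ^ DIM('a))"
    using s b by (simp add: emeasure_cball ennreal_mult[symmetric] mult.assoc)
  finally show ?thesis .
qed

text \<open>By continuity within \<open>\<Theta>\<close> the density is at least
  \<open>p0 t / 2\<close> on the part of \<open>\<Theta>\<close> near \<open>t\<close>;
  \<open>thick\<close> says how much of \<open>\<Theta>\<close> there is. The factor
  \<open>l\<close> shrinks the ball into that neighbourhood but keeps its radius proportional to
  \<epsilon>, so one constant serves for all \<epsilon> up to 1.\<close>

lemma thick_ball_lower:
  fixes t :: "'a::euclidean_space"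
  assumes P0: "P0 = density lborel (\<lambda>\<theta>. ennreal (indicator \<Theta> \<theta> * p0 \<theta>))" and m: "(\<lambda>\<theta>. indicator \<Theta> \<theta> * p0 \<theta>) \<in> borel_measurable borel"
    and \<Theta>: "compact \<Theta>" and cont: "continuous_on \<Theta> p0" and t: "t \<in> \<Theta>" and pos: "p0 t > 0"
    and c: "c > 0" and thick: "\<And>\<epsilon>. 0 < \<epsilon> \<Longrightarrow> \<epsilon> \<le> 1 \<Longrightarrow> measure lborel (\<Theta> \<inter> ball t \<epsilon>) \<ge> c * \<epsilon> ^ DIM('a)"
  shows "\<exists>a>0. \<forall>\<epsilon>. 0 < \<epsilon> \<longrightarrow> \<epsilon> \<le> 1 \<longrightarrow> ennreal (a * \<epsilon> ^ DIM('a)) \<le> emeasure P0 (ball t \<epsilon>)"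
proof -
  obtain \<eta> where \<eta>: "\<eta> > 0" "\<And>\<theta>. \<theta> \<in> \<Theta> \<Longrightarrow> dist \<theta> t < \<eta> \<Longrightarrow> dist (p0 \<theta>) (p0 t) < p0 t / 2"
    using cont t pos unfolding continuous_on_iff by (metis half_gt_zero)
  define l where "l = min 1 \<eta>"
  have l: "0 < l" "l \<le> 1" "l \<le> \<eta>" using \<eta> by (auto simp: l_def)
  define a where "a = p0 t / 2 * (c * l ^ DIM('a))"
  have "ennreal (a * \<epsilon> ^ DIM('a)) \<le> emeasure P0 (ball t \<epsilon>)" if \<epsilon>: "0 < \<epsilon>" "\<epsilon> \<le> 1" for \<epsilon>
  proof -
    define A where "A = \<Theta> \<inter> ball t (l * \<epsilon>)"
    have "l * \<epsilon> \<le> l * 1" using l \<epsilon> by (intro mult_left_mono) auto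
    moreover have "l * \<epsilon> \<le> 1 * \<epsilon>" using l \<epsilon> by (intro mult_right_mono) auto
    moreover have "0 < l * \<epsilon>" using l \<epsilon> by simp
    ultimately have le: "0 < l * \<epsilon>" "l * \<epsilon> \<le> 1" "l * \<epsilon> \<le> \<epsilon>" "l * \<epsilon> \<le> \<eta>" using l \<epsilon> by linarith+
    have A: "A \<in> sets lborel" unfolding A_def using \<Theta> by (auto intro: borel_compact)
    have "bounded A" unfolding A_def by (simp add: bounded_Int)
    then have fin: "emeasure lborel A \<noteq> top" using emeasure_bounded_finite by fastforce
    have "a * \<epsilon> ^ DIM('a) = p0 t / 2 * (c * (l * \<epsilon>) ^ DIM('a))" by (simp add: a_def power_mult_distrib)
    also have "\<dots> \<le> p0 t / 2 * measure lborel A" unfolding A_def using thick[OF le(1,2)] pos by (intro mult_left_mono) auto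
    finally have "ennreal (a * \<epsilon> ^ DIM('a)) \<le> ennreal (p0 t / 2) * emeasure lborel A"
      unfolding emeasure_eq_ennreal_measure[OF fin] using pos by (subst ennreal_mult[symmetric]) (auto intro: ennreal_leI)
    also have "\<dots> = (\<integral>\<^sup>+\<theta>. ennreal (p0 t / 2) * indicator A \<theta> \<partial>lborel)" by (rule nn_integral_cmult_indicator[OF A, symmetric])
    also have "\<dots> \<le> (\<integral>\<^sup>+\<theta>. ennreal (indicator \<Theta> \<theta> * p0 \<theta>) * indicator (ball t \<epsilon>) \<theta> \<partial>lborel)"
    proof (rule nn_integral_mono)
      fix \<theta>
      show "ennreal (p0 t / 2) * indicator A \<theta> \<le> ennreal (indicator \<Theta> \<theta> * p0 \<theta>) * indicator (ball t \<epsilon>) \<theta>"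
      proof (cases "\<theta> \<in> A")
        case True
        then have t: "\<theta> \<in> \<Theta>" "dist \<theta> t < l * \<epsilon>" by (auto simp: A_def dist_commute)
        then have "dist (p0 \<theta>) (p0 t) < p0 t / 2" using le by (intro \<eta>(2)) auto
        then have "p0 t / 2 \<le> p0 \<theta>" unfolding dist_real_def by linarith
        then show ?thesis using True t le by (auto simp: dist_commute intro!: ennreal_leI)
      qed simp
    qed
    also have "\<dots> = emeasure P0 (ball t \<epsilon>)" unfolding P0 using m by (intro emeasure_density[symmetric]) auto
    finally show ?thesis .
  qed
  moreover have "a > 0" using pos c l by (simp add: a_def)
  ultimately show ?thesis by blast
qed

text \<open>What remains is to supply the hypotheses of \<open>posterior_allocation_tendsto\<close>:
  upper ball bounds from the boundedness of \<open>p0\<close>, lower ones from its positivity at the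
  true atoms and the thickness of \<open>\<Theta>\<close>, domination of shifted kernels from the
  gradient bound for \<open>ln f\<close> on a bounded set of shifts, and a finite second moment of
  the dominating weight.\<close>

theorem theorem5:
  fixes f :: "real ^ 'd \<Rightarrow> real"
    and \<alpha> :: real
    and P0 :: "(real ^ 'd) measure"
    and p0 :: "real ^ 'd \<Rightarrow> real"
    and \<Theta> :: "(real ^ 'd) set"
    and K :: nat
    and w_star :: "nat \<Rightarrow> real"
    and \<theta>_star :: "nat \<Rightarrow> real ^ 'd"
    and P_star Q :: "(real ^ 'd) measure"
    and \<delta> :: real
  assumes density_f: "probability_density f"
    and alpha: "\<alpha> > 0"
    \<comment> \<open>(A1)\<close>
    and P_star: "P_star = atomic_measure {1..K} w_star \<theta>_star"
    and w_pos: "\<And>k. k \<in> {1..K} \<Longrightarrow> w_star k > 0"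
    and w_sum: "(\<Sum>k = 1..K. w_star k) = 1"
    and distinct_atoms: "inj_on \<theta>_star {1..K}"
    and Q: "Q = density lborel (\<lambda>x. ennreal (mixture f P_star x))"
    \<comment> \<open>(A2)\<close>
    and compact: "compact \<Theta>"
    and atoms_in: "\<And>k. k \<in> {1..K} \<Longrightarrow> \<theta>_star k \<in> \<Theta>"
    \<comment> \<open>(A3)\<close>
    and P0_prob: "prob_space P0"
    and P0_density: "P0 = density lborel (\<lambda>\<theta>. ennreal (indicator \<Theta> \<theta> * p0 \<theta>))"
    and p0_nonneg: "\<And>\<theta>. \<theta> \<in> \<Theta> \<Longrightarrow> p0 \<theta> \<ge> 0"
    and p0_cont: "continuous_on \<Theta> p0"
    and p0_bounded: "bounded (p0 ` \<Theta>)"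
    and p0_pos: "\<And>k. k \<in> {1..K} \<Longrightarrow> p0 (\<theta>_star k) > 0"
    \<comment> \<open>Implicit in (A3): \<open>\<Theta>\<close> is not Lebesgue-thin at the true atoms. Otherwise (say, at an isolated point
        of \<open>\<Theta>\<close>) \<open>p0 (\<theta>_star k)\<close> is not determined by \<open>P0\<close>, and the conclusion can fail. It holds
        at interior points and at every point of a convex body.\<close>
    and Theta_thick: "\<exists>c>0. \<forall>k\<in>{1..K}. \<forall>\<epsilon>\<in>{0<..1}.
          measure lborel (\<Theta> \<inter> ball (\<theta>_star k) \<epsilon>) \<ge> c * \<epsilon> ^ CARD('d)"
    \<comment> \<open>(B1)\<close>
    and B1_smooth: "C3 f"
    and B1_bounds: "\<exists>F. \<forall>x. 0 < f x \<and> f x < F"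
    \<comment> \<open>(B2)\<close>
    and B2: "\<exists>R>0. \<exists>\<gamma>\<ge>0.
          (\<forall>x. norm (nabla (\<lambda>y. ln (f y)) x) \<le> R * (1 + norm x) powr \<gamma> \<and>
               norm (nabla (nabla (\<lambda>y. ln (f y))) x) \<le> R * (1 + norm x) powr \<gamma>) \<and>
          (\<forall>M>0. (\<integral>\<^sup>+x. ennreal (exp (M * norm x powr \<gamma>) * f x) \<partial>lborel) < \<infinity>)"
    \<comment> \<open>(B3)\<close>
    and B3: "\<exists>C>0. \<exists>r>0. \<forall>x.
          norm (nabla f x) \<le> C * (1 + norm x) powr - (real CARD('d) + r) \<and>
          norm (nabla (nabla f) x) \<le> C * (1 + norm x) powr - (real CARD('d) + r) \<and>
          norm (nabla (nabla (nabla f)) x) \<le> C * (1 + norm x) powr - (real CARD('d) + r)"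
    and delta: "\<delta> > 0"
  shows "tendsto_in_prob (\<Pi>\<^sub>M i\<in>{1..}. Q)
           (\<lambda>n X. measure (allocation_posterior f \<alpha> P0 n X)
              {c \<in> {1..n} \<rightarrow>\<^sub>E {1..}.
                 1 / real n * (\<Sum>i = 1..n. of_bool (c i > K)) > 1 / real n powr (1 / 2 - \<delta>)})
           0"
proof -
  obtain F where F: "\<And>x. 0 < f x \<and> f x < F" using B1_bounds by blast
  obtain R \<gamma> where R: "R > 0" and \<gamma>: "\<gamma> \<ge> 0" and grad: "\<And>x. norm (nabla (\<lambda>y. ln (f y)) x) \<le> R * (1 + norm x) powr \<gamma>"
    and mom: "\<And>M. M > 0 \<Longrightarrow> (\<integral>\<^sup>+x. ennreal (exp (M * norm x powr \<gamma>) * f x) \<partial>lborel) < \<infinity>"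
    using B2 by blast
  have K: "K \<ge> 1" using w_sum by (cases K) auto
  have \<Theta>b: "\<Theta> \<in> sets borel" using compact by (rule borel_compact)
  have bnd: "bounded \<Theta>" using compact by (rule compact_imp_bounded)
  have pm: "(\<lambda>\<theta>. indicator \<Theta> \<theta> * p0 \<theta>) \<in> borel_measurable borel"
    using borel_measurable_continuous_on_indicator[OF \<Theta>b p0_cont] by simp
  have AE: "AE \<theta> in P0. \<theta> \<in> \<Theta>"
    unfolding P0_density using pm by (subst AE_density) (auto simp: indicator_def)
  interpret dpm f \<alpha> P0 \<Theta> K w_star \<theta>_star F
  proof (rule dpm.intro)
    show "sets P0 = sets borel" by (simp add: P0_density)
    show "0 < f x \<and> f x < F" for x by (rule F)
    show "0 < w_star c" if "c \<in> {1..K}" for c by (rule w_pos[OF that])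
    show "\<theta>_star c \<in> \<Theta>" if "c \<in> {1..K}" for c by (rule atoms_in[OF that])
  qed (fact density_f alpha P0_prob AE bnd K w_sum distinct_atoms)+
  have QQ: "Q = density lborel (\<lambda>x. ennreal (true_dens x))" by (simp only: Q P_star mixture_true)
  obtain b where b: "\<And>\<theta>. \<theta> \<in> \<Theta> \<Longrightarrow> \<bar>p0 \<theta>\<bar> \<le> b" "b > 0" using p0_bounded by (force simp: bounded_pos)
  have pb: "indicator \<Theta> \<theta> * p0 \<theta> \<le> b" for \<theta> using b(1)[of \<theta>] b(2) by (auto simp: indicator_def abs_le_iff)
  define Cb where "Cb = b * unit_ball_vol (DIM(real ^ 'd))"
  have Cb: "Cb \<ge> 0" using b by (simp add: Cb_def)
  have ball: "emeasure P0 (cball x s) \<le> ennreal (Cb * s ^ DIM(real ^ 'd))" if "s \<ge> 0" for x s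
    unfolding Cb_def by (rule emeasure_density_bounded_cball[OF P0_density pm pb that]) (use b in simp)
  obtain B where B: "B > 0" "\<And>\<theta>. \<theta> \<in> \<Theta> \<Longrightarrow> norm \<theta> \<le> B" using bnd by (auto simp: bounded_pos)
  have "f differentiable_on UNIV" using B1_smooth by (simp add: C3_def)
  from log_Lipschitz_ratio[OF this _ \<gamma> R grad, where B = B] F B
  obtain C a where C: "C \<ge> 1" and a: "a > 0" and ratio: "\<forall>x \<theta> \<theta>'. norm \<theta> \<le> B \<longrightarrow> norm \<theta>' \<le> B \<longrightarrow>
     \<bar>f (x - \<theta>) - f (x - \<theta>')\<bar> \<le> norm (\<theta> - \<theta>') * (C * exp (a * norm x powr \<gamma>)) * f (x - \<theta>') \<and>
     f (x - \<theta>) \<le> C * exp (a * norm x powr \<gamma>) * f (x - \<theta>')" by (metis less_imp_le)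
  define W where "W x = C * exp (a * norm x powr \<gamma>)" for x :: "real ^ 'd"
  have Wm: "W \<in> borel_measurable borel" unfolding W_def by measurable
  have W0: "W x \<ge> 0" for x using C by (simp add: W_def)
  have Wfin: "(\<integral>\<^sup>+x. ennreal ((W x)\<^sup>2 * true_dens x) \<partial>lborel) < \<infinity>"
  proof -
    have fm: "f \<in> borel_measurable borel" using density_f by (simp add: probability_density_def)
    have "(\<integral>\<^sup>+x. ennreal ((W x)\<^sup>2 * true_dens x) \<partial>lborel) \<le> (\<integral>\<^sup>+x. ennreal (C ^ 3) * ennreal (exp (3 * a * norm x powr \<gamma>) * f x) \<partial>lborel)"
    proof (rule nn_integral_mono)
      fix x
      \<comment> \<open>Comparing the true density with the unshifted kernel costs a third factor
        \<open>W x\<close>. This is why the exponential moment of \<open>f\<close> is taken at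
        \<open>3 * a\<close> and the constant is \<open>C ^ 3\<close>.\<close>
      have "true_dens x \<le> (\<Sum>c = 1..K. w_star c * (W x * f x))"
        unfolding true_dens_def
      proof (intro sum_mono mult_left_mono)
        fix c assume c: "c \<in> {1..K}"
        show "f (x - \<theta>_star c) \<le> W x * f x" using ratio[rule_format, of "\<theta>_star c" 0 x] B atoms_in[OF c] by (simp add: W_def)
        show "0 \<le> w_star c" using w_pos[OF c] by simp
      qed
      also have "\<dots> = W x * f x" by (simp add: sum_distrib_right[symmetric] w_sum[unfolded One_nat_def])
      finally have "(W x)\<^sup>2 * true_dens x \<le> (W x)\<^sup>2 * (W x * f x)" by (rule mult_left_mono) simp
      also have "\<dots> = C ^ 3 * (exp (3 * a * norm x powr \<gamma>) * f x)"
      proof -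
        have "exp (3 * a * norm x powr \<gamma>) = exp (a * norm x powr \<gamma>) ^ 3"
          using exp_of_nat_mult[of 3 "a * norm x powr \<gamma>"] by (simp add: mult.assoc)
        then show ?thesis by (simp add: W_def power2_eq_square power3_eq_cube mult_ac)
      qed
      finally show "ennreal ((W x)\<^sup>2 * true_dens x) \<le> ennreal (C ^ 3) * ennreal (exp (3 * a * norm x powr \<gamma>) * f x)"
        using C F[of x] by (simp add: ennreal_mult[symmetric] ennreal_leI)
    qed
    also have "\<dots> = ennreal (C ^ 3) * (\<integral>\<^sup>+x. ennreal (exp (3 * a * norm x powr \<gamma>) * f x) \<partial>lborel)"
      using fm by (intro nn_integral_cmult) measurable
    also have "\<dots> < \<infinity>" using mom[of "3 * a"] a by (simp add: ennreal_mult_less_top)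
    finally show ?thesis .
  qed
  obtain c1 where c1: "c1 > 0" "\<forall>k\<in>{1..K}. \<forall>\<epsilon>\<in>{0<..1}. measure lborel (\<Theta> \<inter> ball (\<theta>_star k) \<epsilon>) \<ge> c1 * \<epsilon> ^ CARD('d)"
    using Theta_thick by blast
  have "\<forall>k\<in>{1..K}. \<exists>a>0. \<forall>\<epsilon>. 0 < \<epsilon> \<longrightarrow> \<epsilon> \<le> 1 \<longrightarrow> ennreal (a * \<epsilon> ^ DIM(real ^ 'd)) \<le> emeasure P0 (ball (\<theta>_star k) \<epsilon>)"
  proof
    fix k assume k: "k \<in> {1..K}"
    show "\<exists>a>0. \<forall>\<epsilon>. 0 < \<epsilon> \<longrightarrow> \<epsilon> \<le> 1 \<longrightarrow> ennreal (a * \<epsilon> ^ DIM(real ^ 'd)) \<le> emeasure P0 (ball (\<theta>_star k) \<epsilon>)"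
      by (rule thick_ball_lower[OF P0_density pm compact p0_cont atoms_in[OF k] p0_pos[OF k] c1(1)]) (use c1(2) k in simp)
  qed
  from bchoice[OF this] obtain A where A: "\<forall>k\<in>{1..K}. A k > 0 \<and> (\<forall>\<epsilon>. 0 < \<epsilon> \<longrightarrow> \<epsilon> \<le> 1 \<longrightarrow> ennreal (A k * \<epsilon> ^ DIM(real ^ 'd)) \<le> emeasure P0 (ball (\<theta>_star k) \<epsilon>))" ..
  define c0 where "c0 = Min (A ` {1..K})"
  have c0: "c0 > 0" unfolding c0_def using A K by (subst Min_gr_iff) auto
  have thick: "ennreal (c0 * \<epsilon> ^ DIM(real ^ 'd)) \<le> emeasure P0 (ball (\<theta>_star k) \<epsilon>)" if k: "k \<in> {1..K}" and \<epsilon>: "0 < \<epsilon>" "\<epsilon> \<le> 1" for k \<epsilon>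
  proof -
    have "c0 \<le> A k" unfolding c0_def using k by (intro Min_le) auto
    then have "ennreal (c0 * \<epsilon> ^ DIM(real ^ 'd)) \<le> ennreal (A k * \<epsilon> ^ DIM(real ^ 'd))" using \<epsilon> by (intro ennreal_leI mult_right_mono) auto
    also have "\<dots> \<le> emeasure P0 (ball (\<theta>_star k) \<epsilon>)" using A k \<epsilon> by blast
    finally show ?thesis .
  qed
  have dom: "\<bar>f (x - \<theta>) - f (x - \<theta>')\<bar> \<le> norm (\<theta> - \<theta>') * W x * f (x - \<theta>') \<and> f (x - \<theta>) \<le> W x * f (x - \<theta>')"
    if "\<theta> \<in> \<Theta>" "\<theta>' \<in> \<Theta>" for x \<theta> \<theta>'
    using ratio B(2)[OF that(1)] B(2)[OF that(2)] unfolding W_def by blast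
  show ?thesis unfolding tendsto_in_prob_def QQ
  proof (intro conjI allI impI)
    fix e :: real assume e: "e > 0"
    show "(\<lambda>n. measure QI {X \<in> space QI. \<bar>measure (allocation_posterior f \<alpha> P0 n X)
              {c \<in> {1..n} \<rightarrow>\<^sub>E {1..}. 1 / real n * (\<Sum>i = 1..n. of_bool (c i > K)) > 1 / real n powr (1 / 2 - \<delta>)} - 0\<bar> > e}) \<longlonglongrightarrow> 0"
      unfolding diff_zero abs_of_nonneg[OF measure_nonneg]
      by (rule posterior_allocation_tendsto[OF ball Cb dom Wm Wfin thick c0 delta e])
  qed (rule posterior_measurable, blast)
qed

end
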